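(* Let $p\in(1,+\infty)$ and let $\{w^\varepsilon\}\subset L^p(\Omega)$ be a sequence satisfying $$\|w^\varepsilon\|_{L^p(\Omega)}+\varepsilon\|\nabla w^\varepsilon\|_{L^p(\Omega)}\le C$$ with $C$ independent of $\varepsilon$. Then there exist a subsequence (denoted again by $\{w^\varepsilon\}$) and $w\in L^p(\Omega;W^{1,p}_{\rm per}(Y_x))$ such that, as $\varepsilon\to0$, $$\mathcal T^\varepsilon_{\mathcal L}(w^\varepsilon)\rightharpoonup w(\cdot,D_x\cdot)\quad\text{weakly in }L^p(\Omega;W^{1,p}(Y)),$$ $$\varepsilon\,\mathcal T^\varepsilon_{\mathcal L}(\nabla w^\varepsilon)\rightharpoonup D_x^{-T}\nabla_y w(\cdot,D_x\cdot)\quad\text{weakly in }L^p(\Omega\times Y).$$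
   Context: Setting. $\Omega\subset\mathbb R^d$ is a bounded Lipschitz domain, $Y=(0,1)^d$. $D:\mathbb R^d\to\mathbb R^{d\times d}$ takes invertible matrix values, $D,D^{-1}\in\mathrm{Lip}(\mathbb R^d;\mathbb R^{d\times d})$ ($D^{-1}(x)$ is the inverse matrix), and $0<D_1\le|\det D(x)|\le D_2<\infty$ for all $x\in\overline\Omega$. Write $D_x=D(x)$, $D_x^{-1}=D^{-1}(x)$, $D_x^{-T}=(D_x^{-1})^T$, $Y_x=D_xY$. Fix $0<r<1$. For every $\varepsilon>0$, $\{\Omega^\varepsilon_n\}_{1\le n\le N_\varepsilon}$ is a family of open pairwise disjoint cubes of side $\varepsilon^r$ with $\Omega\subset\bigcup_{n}\overline{\Omega^\varepsilon_n}$ and $\Omega^\varepsilon_n\cap\Omega\ne\emptyset$; $x_n^\varepsilon\in\Omega_n^\varepsilon\cap\Omega$ are arbitrary fixed points. Set $\Xi_n^\varepsilon=\{\xi\in\mathbb Z^d:\varepsilon D_{x_n^\varepsilon}(Y+\xi)\cap\Omega_n^\varepsilon\neq\emptyset\}$, $\hat\Xi_n^\varepsilon=\{\xi\in\Xi_n^\varepsilon:\varepsilon D_{x_n^\varepsilon}(Y+\xi)\subset\Omega_n^\varepsilon\cap\Omega\}$, $\hat\Omega_n^\varepsilon=\mathrm{Int}\big(\bigcup_{\xi\in\hat\Xi_n^\varepsilon}\varepsilon D_{x_n^\varepsilon}(\overline Y+\xi)\big)$. l-p unfolding operator: for Lebesgue-measurable $\psi$ on $\Omega$, $$\mathcal T^\varepsilon_{\mathcal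 L}(\psi)(x,y)=\sum_{n=1}^{N_\varepsilon}\psi\big(\varepsilon D_{x_n^\varepsilon}[D^{-1}_{x_n^\varepsilon}x/\varepsilon]_Y+\varepsilon D_{x_n^\varepsilon}y\big)\chi_{\hat\Omega_n^\varepsilon}(x),\quad x\in\Omega,\ y\in Y,$$ where $[z]_Y\in\mathbb Z^d$ is the componentwise integer part (so $z-[z]_Y\in[0,1)^d$); it is applied componentwise to vector fields. Spaces: $w\in L^p(\Omega;W^{1,p}_{\rm per}(Y_x))$ means $w(x,y)=\widetilde w(x,D_x^{-1}y)$ with $\widetilde w\in L^p(\Omega;W^{1,p}_{\rm per}(Y))$ ($Y$-periodic in the second variable). $w(\cdot,D_x\cdot)$ denotes $(x,y)\mapsto w(x,D_xy)$, $y\in Y$, and $D_x^{-T}\nabla_yw(\cdot,D_x\cdot)$ denotes $(x,y)\mapsto D_x^{-T}\nabla_y[w(x,D_xy)]$. *)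

theory Defs
  imports "HOL-Analysis.Analysis"
begin

section \<open>Lebesgue and Sobolev spaces\<close>

text \<open>
  Elements of all function spaces are representatives, i.e. functions on the whole type whose
  values off the underlying set are irrelevant; they are not quotiented by a.e. equality.
\<close>

definition Lp :: "real \<Rightarrow> 'a::euclidean_space set \<Rightarrow> ('a \<Rightarrow> 'b::euclidean_space) set" where
  "Lp p U = {f \<in> borel_measurable (lebesgue_on U).
               integrable (lebesgue_on U) (\<lambda>x. norm (f x) powr p)}"

definition Lp_norm :: "real \<Rightarrow> 'a::euclidean_space set \<Rightarrow> ('a \<Rightarrow> 'b::euclidean_space) \<Rightarrow> real" where
  "Lp_norm p U f = (LINT x|lebesgue_on U. norm (f x) powr p) powr (1 / p)"

definition locally_integrable_on ::
    "('a::euclidean_space \<Rightarrow> 'b::euclidean_space) \<Rightarrow> 'a set \<Rightarrow> bool" where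
  "locally_integrable_on f U \<longleftrightarrow> (\<forall>K. compact K \<and> K \<subseteq> U \<longrightarrow> integrable (lebesgue_on K) f)"

primrec C_k :: "nat \<Rightarrow> ('a::euclidean_space \<Rightarrow> real) \<Rightarrow> bool" where
  "C_k 0 f \<longleftrightarrow> continuous_on UNIV f"
| "C_k (Suc k) f \<longleftrightarrow> (\<forall>x. f differentiable at x) \<and>
     (\<forall>v. C_k k (\<lambda>x. frechet_derivative f (at x) v))"

definition test_function :: "'a::euclidean_space set \<Rightarrow> ('a \<Rightarrow> real) \<Rightarrow> bool" where
  "test_function U \<phi> \<longleftrightarrow> (\<forall>k. C_k k \<phi>) \<and>
     compact (closure {x. \<phi> x \<noteq> 0}) \<and> closure {x. \<phi> x \<noteq> 0} \<subseteq> U"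

definition has_weak_gradient ::
    "(real^'d) set \<Rightarrow> (real^'d \<Rightarrow> real) \<Rightarrow> (real^'d \<Rightarrow> real^'d) \<Rightarrow> bool" where
  "has_weak_gradient U u g \<longleftrightarrow>
     locally_integrable_on u U \<and> locally_integrable_on g U \<and>
     (\<forall>\<phi> i. test_function U \<phi> \<longrightarrow>
        (LINT x|lebesgue_on U. u x * frechet_derivative \<phi> (at x) (axis i 1)) =
        - (LINT x|lebesgue_on U. g x $ i * \<phi> x))"

definition W1p :: "real \<Rightarrow> (real^'d) set \<Rightarrow> (real^'d \<Rightarrow> real) set" where
  "W1p p U = {u \<in> Lp p U. \<exists>g \<in> Lp p U. has_weak_gradient U u g}"

text \<open>The weak gradient is unique a.e., so the choice below does not affect the norm.\<close>

definition weak_gradient :: "(real^'d) set \<Rightarrow> (real^'d \<Rightarrow> real) \<Rightarrow> real^'d \<Rightarrow> real^'d" where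
  "weak_gradient U u = (SOME g. has_weak_gradient U u g)"

definition W1p_norm :: "real \<Rightarrow> (real^'d) set \<Rightarrow> (real^'d \<Rightarrow> real) \<Rightarrow> real" where
  "W1p_norm p U u = (Lp_norm p U u powr p + Lp_norm p U (weak_gradient U u) powr p) powr (1 / p)"

definition unit_cell :: "(real^'d) set" where
  "unit_cell = {y. \<forall>i. 0 < y $ i \<and> y $ i < 1}"

definition int_lattice :: "(real^'d) set" where
  "int_lattice = {\<xi>. \<forall>i. \<xi> $ i \<in> \<int>}"

text \<open>
  Periodic functions live on the whole space; having a weak gradient there (rather than
  only inside the cell) is what makes the traces on opposite faces agree.
\<close>

definition W1p_per :: "real \<Rightarrow> (real^'d \<Rightarrow> real) set" where
  "W1p_per p = {u. (\<forall>y. \<forall>\<xi>\<in>int_lattice. u (y + \<xi>) = u y) \<and> u \<in> Lp p unit_cell \<and>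
                   (\<exists>g \<in> Lp p unit_cell. has_weak_gradient UNIV u g)}"

section \<open>Bochner spaces and weak convergence\<close>

text \<open>
  A function u of two variables is read as the map sending x to the function u (x, _), with
  values in the function space V whose norm is nrm.
\<close>

definition strongly_measurable_on ::
    "'a::euclidean_space set \<Rightarrow> ('c \<Rightarrow> real) set \<Rightarrow> (('c \<Rightarrow> real) \<Rightarrow> real) \<Rightarrow>
     ('a \<times> 'c \<Rightarrow> real) \<Rightarrow> bool" where
  "strongly_measurable_on U V nrm u \<longleftrightarrow>
     (\<exists>s :: nat \<Rightarrow> 'a \<Rightarrow> 'c \<Rightarrow> real.
        (\<forall>k. simple_function (lebesgue_on U) (s k) \<and> s k ` U \<subseteq> V) \<and>
        (AE x in lebesgue_on U. (\<lambda>k. nrm (\<lambda>y. s k x y - u (x, y))) \<longlonglongrightarrow> 0))"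

definition bochner_Lp ::
    "real \<Rightarrow> 'a::euclidean_space set \<Rightarrow> ('c \<Rightarrow> real) set \<Rightarrow> (('c \<Rightarrow> real) \<Rightarrow> real) \<Rightarrow>
     ('a \<times> 'c \<Rightarrow> real) set" where
  "bochner_Lp p U V nrm =
     {u. (AE x in lebesgue_on U. (\<lambda>y. u (x, y)) \<in> V) \<and> strongly_measurable_on U V nrm u \<and>
         integrable (lebesgue_on U) (\<lambda>x. nrm (\<lambda>y. u (x, y)) powr p)}"

definition bochner_Lp_norm ::
    "real \<Rightarrow> 'a::euclidean_space set \<Rightarrow> (('c \<Rightarrow> real) \<Rightarrow> real) \<Rightarrow> ('a \<times> 'c \<Rightarrow> real) \<Rightarrow> real" where
  "bochner_Lp_norm p U nrm u =
     (LINT x|lebesgue_on U. nrm (\<lambda>y. u (x, y)) powr p) powr (1 / p)"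

text \<open>
  Boundedness with respect to the seminorm N makes the functional vanish on differences of
  a.e. equal representatives, so these are exactly the elements of the dual of the quotient.
\<close>

definition bounded_functional ::
    "('x \<Rightarrow> 'b::real_vector) set \<Rightarrow> (('x \<Rightarrow> 'b) \<Rightarrow> real) \<Rightarrow> (('x \<Rightarrow> 'b) \<Rightarrow> real) \<Rightarrow> bool" where
  "bounded_functional X N l \<longleftrightarrow>
     (\<forall>u\<in>X. \<forall>v\<in>X. l (\<lambda>z. u z + v z) = l u + l v) \<and>
     (\<forall>c. \<forall>u\<in>X. l (\<lambda>z. c *\<^sub>R u z) = c * l u) \<and>
     (\<exists>K. \<forall>u\<in>X. \<bar>l u\<bar> \<le> K * N u)"

definition weakly_convergent_to ::
    "('x \<Rightarrow> 'b::real_vector) set \<Rightarrow> (('x \<Rightarrow> 'b) \<Rightarrow> real) \<Rightarrow> (nat \<Rightarrow> 'x \<Rightarrow> 'b) \<Rightarrow>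
     ('x \<Rightarrow> 'b) \<Rightarrow> bool" where
  "weakly_convergent_to X N f u \<longleftrightarrow>
     (\<forall>k. f k \<in> X) \<and> u \<in> X \<and> (\<forall>l. bounded_functional X N l \<longrightarrow> (\<lambda>k. l (f k)) \<longlonglongrightarrow> l u)"

definition weakly_in_Lp ::
    "real \<Rightarrow> 'a::euclidean_space set \<Rightarrow> (nat \<Rightarrow> 'a \<Rightarrow> 'b::euclidean_space) \<Rightarrow> ('a \<Rightarrow> 'b) \<Rightarrow> bool" where
  "weakly_in_Lp p U = weakly_convergent_to (Lp p U) (Lp_norm p U)"

definition weakly_in_Lp_W1p ::
    "real \<Rightarrow> 'a::euclidean_space set \<Rightarrow> (real^'d) set \<Rightarrow> (nat \<Rightarrow> 'a \<times> (real^'d) \<Rightarrow> real) \<Rightarrow>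
     ('a \<times> (real^'d) \<Rightarrow> real) \<Rightarrow> bool" where
  "weakly_in_Lp_W1p p U S =
     weakly_convergent_to (bochner_Lp p U (W1p p S) (W1p_norm p S))
                          (bochner_Lp_norm p U (W1p_norm p S))"

definition Lp_W1p_per_transformed ::
    "real \<Rightarrow> (real^'d) set \<Rightarrow> (real^'d \<Rightarrow> real^'d^'d) \<Rightarrow> ((real^'d) \<times> (real^'d) \<Rightarrow> real) set" where
  "Lp_W1p_per_transformed p \<Omega> D =
     {w. \<exists>w'. w' \<in> bochner_Lp p \<Omega> (W1p_per p) (W1p_norm p unit_cell) \<and>
              (\<forall>x\<in>\<Omega>. \<forall>y. w (x, y) = w' (x, matrix_inv (D x) *v y))}"

section \<open>Domains and cubes\<close>

text \<open>
  Near each boundary point the set is the strict epigraph, in some unit direction \<nu>, of a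
  Lipschitz function on the hyperplane orthogonal to \<nu>.
\<close>

definition lipschitz_domain :: "'a::euclidean_space set \<Rightarrow> bool" where
  "lipschitz_domain \<Omega> \<longleftrightarrow> open \<Omega> \<and> connected \<Omega> \<and> \<Omega> \<noteq> {} \<and>
     (\<forall>x0\<in>frontier \<Omega>. \<exists>\<rho>>0. \<exists>\<nu>. norm \<nu> = 1 \<and>
        (\<exists>\<gamma> :: 'a \<Rightarrow> real. (\<exists>L. L-lipschitz_on {x. x \<bullet> \<nu> = 0} \<gamma>) \<and>
           \<Omega> \<inter> ball x0 \<rho> = {x \<in> ball x0 \<rho>. \<gamma> (x - (x \<bullet> \<nu>) *\<^sub>R \<nu>) < x \<bullet> \<nu>}))"

text \<open>Cubes need not be parallel to the coordinate axes.\<close>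

definition open_cube :: "real \<Rightarrow> (real^'d) set \<Rightarrow> bool" where
  "open_cube a Q \<longleftrightarrow> (\<exists>c. \<exists>R :: real^'d \<Rightarrow> real^'d. orthogonal_transformation R \<and>
     Q = (\<lambda>z. c + R z) ` {z. \<forall>i. 0 < z $ i \<and> z $ i < a})"

section \<open>The locally periodic unfolding operator\<close>

definition int_part :: "real^'d \<Rightarrow> real^'d" where
  "int_part z = (\<chi> i. of_int \<lfloor>z $ i\<rfloor>)"

text \<open>
  In the following definitions A is the matrix D at the chosen point of the cube Q.
\<close>

definition scaled_cell :: "real \<Rightarrow> real^'d^'d \<Rightarrow> (real^'d) set \<Rightarrow> real^'d \<Rightarrow> (real^'d) set" where
  "scaled_cell \<epsilon> A S \<xi> = (\<lambda>y. \<epsilon> *\<^sub>R (A *v (y + \<xi>))) ` S"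

definition Xi :: "real \<Rightarrow> real^'d^'d \<Rightarrow> (real^'d) set \<Rightarrow> (real^'d) set" where
  "Xi \<epsilon> A Q = {\<xi> \<in> int_lattice. scaled_cell \<epsilon> A unit_cell \<xi> \<inter> Q \<noteq> {}}"

definition Xi_hat ::
    "real \<Rightarrow> real^'d^'d \<Rightarrow> (real^'d) set \<Rightarrow> (real^'d) set \<Rightarrow> (real^'d) set" where
  "Xi_hat \<epsilon> A Q \<Omega> = {\<xi> \<in> Xi \<epsilon> A Q. scaled_cell \<epsilon> A unit_cell \<xi> \<subseteq> Q \<inter> \<Omega>}"

definition Omega_hat ::
    "real \<Rightarrow> real^'d^'d \<Rightarrow> (real^'d) set \<Rightarrow> (real^'d) set \<Rightarrow> (real^'d) set" where
  "Omega_hat \<epsilon> A Q \<Omega> = interior (\<Union>\<xi>\<in>Xi_hat \<epsilon> A Q \<Omega>. scaled_cell \<epsilon> A (closure unit_cell) \<xi>)"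

definition unfolding_op ::
    "(real^'d) set \<Rightarrow> (real^'d \<Rightarrow> real^'d^'d) \<Rightarrow> (real \<Rightarrow> nat) \<Rightarrow>
     (real \<Rightarrow> nat \<Rightarrow> (real^'d) set) \<Rightarrow> (real \<Rightarrow> nat \<Rightarrow> real^'d) \<Rightarrow> real \<Rightarrow>
     (real^'d \<Rightarrow> 'b::real_vector) \<Rightarrow> (real^'d) \<times> (real^'d) \<Rightarrow> 'b" where
  "unfolding_op \<Omega> D N Q pt \<epsilon> \<psi> = (\<lambda>(x, y).
     \<Sum>n\<in>{1..N \<epsilon>}. let A = D (pt \<epsilon> n) in
       indicat_real (Omega_hat \<epsilon> A (Q \<epsilon> n) \<Omega>) x *\<^sub>R
       \<psi> (\<epsilon> *\<^sub>R (A *v int_part ((1 / \<epsilon>) *\<^sub>R (matrix_inv A *v x))) + \<epsilon> *\<^sub>R (A *v y)))"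

end

theory Submission
  imports Defs "HOL-Library.Diagonal_Subsequence" "HOL-Computational_Algebra.Polynomial"
begin

text \<open>
  Weak convergence is obtained from Mazur's lemma instead of duality: if every subsequence of a sequence
  has convex combinations that converge in norm to one and the same limit, then every bounded functional
  converges along the sequence. Uniform convexity of the p-th power of the norm produces such convex
  combinations for a subsequence of any sequence bounded in L^p, and a diagonal argument over countably
  many test sets makes the limit unique. This is applied to the triple consisting of the unfolded
  function, its gradient in the cell variable y and the unfolded scaled gradient. The convex combinations
  are simple functions of x with values in the Sobolev space, so the limit is Bochner measurable.

  Periodicity comes from a discrete summation by parts: the pairing of the unfolded function with a
  test function summed over all lattice translates can be rearranged over the lattice points of a cube,
  where it vanishes by the definition of the weak gradient, up to the oscillation of the weight on the
  scale \<epsilon> and up to a boundary layer of the cubes of relative measure O(\<epsilon>^(1-r)). Hence the periodic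
  extension of the limit has a weak gradient on the whole space. Finally the two gradients
  are related by the transpose of D at the chosen points, which converges uniformly to that of D(x) because the
  cubes shrink.
\<close>

section \<open>Uniform convexity and Mazur limits\<close>

text \<open>Norm-convergent convex combinations suit both target spaces because a bounded functional
  is used only through its linearity and its bound, so no description of the dual of the Bochner
  space enters. The three sequences are bundled into one because a Sobolev limit needs the function
  and its y-gradient to converge with identical weights.

  Why translates of test functions occur: integrating a periodic extension against a test function
  on the whole space is the same as integrating over one cell against the sum of all translates of
  that function.

  The obstacle is that cells are arranged in a common lattice only inside one cube; the matrix, and
  with it the lattice, changes from cube to cube. Shifting by a lattice vector is therefore
  legitimate only for cells whose distance to the faces of their cube is of order \<epsilon> or
  more. What is lost near the faces is controlled because p > 1: functions bounded in L^p are
  uniformly integrable, so a layer of small measure carries a small integral. The inequality a <= l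
  + l^(1-p) a^p expresses this and serves throughout as the passage from L^p to L^1.\<close>

lemma powr_strict_midpoint:
  fixes s t p :: real
  assumes p: "1 < p" and st: "0 \<le> s" "s < t"
  shows "((s + t) / 2) powr p < (s powr p + t powr p) / 2"
proof -
  define m where "m = (s + t) / 2"
  have m: "s < m" "m < t" "0 < m" using st by (auto simp: m_def)
  have cont: "continuous_on {a..b} (\<lambda>x::real. x powr p)" if "0 \<le> a" for a b
    using that p by (intro continuous_on_powr' continuous_intros) auto
  have der: "((\<lambda>x::real. x powr p) has_derivative (\<lambda>h. h * (p * x powr (p - 1)))) (at x)" if "0 < x" for x
    using that has_real_derivative_powr[of x p] by (simp add: has_field_derivative_def mult.commute[of _ "p * x powr (p - 1)"])
  \<comment> \<open>Mean value points of the two halves; strict growth of the derivative p x^(p-1)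
    makes the right increment larger. Differentiability is needed only inside the halves, so s = 0
    is allowed.\<close>
  obtain z1 where z1: "s < z1" "z1 < m" "m powr p - s powr p = (m - s) * (p * z1 powr (p - 1))"
  proof -
    have "\<exists>z\<in>{s<..<m}. m powr p - s powr p = (m - s) * (p * z powr (p - 1))"
      by (rule mvt[OF m(1) cont[OF st(1)]]) (use st der in auto)
    then show ?thesis using that by auto
  qed
  obtain z2 where z2: "m < z2" "z2 < t" "t powr p - m powr p = (t - m) * (p * z2 powr (p - 1))"
  proof -
    have "\<exists>z\<in>{m<..<t}. t powr p - m powr p = (t - m) * (p * z powr (p - 1))"
      by (rule mvt[OF m(2) cont]) (use st m der in auto)
    then show ?thesis using that by auto
  qed
  have eq: "t - m = m - s" by (simp add: m_def field_simps)
  have "z1 powr (p - 1) < z2 powr (p - 1)"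
    using z1 z2 st p by (intro powr_less_mono2) auto
  then have "(m - s) * (p * z1 powr (p - 1)) < (m - s) * (p * z2 powr (p - 1))"
    using m p by simp
  then have "m powr p - s powr p < t powr p - m powr p"
    using z1(3) z2(3) eq by simp
  then show ?thesis unfolding m_def[symmetric] by simp
qed

lemma powr_midpoint_le:
  fixes s t p :: real
  assumes p: "1 < p" and st: "0 \<le> s" "0 \<le> t"
  shows "((s + t) / 2) powr p \<le> (s powr p + t powr p) / 2"
  using powr_strict_midpoint[OF p, of s t] powr_strict_midpoint[OF p, of t s] st
  by (cases s t rule: linorder_cases) (auto simp: add.commute)

lemma norm_powr_midpoint_le:
  fixes a b :: "'b::real_normed_vector"
  assumes p: "1 < p"
  shows "norm ((1/2) *\<^sub>R (a + b)) powr p \<le> (norm a powr p + norm b powr p) / 2"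
proof -
  have "norm ((1/2) *\<^sub>R (a + b)) \<le> (norm a + norm b) / 2"
    using norm_triangle_ineq[of a b] by simp
  then have "norm ((1/2) *\<^sub>R (a + b)) powr p \<le> ((norm a + norm b) / 2) powr p"
    using p by (intro powr_mono2) auto
  also have "\<dots> \<le> (norm a powr p + norm b powr p) / 2"
    by (rule powr_midpoint_le[OF p]) auto
  finally show ?thesis .
qed

text \<open>Strictness has two sources: for equal norms the parallelogram law makes the midpoint
  strictly shorter, and for different norms the scalar inequality is already strict.\<close>

lemma norm_powr_midpoint_less:
  fixes a b :: "'b::real_inner"
  assumes p: "1 < p" and "a \<noteq> b"
  shows "norm ((1/2) *\<^sub>R (a + b)) powr p < (norm a powr p + norm b powr p) / 2"
proof (cases "norm a = norm b")
  case True
  have "(norm (a + b))\<^sup>2 + (norm (a - b))\<^sup>2 = 2 * (norm a)\<^sup>2 + 2 * (norm b)\<^sup>2"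
    by (simp add: power2_norm_eq_inner inner_add inner_diff inner_commute)
  moreover have "0 < (norm (a - b))\<^sup>2" using assms by simp
  ultimately have "(norm (a + b))\<^sup>2 < (2 * norm a)\<^sup>2"
    unfolding True power_mult_distrib by (simp only: power2_eq_square[of "2::real"])
  then have "norm (a + b) < 2 * norm a" by (rule power2_less_imp_less) simp
  then have "norm ((1/2) *\<^sub>R (a + b)) < norm a" by simp
  then have "norm ((1/2) *\<^sub>R (a + b)) powr p < norm a powr p"
    using p by (intro powr_less_mono2) auto
  then show ?thesis using True by simp
next
  case False
  have "norm ((1/2) *\<^sub>R (a + b)) \<le> (norm a + norm b) / 2"
    using norm_triangle_ineq[of a b] by simp
  then have "norm ((1/2) *\<^sub>R (a + b)) powr p \<le> ((norm a + norm b) / 2) powr p"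
    using p by (intro powr_mono2) auto
  also have "\<dots> < (norm a powr p + norm b powr p) / 2"
    using powr_strict_midpoint[OF p, of "norm a" "norm b"] powr_strict_midpoint[OF p, of "norm b" "norm a"] False
    by (cases "norm a" "norm b" rule: linorder_cases) (auto simp: add.commute)
  finally show ?thesis .
qed

text \<open>Takes the place of Minkowski's inequality on the level of p-th powers, by convexity
  applied to twice the midpoint. Only the finiteness of the constant 2^p matters later.\<close>

lemma norm_add_powr_le:
  fixes a b :: "'b::real_normed_vector"
  assumes p: "1 < p"
  shows "norm (a + b) powr p \<le> 2 powr p * (norm a powr p + norm b powr p)"
proof -
  have "norm (a + b) powr p = 2 powr p * norm ((1/2) *\<^sub>R (a + b)) powr p"
    by (simp add: powr_mult[symmetric])
  also have "\<dots> \<le> 2 powr p * ((norm a powr p + norm b powr p) / 2)"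
    by (intro mult_left_mono norm_powr_midpoint_le p) simp
  also have "\<dots> \<le> 2 powr p * (norm a powr p + norm b powr p)"
    by (intro mult_left_mono) auto
  finally show ?thesis .
qed

text \<open>
  On the unit sphere of pairs the deficit in the midpoint inequality is bounded below by a positive
  constant on the compact set where the distance of the two points is not small; homogeneity does the rest.
\<close>

lemma uniform_convexity_powr:
  fixes p \<eta> :: real
  assumes p: "1 < p" and \<eta>: "0 < \<eta>"
  obtains K where "0 \<le> K" "\<And>a b :: 'b::euclidean_space. norm (a - b) powr p \<le> \<eta> * (norm a powr p + norm b powr p)
      + K * ((norm a powr p + norm b powr p) / 2 - norm ((1/2) *\<^sub>R (a + b)) powr p)"
proof -
  define S where "S = {(a :: 'b, b :: 'b). norm a powr p + norm b powr p = 1}"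
  define E where "E = {z \<in> S. \<eta> \<le> norm (fst z - snd z) powr p}"
  define g where "g = (\<lambda>z :: 'b \<times> 'b. (norm (fst z) powr p + norm (snd z) powr p) / 2
      - norm ((1/2) *\<^sub>R (fst z + snd z)) powr p)"
  have p0: "p \<noteq> 0" "0 < p" using p by auto
  have le1: "x \<le> 1" if "x powr p \<le> 1" "0 \<le> x" for x :: real
  proof (rule ccontr)
    assume "\<not> x \<le> 1"
    then have "1 powr p < x powr p" using p by (intro powr_less_mono2) auto
    then show False using that by simp
  qed
  have Snorm: "norm a \<le> 1 \<and> norm b \<le> 1" if "(a, b) \<in> S" for a b
  proof -
    have "norm a powr p + norm b powr p = 1" using that by (simp add: S_def)
    then have "norm a powr p \<le> 1" "norm b powr p \<le> 1"
      using powr_ge_zero[of "norm a" p] powr_ge_zero[of "norm b" p] by linarith+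
    then show ?thesis using le1[of "norm a"] le1[of "norm b"] by simp
  qed
  have cont: "continuous_on UNIV (\<lambda>z :: 'b \<times> 'b. norm (fst z) powr p + norm (snd z) powr p)"
    "continuous_on UNIV (\<lambda>z :: 'b \<times> 'b. norm (fst z - snd z) powr p)"
    "continuous_on UNIV g"
    unfolding g_def using p by (intro continuous_on_powr' continuous_intros; simp)+
  have "closed E"
  proof -
    have "E = (\<lambda>z. norm (fst z) powr p + norm (snd z) powr p) -` {1} \<inter> (\<lambda>z. norm (fst z - snd z) powr p) -` {\<eta>..}"
      by (auto simp: E_def S_def)
    then show ?thesis
      by (simp only: closed_Int closed_vimage[OF closed_singleton cont(1)] closed_vimage[OF closed_atLeast cont(2)])
  qed
  moreover have "bounded E"
  proof (rule boundedI)
    fix z assume "z \<in> E"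
    then have "norm (fst z) \<le> 1" "norm (snd z) \<le> 1" using Snorm[of "fst z" "snd z"] by (auto simp: E_def)
    then show "norm z \<le> 2" using norm_Pair_le[of "fst z" "snd z"] by simp
  qed
  ultimately have cE: "compact E" by (simp add: compact_eq_bounded_closed)
  have gpos: "0 < g z" if "z \<in> E" for z
  proof -
    have "fst z \<noteq> snd z" using that \<eta> by (auto simp: E_def)
    then show ?thesis using norm_powr_midpoint_less[OF p, of "fst z" "snd z"] by (simp add: g_def)
  qed
  have gnn: "0 \<le> g z" for z using norm_powr_midpoint_le[OF p, of "fst z" "snd z"] by (simp add: g_def)
  obtain m where m: "0 < m" "\<And>z. z \<in> E \<Longrightarrow> m \<le> g z"
  proof (cases "E = {}")
    case True then show ?thesis using that[of 1] by auto
  next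
    case False
    then obtain z0 where "z0 \<in> E" "\<forall>z\<in>E. g z0 \<le> g z"
      using continuous_attains_inf[OF cE _ continuous_on_subset[OF cont(3)]] by blast
    then show ?thesis using that[of "g z0"] gpos by auto
  qed
  \<comment> \<open>On the sphere both norms are at most 1, so the p-th power of the distance is at
    most 2^p; dividing by the least deficit \<open>m\<close> on \<open>E\<close> lets the deficit
    pay for it. Off \<open>E\<close> the term with \<eta> suffices.\<close>
  define K where "K = 2 powr p / m"
  have K0: "0 \<le> K" using m by (simp add: K_def)
  have unit: "norm (a - b) powr p \<le> \<eta> + K * g (a, b)" if "(a, b) \<in> S" for a b
  proof (cases "(a, b) \<in> E")
    case True
    have "norm (a - b) \<le> 2" using Snorm[OF that] norm_triangle_ineq4[of a b] by simp
    then have "norm (a - b) powr p \<le> 2 powr p" using p by (intro powr_mono2) auto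
    also have "\<dots> = K * m" using m by (simp add: K_def)
    also have "\<dots> \<le> K * g (a, b)" using m(2)[OF True] K0 by (intro mult_left_mono) auto
    finally show ?thesis using \<eta> by simp
  next
    case False
    then show ?thesis using that gnn[of "(a, b)"] K0 by (simp add: E_def add_increasing2)
  qed
  have main: "norm (a - b) powr p \<le> \<eta> * (norm a powr p + norm b powr p) + K * g (a, b)" for a b :: 'b
  proof (cases "norm a powr p + norm b powr p = 0")
    case True
    then have "norm a powr p = 0" "norm b powr p = 0"
      using powr_ge_zero[of "norm a" p] powr_ge_zero[of "norm b" p] by linarith+
    then have "a = 0" "b = 0" by auto
    then show ?thesis by (simp add: g_def)
  next
    case False
    define T where "T = norm a powr p + norm b powr p"
    have T: "0 < T" using False by (simp add: T_def order_less_le add_nonneg_nonneg)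
    \<comment> \<open>The p-th root of \<open>T\<close> rescales the pair onto the sphere; every
      term of the claim has degree p, so the estimate scales back by the factor
      \<open>T\<close>.\<close>
    define t where "t = T powr (1 / p)"
    have t: "0 < t" "t powr p = T" using T p0 by (auto simp: t_def powr_powr)
    define a' b' where "a' = (1 / t) *\<^sub>R a" and "b' = (1 / t) *\<^sub>R b"
    have sc: "norm ((1 / t) *\<^sub>R c) powr p = norm c powr p / T" for c :: 'b
      using t by (simp add: powr_divide)
    have "norm a' powr p + norm b' powr p = 1"
      using T unfolding a'_def b'_def sc by (simp only: add_divide_distrib[symmetric] T_def[symmetric]) simp
    then have "(a', b') \<in> S" by (simp add: S_def)
    from unit[OF this]
    have "norm (a' - b') powr p \<le> \<eta> + K * g (a', b')" .
    moreover have "norm (a' - b') powr p = norm (a - b) powr p / T"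
      unfolding a'_def b'_def scaleR_diff_right[symmetric] by (rule sc)
    moreover have "g (a', b') = g (a, b) / T"
    proof -
      have "(1/2) *\<^sub>R (a' + b') = (1 / t) *\<^sub>R ((1/2) *\<^sub>R (a + b))"
        by (simp add: a'_def b'_def algebra_simps)
      then have e: "norm ((1/2) *\<^sub>R (a' + b')) powr p = norm ((1/2) *\<^sub>R (a + b)) powr p / T"
        using sc[of "(1/2) *\<^sub>R (a + b)"] by metis
      have "norm a' powr p = norm a powr p / T" "norm b' powr p = norm b powr p / T"
        unfolding a'_def b'_def by (rule sc)+
      then show ?thesis using e unfolding g_def fst_conv snd_conv by (simp add: diff_divide_distrib add_divide_distrib)
    qed
    ultimately have "norm (a - b) powr p / T \<le> \<eta> + K * (g (a, b) / T)" by simp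
    then have "norm (a - b) powr p \<le> (\<eta> + K * (g (a, b) / T)) * T" using T by (simp add: pos_divide_le_eq)
    also have "\<dots> = \<eta> * T + K * g (a, b)" using T by (simp add: field_simps)
    finally show ?thesis by (simp add: T_def)
  qed
  show ?thesis by (rule that[OF K0]) (use main in \<open>simp add: g_def\<close>)
qed


text \<open>The same notion over an arbitrary measure, since the argument moves between
  \<open>lebesgue_on\<close> a set and products of such measures; \<open>Lp_eq\<close> identifies it
  with \<open>Lp\<close> in the first case.\<close>

definition Lp_fun :: "real \<Rightarrow> 'x measure \<Rightarrow> ('x \<Rightarrow> 'b::euclidean_space) set" where
  "Lp_fun p M = {f \<in> borel_measurable M. integrable M (\<lambda>x. norm (f x) powr p)}"

lemma Lp_funD:
  assumes "f \<in> Lp_fun p M"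
  shows "f \<in> borel_measurable M" "integrable M (\<lambda>x. norm (f x) powr p)"
  using assms by (auto simp: Lp_fun_def)

lemma Lp_fun_bounded_by:
  assumes "f \<in> borel_measurable M" "integrable M g" "\<And>x. x \<in> space M \<Longrightarrow> norm (f x) powr p \<le> g x"
  shows "f \<in> Lp_fun p M"
proof -
  have "integrable M (\<lambda>x. norm (f x) powr p)"
  proof (rule Bochner_Integration.integrable_bound[OF assms(2)])
    show "(\<lambda>x. norm (f x) powr p) \<in> borel_measurable M" using assms(1) by measurable
    show "AE x in M. norm (norm (f x) powr p) \<le> norm (g x)"
      using assms(3) by (intro AE_I2) (auto intro: order_trans[OF _ abs_ge_self])
  qed
  then show ?thesis using assms(1) by (simp add: Lp_fun_def)
qed

lemma Lp_fun_zero [simp]: "(\<lambda>x. 0) \<in> Lp_fun p M"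
  by (simp add: Lp_fun_def)

lemma Lp_fun_add:
  assumes p: "1 < p" and f: "f \<in> Lp_fun p M" and g: "g \<in> Lp_fun p M"
  shows "(\<lambda>x. f x + g x) \<in> Lp_fun p M"
  by (rule Lp_fun_bounded_by[where g = "\<lambda>x. 2 powr p * (norm (f x) powr p + norm (g x) powr p)"])
    (use Lp_funD[OF f] Lp_funD[OF g] norm_add_powr_le[OF p] in auto)

lemma Lp_fun_scaleR:
  assumes f: "f \<in> Lp_fun p M"
  shows "(\<lambda>x. c *\<^sub>R f x) \<in> Lp_fun p M"
  using Lp_funD[OF f] by (auto simp: Lp_fun_def powr_mult)

lemma Lp_fun_diff:
  assumes p: "1 < p" and f: "f \<in> Lp_fun p M" and g: "g \<in> Lp_fun p M"
  shows "(\<lambda>x. f x - g x) \<in> Lp_fun p M"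
  using Lp_fun_add[OF p f Lp_fun_scaleR[OF g, of "-1"]] by simp

lemma Lp_fun_sum:
  assumes p: "1 < p" and "\<And>i. i \<in> I \<Longrightarrow> f i \<in> Lp_fun p M"
  shows "(\<lambda>x. \<Sum>i\<in>I. f i x) \<in> Lp_fun p M"
  using assms(2) by (induction I rule: infinite_finite_induct) (auto intro: Lp_fun_add[OF p])

text \<open>The truncation bound below replaces Hoelder's inequality on sets of finite measure.\<close>

lemma le_add_powr:
  fixes a l p :: real
  assumes "1 \<le> p" "0 < l" "0 \<le> a"
  shows "a \<le> l + l powr (1 - p) * a powr p"
proof (cases "a \<le> l")
  case True then show ?thesis by (simp add: add_increasing2)
next
  case False
  \<comment> \<open>The exponent 1 - p is nonpositive, so passing from a down to l enlarges the
    power; multiplying by a^p gives back a on the left.\<close>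
  then have "a powr (1 - p) \<le> l powr (1 - p)" using assms by (intro powr_mono2') auto
  then have "a powr (1 - p) * a powr p \<le> l powr (1 - p) * a powr p" by (intro mult_right_mono) auto
  moreover have "a powr (1 - p) * a powr p = a" using False assms by (simp flip: powr_add)
  ultimately show ?thesis using assms by linarith
qed

lemma Lp_fun_integrable:
  assumes p: "1 < p" and M: "finite_measure M" and f: "f \<in> Lp_fun p M"
  shows "integrable M f"
proof (rule Bochner_Integration.integrable_bound[where f = "\<lambda>x. 1 + norm (f x) powr p"])
  interpret finite_measure M by fact
  show "integrable M (\<lambda>x. 1 + norm (f x) powr p)" using Lp_funD[OF f] by simp
  show "AE x in M. norm (f x) \<le> norm (1 + norm (f x) powr p)"
    using le_add_powr[of p 1] p by (intro AE_I2) (simp add: add_nonneg_nonneg)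
qed (use Lp_funD[OF f] in simp)

lemma LINT_norm_le_powr:
  assumes p: "1 < p" and M: "finite_measure M" and f: "f \<in> Lp_fun p M" and l: "0 < l"
  shows "(LINT x|M. norm (f x)) \<le> l * measure M (space M) + l powr (1 - p) * (LINT x|M. norm (f x) powr p)"
proof -
  interpret finite_measure M by fact
  have "(LINT x|M. norm (f x)) \<le> (LINT x|M. l + l powr (1 - p) * norm (f x) powr p)"
    using Lp_fun_integrable[OF p M f] Lp_funD[OF f] le_add_powr[of p l] p l
    by (intro integral_mono) auto
  then show ?thesis using Lp_funD[OF f] by (simp add: mult.commute)
qed

text \<open>The level \<open>l\<close> is fixed before n: it makes the measure term smaller than
  r/2, and afterwards l^(1-p) is a constant in front of a null sequence.\<close>

lemma Lp_tendsto_L1: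
  assumes p: "1 < p" and M: "finite_measure M" and f: "\<And>n. f n \<in> Lp_fun p M"
    and lim: "(\<lambda>n. LINT x|M. norm (f n x) powr p) \<longlonglongrightarrow> 0"
  shows "(\<lambda>n. LINT x|M. norm (f n x)) \<longlonglongrightarrow> 0"
proof (rule LIMSEQ_I)
  fix r :: real assume r: "0 < r"
  define m where "m = measure M (space M)"
  define l where "l = r / (2 * (m + 1))"
  have m: "0 \<le> m" by (simp add: m_def)
  have l: "0 < l" using r m by (simp add: l_def)
  have lm: "l * m < r / 2" using r m by (simp add: l_def field_simps)
  have "(\<lambda>n. l powr (1 - p) * (LINT x|M. norm (f n x) powr p)) \<longlonglongrightarrow> l powr (1 - p) * 0"
    by (intro tendsto_mult_left lim)
  then have "eventually (\<lambda>n. l powr (1 - p) * (LINT x|M. norm (f n x) powr p) < r / 2) sequentially"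
    using r by (intro order_tendstoD(2)[where y = "l powr (1 - p) * 0"]) auto
  then obtain n0 where n0: "\<And>n. n \<ge> n0 \<Longrightarrow> l powr (1 - p) * (LINT x|M. norm (f n x) powr p) < r / 2"
    by (auto simp: eventually_sequentially)
  have "norm ((LINT x|M. norm (f n x)) - 0) < r" if "n \<ge> n0" for n
    using LINT_norm_le_powr[OF p M f[of n] l] n0[OF that] lm by (simp add: m_def)
  then show "\<exists>n0. \<forall>n\<ge>n0. norm ((LINT x|M. norm (f n x)) - 0) < r" by blast
qed

text \<open>Weights are total functions on the naturals vanishing outside {n..<m}. This makes
  combinations of different lengths comparable after enlarging m, and the lower bound n records that
  only the tail from n on is used.\<close>

definition conv_weights :: "nat \<Rightarrow> nat \<Rightarrow> (nat \<Rightarrow> real) \<Rightarrow> bool" where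
  "conv_weights n m c \<longleftrightarrow> (\<forall>k. 0 \<le> c k) \<and> (\<forall>k. c k \<noteq> 0 \<longrightarrow> n \<le> k \<and> k < m) \<and> sum c {..<m} = 1"

lemma conv_weights_mono: "conv_weights n m c \<Longrightarrow> n' \<le> n \<Longrightarrow> conv_weights n' m c"
  by (fastforce simp: conv_weights_def)

lemma conv_weights_sum:
  fixes f :: "nat \<Rightarrow> 'v::real_vector"
  assumes "conv_weights n m c" "m \<le> m'"
  shows "(\<Sum>k<m'. c k *\<^sub>R f k) = (\<Sum>k<m. c k *\<^sub>R f k)"
  by (rule sum.mono_neutral_right) (use assms in \<open>force simp: conv_weights_def\<close>)+

lemma conv_weights_extend:
  assumes "conv_weights n m c" "m \<le> m'"
  shows "conv_weights n m' c"
proof -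
  have "sum c {..<m'} = sum c {..<m}"
    by (rule sum.mono_neutral_right) (use assms in \<open>force simp: conv_weights_def\<close>)+
  then show ?thesis using assms by (fastforce simp: conv_weights_def)
qed

lemma conv_weights_single: "conv_weights n (Suc n) (\<lambda>k. if k = n then 1 else 0)"
  by (auto simp: conv_weights_def)

lemma conv_weights_midpoint:
  assumes "conv_weights n m c" "conv_weights n m d"
  shows "conv_weights n m (\<lambda>k. (c k + d k) / 2)"
proof -
  have "(\<Sum>k<m. (c k + d k) / 2) = 1"
    unfolding sum_divide_distrib[symmetric] sum.distrib using assms by (simp add: conv_weights_def)
  moreover have "n \<le> k \<and> k < m" if "(c k + d k) / 2 \<noteq> 0" for k
  proof -
    have "c k \<noteq> 0 \<or> d k \<noteq> 0" using that by auto
    then show ?thesis using assms by (auto simp: conv_weights_def)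
  qed
  moreover have "0 \<le> (c k + d k) / 2" for k using assms by (simp add: conv_weights_def)
  ultimately show ?thesis unfolding conv_weights_def by blast
qed

lemma conv_weights_bound:
  fixes f :: "nat \<Rightarrow> real"
  assumes c: "conv_weights n m c" and f: "\<And>k. n \<le> k \<Longrightarrow> f k \<le> B"
  shows "(\<Sum>k<m. c k * f k) \<le> B"
proof -
  have "(\<Sum>k<m. c k * f k) \<le> (\<Sum>k<m. c k * B)"
  proof (rule sum_mono)
    fix k
    show "c k * f k \<le> c k * B"
      using c f by (cases "c k = 0") (auto simp: conv_weights_def intro!: mult_left_mono)
  qed
  then show ?thesis using c by (simp add: conv_weights_def flip: sum_distrib_right)
qed

text \<open>The n-th combination uses only terms from n on, all of which are already close to the
  limit.\<close>

lemma conv_weights_tendsto: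
  fixes a :: "nat \<Rightarrow> 'v::real_normed_vector"
  assumes c: "\<And>n. conv_weights n (m n) (c n)" and a: "a \<longlonglongrightarrow> l"
  shows "(\<lambda>n. \<Sum>k<m n. c n k *\<^sub>R a k) \<longlonglongrightarrow> l"
proof (rule LIMSEQ_I)
  fix r :: real assume r: "0 < r"
  obtain n0 where n0: "\<And>k. k \<ge> n0 \<Longrightarrow> norm (a k - l) < r / 2"
    using LIMSEQ_D[OF a, of "r / 2"] r by auto
  have "norm ((\<Sum>k<m n. c n k *\<^sub>R a k) - l) < r" if n: "n \<ge> n0" for n
  proof -
    have "(\<Sum>k<m n. c n k *\<^sub>R a k) - l = (\<Sum>k<m n. c n k *\<^sub>R (a k - l))"
      using c[of n] by (simp add: scaleR_diff_right sum_subtractf conv_weights_def flip: scaleR_sum_left)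
    then have "norm ((\<Sum>k<m n. c n k *\<^sub>R a k) - l) \<le> (\<Sum>k<m n. norm (c n k *\<^sub>R (a k - l)))"
      by (simp only: norm_sum)
    also have "\<dots> = (\<Sum>k<m n. c n k * norm (a k - l))"
      using c[of n] by (simp add: conv_weights_def)
    also have "\<dots> \<le> r / 2"
    proof (rule conv_weights_bound[OF c])
      fix k assume "n \<le> k"
      then have "n0 \<le> k" using n by simp
      from less_imp_le[OF n0[OF this]] show "norm (a k - l) \<le> r / 2" .
    qed
    finally show ?thesis using r by simp
  qed
  then show "\<exists>n0. \<forall>n\<ge>n0. norm ((\<Sum>k<m n. c n k *\<^sub>R a k) - l) < r" by blast
qed

text \<open>
  Almost minimal elements of the decreasing sequence of convex hulls of the tails form a Cauchy
  sequence, because midpoints stay in the hulls and the p-th power of the norm is uniformly convex.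
\<close>

lemma Lp_convex_combinations_Cauchy:
  fixes F :: "nat \<Rightarrow> 'x \<Rightarrow> 'b::euclidean_space"
  assumes p: "1 < p" and F: "\<And>k. F k \<in> Lp_fun p M"
    and bound: "\<And>k. (LINT x|M. norm (F k x) powr p) \<le> C"
  obtains c m where "\<And>n. conv_weights n (m n) (c n)"
    "\<forall>e>0. \<exists>N. \<forall>i\<ge>N. \<forall>j\<ge>N.
       (LINT x|M. norm ((\<Sum>k<m i. c i k *\<^sub>R F k x) - (\<Sum>k<m j. c j k *\<^sub>R F k x)) powr p) < e"
proof -
  \<comment> \<open>\<open>E\<close> is the energy of a combination, \<open>D n\<close> the set of
    energies over the hull of the tail from n, and \<open>d n\<close> its infimum. The hulls shrink,
    so \<open>d\<close> increases, and it is bounded by \<open>C\<close>; hence it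
    converges.\<close>
  define E where "E = (\<lambda>m c. LINT x|M. norm (\<Sum>k<m. c k *\<^sub>R F k x) powr p)"
  define D where "D = (\<lambda>n. {E m c |m c. conv_weights n m c})"
  define d where "d = (\<lambda>n. Inf (D n))"
  have Lp: "(\<lambda>x. \<Sum>k<m. c k *\<^sub>R F k x) \<in> Lp_fun p M" for m c
    by (intro Lp_fun_sum Lp_fun_scaleR F p)
  have E0: "0 \<le> E m c" for m c by (simp add: E_def)
  have bdd: "bdd_below (D n)" for n by (rule bdd_belowI[of _ 0]) (auto simp: D_def E0)
  have single: "E (Suc n) (\<lambda>k. if k = n then 1 else 0) = (LINT x|M. norm (F n x) powr p)" for n
    by (simp add: E_def if_distrib[where f = "\<lambda>a. a *\<^sub>R _"] cong: if_cong)
  have inD: "(LINT x|M. norm (F n x) powr p) \<in> D n" for n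
    using conv_weights_single[of n] single[of n, symmetric] unfolding D_def by blast
  have d_le: "d n \<le> E m c" if "conv_weights n m c" for n m c
    unfolding d_def by (rule cInf_lower[OF _ bdd]) (use that in \<open>auto simp: D_def\<close>)
  have d_C: "d n \<le> C" for n
    using cInf_lower[OF inD bdd] bound[of n] unfolding d_def by (rule order_trans)
  have d_mono: "incseq d"
  proof (rule incseq_SucI)
    fix n show "d n \<le> d (Suc n)"
      unfolding d_def
    proof (rule cInf_superset_mono[OF _ bdd])
      show "D (Suc n) \<noteq> {}" using inD[of "Suc n"] by auto
      show "D (Suc n) \<subseteq> D n" unfolding D_def using conv_weights_mono[of "Suc n" _ _ n] by fastforce
    qed
  qed
  have "\<exists>m c. conv_weights n m c \<and> E m c < d n + 1 / real (Suc n)" for n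
  proof -
    have "\<exists>e\<in>D n. e < d n + 1 / real (Suc n)"
      using inD[of n] unfolding d_def by (intro cInf_lessD) auto
    then show ?thesis by (auto simp: D_def)
  qed
  then obtain m c where cw: "\<And>n. conv_weights n (m n) (c n)"
    and near: "\<And>n. E (m n) (c n) < d n + 1 / real (Suc n)" by metis
  define h where "h = (\<lambda>n x. \<Sum>k<m n. c n k *\<^sub>R F k x)"
  have hLp: "h n \<in> Lp_fun p M" for n unfolding h_def by (rule Lp)
  have C0: "0 \<le> C" using order_trans[OF _ bound[of 0], of 0] by simp
  have hE: "(LINT x|M. norm (h n x) powr p) = E (m n) (c n)" for n by (simp add: h_def E_def)
  have hC: "(LINT x|M. norm (h n x) powr p) \<le> C + 1" for n
  proof -
    have "1 / real (Suc n) \<le> 1" by simp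
    then show ?thesis using near[of n] d_C[of n] hE[of n] by linarith
  qed
  have "convergent d" using incseq_convergent[OF d_mono, of C] d_C unfolding convergent_def by blast
  then have "Cauchy d" by (rule convergent_Cauchy)
  \<comment> \<open>For i <= j the combination with index j also lies in the hull of the tail from
    i, and so does the midpoint, whose energy is therefore at least \<open>d i\<close>.
    Near-minimality of both then forces the convexity deficit to be small.\<close>
  have mid: "d i \<le> (LINT x|M. norm ((1/2) *\<^sub>R (h i x + h j x)) powr p)" if "i \<le> j" for i j
  proof -
    define m' where "m' = max (m i) (m j)"
    have ci: "conv_weights i m' (c i)" by (rule conv_weights_extend[OF cw]) (simp add: m'_def)
    have cj: "conv_weights i m' (c j)"
      by (rule conv_weights_mono[OF conv_weights_extend[OF cw] that]) (simp add: m'_def)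
    have "(\<Sum>k<m'. ((c i k + c j k) / 2) *\<^sub>R F k x) = (1/2) *\<^sub>R (h i x + h j x)" for x
    proof -
      have "h i x = (\<Sum>k<m'. c i k *\<^sub>R F k x)" "h j x = (\<Sum>k<m'. c j k *\<^sub>R F k x)"
        unfolding h_def by (rule conv_weights_sum[OF cw, symmetric], simp add: m'_def)+
      then show ?thesis
        by (simp add: scaleR_sum_right scaleR_add_left scaleR_add_right sum.distrib add_divide_distrib)
    qed
    then show ?thesis using d_le[OF conv_weights_midpoint[OF ci cj]] by (simp add: E_def)
  qed
  have "\<exists>N. \<forall>i\<ge>N. \<forall>j\<ge>N. (LINT x|M. norm (h i x - h j x) powr p) < e" if e: "0 < e" for e
  proof -
    \<comment> \<open>Each energy is at most C + 1, so the term with \<eta> contributes at most e/2;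
      the choice of \<delta> below bounds the term with \<open>K\<close> by e/4.\<close>
    define \<eta> where "\<eta> = e / (4 * (C + 1))"
    have \<eta>: "0 < \<eta>" using e C0 by (simp add: \<eta>_def)
    obtain K where K: "0 \<le> K" "\<And>a b :: 'b. norm (a - b) powr p \<le> \<eta> * (norm a powr p + norm b powr p)
      + K * ((norm a powr p + norm b powr p) / 2 - norm ((1/2) *\<^sub>R (a + b)) powr p)"
      using uniform_convexity_powr[OF p \<eta>] by blast
    define \<delta> where "\<delta> = e / (8 * (K + 1))"
    have \<delta>: "0 < \<delta>" using e K by (simp add: \<delta>_def)
    obtain N1 where N1: "\<And>i j. i \<ge> N1 \<Longrightarrow> j \<ge> N1 \<Longrightarrow> norm (d i - d j) < \<delta>"
      using CauchyD[OF \<open>Cauchy d\<close> \<delta>] by blast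
    obtain N2 where N2: "1 / real (Suc N2) < \<delta>" using nat_approx_posE[OF \<delta>] by blast
    have arith: "(a + b) / 2 - z \<le> x + x" if "a < u + x" "b < v + x" "v - u < x" "u \<le> z" "0 < x" for a b u v x z :: real
      using that by argo
    have key: "(LINT x|M. norm (h i x - h j x) powr p) < e" if ij: "max N1 N2 \<le> i" "i \<le> j" for i j
    proof -
      note int = Lp_funD(2)[OF hLp]
      have intm: "integrable M (\<lambda>x. norm ((1/2) *\<^sub>R (h i x + h j x)) powr p)"
        by (rule Lp_funD(2)[OF Lp_fun_scaleR[OF Lp_fun_add[OF p hLp hLp]]])
      have "(LINT x|M. norm (h i x - h j x) powr p) \<le>
          (LINT x|M. \<eta> * (norm (h i x) powr p + norm (h j x) powr p)
      + K * ((norm (h i x) powr p + norm (h j x) powr p) / 2 - norm ((1/2) *\<^sub>R (h i x + h j x)) powr p))"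
        using int[of i] int[of j] intm Lp_funD(2)[OF Lp_fun_diff[OF p hLp hLp]]
        by (intro integral_mono K) auto
      also have "\<dots> = \<eta> * (E (m i) (c i) + E (m j) (c j))
      + K * ((E (m i) (c i) + E (m j) (c j)) / 2 - (LINT x|M. norm ((1/2) *\<^sub>R (h i x + h j x)) powr p))"
        using int[of i] int[of j] intm unfolding hE[symmetric] by simp
      also have "\<dots> \<le> \<eta> * ((C + 1) + (C + 1)) + K * (\<delta> + \<delta>)"
      proof (intro add_mono mult_left_mono)
        have "1 / real (Suc i) \<le> 1 / real (Suc N2)" "1 / real (Suc j) \<le> 1 / real (Suc N2)"
          using ij by (auto simp: field_simps)
        with N2 have i: "1 / real (Suc i) < \<delta>" and j: "1 / real (Suc j) < \<delta>" by (blast intro: le_less_trans)+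
        have "E (m i) (c i) < d i + \<delta>" "E (m j) (c j) < d j + \<delta>"
          by (rule less_trans[OF near add_strict_left_mono[OF i]], rule less_trans[OF near add_strict_left_mono[OF j]])
        moreover have "d j - d i < \<delta>" using N1[of i j] ij by auto
        ultimately show "(E (m i) (c i) + E (m j) (c j)) / 2
            - (LINT x|M. norm ((1/2) *\<^sub>R (h i x + h j x)) powr p) \<le> \<delta> + \<delta>"
          using mid[OF ij(2)] \<delta> arith[of "E (m i) (c i)" "d i" \<delta> "E (m j) (c j)" "d j"] by blast
      qed (use hC[unfolded hE] \<eta> K in auto)
      also have "\<dots> < e"
      proof -
        have "\<eta> * ((C + 1) + (C + 1)) = e / 2" using C0 by (simp add: \<eta>_def field_simps)
        moreover have "x * (e / (8 * x)) = e / 8" if "0 < x" for x :: real using that by simp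
        from this[of "K + 1"] have "(K + 1) * \<delta> = e / 8" unfolding \<delta>_def using K(1) by linarith
        then have "K * (\<delta> + \<delta>) \<le> e / 4" using \<delta> unfolding distrib_left distrib_right by linarith
        ultimately show ?thesis using e by linarith
      qed
      finally show ?thesis .
    qed
    have "(LINT x|M. norm (h i x - h j x) powr p) < e" if "max N1 N2 \<le> i" "max N1 N2 \<le> j" for i j
      using key[of i j] key[of j i] that by (cases "i \<le> j") (auto simp: norm_minus_commute)
    then show ?thesis by blast
  qed
  with cw show ?thesis unfolding h_def by (intro that[of m c]) auto
qed

text \<open>Riesz-Fischer: on a finite measure space the sequence is also Cauchy in L^1, which
  yields an almost everywhere convergent subsequence, and Fatou's lemma carries the Cauchy bound
  over to its limit.\<close>

lemma Lp_complete:
  fixes h :: "nat \<Rightarrow> 'x \<Rightarrow> 'b::euclidean_space"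
  assumes p: "1 < p" and M: "finite_measure M" and h: "\<And>n. h n \<in> Lp_fun p M"
    and Cauchy: "\<And>e. 0 < e \<Longrightarrow> \<exists>N. \<forall>i\<ge>N. \<forall>j\<ge>N. (LINT x|M. norm (h i x - h j x) powr p) < e"
  obtains r L where "strict_mono (r :: nat \<Rightarrow> nat)" "L \<in> Lp_fun p M"
    "(\<lambda>n. LINT x|M. norm (h (r n) x - L x) powr p) \<longlonglongrightarrow> 0"
proof -
  interpret finite_measure M by fact
  have hm[measurable]: "h n \<in> borel_measurable M" for n by (rule Lp_funD(1)[OF h])
  have dLp: "(\<lambda>x. h i x - h j x) \<in> Lp_fun p M" for i j by (rule Lp_fun_diff[OF p h h])
  have "\<exists>N. \<forall>i\<ge>N. \<forall>j\<ge>N. (LINT x|M. norm (h i x - h j x)) < e" if e: "0 < e" for e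
  proof -
    define l where "l = e / (2 * (measure M (space M) + 1))"
    have l: "0 < l" using e by (simp add: l_def add_nonneg_pos)
    have lm: "l * measure M (space M) < e / 2"
    proof -
      have "e / (2 * a) * a = e / 2" if "0 < a" for a :: real using that by simp
      from this[of "measure M (space M) + 1"] have "l * (measure M (space M) + 1) = e / 2"
        unfolding l_def by (simp only: add_nonneg_pos measure_nonneg zero_less_one)
      then show ?thesis using l by (simp add: distrib_left)
    qed
    \<comment> \<open>The factor l^(p-1) cancels against l^(1-p) in the truncation bound.\<close>
    obtain N where N: "\<And>i j. i \<ge> N \<Longrightarrow> j \<ge> N \<Longrightarrow> (LINT x|M. norm (h i x - h j x) powr p) < e / 2 * l powr (p - 1)"
      using Cauchy[of "e / 2 * l powr (p - 1)"] e l by auto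
    have "(LINT x|M. norm (h i x - h j x)) < e" if "i \<ge> N" "j \<ge> N" for i j
    proof -
      have "l powr (1 - p) * (LINT x|M. norm (h i x - h j x) powr p) \<le> l powr (1 - p) * (e / 2 * l powr (p - 1))"
        using N[OF that] by (intro mult_left_mono) auto
      also have "\<dots> = e / 2" using l by (simp add: powr_diff)
      finally show ?thesis using LINT_norm_le_powr[OF p M dLp[of i j] l] lm by linarith
    qed
    then show ?thesis by blast
  qed
  with cauchy_L1_AE_cauchy_subseq[of M h] Lp_fun_integrable[OF p M h]
  obtain r where r: "strict_mono r" "AE x in M. Cauchy (\<lambda>i. h (r i) x)" by auto
  define L where "L = (\<lambda>x. lim (\<lambda>i. h (r i) x))"
  have Lm[measurable]: "L \<in> borel_measurable M" unfolding L_def by measurable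
  have conv: "AE x in M. (\<lambda>i. h (r i) x) \<longlonglongrightarrow> L x"
    using r(2) by eventually_elim (simp add: L_def Cauchy_convergent_iff convergent_LIMSEQ_iff)
  have key: "integrable M (\<lambda>x. norm (h (r i) x - L x) powr p) \<and> (LINT x|M. norm (h (r i) x - L x) powr p) \<le> e"
    if e: "0 < e" and N: "\<And>i j. i \<ge> N \<Longrightarrow> j \<ge> N \<Longrightarrow> (LINT x|M. norm (h i x - h j x) powr p) < e" and i: "N \<le> i" for e N i
  proof -
    have rk: "N \<le> r k" if "N \<le> k" for k using seq_suble[OF r(1), of k] that by simp
    have "(\<integral>\<^sup>+x. ennreal (norm (h (r i) x - L x) powr p) \<partial>M)
        = (\<integral>\<^sup>+x. liminf (\<lambda>j. ennreal (norm (h (r i) x - h (r j) x) powr p)) \<partial>M)"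
    proof (rule nn_integral_cong_AE, use conv in eventually_elim)
      fix x assume "(\<lambda>i. h (r i) x) \<longlonglongrightarrow> L x"
      then have "(\<lambda>j. ennreal (norm (h (r i) x - h (r j) x) powr p)) \<longlonglongrightarrow> ennreal (norm (h (r i) x - L x) powr p)"
        using p by (intro tendsto_ennrealI tendsto_powr' tendsto_intros) auto
      from lim_imp_Liminf[OF _ this]
      show "ennreal (norm (h (r i) x - L x) powr p) = liminf (\<lambda>j. ennreal (norm (h (r i) x - h (r j) x) powr p))"
        by (metis trivial_limit_sequentially)
    qed
    also have "\<dots> \<le> liminf (\<lambda>j. \<integral>\<^sup>+x. ennreal (norm (h (r i) x - h (r j) x) powr p) \<partial>M)"
      by (rule nn_integral_liminf) measurable
    also have "\<dots> \<le> ennreal e"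
    proof (rule Liminf_le)
      show "eventually (\<lambda>j. (\<integral>\<^sup>+x. ennreal (norm (h (r i) x - h (r j) x) powr p) \<partial>M) \<le> ennreal e) sequentially"
      proof (rule eventually_sequentiallyI[of N])
        fix j assume "N \<le> j"
        then show "(\<integral>\<^sup>+x. ennreal (norm (h (r i) x - h (r j) x) powr p) \<partial>M) \<le> ennreal e"
          using N[OF rk[OF i] rk[of j]] Lp_funD(2)[OF dLp] by (subst nn_integral_eq_integral) (auto intro: ennreal_leI)
      qed
    qed simp
    finally have *: "(\<integral>\<^sup>+x. ennreal (norm (h (r i) x - L x) powr p) \<partial>M) \<le> ennreal e" .
    have I: "integrable M (\<lambda>x. norm (h (r i) x - L x) powr p)"
      using * by (intro integrableI_bounded) (auto simp: top.not_eq_extremum[symmetric] top_unique)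
    then show ?thesis using * e by (simp add: nn_integral_eq_integral)
  qed
  obtain N1 where N1: "\<And>i j. i \<ge> N1 \<Longrightarrow> j \<ge> N1 \<Longrightarrow> (LINT x|M. norm (h i x - h j x) powr p) < 1"
    using Cauchy[of 1] by auto
  have "(\<lambda>x. h (r N1) x - L x) \<in> Lp_fun p M" using key[OF _ N1, of N1] by (simp add: Lp_fun_def)
  from Lp_fun_diff[OF p h[of "r N1"] this] have LLp: "L \<in> Lp_fun p M" by simp
  have "(\<lambda>n. LINT x|M. norm (h (r n) x - L x) powr p) \<longlonglongrightarrow> 0"
  proof (rule LIMSEQ_I)
    fix e :: real assume e: "0 < e"
    obtain N where N: "\<And>i j. i \<ge> N \<Longrightarrow> j \<ge> N \<Longrightarrow> (LINT x|M. norm (h i x - h j x) powr p) < e / 2"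
      using Cauchy[of "e / 2"] e by auto
    have "norm ((LINT x|M. norm (h (r n) x - L x) powr p) - 0) < e" if "n \<ge> N" for n
      using key[of "e / 2", OF _ N that] e by simp
    then show "\<exists>N. \<forall>n\<ge>N. norm ((LINT x|M. norm (h (r n) x - L x) powr p) - 0) < e" by blast
  qed
  with r(1) LLp show ?thesis by (rule that)
qed


text \<open>If the sequence were at least l + e infinitely often, all convex combinations of the
  subsequence of such terms would be so as well, against the assumption; the lower bound follows by
  changing signs.\<close>

lemma tendsto_of_convex_combinations:
  fixes a :: "nat \<Rightarrow> real"
  assumes "\<And>t :: nat \<Rightarrow> nat. strict_mono t \<Longrightarrow>
    \<exists>c m. (\<forall>n. conv_weights n (m n) (c n)) \<and> (\<lambda>n. \<Sum>k<m n. c n k * a (t k)) \<longlonglongrightarrow> l"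
  shows "a \<longlonglongrightarrow> l"
proof -
  have upper: "eventually (\<lambda>k. b k < l' + e) sequentially"
    if e: "0 < e" and b: "\<And>t :: nat \<Rightarrow> nat. strict_mono t \<Longrightarrow>
    \<exists>c m. (\<forall>n. conv_weights n (m n) (c n)) \<and> (\<lambda>n. \<Sum>k<m n. c n k * b (t k)) \<longlonglongrightarrow> l'" for b :: "nat \<Rightarrow> real" and l' e
  proof (rule ccontr)
    assume "\<not> eventually (\<lambda>k. b k < l' + e) sequentially"
    then have "infinite {k. l' + e \<le> b k}"
      by (simp add: eventually_sequentially infinite_nat_iff_unbounded_le not_less)
    then obtain t :: "nat \<Rightarrow> nat" where t: "strict_mono t" "\<And>n. t n \<in> {k. l' + e \<le> b k}"
      using infinite_enumerate[of "{k. l' + e \<le> b k}"] by blast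
    obtain c m where c: "\<And>n. conv_weights n (m n) (c n)" and lim: "(\<lambda>n. \<Sum>k<m n. c n k * b (t k)) \<longlonglongrightarrow> l'"
      using b[OF t(1)] by blast
    have "l' + e \<le> (\<Sum>k<m n. c n k * b (t k))" for n
    proof -
      have "(\<Sum>k<m n. c n k * - b (t k)) \<le> - (l' + e)"
      proof (rule conv_weights_bound[OF c[of n]])
        show "- b (t k) \<le> - (l' + e)" for k using t(2)[of k] by simp
      qed
      then show ?thesis by (simp add: sum_negf)
    qed
    then have "l' + e \<le> l'" by (intro LIMSEQ_le_const[OF lim]) auto
    then show False using e by simp
  qed
  show ?thesis
  proof (rule order_tendstoI)
    fix y assume "l < y"
    then show "eventually (\<lambda>k. a k < y) sequentially" using upper[of "y - l" a l] assms by auto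
  next
    fix y assume y: "y < l"
    have "eventually (\<lambda>k. - a k < - l + (l - y)) sequentially"
    proof (rule upper)
      fix t :: "nat \<Rightarrow> nat" assume "strict_mono t"
      from assms[OF this] obtain c m where "\<forall>n. conv_weights n (m n) (c n)" "(\<lambda>n. \<Sum>k<m n. c n k * a (t k)) \<longlonglongrightarrow> l"
        by blast
      then show "\<exists>c m. (\<forall>n. conv_weights n (m n) (c n)) \<and> (\<lambda>n. \<Sum>k<m n. c n k * - a (t k)) \<longlonglongrightarrow> - l"
        by (intro exI[of _ c] exI[of _ m]) (auto simp: sum_negf intro: tendsto_minus)
    qed (use y in simp)
    then show "eventually (\<lambda>k. y < a k) sequentially" by simp
  qed
qed

text \<open>The quantification over all subsequences with one and the same \<open>L\<close> is what
  gives convergence of functionals along the entire sequence; norm convergence of combinations of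
  \<open>F\<close> alone would say nothing about the individual terms.\<close>

definition mazur_limit :: "real \<Rightarrow> 'x measure \<Rightarrow> (nat \<Rightarrow> 'x \<Rightarrow> 'b::euclidean_space) \<Rightarrow> ('x \<Rightarrow> 'b) \<Rightarrow> bool" where
  "mazur_limit p M F L \<longleftrightarrow> (\<forall>k. F k \<in> Lp_fun p M) \<and> L \<in> Lp_fun p M \<and>
     (\<forall>t :: nat \<Rightarrow> nat. strict_mono t \<longrightarrow> (\<exists>c m. (\<forall>n. conv_weights n (m n) (c n)) \<and>
        (\<lambda>n. LINT x|M. norm ((\<Sum>k<m n. c n k *\<^sub>R F (t k) x) - L x) powr p) \<longlonglongrightarrow> 0))"

lemma integral_inner_tendsto:
  fixes h :: "nat \<Rightarrow> 'x \<Rightarrow> 'b::euclidean_space"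
  assumes p: "1 < p" and M: "finite_measure M" and h: "\<And>n. h n \<in> Lp_fun p M" and L: "L \<in> Lp_fun p M"
    and lim: "(\<lambda>n. LINT x|M. norm (h n x - L x) powr p) \<longlonglongrightarrow> 0"
    and psi: "\<psi> \<in> borel_measurable M" "\<And>x. norm (\<psi> x) \<le> B"
  shows "(\<lambda>n. LINT x|M. \<psi> x \<bullet> h n x) \<longlonglongrightarrow> (LINT x|M. \<psi> x \<bullet> L x)"
proof -
  have psi_int: "integrable M (\<lambda>x. \<psi> x \<bullet> f x)" if f: "f \<in> Lp_fun p M" for f
  proof (rule Bochner_Integration.integrable_bound)
    show "integrable M (\<lambda>x. B * norm (f x))" using Lp_fun_integrable[OF p M f] by simp
    show "(\<lambda>x. \<psi> x \<bullet> f x) \<in> borel_measurable M" using psi Lp_funD[OF f] by measurable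
    have "norm (\<psi> x \<bullet> f x) \<le> norm (B * norm (f x))" for x
      using Cauchy_Schwarz_ineq2[of "\<psi> x" "f x"] mult_right_mono[OF psi(2)[of x] norm_ge_zero[of "f x"]]
      by (simp add: abs_mult) (metis (no_types) abs_ge_self dual_order.trans mult_right_mono norm_ge_zero psi(2))
    then show "AE x in M. norm (\<psi> x \<bullet> f x) \<le> norm (B * norm (f x))" by simp
  qed
  have dLp: "(\<lambda>x. h n x - L x) \<in> Lp_fun p M" for n by (rule Lp_fun_diff[OF p h L])
  have "(\<lambda>n. B * (LINT x|M. norm (h n x - L x))) \<longlonglongrightarrow> B * 0"
    by (intro tendsto_mult_left Lp_tendsto_L1[OF p M dLp lim])
  then have lim0: "(\<lambda>n. B * (LINT x|M. norm (h n x - L x))) \<longlonglongrightarrow> 0" by simp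
  have "(\<lambda>n. (LINT x|M. \<psi> x \<bullet> h n x) - (LINT x|M. \<psi> x \<bullet> L x)) \<longlonglongrightarrow> 0"
  proof (rule Lim_null_comparison[OF _ lim0], rule always_eventually, rule allI)
    fix n
    have "norm ((LINT x|M. \<psi> x \<bullet> h n x) - (LINT x|M. \<psi> x \<bullet> L x)) = norm (LINT x|M. \<psi> x \<bullet> (h n x - L x))"
      using psi_int[OF h] psi_int[OF L] by (simp add: inner_diff_right)
    also have "\<dots> \<le> (LINT x|M. norm (\<psi> x \<bullet> (h n x - L x)))" by (rule integral_norm_bound)
    also have "\<dots> \<le> (LINT x|M. B * norm (h n x - L x))"
    proof (rule integral_mono)
      show "norm (\<psi> x \<bullet> (h n x - L x)) \<le> B * norm (h n x - L x)" for x
        using Cauchy_Schwarz_ineq2[of "\<psi> x" "h n x - L x"] mult_right_mono[OF psi(2)[of x] norm_ge_zero[of "h n x - L x"]]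
        by simp
    qed (use psi_int[OF dLp] Lp_fun_integrable[OF p M dLp] in auto)
    finally show "norm ((LINT x|M. \<psi> x \<bullet> h n x) - (LINT x|M. \<psi> x \<bullet> L x)) \<le> B * (LINT x|M. norm (h n x - L x))"
      by simp
  qed
  then show ?thesis by (simp add: LIM_zero_iff)
qed

text \<open>Bounded test functions suffice for the limits taken later, so no dual exponent occurs:
  on a finite measure space L^p convergence of the combinations implies L^1 convergence.\<close>

lemma mazur_limit_inner:
  fixes F :: "nat \<Rightarrow> 'x \<Rightarrow> 'b::euclidean_space"
  assumes p: "1 < p" and M: "finite_measure M" and maz: "mazur_limit p M F L"
    and psi: "\<psi> \<in> borel_measurable M" "\<And>x. norm (\<psi> x) \<le> B"
  shows "(\<lambda>k. LINT x|M. \<psi> x \<bullet> F k x) \<longlonglongrightarrow> (LINT x|M. \<psi> x \<bullet> L x)"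
proof (rule tendsto_of_convex_combinations)
  fix t :: "nat \<Rightarrow> nat" assume t: "strict_mono t"
  have F: "F k \<in> Lp_fun p M" for k using maz by (simp add: mazur_limit_def)
  have L: "L \<in> Lp_fun p M" using maz by (simp add: mazur_limit_def)
  obtain c m where c: "\<And>n. conv_weights n (m n) (c n)"
    and lim: "(\<lambda>n. LINT x|M. norm ((\<Sum>k<m n. c n k *\<^sub>R F (t k) x) - L x) powr p) \<longlonglongrightarrow> 0"
    using maz t unfolding mazur_limit_def by blast
  have psi_int: "integrable M (\<lambda>x. \<psi> x \<bullet> F k x)" for k
  proof (rule Bochner_Integration.integrable_bound)
    show "integrable M (\<lambda>x. B * norm (F k x))" using Lp_fun_integrable[OF p M F] by simp
    show "(\<lambda>x. \<psi> x \<bullet> F k x) \<in> borel_measurable M" using psi Lp_funD[OF F] by measurable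
    have "norm (\<psi> x \<bullet> F k x) \<le> norm (B * norm (F k x))" for x
      using Cauchy_Schwarz_ineq2[of "\<psi> x" "F k x"] mult_right_mono[OF psi(2)[of x] norm_ge_zero[of "F k x"]]
        abs_ge_self[of "B * norm (F k x)"] by simp
    then show "AE x in M. norm (\<psi> x \<bullet> F k x) \<le> norm (B * norm (F k x))" by simp
  qed
  have "(\<lambda>n. LINT x|M. \<psi> x \<bullet> (\<Sum>k<m n. c n k *\<^sub>R F (t k) x)) \<longlonglongrightarrow> (LINT x|M. \<psi> x \<bullet> L x)"
    by (rule integral_inner_tendsto[OF p M _ L lim psi]) (intro Lp_fun_sum Lp_fun_scaleR F p)
  moreover have "(LINT x|M. \<psi> x \<bullet> (\<Sum>k<m n. c n k *\<^sub>R F (t k) x)) = (\<Sum>k<m n. c n k * (LINT x|M. \<psi> x \<bullet> F (t k) x))" for n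
    using psi_int by (simp add: inner_sum_right)
  ultimately show "\<exists>c m. (\<forall>n. conv_weights n (m n) (c n)) \<and>
      (\<lambda>n. \<Sum>k<m n. c n k * (LINT x|M. \<psi> x \<bullet> F (t k) x)) \<longlonglongrightarrow> (LINT x|M. \<psi> x \<bullet> L x)"
    using c by auto
qed

text \<open>
  Testing against countably many sets that determine integrable functions pins down the limit, so
  it is the same for convex combinations of every further subsequence.
\<close>

theorem Lp_bounded_mazur_subsequence:
  fixes F :: "nat \<Rightarrow> 'x \<Rightarrow> 'b::euclidean_space" and G :: "nat \<Rightarrow> 'x set"
  assumes p: "1 < p" and M: "finite_measure M" and F: "\<And>k. F k \<in> Lp_fun p M"
    and bound: "\<And>k. (LINT x|M. norm (F k x) powr p) \<le> C"
    and G: "\<And>n. G n \<in> sets M"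
    and determ: "\<And>f :: 'x \<Rightarrow> 'b. integrable M f \<Longrightarrow> (\<And>n. (LINT x|M. indicat_real (G n) x *\<^sub>R f x) = 0) \<Longrightarrow> AE x in M. f x = 0"
  obtains s L where "strict_mono (s :: nat \<Rightarrow> nat)" "mazur_limit p M (F \<circ> s) L"
proof -
  interpret finite_measure M by fact
  \<comment> \<open>The moments on the test sets. They are bounded uniformly in k, so a diagonal
    subsequence makes all of them converge, with limits \<open>J n\<close>.\<close>
  define I where "I = (\<lambda>n k. LINT x|M. indicat_real (G n) x *\<^sub>R F k x)"
  have intF: "integrable M (F k)" for k by (rule Lp_fun_integrable[OF p M F])
  have intG: "integrable M (\<lambda>x. indicat_real (G n) x *\<^sub>R f x)" if "integrable M f" for n and f :: "'x \<Rightarrow> 'b"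
    by (rule integrable_mult_indicator[OF G that])
  have I_bound: "norm (I n k) \<le> measure M (space M) + C" for n k
  proof -
    have "norm (I n k) \<le> (LINT x|M. norm (indicat_real (G n) x *\<^sub>R F k x))"
      unfolding I_def by (rule integral_norm_bound)
    also have "\<dots> \<le> (LINT x|M. norm (F k x))"
      by (intro integral_mono integrable_norm intG intF) (auto simp: indicator_def)
    also have "\<dots> \<le> measure M (space M) + C"
      using LINT_norm_le_powr[OF p M F, of 1 k] bound[of k] by simp
    finally show ?thesis .
  qed
  interpret subseqs "\<lambda>n s. convergent (\<lambda>k. I n (s k))"
  proof
    fix n and s :: "nat \<Rightarrow> nat" assume "strict_mono s"
    have "bounded (range (\<lambda>k. I n (s k)))" using I_bound by (intro boundedI) auto
    from bounded_imp_convergent_subsequence[OF this]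
    show "\<exists>r'. strict_mono r' \<and> convergent (\<lambda>k. I n ((s \<circ> r') k))"
      by (auto simp: convergent_def o_def)
  qed
  define s where "s = diagseq"
  have s: "strict_mono s" unfolding s_def by (rule subseq_diagseq)
  have "convergent (\<lambda>k. I n (s k))" for n
  proof -
    have "convergent (\<lambda>k. I n ((s \<circ> ((+) (Suc n))) k))"
      unfolding s_def by (rule diagseq_holds) (auto simp: convergent_def o_def intro: LIMSEQ_subseq_LIMSEQ[unfolded o_def])
    then show ?thesis using convergent_ignore_initial_segment[of "\<lambda>k. I n (s k)" "Suc n"] by (simp add: add.commute)
  qed
  then obtain J where J: "\<And>n. (\<lambda>k. I n (s k)) \<longlonglongrightarrow> J n" unfolding convergent_def by metis
  \<comment> \<open>Every further subsequence has norm-convergent convex combinations, and combining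
    does not change the limits of the moments. All the resulting limits therefore share the moments
    \<open>J n\<close> and coincide almost everywhere by \<open>determ\<close>.\<close>
  have ex: "\<exists>L c m. L \<in> Lp_fun p M \<and> (\<forall>n. conv_weights n (m n) (c n)) \<and>
      (\<lambda>n. LINT x|M. norm ((\<Sum>k<m n. c n k *\<^sub>R F (s (t k)) x) - L x) powr p) \<longlonglongrightarrow> 0 \<and>
      (\<forall>n. (LINT x|M. indicat_real (G n) x *\<^sub>R L x) = J n)" if t: "strict_mono t" for t
  proof -
    obtain c m where c: "\<And>n. conv_weights n (m n) (c n)" and Cau: "\<forall>e>0. \<exists>N. \<forall>i\<ge>N. \<forall>j\<ge>N.
       (LINT x|M. norm ((\<Sum>k<m i. c i k *\<^sub>R F (s (t k)) x) - (\<Sum>k<m j. c j k *\<^sub>R F (s (t k)) x)) powr p) < e"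
      by (rule Lp_convex_combinations_Cauchy[of p "\<lambda>k. F (s (t k))" M C, OF p F bound]) (rule that; assumption)
    define h where "h = (\<lambda>n x. \<Sum>k<m n. c n k *\<^sub>R F (s (t k)) x)"
    have h: "h n \<in> Lp_fun p M" for n unfolding h_def by (intro Lp_fun_sum Lp_fun_scaleR F p)
    obtain r L where r: "strict_mono (r :: nat \<Rightarrow> nat)" and L: "L \<in> Lp_fun p M"
      and lim: "(\<lambda>n. LINT x|M. norm (h (r n) x - L x) powr p) \<longlonglongrightarrow> 0"
    proof (rule Lp_complete[OF p M h])
      show "\<exists>N. \<forall>i\<ge>N. \<forall>j\<ge>N. (LINT x|M. norm (h i x - h j x) powr p) < e" if "0 < e" for e
        using Cau that unfolding h_def by blast
    qed (rule that)
    have cr: "conv_weights n (m (r n)) (c (r n))" for n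
      by (rule conv_weights_mono[OF c seq_suble[OF r]])
    have "(LINT x|M. indicat_real (G n) x *\<^sub>R L x) = J n" for n
    proof (rule LIMSEQ_unique)
      have hL: "(\<lambda>x. h (r k) x - L x) \<in> Lp_fun p M" for k by (rule Lp_fun_diff[OF p h L])
      have lim1: "(\<lambda>k. LINT x|M. norm (h (r k) x - L x)) \<longlonglongrightarrow> 0" by (rule Lp_tendsto_L1[OF p M hL lim])
      have "(\<lambda>k. (LINT x|M. indicat_real (G n) x *\<^sub>R h (r k) x) - (LINT x|M. indicat_real (G n) x *\<^sub>R L x)) \<longlonglongrightarrow> 0"
      proof (rule Lim_null_comparison[OF _ lim1], rule always_eventually, rule allI)
        fix k
        note ih = Lp_fun_integrable[OF p M h] and iL = Lp_fun_integrable[OF p M L] and ihL = Lp_fun_integrable[OF p M hL]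
        have "norm ((LINT x|M. indicat_real (G n) x *\<^sub>R h (r k) x) - (LINT x|M. indicat_real (G n) x *\<^sub>R L x))
            = norm (LINT x|M. indicat_real (G n) x *\<^sub>R (h (r k) x - L x))"
          using intG[OF ih] intG[OF iL] by (simp add: scaleR_diff_right)
        also have "\<dots> \<le> (LINT x|M. norm (indicat_real (G n) x *\<^sub>R (h (r k) x - L x)))" by (rule integral_norm_bound)
        also have "\<dots> \<le> (LINT x|M. norm (h (r k) x - L x))"
          by (intro integral_mono integrable_norm intG ihL) (auto simp: indicator_def)
        finally show "norm ((LINT x|M. indicat_real (G n) x *\<^sub>R h (r k) x) - (LINT x|M. indicat_real (G n) x *\<^sub>R L x))
            \<le> (LINT x|M. norm (h (r k) x - L x))" .
      qed
      then show "(\<lambda>k. LINT x|M. indicat_real (G n) x *\<^sub>R h (r k) x) \<longlonglongrightarrow> (LINT x|M. indicat_real (G n) x *\<^sub>R L x)"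
        by (simp add: LIM_zero_iff)
      have "(LINT x|M. indicat_real (G n) x *\<^sub>R h i x) = (\<Sum>k<m i. c i k *\<^sub>R I n (s (t k)))" for i
      proof -
        have "(LINT x|M. indicat_real (G n) x *\<^sub>R h i x)
          = (LINT x|M. (\<Sum>k<m i. c i k *\<^sub>R (indicat_real (G n) x *\<^sub>R F (s (t k)) x)))"
          by (simp add: h_def scaleR_sum_right mult.commute)
        also have "\<dots> = (\<Sum>k<m i. LINT x|M. c i k *\<^sub>R (indicat_real (G n) x *\<^sub>R F (s (t k)) x))"
          by (intro Bochner_Integration.integral_sum integrable_scaleR_right intG intF)
        finally show ?thesis by (simp only: integral_scaleR_right I_def)
      qed
      then show "(\<lambda>k. LINT x|M. indicat_real (G n) x *\<^sub>R h (r k) x) \<longlonglongrightarrow> J n"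
        using conv_weights_tendsto[OF cr LIMSEQ_subseq_LIMSEQ[OF J[of n] t, unfolded o_def]] by simp
    qed
    with L cr lim show ?thesis unfolding h_def
      by (intro exI[of _ L] exI[of _ "\<lambda>n. c (r n)"] exI[of _ "\<lambda>n. m (r n)"]) auto
  qed
  \<comment> \<open>The identity subsequence fixes the reference limit.\<close>
  obtain L where L: "L \<in> Lp_fun p M" and LJ: "\<And>n. (LINT x|M. indicat_real (G n) x *\<^sub>R L x) = J n"
    using ex[OF strict_mono_id] by auto
  have "mazur_limit p M (F \<circ> s) L"
    unfolding mazur_limit_def
  proof (intro conjI allI impI)
    fix t :: "nat \<Rightarrow> nat" assume "strict_mono t"
    from ex[OF this] obtain L' c m where L': "L' \<in> Lp_fun p M" and c: "\<forall>n. conv_weights n (m n) (c n)"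
      and lim: "(\<lambda>n. LINT x|M. norm ((\<Sum>k<m n. c n k *\<^sub>R F (s (t k)) x) - L' x) powr p) \<longlonglongrightarrow> 0"
      and LJ': "\<And>n. (LINT x|M. indicat_real (G n) x *\<^sub>R L' x) = J n" by blast
    have "AE x in M. L' x - L x = 0"
    proof (rule determ)
      note i = Lp_fun_integrable[OF p M L] Lp_fun_integrable[OF p M L']
      show "integrable M (\<lambda>x. L' x - L x)" using i by simp
      show "(LINT x|M. indicat_real (G n) x *\<^sub>R (L' x - L x)) = 0" for n
        using intG[OF i(1)] intG[OF i(2)] by (simp add: scaleR_diff_right LJ LJ')
    qed
    then have AE: "AE x in M. L' x = L x" by simp
    have "(LINT x|M. norm ((\<Sum>k<m n. c n k *\<^sub>R F (s (t k)) x) - L' x) powr p)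
        = (LINT x|M. norm ((\<Sum>k<m n. c n k *\<^sub>R F (s (t k)) x) - L x) powr p)" for n
    proof (rule integral_cong_AE)
      have [measurable]: "L \<in> borel_measurable M" "L' \<in> borel_measurable M" "F k \<in> borel_measurable M" for k
        using Lp_funD[OF L] Lp_funD[OF L'] Lp_funD[OF F] by auto
      show "(\<lambda>x. norm ((\<Sum>k<m n. c n k *\<^sub>R F (s (t k)) x) - L' x) powr p) \<in> borel_measurable M" by measurable
      show "(\<lambda>x. norm ((\<Sum>k<m n. c n k *\<^sub>R F (s (t k)) x) - L x) powr p) \<in> borel_measurable M" by measurable
    qed (use AE in auto)
    with c lim show "\<exists>c m. (\<forall>n. conv_weights n (m n) (c n)) \<and>
        (\<lambda>n. LINT x|M. norm ((\<Sum>k<m n. c n k *\<^sub>R (F \<circ> s) (t k) x) - L x) powr p) \<longlonglongrightarrow> 0" by auto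
  qed (use F L in auto)
  with s show ?thesis by (rule that)
qed

section \<open>Test functions and weak gradients\<close>

lemma sigma_finite_lebesgue_on: "S \<in> sets lebesgue \<Longrightarrow> sigma_finite_measure (lebesgue_on S)"
proof (rule sigma_finite_measure_restrict_space)
  obtain A :: "'a set set" where "countable A" "A \<subseteq> sets lborel" "\<Union>A = space lborel" "\<forall>a\<in>A. emeasure lborel a \<noteq> \<infinity>"
    using lborel.sigma_finite_countable by auto
  then show "sigma_finite_measure (lebesgue :: 'a measure)"
    by (intro sigma_finite_measure.intro exI[of _ A]) (auto simp: subset_eq)
qed

text \<open>The sets over which \<open>f\<close> integrates to zero form a lambda system: the
  vanishing total gives complements, dominated convergence gives disjoint unions. The pi-lambda
  theorem yields all Borel sets, and Lebesgue sets differ from Borel sets by null sets.\<close>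

lemma AE_zero_from_generator:
  fixes f :: "'a::euclidean_space \<Rightarrow> 'b::euclidean_space"
  assumes f: "integrable (lebesgue_on S) f" and S: "S \<in> sets lebesgue"
    and stable: "Int_stable \<G>" and gen: "sigma_sets UNIV \<G> = sets borel"
    and zero: "\<And>G. G \<in> \<G> \<Longrightarrow> (LINT x|lebesgue_on S. indicat_real G x *\<^sub>R f x) = 0"
    and total: "(LINT x|lebesgue_on S. f x) = 0"
  shows "AE x in lebesgue_on S. f x = 0"
proof (rule sigma_finite_measure.density_zero[OF sigma_finite_lebesgue_on[OF S] f])
  have meas: "indicat_real A \<in> borel_measurable (lebesgue_on S)" if "A \<in> sets borel" for A
    using that by (intro measurable_restrict_space1 measurable_completion) simp
  have intA: "integrable (lebesgue_on S) (\<lambda>x. indicat_real A x *\<^sub>R f x)" if "A \<in> sets borel" for A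
  proof (rule Bochner_Integration.integrable_bound[OF f])
    show "(\<lambda>x. indicat_real A x *\<^sub>R f x) \<in> borel_measurable (lebesgue_on S)"
      by (intro borel_measurable_scaleR meas that borel_measurable_integrable[OF f])
  qed (auto simp: indicator_def)
  have borel0: "(LINT x|lebesgue_on S. indicat_real A x *\<^sub>R f x) = 0" if "A \<in> sigma_sets UNIV \<G>" for A
  proof (rule sigma_sets_induct_disjoint[OF stable _ that])
    show "(LINT x|lebesgue_on S. indicat_real (UNIV - A) x *\<^sub>R f x) = 0"
      if A: "A \<in> sigma_sets UNIV \<G>" and 0: "(LINT x|lebesgue_on S. indicat_real A x *\<^sub>R f x) = 0" for A
    proof -
      have "(LINT x|lebesgue_on S. indicat_real (UNIV - A) x *\<^sub>R f x)
          = (LINT x|lebesgue_on S. f x - indicat_real A x *\<^sub>R f x)"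
        by (intro Bochner_Integration.integral_cong) (auto simp: indicator_def)
      then show ?thesis using 0 total f intA[of A] A gen by simp
    qed
    show "(LINT x|lebesgue_on S. indicat_real (\<Union>i. A i) x *\<^sub>R f x) = 0"
      if disj: "disjoint_family A" and A: "range A \<subseteq> sigma_sets UNIV \<G>"
        and 0: "\<And>i. (LINT x|lebesgue_on S. indicat_real (A i) x *\<^sub>R f x) = 0" for A :: "nat \<Rightarrow> 'a set"
    proof -
      have A': "A i \<in> sets borel" for i using A gen by auto
      have eq: "(\<Sum>i<n. indicat_real (A i) x) = indicat_real (\<Union>i<n. A i) x" for n x
        using disj by (subst indicator_UN_disjoint) (auto simp: disjoint_family_on_def)
      have "(\<lambda>n. LINT x|lebesgue_on S. (\<Sum>i<n. indicat_real (A i) x) *\<^sub>R f x)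
          \<longlonglongrightarrow> (LINT x|lebesgue_on S. indicat_real (\<Union>i. A i) x *\<^sub>R f x)"
      proof (rule integral_dominated_convergence[where w = "\<lambda>x. norm (f x)"])
        show "(\<lambda>x. indicat_real (\<Union>i. A i) x *\<^sub>R f x) \<in> borel_measurable (lebesgue_on S)"
          using intA[of "\<Union>i. A i"] A' by auto
        show "(\<lambda>x. (\<Sum>i<n. indicat_real (A i) x) *\<^sub>R f x) \<in> borel_measurable (lebesgue_on S)" for n
          using meas[OF A'] f by measurable
        show "AE x in lebesgue_on S. (\<lambda>n. (\<Sum>i<n. indicat_real (A i) x) *\<^sub>R f x) \<longlonglongrightarrow> indicat_real (\<Union>i. A i) x *\<^sub>R f x"
          unfolding eq by (intro AE_I2 tendsto_scaleR tendsto_const LIMSEQ_indicator_UN)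
        show "AE x in lebesgue_on S. norm ((\<Sum>i<n. indicat_real (A i) x) *\<^sub>R f x) \<le> norm (f x)" for n
          unfolding eq by (auto simp: indicator_def)
      qed (use f in auto)
      moreover have "(LINT x|lebesgue_on S. (\<Sum>i<n. indicat_real (A i) x) *\<^sub>R f x) = 0" for n
      proof -
        have "(LINT x|lebesgue_on S. (\<Sum>i<n. indicat_real (A i) x) *\<^sub>R f x)
          = (\<Sum>i<n. LINT x|lebesgue_on S. indicat_real (A i) x *\<^sub>R f x)"
          unfolding scaleR_sum_left by (intro Bochner_Integration.integral_sum intA A')
        then show ?thesis using 0 by simp
      qed
      ultimately show ?thesis by (simp add: LIMSEQ_const_iff)
    qed
  qed (use zero in auto)
  fix A assume A: "A \<in> sets (lebesgue_on S)"
  then have "A \<in> sets lebesgue" "A \<subseteq> S" using S by (auto simp: sets_restrict_space_iff)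
  then obtain B N N' where B: "A = B \<union> N" "N \<subseteq> N'" "N' \<in> null_sets lborel" "B \<in> sets lborel"
    by (meson sets_completionE)
  have N': "N' \<in> null_sets lebesgue" using B by (meson null_sets_completionI)
  have "AE x in lebesgue. x \<notin> N'" by (rule AE_not_in[OF N'])
  then have "AE x in lebesgue_on S. x \<notin> N'" using S by (subst AE_restrict_space_iff) auto
  then have ae: "AE x in lebesgue_on S. indicat_real A x *\<^sub>R f x = indicat_real B x *\<^sub>R f x"
    by eventually_elim (use B in \<open>auto simp: indicator_def\<close>)
  have "(LINT x|lebesgue_on S. indicat_real A x *\<^sub>R f x) = (LINT x|lebesgue_on S. indicat_real B x *\<^sub>R f x)"
    using ae by (intro integral_cong_AE borel_measurable_scaleR borel_measurable_indicator A borel_measurable_integrable[OF f] meas) (use B in auto)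
  also have "\<dots> = 0" using borel0[of B] B gen by simp
  finally show "set_lebesgue_integral (lebesgue_on S) A f = 0"
    by (simp add: set_lebesgue_integral_def)
qed

text \<open>Finite intersections of a countable basis; the empty intersection contributes
  \<open>UNIV\<close>, which later supplies the vanishing total integral.\<close>

lemma countable_Int_stable_generator:
  obtains G :: "nat \<Rightarrow> 'a::second_countable_topology set"
  where "Int_stable (range G)" "sigma_sets UNIV (range G) = sets borel" "UNIV \<in> range G"
proof -
  obtain B :: "'a set set" where B: "countable B" "topological_basis B" using ex_countable_basis by blast
  define B' where "B' = Inter ` {F. finite F \<and> F \<subseteq> B}"
  have cB': "countable B'" unfolding B'_def by (intro countable_image countable_Collect_finite_subset B)
  have UN: "UNIV \<in> B'" unfolding B'_def by (rule image_eqI[of _ _ "{}"]) auto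
  have BB': "B \<subseteq> B'" unfolding B'_def by (force intro: image_eqI[of _ _ "{b}" for b])
  have "Int_stable B'"
  proof (rule Int_stableI)
    fix a b assume "a \<in> B'" "b \<in> B'"
    then obtain F F' where "a = \<Inter>F" "b = \<Inter>F'" "finite F" "F \<subseteq> B" "finite F'" "F' \<subseteq> B"
      by (auto simp: B'_def)
    then show "a \<inter> b \<in> B'" unfolding B'_def by (intro image_eqI[of _ _ "F \<union> F'"]) auto
  qed
  moreover have "sigma_sets UNIV B' = sets borel"
  proof -
    have "sets (borel :: 'a measure) = sigma_sets UNIV B"
      unfolding borel_eq_countable_basis[OF B] by (rule sets_measure_of) simp
    moreover have "B' \<subseteq> sets borel"
    proof
      fix b assume "b \<in> B'"
      then obtain F where "b = \<Inter>F" "finite F" "F \<subseteq> B" by (auto simp: B'_def)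
      then have "open b" using topological_basis_open[OF B(2)] by (auto intro!: open_Inter)
      then show "b \<in> sets borel" by simp
    qed
    ultimately show ?thesis
      using sigma_sets_mono'[OF BB', of UNIV] sets.sigma_sets_subset[of B' borel] by (intro subset_antisym) auto
  qed
  moreover have "range (from_nat_into B') = B'" using UN cB' by (intro range_from_nat_into) auto
  ultimately show ?thesis using UN by (intro that[of "from_nat_into B'"]) simp_all
qed

section \<open>Smooth functions and smooth bumps on boxes\<close>

lemma C_k_continuous: "C_k k f \<Longrightarrow> continuous_on UNIV f"
  by (cases k) (auto intro: continuous_at_imp_continuous_on differentiable_imp_continuous_within)

lemma C_k_SucD: "C_k (Suc k) f \<Longrightarrow> C_k k f"
proof (induction k arbitrary: f)
  case 0 then show ?case using C_k_continuous[OF 0] by (simp only: C_k.simps(1))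
next
  case (Suc k)
  have "f differentiable at x" "C_k (Suc k) (\<lambda>x. frechet_derivative f (at x) v)" for x v
    using Suc.prems by (simp_all only: C_k.simps(2)[of "Suc k" f])
  with Suc.IH show ?case by (simp only: C_k.simps(2)[of k f]) simp
qed

lemma C_k_const: "C_k k (\<lambda>x. c)"
  by (induction k arbitrary: c) auto

lemma C_k_add: "C_k k f \<Longrightarrow> C_k k g \<Longrightarrow> C_k k (\<lambda>x. f x + g x)"
proof (induction k arbitrary: f g)
  case (Suc k)
  have "frechet_derivative (\<lambda>x. f x + g x) (at x) = (\<lambda>v. frechet_derivative f (at x) v + frechet_derivative g (at x) v)" for x
    using Suc.prems by (intro frechet_derivative_at[symmetric] has_derivative_add) (simp_all add: frechet_derivative_works[symmetric])
  then show ?case using Suc by simp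
qed (auto intro: continuous_on_add)

lemma C_k_mult: "C_k k f \<Longrightarrow> C_k k g \<Longrightarrow> C_k k (\<lambda>x. f x * g x)"
proof (induction k arbitrary: f g)
  case (Suc k)
  have "frechet_derivative (\<lambda>x. f x * g x) (at x) = (\<lambda>v. f x * frechet_derivative g (at x) v + frechet_derivative f (at x) v * g x)" for x
    using Suc.prems by (intro frechet_derivative_at[symmetric] has_derivative_mult) (simp_all add: frechet_derivative_works[symmetric])
  then show ?case using Suc.prems Suc.IH C_k_SucD[OF Suc.prems(1)] C_k_SucD[OF Suc.prems(2)] by (auto intro!: C_k_add)
qed (auto intro: continuous_on_mult)

lemma C_k_prod: "(\<And>i. i \<in> I \<Longrightarrow> C_k k (f i)) \<Longrightarrow> C_k k (\<lambda>x. \<Prod>i\<in>I. f i x)"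
  by (induction I rule: infinite_finite_induct) (auto intro: C_k_mult C_k_const)

lemma C_k_compose_affine:
  fixes L :: "'a::euclidean_space \<Rightarrow> 'b::euclidean_space"
  assumes L: "bounded_linear L" and f: "C_k k f"
  shows "C_k k (\<lambda>x. f (L x + c))"
  using f
proof (induction k arbitrary: f)
  case 0
  have "continuous_on UNIV (\<lambda>x. L x + c)" by (intro continuous_intros bounded_linear.continuous_on[OF L])
  then show ?case using 0 by (auto intro: continuous_on_compose2)
next
  case (Suc k)
  have d: "((\<lambda>x. f (L x + c)) has_derivative (\<lambda>v. frechet_derivative f (at (L x + c)) (L v))) (at x)" for x
  proof (rule has_derivative_compose[of "\<lambda>x. L x + c" L x UNIV f])
    show "((\<lambda>x. L x + c) has_derivative L) (at x)"
      using has_derivative_add[OF bounded_linear_imp_has_derivative[OF L] has_derivative_const[of c]] by simp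
    show "(f has_derivative frechet_derivative f (at (L x + c))) (at (L x + c))"
      using Suc.prems by (simp add: frechet_derivative_works[symmetric])
  qed
  then have "frechet_derivative (\<lambda>x. f (L x + c)) (at x) = (\<lambda>v. frechet_derivative f (at (L x + c)) (L v))" for x
    by (rule frechet_derivative_at[symmetric])
  moreover have "(\<lambda>x. f (L x + c)) differentiable at x" for x using d by (auto simp: differentiable_def)
  moreover have "C_k k (\<lambda>x. frechet_derivative f (at (L x + c)) (L v))" for v
    using Suc.prems by (intro Suc.IH) simp
  ultimately show ?case by simp
qed

text \<open>The functions P(1/t) exp(-1/t), continued by 0 to t <= 0. Carrying the polynomial makes
  the family closed under differentiation, so smoothness is a plain induction.\<close>

definition flat_exp :: "real poly \<Rightarrow> real \<Rightarrow> real" where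
  "flat_exp P t = (if 0 < t then poly P (1 / t) * exp (- (1 / t)) else 0)"

lemma flat_exp_tendsto_0: "(flat_exp P \<longlongrightarrow> 0) (at 0)"
proof (rule filterlim_split_at)
  show "(flat_exp P \<longlongrightarrow> 0) (at_left 0)"
    by (rule tendsto_eventually) (auto simp: flat_exp_def eventually_at_filter)
  have "((\<lambda>s. poly P s * exp (- s)) \<longlongrightarrow> (\<Sum>i\<le>degree P. coeff P i * 0)) at_top"
  proof -
    have "((\<lambda>s. \<Sum>i\<le>degree P. coeff P i * (s ^ i / exp s)) \<longlongrightarrow> (\<Sum>i\<le>degree P. coeff P i * 0)) at_top"
      by (intro tendsto_sum tendsto_mult_left tendsto_power_div_exp_0)
    moreover have "(\<lambda>s. \<Sum>i\<le>degree P. coeff P i * (s ^ i / exp s)) = (\<lambda>s. poly P s * exp (- s))"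
      by (simp add: poly_altdef sum_distrib_right exp_minus divide_inverse mult.assoc)
    ultimately show ?thesis by simp
  qed
  then have "((\<lambda>s. poly P s * exp (- s)) \<longlongrightarrow> 0) at_top" by simp
  from filterlim_compose[OF this filterlim_inverse_at_top_right]
  have "((\<lambda>t. poly P (1 / t) * exp (- (1 / t))) \<longlongrightarrow> 0) (at_right 0)" by (simp add: inverse_eq_divide)
  then show "(flat_exp P \<longlongrightarrow> 0) (at_right 0)"
    by (rule Lim_transform_eventually) (auto simp: flat_exp_def eventually_at_filter)
qed

text \<open>The chain rule in 1/t produces the factor 1/t^2, which is the polynomial
  \<open>[:0, 0, 1:]\<close> evaluated at 1/t.\<close>

lemma flat_exp_deriv:
  "(flat_exp P has_field_derivative flat_exp ([:0, 0, 1:] * (P - pderiv P)) t) (at t)"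
proof (cases "0::real" t rule: linorder_cases)
  case less
  have "((\<lambda>t. poly P (1 / t) * exp (- (1 / t))) has_field_derivative
     (poly (pderiv P) (1 / t) * (- (1 / t\<^sup>2))) * exp (- (1 / t)) + exp (- (1 / t)) * (1 / t\<^sup>2) * poly P (1 / t)) (at t)"
    using less by (auto intro!: derivative_eq_intros DERIV_chain2[OF poly_DERIV] simp: power2_eq_square divide_inverse)
  moreover have "(poly (pderiv P) (1 / t) * (- (1 / t\<^sup>2))) * exp (- (1 / t)) + exp (- (1 / t)) * (1 / t\<^sup>2) * poly P (1 / t)
      = flat_exp ([:0, 0, 1:] * (P - pderiv P)) t"
    using less by (simp add: flat_exp_def field_simps power2_eq_square)
  ultimately have "((\<lambda>t. poly P (1 / t) * exp (- (1 / t))) has_field_derivative flat_exp ([:0, 0, 1:] * (P - pderiv P)) t) (at t)"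
    by simp
  then show ?thesis
    by (rule has_field_derivative_transform_within_open[of _ _ _ "{0<..}"]) (use less in \<open>auto simp: flat_exp_def\<close>)
next
  case equal
  \<comment> \<open>The difference quotient at 0 is again a member of the family: dividing by h
    multiplies the polynomial by X.\<close>
  have "((\<lambda>h. (flat_exp P (0 + h) - flat_exp P 0) / h) \<longlongrightarrow> 0) (at 0)"
    by (rule Lim_transform_eventually[OF flat_exp_tendsto_0[of "[:0, 1:] * P"]])
      (auto simp: flat_exp_def eventually_at_filter)
  then show ?thesis unfolding equal[symmetric] DERIV_def by (simp add: flat_exp_def)
next
  case greater
  have "((\<lambda>t. 0) has_field_derivative flat_exp ([:0, 0, 1:] * (P - pderiv P)) t) (at t)"
    using greater by (simp add: flat_exp_def)
  then show ?thesis
    by (rule has_field_derivative_transform_within_open[of _ _ _ "{..<0}"]) (use greater in \<open>auto simp: flat_exp_def\<close>)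
qed

lemma C_k_flat_exp: "C_k k (flat_exp P)"
proof (induction k arbitrary: P)
  case 0
  show ?case using DERIV_isCont[OF flat_exp_deriv] by (simp add: continuous_at_imp_continuous_on)
next
  case (Suc k)
  \<comment> \<open>The direction v enters only as a scalar factor, which is absorbed into the
    polynomial, so the induction hypothesis applies to every direction.\<close>
  have "frechet_derivative (flat_exp P) (at t) = (\<lambda>v. flat_exp (smult v ([:0, 0, 1:] * (P - pderiv P))) t)" for t
    using flat_exp_deriv[of P t, unfolded has_field_derivative_def]
    by (intro frechet_derivative_at[symmetric]) (rule has_derivative_eq_rhs, assumption, auto simp: flat_exp_def)
  moreover have "flat_exp P differentiable at t" for t
    using flat_exp_deriv[of P t, unfolded has_field_derivative_def] by (auto simp: differentiable_def)
  ultimately show ?case using Suc by simp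
qed

text \<open>Each factor is exp(-1/(n c)) with c the signed distance to a face plane, and 0 when c <=
  0. As n grows, the bumps tend pointwise to the indicator of the open box while staying between 0
  and 1.\<close>

definition box_bump :: "real \<Rightarrow> real^'d \<Rightarrow> real^'d \<Rightarrow> real^'d \<Rightarrow> real" where
  "box_bump n a b y = (\<Prod>i\<in>UNIV. flat_exp 1 (n * (y $ i - a $ i)) * flat_exp 1 (n * (b $ i - y $ i)))"

lemma flat_exp_1: "0 \<le> flat_exp 1 t" "flat_exp 1 t \<le> 1" "t \<le> 0 \<Longrightarrow> flat_exp 1 t = 0"
  by (auto simp: flat_exp_def)

lemma C_k_box_bump: "C_k k (box_bump n a b)"
proof -
  have "C_k k (\<lambda>y. flat_exp 1 (n * y $ i + - (n * a $ i)) * flat_exp 1 ((- n) * y $ i + n * b $ i))" for i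
    by (intro C_k_mult C_k_compose_affine C_k_flat_exp bounded_linear_const_mult bounded_linear_vec_nth)
  then have "C_k k (\<lambda>y. flat_exp 1 (n * (y $ i - a $ i)) * flat_exp 1 (n * (b $ i - y $ i)))" for i
    by (simp add: algebra_simps)
  then show ?thesis unfolding box_bump_def[abs_def] by (intro C_k_prod)
qed

lemma box_bump_zero: "0 < n \<Longrightarrow> y \<notin> box a b \<Longrightarrow> box_bump n a b y = 0"
  unfolding box_bump_def
  by (rule prod_zero) (fastforce simp: mem_box_cart not_less mult_le_0_iff intro: flat_exp_1(3))+

lemma box_bump_bound: "norm (box_bump n a b y) \<le> 1"
  unfolding box_bump_def real_norm_def abs_prod
  by (rule prod_le_1) (auto simp: abs_mult flat_exp_1 intro!: mult_le_one)

lemma box_bump_tendsto: "(\<lambda>n. box_bump (real (Suc n)) a b y) \<longlonglongrightarrow> indicat_real (box a b) y"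
proof (cases "y \<in> box a b")
  case True
  have *: "(\<lambda>n. flat_exp 1 (real (Suc n) * c)) \<longlonglongrightarrow> 1" if "0 < c" for c
  proof -
    have "(\<lambda>n. exp (- (inverse (real (Suc n)) * (1 / c)))) \<longlonglongrightarrow> exp (- (0 * (1 / c)))"
      by (intro tendsto_intros LIMSEQ_inverse_real_of_nat)
    then show ?thesis using that by (simp add: flat_exp_def divide_inverse mult.commute del: of_nat_Suc)
  qed
  have "(\<lambda>n. box_bump (real (Suc n)) a b y) \<longlonglongrightarrow> (\<Prod>i\<in>(UNIV :: 'a set). 1 * 1)"
    unfolding box_bump_def using True by (intro tendsto_prod tendsto_mult *) (auto simp: mem_box_cart)
  then show ?thesis using True by simp
next
  case False
  then show ?thesis by (simp add: box_bump_zero)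
qed

lemma test_function_box_bump:
  assumes "0 < n" "cbox a b \<subseteq> U"
  shows "test_function U (box_bump n a b)"
proof -
  have "{y. box_bump n a b y \<noteq> 0} \<subseteq> cbox a b" using box_bump_zero[OF assms(1)] box_subset_cbox by blast
  then have sub: "closure {y. box_bump n a b y \<noteq> 0} \<subseteq> cbox a b" by (simp add: closure_minimal closed_cbox)
  then have "compact (closure {y. box_bump n a b y \<noteq> 0})"
    using bounded_subset[OF bounded_cbox sub] by (simp add: compact_eq_bounded_closed)
  then show ?thesis using sub assms C_k_box_bump by (auto simp: test_function_def)
qed

lemma integrable_lebesgue_on_cong_support:
  fixes h :: "'a::euclidean_space \<Rightarrow> 'b::euclidean_space"
  assumes "S \<in> sets lebesgue" "K \<in> sets lebesgue" "K \<subseteq> S" "\<And>x. x \<in> S \<Longrightarrow> x \<notin> K \<Longrightarrow> h x = 0"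
  shows "integrable (lebesgue_on S) h \<longleftrightarrow> integrable (lebesgue_on K) h"
    and "(LINT x|lebesgue_on S. h x) = (LINT x|lebesgue_on K. h x)"
proof -
  have "(\<lambda>x. indicat_real S x *\<^sub>R h x) = (\<lambda>x. indicat_real K x *\<^sub>R h x)"
    using assms by (auto simp: indicator_def fun_eq_iff)
  then show "integrable (lebesgue_on S) h \<longleftrightarrow> integrable (lebesgue_on K) h"
    and "(LINT x|lebesgue_on S. h x) = (LINT x|lebesgue_on K. h x)"
    using assms by (simp_all add: integrable_restrict_space integral_restrict_space)
qed

lemma continuous_measurable_lebesgue_on:
  fixes f :: "'a::euclidean_space \<Rightarrow> 'b::euclidean_space"
  shows "continuous_on UNIV f \<Longrightarrow> f \<in> borel_measurable (lebesgue_on S)"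
  by (intro measurable_restrict_space1 measurable_completion) (simp add: borel_measurable_continuous_onI)

lemma integrable_bounded_scaleR:
  fixes g :: "'a \<Rightarrow> 'b::euclidean_space"
  assumes "integrable M g" "\<psi> \<in> borel_measurable M" "\<And>x. x \<in> space M \<Longrightarrow> \<bar>\<psi> x\<bar> \<le> B"
  shows "integrable M (\<lambda>x. \<psi> x *\<^sub>R g x)"
proof (rule Bochner_Integration.integrable_bound[where f = "\<lambda>x. B * norm (g x)"])
  show "AE x in M. norm (\<psi> x *\<^sub>R g x) \<le> norm (B * norm (g x))"
  proof (rule AE_I2)
    fix x assume "x \<in> space M"
    then have "\<bar>\<psi> x\<bar> * norm (g x) \<le> B * norm (g x)" using assms(3) by (intro mult_right_mono) auto
    then show "norm (\<psi> x *\<^sub>R g x) \<le> norm (B * norm (g x))" by simp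
  qed
qed (use assms in auto)

lemma integrable_cutoff:
  fixes g :: "'a::euclidean_space \<Rightarrow> 'b::euclidean_space"
  assumes g: "locally_integrable_on g U" and U: "open U" and K: "compact K" "K \<subseteq> U"
    and psi: "continuous_on UNIV \<psi>" "\<And>x. x \<notin> K \<Longrightarrow> \<psi> x = 0"
  shows "integrable (lebesgue_on U) (\<lambda>x. \<psi> x *\<^sub>R g x)"
proof -
  have "compact (\<psi> ` K)" by (rule compact_continuous_image[OF continuous_on_subset[OF psi(1)] K(1)]) simp
  then obtain B where B: "\<And>x. x \<in> K \<Longrightarrow> \<bar>\<psi> x\<bar> \<le> B"
    using compact_imp_bounded[of "\<psi> ` K"] by (auto simp: bounded_iff)
  have "integrable (lebesgue_on K) (\<lambda>x. \<psi> x *\<^sub>R g x)"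
    using g K B by (intro integrable_bounded_scaleR[where B = B] continuous_measurable_lebesgue_on psi)
      (auto simp: locally_integrable_on_def)
  then show ?thesis
    using U K psi(2) by (subst integrable_lebesgue_on_cong_support(1)[of U K]) (auto intro: lmeasurable_compact fmeasurableD)
qed

lemma test_functionD:
  assumes "test_function U \<phi>"
  obtains K where "compact K" "K \<subseteq> U" "\<And>x. x \<notin> K \<Longrightarrow> \<phi> x = 0"
    "\<And>x v. x \<notin> K \<Longrightarrow> frechet_derivative \<phi> (at x) v = 0"
proof
  define K where "K = closure {x. \<phi> x \<noteq> 0}"
  show "compact K" "K \<subseteq> U" using assms by (auto simp: test_function_def K_def)
  show 0: "\<phi> x = 0" if "x \<notin> K" for x
    using that closure_subset[of "{x. \<phi> x \<noteq> 0}"] by (auto simp: K_def)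
  show "frechet_derivative \<phi> (at x) v = 0" if x: "x \<notin> K" for x v
  proof -
    have "(\<phi> has_derivative (\<lambda>v. 0)) (at x)"
      by (rule has_derivative_transform_within_open[of "\<lambda>x. 0" _ _ _ "- K"])
        (use 0 x \<open>compact K\<close> in \<open>auto simp: compact_imp_closed\<close>)
    then show ?thesis using frechet_derivative_at by metis
  qed
qed

lemma test_function_continuous:
  assumes "test_function U \<phi>"
  shows "continuous_on UNIV \<phi>" "continuous_on UNIV (\<lambda>x. frechet_derivative \<phi> (at x) v)"
proof -
  show "continuous_on UNIV \<phi>" using assms C_k_continuous[of 0 \<phi>] unfolding test_function_def by blast
  have "C_k (Suc 0) \<phi>" using assms by (simp only: test_function_def)
  then show "continuous_on UNIV (\<lambda>x. frechet_derivative \<phi> (at x) v)" by simp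
qed

lemma test_function_mono: "test_function U \<phi> \<Longrightarrow> U \<subseteq> V \<Longrightarrow> test_function V \<phi>"
  by (auto simp: test_function_def)

lemma continuous_zero_outside_compact_bounded:
  fixes \<psi> :: "'a::topological_space \<Rightarrow> real"
  assumes "compact K" "continuous_on UNIV \<psi>" "\<And>x. x \<notin> K \<Longrightarrow> \<psi> x = 0"
  obtains B where "0 \<le> B" "\<And>x. \<bar>\<psi> x\<bar> \<le> B"
proof -
  have "compact (\<psi> ` K)" by (rule compact_continuous_image[OF continuous_on_subset[OF assms(2)] assms(1)]) simp
  then obtain B where B: "\<And>x. x \<in> K \<Longrightarrow> \<bar>\<psi> x\<bar> \<le> B"
    using compact_imp_bounded[of "\<psi> ` K"] by (auto simp: bounded_iff)
  have "\<bar>\<psi> x\<bar> \<le> max 0 B" for x using B[of x] assms(3)[of x] by (cases "x \<in> K") auto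
  then show ?thesis using that[of "max 0 B"] by auto
qed

lemma test_function_bounded:
  assumes "test_function U \<phi>"
  obtains B where "0 \<le> B" "\<And>x. \<bar>\<phi> x\<bar> \<le> B" "\<And>x. \<bar>frechet_derivative \<phi> (at x) v\<bar> \<le> B"
proof -
  obtain K where K: "compact K" "\<And>x. x \<notin> K \<Longrightarrow> \<phi> x = 0" "\<And>x v. x \<notin> K \<Longrightarrow> frechet_derivative \<phi> (at x) v = 0"
    using test_functionD[OF assms] by metis
  obtain B1 where B1: "0 \<le> B1" "\<And>x. \<bar>\<phi> x\<bar> \<le> B1"
    using continuous_zero_outside_compact_bounded[OF K(1) test_function_continuous(1)[OF assms] K(2)] by blast
  obtain B2 where B2: "0 \<le> B2" "\<And>x. \<bar>frechet_derivative \<phi> (at x) v\<bar> \<le> B2"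
    using continuous_zero_outside_compact_bounded[OF K(1) test_function_continuous(2)[OF assms] K(3)] by blast
  show ?thesis using that[of "max B1 B2"] B1 B2 by (meson le_max_iff_disj)
qed

lemma integrable_test_function:
  fixes u :: "'a::euclidean_space \<Rightarrow> real"
  assumes u: "locally_integrable_on u U" and U: "open U" and phi: "test_function U \<phi>"
  shows "integrable (lebesgue_on U) (\<lambda>x. u x * \<phi> x)"
    "integrable (lebesgue_on U) (\<lambda>x. u x * frechet_derivative \<phi> (at x) v)"
proof -
  obtain K where K: "compact K" "K \<subseteq> U" "\<And>x. x \<notin> K \<Longrightarrow> \<phi> x = 0"
    "\<And>x v. x \<notin> K \<Longrightarrow> frechet_derivative \<phi> (at x) v = 0" using test_functionD[OF phi] by metis
  show "integrable (lebesgue_on U) (\<lambda>x. u x * \<phi> x)"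
    using integrable_cutoff[OF u U K(1,2) test_function_continuous(1)[OF phi] K(3)] by (simp add: mult.commute)
  show "integrable (lebesgue_on U) (\<lambda>x. u x * frechet_derivative \<phi> (at x) v)"
    using integrable_cutoff[OF u U K(1,2) test_function_continuous(2)[OF phi] K(4)] by (simp add: mult.commute)
qed

lemma locally_integrable_on_component:
  fixes g :: "'a::euclidean_space \<Rightarrow> real^'d"
  shows "locally_integrable_on g U \<Longrightarrow> locally_integrable_on (\<lambda>x. g x $ i) U"
  unfolding locally_integrable_on_def
  by (auto intro: integrable_bounded_linear[OF bounded_linear_vec_nth])

text \<open>An open set is a countable union of compact boxes, on each of which the function is
  integrable and hence measurable.\<close>

lemma locally_integrable_on_measurable:
  fixes g :: "'a::euclidean_space \<Rightarrow> 'b::euclidean_space"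
  assumes g: "locally_integrable_on g U" and U: "open U"
  shows "g \<in> borel_measurable (lebesgue_on U)"
proof -
  obtain \<D> where \<D>: "countable \<D>" "\<D> \<subseteq> Pow U" "\<And>X. X \<in> \<D> \<Longrightarrow> \<exists>a b. X = cbox a b" "\<Union>\<D> = U"
    using open_countable_Union_open_cbox[OF U] by blast
  show ?thesis
  proof (rule measurable_piecewise_restrict[OF \<D>(1)])
    fix X assume X: "X \<in> \<D>"
    then obtain a b where ab: "X = cbox a b" using \<D> by blast
    have XU: "X \<subseteq> U" using X \<D> by auto
    show "X \<inter> space (lebesgue_on U) \<in> sets (lebesgue_on U)"
      using U XU by (auto simp: sets_restrict_space_iff ab Int_absorb2)
    have "g \<in> borel_measurable (lebesgue_on X)" using g XU ab
      unfolding locally_integrable_on_def by (auto intro: borel_measurable_integrable)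
    moreover have "restrict_space (lebesgue_on U) X = lebesgue_on X"
      using XU U by (subst restrict_restrict_space) (auto simp: ab Int_absorb1)
    ultimately show "g \<in> borel_measurable (restrict_space (lebesgue_on U) X)" by simp
  qed (use \<D> in auto)
qed

lemma locally_integrable_on_mono: "locally_integrable_on f U \<Longrightarrow> V \<subseteq> U \<Longrightarrow> locally_integrable_on f V"
  unfolding locally_integrable_on_def by blast

lemma Lp_eq: "Lp p U = Lp_fun p (lebesgue_on U)"
  by (simp add: Lp_def Lp_fun_def)

text \<open>Smooth bumps replace the indicators of boxes, so \<open>g\<close> integrates to zero
  over every box whose closure lies in \<open>U\<close>. On one such box the pi-lambda argument
  applies, and countably many of them exhaust \<open>U\<close> up to null sets.\<close>

lemma fundamental_lemma:
  fixes g :: "real^'d \<Rightarrow> real"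
  assumes g: "locally_integrable_on g U" and U: "open U"
    and zero: "\<And>\<phi>. test_function U \<phi> \<Longrightarrow> (LINT x|lebesgue_on U. g x * \<phi> x) = 0"
  shows "AE x in lebesgue_on U. g x = 0"
proof -
  have box0: "(LINT x|lebesgue_on U. indicat_real (box a b) x * g x) = 0" if ab: "cbox a b \<subseteq> U" for a b
  proof -
    have gK: "integrable (lebesgue_on U) (\<lambda>x. indicat_real (cbox a b) x * g x)"
    proof -
      have "integrable (lebesgue_on (cbox a b)) (\<lambda>x. indicat_real (cbox a b) x * g x)"
        using g ab by (subst Bochner_Integration.integrable_cong[where g = g, OF refl]) (auto simp: locally_integrable_on_def)
      then show ?thesis using U ab
        by (subst integrable_lebesgue_on_cong_support(1)[of U "cbox a b"]) auto
    qed
    have gm: "g \<in> borel_measurable (lebesgue_on U)" by (rule locally_integrable_on_measurable[OF g U])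
    have "(\<lambda>n. LINT x|lebesgue_on U. g x * box_bump (real (Suc n)) a b x) \<longlonglongrightarrow> (LINT x|lebesgue_on U. g x * indicat_real (box a b) x)"
    proof (rule integral_dominated_convergence)
      show "integrable (lebesgue_on U) (\<lambda>x. norm (indicat_real (cbox a b) x * g x))" using gK by (rule integrable_norm)
      show "(\<lambda>x. g x * indicat_real (box a b) x) \<in> borel_measurable (lebesgue_on U)"
        using U by (intro borel_measurable_times gm borel_measurable_indicator') (auto simp: sets_restrict_space_iff)
      show "(\<lambda>x. g x * box_bump (real (Suc n)) a b x) \<in> borel_measurable (lebesgue_on U)" for n
        by (intro borel_measurable_times gm continuous_measurable_lebesgue_on C_k_continuous[OF C_k_box_bump])
      show "AE x in lebesgue_on U. (\<lambda>n. g x * box_bump (real (Suc n)) a b x) \<longlonglongrightarrow> g x * indicat_real (box a b) x"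
        by (intro AE_I2 tendsto_mult_left box_bump_tendsto)
      have "norm (g x * box_bump (real (Suc n)) a b x) \<le> norm (indicat_real (cbox a b) x * g x)" for n x
      proof (cases "x \<in> cbox a b")
        case True
        then show ?thesis using box_bump_bound[of "real (Suc n)" a b x]
          by (simp add: abs_mult mult_left_le)
      next
        case False
        then have "x \<notin> box a b" using box_subset_cbox by blast
        then show ?thesis by (simp add: box_bump_zero)
      qed
      then show "AE x in lebesgue_on U. norm (g x * box_bump (real (Suc n)) a b x) \<le> norm (indicat_real (cbox a b) x * g x)" for n
        by simp
    qed
    moreover have "(LINT x|lebesgue_on U. g x * box_bump (real (Suc n)) a b x) = 0" for n
      using ab by (intro zero test_function_box_bump) auto
    ultimately show ?thesis by (simp add: LIMSEQ_const_iff mult.commute)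
  qed
  have on_box: "AE x in lebesgue_on (box c d). g x = 0" if cd: "cbox c d \<subseteq> U" for c d
  proof (rule AE_zero_from_generator[where \<G> = "range (\<lambda>(a, b). box a b)"])
    have sub: "box c d \<subseteq> cbox c d" by (rule box_subset_cbox)
    have "integrable (lebesgue_on (cbox c d)) g" using g cd by (auto simp: locally_integrable_on_def)
    then show "integrable (lebesgue_on (box c d)) g"
      using integrable_mult_indicator[of "box c d" "lebesgue_on (cbox c d)" g] sub
        integrable_restrict_space[of "box c d" "lebesgue_on (cbox c d)" g]
        restrict_restrict_space[of "cbox c d" lebesgue "box c d"]
      by (auto simp: sets_restrict_space_iff Int_absorb1 Int_absorb2)
    show "Int_stable (range (\<lambda>(a, b). box a b :: (real^'d) set))"
    proof (rule Int_stableI)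
      fix A B :: "(real^'d) set" assume "A \<in> range (\<lambda>(a, b). box a b)" "B \<in> range (\<lambda>(a, b). box a b)"
      then obtain a b a' b' where "A = box a b" "B = box a' b'" by auto
      have *: "box q q' \<in> range (\<lambda>(a, b). box a b)" for q q' :: "real^'d"
        by (rule image_eqI[of _ _ "(q, q')"]) auto
      show "A \<inter> B \<in> range (\<lambda>(a, b). box a b)" unfolding \<open>A = _\<close> \<open>B = _\<close> box_Int_box by (rule *)
    qed
    show "sigma_sets UNIV (range (\<lambda>(a, b). box a b :: (real^'d) set)) = sets borel"
      unfolding borel_eq_box by (rule sets_measure_of[symmetric]) simp
    have eq: "(LINT x|lebesgue_on (box c d). indicat_real A x *\<^sub>R g x) = (LINT x|lebesgue_on U. indicat_real (A \<inter> box c d) x * g x)" for A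
    proof -
      have "(LINT x|lebesgue_on U. indicat_real (A \<inter> box c d) x * g x) = (LINT x|lebesgue_on (box c d). indicat_real (A \<inter> box c d) x * g x)"
        using U sub cd by (intro integrable_lebesgue_on_cong_support) auto
      also have "\<dots> = (LINT x|lebesgue_on (box c d). indicat_real A x *\<^sub>R g x)"
        by (intro Bochner_Integration.integral_cong) (auto simp: indicator_def)
      finally show ?thesis by simp
    qed
    \<comment> \<open>Empty boxes are split off because \<open>cbox a b\<close> may be nonempty
      although \<open>box a b\<close> is empty, and then it need not lie in
      \<open>U\<close>.\<close>
    have any: "(LINT x|lebesgue_on U. indicat_real (box a b) x * g x) = 0" if "box a b \<subseteq> box c d" for a b
    proof (cases "box a b = {}")
      case False
      then have "cbox a b = closure (box a b)" by simp
      also have "\<dots> \<subseteq> closure (box c d)" by (rule closure_mono[OF that])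
      also have "\<dots> \<subseteq> cbox c d" by (rule closure_minimal[OF sub closed_cbox])
      finally show ?thesis using cd by (intro box0) auto
    qed simp
    show "(LINT x|lebesgue_on (box c d). indicat_real G x *\<^sub>R g x) = 0" if "G \<in> range (\<lambda>(a, b). box a b)" for G
    proof -
      from that obtain a b where "G = box a b" by auto
      then have "\<exists>a' b'. G \<inter> box c d = box a' b'" by (auto simp: box_Int_box)
      then show ?thesis unfolding eq using any by (metis Int_lower2)
    qed
    show "(LINT x|lebesgue_on (box c d). g x) = 0"
      using eq[of UNIV] any[of c d] by simp
  qed simp
  obtain \<D> where \<D>: "countable \<D>" "\<D> \<subseteq> Pow U" "\<And>X. X \<in> \<D> \<Longrightarrow> \<exists>a b. X = cbox a b" "\<Union>\<D> = U"
    using open_countable_Union_open_cbox[OF U] by blast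
  have "AE x in lebesgue. x \<in> X \<longrightarrow> g x = 0" if X: "X \<in> \<D>" for X
  proof -
    obtain c d where X': "X = cbox c d" using \<D> X by blast
    then have "AE x in lebesgue. x \<in> box c d \<longrightarrow> g x = 0"
      using on_box[of c d] X \<D>(2) by (auto simp: AE_restrict_space_iff)
    moreover have "AE x in lebesgue. x \<notin> cbox c d - box c d"
      using negligible_frontier_interval[of c d] by (intro AE_not_in) (simp add: negligible_iff_null_sets)
    ultimately show ?thesis unfolding X' by eventually_elim auto
  qed
  then have "AE x in lebesgue. \<forall>X\<in>\<D>. x \<in> X \<longrightarrow> g x = 0" using \<D>(1) by (subst AE_ball_countable) auto
  then have "AE x in lebesgue. x \<in> U \<longrightarrow> g x = 0"
  proof eventually_elim
    case (elim x)
    show ?case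
    proof
      assume "x \<in> U"
      then obtain X where "X \<in> \<D>" "x \<in> X" unfolding \<D>(4)[symmetric] by (rule UnionE)
      with elim show "g x = 0" by auto
    qed
  qed
  then show ?thesis using U by (simp add: AE_restrict_space_iff)
qed


section \<open>Calculus of weak gradients and Sobolev norms\<close>

lemma locally_integrable_on_add:
  "locally_integrable_on f U \<Longrightarrow> locally_integrable_on g U \<Longrightarrow> locally_integrable_on (\<lambda>x. f x + g x) U"
  unfolding locally_integrable_on_def by auto

lemma locally_integrable_on_scaleR:
  "locally_integrable_on f U \<Longrightarrow> locally_integrable_on (\<lambda>x. c *\<^sub>R f x) U"
  unfolding locally_integrable_on_def by auto

lemma has_weak_gradient_add:
  assumes U: "open U" and u: "has_weak_gradient U u g" and v: "has_weak_gradient U v h"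
  shows "has_weak_gradient U (\<lambda>x. u x + v x) (\<lambda>x. g x + h x)"
  unfolding has_weak_gradient_def
proof (intro conjI allI impI locally_integrable_on_add)
  have lu: "locally_integrable_on u U" "locally_integrable_on v U" "locally_integrable_on g U" "locally_integrable_on h U"
    using u v by (auto simp: has_weak_gradient_def)
  then show "locally_integrable_on u U" "locally_integrable_on v U" "locally_integrable_on g U" "locally_integrable_on h U"
    by auto
  fix \<phi> i assume phi: "test_function U \<phi>"
  have "(LINT x|lebesgue_on U. u x * frechet_derivative \<phi> (at x) (axis i 1)) = - (LINT x|lebesgue_on U. g x $ i * \<phi> x)"
    "(LINT x|lebesgue_on U. v x * frechet_derivative \<phi> (at x) (axis i 1)) = - (LINT x|lebesgue_on U. h x $ i * \<phi> x)"
    using u v phi by (auto simp: has_weak_gradient_def)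
  then show "(LINT x|lebesgue_on U. (u x + v x) * frechet_derivative \<phi> (at x) (axis i 1)) = - (LINT x|lebesgue_on U. (g x + h x) $ i * \<phi> x)"
    using integrable_test_function(2)[OF lu(1) U phi] integrable_test_function(2)[OF lu(2) U phi]
      integrable_test_function(1)[OF locally_integrable_on_component[OF lu(3)] U phi]
      integrable_test_function(1)[OF locally_integrable_on_component[OF lu(4)] U phi]
    by (simp add: distrib_right)
qed

lemma has_weak_gradient_scaleR:
  assumes u: "has_weak_gradient U u g"
  shows "has_weak_gradient U (\<lambda>x. c * u x) (\<lambda>x. c *\<^sub>R g x)"
  using u locally_integrable_on_scaleR[of u U c] locally_integrable_on_scaleR[of g U c]
  by (auto simp: has_weak_gradient_def mult.assoc)

lemma has_weak_gradient_zero: "has_weak_gradient U (\<lambda>x. 0) (\<lambda>x. 0)"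
  by (auto simp: has_weak_gradient_def locally_integrable_on_def)

lemma has_weak_gradient_sum:
  assumes U: "open U" and u: "\<And>i. i \<in> I \<Longrightarrow> has_weak_gradient U (u i) (g i)"
  shows "has_weak_gradient U (\<lambda>x. \<Sum>i\<in>I. u i x) (\<lambda>x. \<Sum>i\<in>I. g i x)"
  using u by (induction I rule: infinite_finite_induct) (auto intro: has_weak_gradient_add[OF U] has_weak_gradient_zero)

lemma has_weak_gradient_diff:
  assumes U: "open U" and u: "has_weak_gradient U u g" and v: "has_weak_gradient U v h"
  shows "has_weak_gradient U (\<lambda>x. u x - v x) (\<lambda>x. g x - h x)"
  using has_weak_gradient_add[OF U u has_weak_gradient_scaleR[OF v, of "-1"]] by simp

lemma has_weak_gradient_subset:
  assumes u: "has_weak_gradient U u g" and "open U" "open V" "V \<subseteq> U"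
  shows "has_weak_gradient V u g"
  unfolding has_weak_gradient_def
proof (intro conjI allI impI)
  show "locally_integrable_on u V" "locally_integrable_on g V"
    using u assms by (auto simp: has_weak_gradient_def intro: locally_integrable_on_mono)
  fix \<phi> i assume phi: "test_function V \<phi>"
  obtain K where K: "compact K" "K \<subseteq> V" "\<And>x. x \<notin> K \<Longrightarrow> \<phi> x = 0"
    "\<And>x v. x \<notin> K \<Longrightarrow> frechet_derivative \<phi> (at x) v = 0" using test_functionD[OF phi] by metis
  have "(LINT x|lebesgue_on U. u x * frechet_derivative \<phi> (at x) (axis i 1)) = - (LINT x|lebesgue_on U. g x $ i * \<phi> x)"
    using u test_function_mono[OF phi \<open>V \<subseteq> U\<close>] by (auto simp: has_weak_gradient_def)
  moreover have "(LINT x|lebesgue_on U. u x * frechet_derivative \<phi> (at x) (axis i 1)) = (LINT x|lebesgue_on V. u x * frechet_derivative \<phi> (at x) (axis i 1))"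
    using assms K(2,4) by (intro integrable_lebesgue_on_cong_support) (auto simp: subset_eq)
  moreover have "(LINT x|lebesgue_on U. g x $ i * \<phi> x) = (LINT x|lebesgue_on V. g x $ i * \<phi> x)"
    using assms K(2,3) by (intro integrable_lebesgue_on_cong_support) (auto simp: subset_eq)
  ultimately show "(LINT x|lebesgue_on V. u x * frechet_derivative \<phi> (at x) (axis i 1)) = - (LINT x|lebesgue_on V. g x $ i * \<phi> x)"
    by simp
qed

text \<open>The difference of two gradients is a gradient of the zero function, so each of its
  components pairs to zero with every test function.\<close>

lemma has_weak_gradient_unique:
  assumes U: "open U" and u: "has_weak_gradient U u g" and v: "has_weak_gradient U u h"
  shows "AE x in lebesgue_on U. g x = h x"
proof -
  have 0: "has_weak_gradient U (\<lambda>x. 0) (\<lambda>x. g x - h x)"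
    using has_weak_gradient_diff[OF U u v] by simp
  have "AE x in lebesgue_on U. (g x - h x) $ i = 0" for i
  proof (rule fundamental_lemma[OF _ U])
    show "locally_integrable_on (\<lambda>x. (g x - h x) $ i) U"
      using 0 by (intro locally_integrable_on_component) (simp add: has_weak_gradient_def)
    show "(LINT x|lebesgue_on U. (g x - h x) $ i * \<phi> x) = 0" if "test_function U \<phi>" for \<phi>
      using 0 that by (auto simp: has_weak_gradient_def)
  qed
  then have "AE x in lebesgue_on U. \<forall>i\<in>UNIV. (g x - h x) $ i = 0" by (subst AE_finite_all) auto
  then show ?thesis by eventually_elim (simp add: vec_eq_iff)
qed

text \<open>Test functions and their derivatives are bounded, so L^1 convergence of functions and
  gradients suffices to pass to the limit in the defining identity.\<close>

lemma has_weak_gradient_closed: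
  assumes U: "open U" and ug: "\<And>n. has_weak_gradient U (u n) (g n)"
    and un: "\<And>n. integrable (lebesgue_on U) (u n)" and gn: "\<And>n. integrable (lebesgue_on U) (g n)"
    and v: "integrable (lebesgue_on U) v" and h: "integrable (lebesgue_on U) h"
    and lim_u: "(\<lambda>n. LINT x|lebesgue_on U. norm (u n x - v x)) \<longlonglongrightarrow> 0"
    and lim_g: "(\<lambda>n. LINT x|lebesgue_on U. norm (g n x - h x)) \<longlonglongrightarrow> 0"
  shows "has_weak_gradient U v h"
proof -
  have loc: "locally_integrable_on f U" if "integrable (lebesgue_on U) f" for f :: "_ \<Rightarrow> 'b::euclidean_space"
    unfolding locally_integrable_on_def
  proof (intro allI impI)
    fix K assume K: "compact K \<and> K \<subseteq> U"
    then have "K \<in> sets lebesgue" by (simp add: lmeasurable_compact fmeasurableD)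
    then have KU: "K \<inter> space (lebesgue_on U) \<in> sets (lebesgue_on U)"
      using K U by (auto simp: sets_restrict_space_iff Int_absorb2)
    have "restrict_space (lebesgue_on U) K = lebesgue_on K"
      using K U by (subst restrict_restrict_space) (auto simp: Int_absorb1 \<open>K \<in> sets lebesgue\<close>)
    moreover have "integrable (restrict_space (lebesgue_on U) K) f"
      unfolding integrable_restrict_space[OF KU]
      using that by (intro integrable_mult_indicator) (use KU K in \<open>auto simp: Int_absorb2\<close>)
    ultimately show "integrable (lebesgue_on K) f" by simp
  qed
  have lim: "(\<lambda>n. LINT x|lebesgue_on U. f n x * \<psi> x) \<longlonglongrightarrow> (LINT x|lebesgue_on U. k x * \<psi> x)"
    if f: "\<And>n. integrable (lebesgue_on U) (f n)" and k: "integrable (lebesgue_on U) k"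
      and l: "(\<lambda>n. LINT x|lebesgue_on U. norm (f n x - k x)) \<longlonglongrightarrow> 0"
      and psi: "continuous_on UNIV \<psi>" "\<And>x. \<bar>\<psi> x\<bar> \<le> B" for f :: "nat \<Rightarrow> _ \<Rightarrow> real" and k \<psi> B
  proof -
    have I: "integrable (lebesgue_on U) (\<lambda>x. q x * \<psi> x)" if "integrable (lebesgue_on U) q" for q
      using integrable_bounded_scaleR[OF that continuous_measurable_lebesgue_on[OF psi(1)] psi(2)] by (simp add: mult.commute)
    have "(\<lambda>n. B * (LINT x|lebesgue_on U. norm (f n x - k x))) \<longlonglongrightarrow> B * 0" by (intro tendsto_mult_left l)
    then have l0: "(\<lambda>n. B * (LINT x|lebesgue_on U. norm (f n x - k x))) \<longlonglongrightarrow> 0" by simp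
    have "(\<lambda>n. (LINT x|lebesgue_on U. f n x * \<psi> x) - (LINT x|lebesgue_on U. k x * \<psi> x)) \<longlonglongrightarrow> 0"
    proof (rule Lim_null_comparison[OF _ l0], rule always_eventually, rule allI)
      fix n
      have fk: "integrable (lebesgue_on U) (\<lambda>x. f n x - k x)" using f k by auto
      have "norm ((LINT x|lebesgue_on U. f n x * \<psi> x) - (LINT x|lebesgue_on U. k x * \<psi> x)) = norm (LINT x|lebesgue_on U. (f n x - k x) * \<psi> x)"
        using I[OF f] I[OF k] by (simp add: left_diff_distrib)
      also have "\<dots> \<le> (LINT x|lebesgue_on U. norm ((f n x - k x) * \<psi> x))" by (rule integral_norm_bound)
      also have "\<dots> \<le> (LINT x|lebesgue_on U. B * norm (f n x - k x))"
        using fk psi(2) by (intro integral_mono integrable_norm I) (auto simp: abs_mult mult.commute intro!: mult_right_mono)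
      finally show "norm ((LINT x|lebesgue_on U. f n x * \<psi> x) - (LINT x|lebesgue_on U. k x * \<psi> x)) \<le> B * (LINT x|lebesgue_on U. norm (f n x - k x))"
        by simp
    qed
    then show ?thesis by (simp add: LIM_zero_iff)
  qed
  show ?thesis
    unfolding has_weak_gradient_def
  proof (intro conjI allI impI loc v h)
    fix \<phi> i assume phi: "test_function U \<phi>"
    obtain B where B: "\<And>x. \<bar>\<phi> x\<bar> \<le> B" "\<And>x. \<bar>frechet_derivative \<phi> (at x) (axis i 1)\<bar> \<le> B"
      using test_function_bounded[OF phi] by metis
    have comp: "integrable (lebesgue_on U) (\<lambda>x. f x $ i)" if "integrable (lebesgue_on U) f" for f
      using that by (rule integrable_bounded_linear[OF bounded_linear_vec_nth])
    have "(\<lambda>n. LINT x|lebesgue_on U. norm (g n x $ i - h x $ i)) \<longlonglongrightarrow> 0"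
    proof (rule Lim_null_comparison[OF _ lim_g], rule always_eventually, rule allI)
      fix n
      have "(LINT x|lebesgue_on U. norm (g n x $ i - h x $ i)) \<le> (LINT x|lebesgue_on U. norm (g n x - h x))"
      proof (rule integral_mono)
        show "norm (g n x $ i - h x $ i) \<le> norm (g n x - h x)" for x
          using component_le_norm_cart[of "g n x - h x" i] by simp
      qed (intro integrable_norm Bochner_Integration.integrable_diff comp gn h)+
      then show "norm (LINT x|lebesgue_on U. norm (g n x $ i - h x $ i)) \<le> (LINT x|lebesgue_on U. norm (g n x - h x))"
        by simp
    qed
    from lim[OF comp[OF gn] comp[OF h] this test_function_continuous(1)[OF phi] B(1)]
    have 1: "(\<lambda>n. - (LINT x|lebesgue_on U. g n x $ i * \<phi> x)) \<longlonglongrightarrow> - (LINT x|lebesgue_on U. h x $ i * \<phi> x)"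
      by (rule tendsto_minus)
    have 2: "(\<lambda>n. LINT x|lebesgue_on U. u n x * frechet_derivative \<phi> (at x) (axis i 1))
      \<longlonglongrightarrow> (LINT x|lebesgue_on U. v x * frechet_derivative \<phi> (at x) (axis i 1))"
      by (rule lim[OF un v lim_u test_function_continuous(2)[OF phi] B(2)])
    have "(LINT x|lebesgue_on U. u n x * frechet_derivative \<phi> (at x) (axis i 1)) = - (LINT x|lebesgue_on U. g n x $ i * \<phi> x)" for n
      using ug[of n] phi unfolding has_weak_gradient_def by blast
    with 1 2 show "(LINT x|lebesgue_on U. v x * frechet_derivative \<phi> (at x) (axis i 1)) = - (LINT x|lebesgue_on U. h x $ i * \<phi> x)"
      by (simp add: LIMSEQ_unique)
  qed
qed

lemma Lp_norm_powr: "1 < p \<Longrightarrow> Lp_norm p U f powr p = (LINT x|lebesgue_on U. norm (f x) powr p)"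
  by (simp add: Lp_norm_def powr_powr)

text \<open>Removes the choice operator from the norm: by uniqueness any weak gradient at hand
  computes it.\<close>

lemma W1p_norm_eq:
  assumes p: "1 < p" and U: "open U" and u: "has_weak_gradient U u g"
  shows "W1p_norm p U u = ((LINT x|lebesgue_on U. norm (u x) powr p) + (LINT x|lebesgue_on U. norm (g x) powr p)) powr (1 / p)"
proof -
  have w: "has_weak_gradient U u (weak_gradient U u)"
    unfolding weak_gradient_def by (rule someI[of "has_weak_gradient U u", OF u])
  have [measurable]: "g \<in> borel_measurable (lebesgue_on U)" "weak_gradient U u \<in> borel_measurable (lebesgue_on U)"
    using u w by (auto simp: has_weak_gradient_def intro: locally_integrable_on_measurable[OF _ U])
  have "(LINT x|lebesgue_on U. norm (weak_gradient U u x) powr p) = (LINT x|lebesgue_on U. norm (g x) powr p)"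
    using has_weak_gradient_unique[OF U w u] by (intro integral_cong_AE) auto
  then show ?thesis using p by (simp add: W1p_norm_def Lp_norm_powr)
qed

lemma W1p_norm_powr:
  assumes p: "1 < p" and U: "open U" and u: "has_weak_gradient U u g"
  shows "W1p_norm p U u powr p = (LINT x|lebesgue_on U. norm (u x) powr p) + (LINT x|lebesgue_on U. norm (g x) powr p)"
  using p by (simp add: W1p_norm_eq[OF assms] powr_powr)

lemma W1p_norm_nonneg: "0 \<le> W1p_norm p U u"
  by (simp add: W1p_norm_def)

text \<open>Used in place of the triangle inequality; the constant is harmless because the bound
  serves to add null sequences.\<close>

lemma W1p_norm_add_le:
  assumes p: "1 < p" and U: "open U" and u: "u \<in> W1p p U" and v: "v \<in> W1p p U"
  shows "W1p_norm p U (\<lambda>x. u x + v x) powr p \<le> 2 powr p * (W1p_norm p U u powr p + W1p_norm p U v powr p)"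
proof -
  obtain g h where g: "g \<in> Lp p U" "has_weak_gradient U u g" and h: "h \<in> Lp p U" "has_weak_gradient U v h"
    and uv: "u \<in> Lp p U" "v \<in> Lp p U"
    using u v by (auto simp: W1p_def)
  have le: "(LINT x|lebesgue_on U. norm (a x + b x) powr p) \<le>
      2 powr p * ((LINT x|lebesgue_on U. norm (a x) powr p) + (LINT x|lebesgue_on U. norm (b x) powr p))"
    if "a \<in> Lp p U" "b \<in> Lp p U" for a b :: "real^'a \<Rightarrow> 'c::euclidean_space"
  proof -
    have i: "integrable (lebesgue_on U) (\<lambda>x. norm (a x) powr p)" "integrable (lebesgue_on U) (\<lambda>x. norm (b x) powr p)"
      using that by (auto simp: Lp_def)
    have "(LINT x|lebesgue_on U. norm (a x + b x) powr p) \<le> (LINT x|lebesgue_on U. 2 powr p * (norm (a x) powr p + norm (b x) powr p))"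
      using i Lp_funD(2)[OF Lp_fun_add[OF p that[unfolded Lp_eq]]] norm_add_powr_le[OF p]
      by (intro integral_mono) auto
    then show ?thesis using i by simp
  qed
  show ?thesis
    unfolding W1p_norm_powr[OF p U has_weak_gradient_add[OF U g(2) h(2)]] W1p_norm_powr[OF p U g(2)] W1p_norm_powr[OF p U h(2)]
    using le[OF uv] le[OF g(1) h(1)] by (simp add: algebra_simps)
qed

lemma W1p_I: "u \<in> Lp p U \<Longrightarrow> g \<in> Lp p U \<Longrightarrow> has_weak_gradient U u g \<Longrightarrow> u \<in> W1p p U"
  by (auto simp: W1p_def)

lemma W1p_E:
  assumes "u \<in> W1p p U"
  obtains g where "u \<in> Lp p U" "g \<in> Lp p U" "has_weak_gradient U u g"
  using assms by (auto simp: W1p_def)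

lemma W1p_add:
  assumes p: "1 < p" and U: "open U" and u: "u \<in> W1p p U" and v: "v \<in> W1p p U"
  shows "(\<lambda>x. u x + v x) \<in> W1p p U"
proof -
  obtain g where g: "u \<in> Lp p U" "g \<in> Lp p U" "has_weak_gradient U u g" by (rule W1p_E[OF u])
  obtain h where h: "v \<in> Lp p U" "h \<in> Lp p U" "has_weak_gradient U v h" by (rule W1p_E[OF v])
  show ?thesis
    by (rule W1p_I[OF _ _ has_weak_gradient_add[OF U g(3) h(3)]])
      (use Lp_fun_add[OF p] g h in \<open>auto simp: Lp_eq\<close>)
qed

lemma W1p_scaleR:
  assumes u: "u \<in> W1p p U"
  shows "(\<lambda>x. c * u x) \<in> W1p p U"
proof -
  obtain g where g: "u \<in> Lp p U" "g \<in> Lp p U" "has_weak_gradient U u g" by (rule W1p_E[OF u])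
  show ?thesis
    by (rule W1p_I[OF _ _ has_weak_gradient_scaleR[OF g(3), of c]])
      (use Lp_fun_scaleR[of u p "lebesgue_on U" c] Lp_fun_scaleR[of g p "lebesgue_on U" c] g in \<open>auto simp: Lp_eq\<close>)
qed

lemma W1p_norm_scaleR_powr:
  assumes p: "1 < p" and U: "open U" and u: "u \<in> W1p p U"
  shows "W1p_norm p U (\<lambda>x. c * u x) powr p = \<bar>c\<bar> powr p * W1p_norm p U u powr p"
proof -
  obtain g where g: "has_weak_gradient U u g" using u by (auto simp: W1p_def)
  show ?thesis unfolding W1p_norm_powr[OF p U g] W1p_norm_powr[OF p U has_weak_gradient_scaleR[OF g]]
    by (simp add: powr_mult distrib_left abs_mult)
qed

section \<open>Lebesgue measure, affine maps and products\<close>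

text \<open>
  The change of variables theorem of the library is stated for well-ordered index types only;
  a well-ordered copy of an arbitrary finite type transfers it.
\<close>

typedef 'a idx = "UNIV :: 'a set" ..

instance idx :: (finite) finite
proof
  have "(UNIV :: 'a idx set) = Abs_idx ` UNIV" by (metis Abs_idx_cases surj_def)
  then show "finite (UNIV :: 'a idx set)" by (metis finite_imageI finite_class.finite_UNIV)
qed

text \<open>Any injection into the naturals will do; it only transports a well-order to the copied
  type.\<close>

definition idx_rank :: "'a::finite idx \<Rightarrow> nat" where
  "idx_rank = (SOME f. inj f)"

lemma inj_idx_rank: "inj (idx_rank :: 'a::finite idx \<Rightarrow> nat)"
proof -
  have "\<exists>f :: 'a idx \<Rightarrow> nat. inj f" using finite_imp_inj_to_nat_seg[of "UNIV :: 'a idx set"] by auto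
  then show ?thesis unfolding idx_rank_def by (rule someI_ex)
qed

instantiation idx :: (finite) wellorder
begin

definition less_eq_idx :: "'a idx \<Rightarrow> 'a idx \<Rightarrow> bool" where "x \<le> y \<longleftrightarrow> idx_rank x \<le> idx_rank y"
definition less_idx :: "'a idx \<Rightarrow> 'a idx \<Rightarrow> bool" where "x < y \<longleftrightarrow> idx_rank x < idx_rank y"

instance
proof
  fix x y z :: "'a idx" and P :: "'a idx \<Rightarrow> bool"
  show "(x < y) = (x \<le> y \<and> \<not> y \<le> x)" "x \<le> x" "x \<le> y \<or> y \<le> x" by (auto simp: less_eq_idx_def less_idx_def)
  show "x \<le> y \<Longrightarrow> y \<le> z \<Longrightarrow> x \<le> z" by (auto simp: less_eq_idx_def)
  show "x \<le> y \<Longrightarrow> y \<le> x \<Longrightarrow> x = y" using inj_idx_rank by (auto simp: less_eq_idx_def inj_def)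
  show "(\<And>x. (\<And>y. y < x \<Longrightarrow> P y) \<Longrightarrow> P x) \<Longrightarrow> P x" for x
    by (rule measure_induct_rule[of idx_rank P x]) (auto simp: less_idx_def)
qed

end

definition to_idx :: "real^'d \<Rightarrow> real^'d idx" where "to_idx x = (\<chi> i. x $ Rep_idx i)"
definition of_idx :: "real^'d idx \<Rightarrow> real^'d" where "of_idx x = (\<chi> i. x $ Abs_idx i)"

lemma to_of_idx [simp]: "to_idx (of_idx x) = x" "of_idx (to_idx y) = y"
  by (simp_all add: to_idx_def of_idx_def Rep_idx_inverse Abs_idx_inverse)

lemma linear_to_idx: "linear to_idx" and linear_of_idx: "linear of_idx"
  by (auto intro!: linearI simp: to_idx_def of_idx_def vec_eq_iff)

lemma borel_measurable_linear:
  fixes f :: "'a::euclidean_space \<Rightarrow> 'b::euclidean_space"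
  shows "linear f \<Longrightarrow> f \<in> borel_measurable borel"
  by (intro borel_measurable_continuous_onI linear_continuous_on) (simp add: linear_linear)

text \<open>Renaming coordinates maps boxes to boxes with the same side lengths, and Lebesgue
  measure is determined by its values on boxes.\<close>

lemma lborel_idx: "lborel = distr lborel borel (to_idx :: real^'d \<Rightarrow> real^'d idx)"
proof (rule lborel_eqI)
  fix l u :: "real^'d idx" assume lu: "\<And>b. b \<in> Basis \<Longrightarrow> l \<bullet> b \<le> u \<bullet> b"
  have *: "Basis = (\<lambda>i. axis i (1::real)) ` (UNIV :: 'k::finite set)" by (auto simp: Basis_vec_def)
  have prod_ax: "(\<Prod>b\<in>Basis. (x :: real^'k) \<bullet> b) = (\<Prod>i\<in>UNIV. x $ i)" for x :: "real^'k::finite"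
    unfolding * by (subst prod.reindex) (auto simp: inj_on_def axis_eq_axis inner_axis)
  have lu': "l $ i \<le> u $ i" for i using lu[of "axis i 1"] by (auto simp: inner_axis Basis_vec_def)
  have "emeasure (distr lborel borel to_idx) (box l u) = emeasure lborel (to_idx -` box l u)"
    using borel_measurable_linear[OF linear_to_idx] by (subst emeasure_distr) auto
  also have "to_idx -` box l u = box (of_idx l) (of_idx u)"
  proof -
    have "(\<forall>i. Q i) \<longleftrightarrow> (\<forall>j. Q (Abs_idx j :: 'd idx))" for Q by (metis Abs_idx_cases)
    from this[of "\<lambda>i. l $ i < x $ Rep_idx i \<and> x $ Rep_idx i < u $ i" for x :: "real^'d"]
    have "(\<forall>i. l $ i < x $ Rep_idx i \<and> x $ Rep_idx i < u $ i) = (\<forall>i. l $ Abs_idx i < x $ i \<and> x $ i < u $ Abs_idx i)" for x :: "real^'d"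
      by (simp add: Abs_idx_inverse)
    then show ?thesis by (auto simp: mem_box_cart to_idx_def of_idx_def)
  qed
  also have "emeasure lborel (box (of_idx l) (of_idx u)) = (\<Prod>b\<in>Basis. (of_idx u - of_idx l) \<bullet> b)"
    using lu' by (intro emeasure_lborel_box) (auto simp: of_idx_def Basis_vec_def inner_axis)
  also have "(\<Prod>b\<in>Basis. (of_idx u - of_idx l) \<bullet> b) = (\<Prod>b\<in>Basis. (u - l) \<bullet> b)"
    unfolding prod_ax
    by (rule prod.reindex_bij_betw[of Abs_idx UNIV UNIV "\<lambda>i. (u - l) $ i", symmetric, THEN sym, THEN trans[rotated]])
      (auto simp: of_idx_def bij_betw_def inj_on_def Abs_idx_inject intro: Abs_idx_cases)
  finally show "emeasure (distr lborel borel to_idx) (box l u) = (\<Prod>b\<in>Basis. (u - l) \<bullet> b)" .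
qed simp

lemma emeasure_to_idx: "B \<in> sets borel \<Longrightarrow> emeasure lborel (to_idx -` B) = emeasure lborel (B :: (real^('d::finite) idx) set)"
  using borel_measurable_linear[OF linear_to_idx] by (subst lborel_idx, subst emeasure_distr) auto

text \<open>The factor \<open>k\<close> is the absolute determinant of the inverse. It is identified
  on boxes, where the volume formula for linear images applies; uniqueness of \<open>lborel\<close>
  extends the identity to all Borel sets.\<close>

lemma emeasure_linear_vimage_wellorder:
  fixes L :: "real^'n::{finite,wellorder} \<Rightarrow> real^'n::_"
  assumes L: "linear L" "bij L"
  obtains k :: real where "0 < k" "\<And>A. A \<in> sets borel \<Longrightarrow> emeasure lborel (L -` A) = ennreal k * emeasure lborel A"
proof -
  obtain L' where L': "linear L'" "\<And>x. L' (L x) = x" "\<And>x. L (L' x) = x"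
    using linear_injective_isomorphism[OF L(1) bij_is_inj[OF L(2)]] by metis
  have "inj L'" using L'(3) by (metis injI)
  define k where "k = \<bar>det (matrix L')\<bar>"
  have k: "0 < k" using det_nz_iff_inj[OF L'(1)] \<open>inj L'\<close> by (simp add: k_def)
  have vi: "L -` A = L' ` A" for A using L'(2,3) by (auto simp: image_iff) metis
  have Lm: "L \<in> borel_measurable borel" by (rule borel_measurable_linear[OF L(1)])
  have "lborel = density (distr lborel borel L) (\<lambda>_. ennreal (1 / k))"
  proof (rule lborel_eqI)
    fix l u :: "real^'n::{finite,wellorder}" assume lu: "\<And>b. b \<in> Basis \<Longrightarrow> l \<bullet> b \<le> u \<bullet> b"
    have "L -` box l u \<in> sets borel" using measurable_sets_borel[OF Lm, of "box l u"] by simp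
    have "L' ` box l u \<in> lmeasurable" "measure lebesgue (L' ` box l u) = k * measure lebesgue (box l u)"
      using measurable_linear_image[OF L'(1), of "box l u"] measure_linear_image[OF L'(1), of "box l u"] by (auto simp: k_def)
    then have "emeasure lebesgue (L' ` box l u) = ennreal (k * measure lebesgue (box l u))"
      by (simp add: emeasure_eq_measure2)
    then have "emeasure lborel (L -` box l u) = ennreal (k * measure lebesgue (box l u))"
      using \<open>L -` box l u \<in> sets borel\<close> by (simp add: vi)
    then show "emeasure (density (distr lborel borel L) (\<lambda>_. ennreal (1 / k))) (box l u) = (\<Prod>b\<in>Basis. (u - l) \<bullet> b)"
      using Lm k lu by (simp add: emeasure_density nn_integral_cmult emeasure_distr measure_lborel_box_eq)
        (simp add: ennreal_mult[symmetric] prod_nonneg inner_diff_left)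
  qed simp
  then have eq: "emeasure lborel A = ennreal (1 / k) * emeasure lborel (L -` A)" if "A \<in> sets borel" for A
  proof -
    have "emeasure lborel A = emeasure (density (distr lborel borel L) (\<lambda>_. ennreal (1 / k))) A"
      using \<open>lborel = _\<close> by metis
    then show ?thesis using that Lm by (simp add: emeasure_density nn_integral_cmult emeasure_distr)
  qed
  have "emeasure lborel (L -` A) = ennreal k * emeasure lborel A" if "A \<in> sets borel" for A
    unfolding eq[OF that] using k by (simp add: mult.assoc[symmetric] flip: ennreal_mult)
  then show ?thesis using that k by blast
qed

text \<open>Conjugation by the coordinate renaming, which preserves measure, reduces an arbitrary
  finite index type to the well-ordered copy.\<close>

lemma emeasure_linear_vimage:
  fixes L :: "real^'d \<Rightarrow> real^'d"
  assumes L: "linear L" "bij L"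
  obtains k :: real where "0 < k" "\<And>A. A \<in> sets borel \<Longrightarrow> emeasure lborel (L -` A) = ennreal k * emeasure lborel A"
proof -
  define L' where "L' = to_idx \<circ> L \<circ> of_idx"
  have lin: "linear L'" unfolding L'_def by (intro linear_compose linear_to_idx linear_of_idx L)
  have bij_to: "bij (to_idx :: real^'d \<Rightarrow> _)" by (rule o_bij[of of_idx]) (auto simp: fun_eq_iff)
  have bij_of: "bij (of_idx :: _ \<Rightarrow> real^'d)" by (rule o_bij[of to_idx]) (auto simp: fun_eq_iff)
  have "bij L'" unfolding L'_def by (intro bij_comp bij_to bij_of L)
  obtain k where k: "0 < k" "\<And>A. A \<in> sets borel \<Longrightarrow> emeasure lborel (L' -` A) = ennreal k * emeasure lborel A"
    using emeasure_linear_vimage_wellorder[OF lin \<open>bij L'\<close>] by blast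
  have "emeasure lborel (L -` A) = ennreal k * emeasure lborel A" if A: "A \<in> sets borel" for A
  proof -
    have A': "of_idx -` A \<in> sets borel"
      using measurable_sets_borel[OF borel_measurable_linear[OF linear_of_idx] A] by simp
    have "L' -` of_idx -` A \<in> sets borel"
      using measurable_sets_borel[OF borel_measurable_linear[OF lin] A'] by simp
    have "emeasure lborel (L -` A) = emeasure lborel (to_idx -` L' -` of_idx -` A)"
      by (rule arg_cong[where f = "emeasure lborel"]) (auto simp: L'_def)
    also have "\<dots> = ennreal k * emeasure lborel (of_idx -` A)"
      by (simp add: emeasure_to_idx \<open>L' -` of_idx -` A \<in> sets borel\<close> k(2)[OF A'])
    also have "emeasure lborel (of_idx -` A) = emeasure lborel (to_idx -` of_idx -` A)" by (simp add: emeasure_to_idx A')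
    also have "to_idx -` of_idx -` A = A" by auto
    finally show ?thesis .
  qed
  then show ?thesis using that k by blast
qed

text \<open>A Lebesgue set is a Borel set up to a subset of a null set, so beyond Borel
  measurability one needs that preimages of null sets stay null.\<close>

lemma measurable_lebesgueI:
  fixes f :: "'a::euclidean_space \<Rightarrow> 'b::euclidean_space"
  assumes f: "f \<in> borel_measurable borel" and null: "\<And>N. N \<in> null_sets lborel \<Longrightarrow> f -` N \<in> null_sets lborel"
  shows "f \<in> lebesgue \<rightarrow>\<^sub>M lebesgue"
proof (rule measurableI)
  fix A :: "'b set" assume "A \<in> sets lebesgue"
  then obtain S N N' where A: "A = S \<union> N" "N \<subseteq> N'" "N' \<in> null_sets lborel" "S \<in> sets lborel"
    by (meson sets_completionE)
  have "f -` S \<in> sets lborel" using measurable_sets_borel[OF f, of S] A by simp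
  then have "f -` S \<union> f -` N \<in> sets lebesgue"
    by (intro sets_completionI[where N' = "f -` N'"]) (use A null[OF A(3)] in auto)
  then show "f -` A \<inter> space lebesgue \<in> sets lebesgue" by (simp add: A)
qed simp

text \<open>The density \<open>k\<close> is kept abstract. Where its value matters, it is recovered
  by comparing the volume of one cell with that of its image.\<close>

lemma affine_lebesgue:
  fixes L :: "real^'d \<Rightarrow> real^'d"
  assumes L: "linear L" "bij L"
  obtains k :: real where "0 < k" "(\<lambda>y. L y + c) \<in> lebesgue \<rightarrow>\<^sub>M lebesgue"
    "distr lebesgue lebesgue (\<lambda>y. L y + c) = density lebesgue (\<lambda>_. ennreal k)"
proof -
  obtain k where k: "0 < k" "\<And>A. A \<in> sets borel \<Longrightarrow> emeasure lborel (L -` A) = ennreal k * emeasure lborel A"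
    using emeasure_linear_vimage[OF L] by blast
  define T where "T = (\<lambda>y. L y + c)"
  have Tm: "T \<in> borel_measurable borel" unfolding T_def using borel_measurable_linear[OF L(1)] by measurable
  have kT: "emeasure lborel (T -` A) = ennreal k * emeasure lborel A" if A: "A \<in> sets borel" for A
  proof -
    have A': "(+) c -` A \<in> sets borel" using measurable_sets_borel[of "(+) c" borel A] A by simp
    have "T -` A = L -` ((+) c -` A)" by (auto simp: T_def add.commute)
    then have "emeasure lborel (T -` A) = ennreal k * emeasure lborel ((+) c -` A)" using k(2)[OF A'] by simp
    also have "emeasure lborel ((+) c -` A) = emeasure (distr lborel borel ((+) c)) A"
      using A by (subst emeasure_distr) auto
    finally show ?thesis by (simp add: lborel_distr_plus)
  qed
  have TL: "T \<in> lebesgue \<rightarrow>\<^sub>M lebesgue"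
  proof (rule measurable_lebesgueI[OF Tm])
    fix N :: "(real^'d) set" assume N: "N \<in> null_sets lborel"
    then show "T -` N \<in> null_sets lborel"
      using kT[of N] measurable_sets_borel[OF Tm, of N] by (auto simp: null_sets_def)
  qed
  have "distr lebesgue lebesgue T = density lebesgue (\<lambda>_. ennreal k)"
  proof (rule measure_eqI)
    fix A assume "A \<in> sets (distr lebesgue lebesgue T)"
    then have A: "A \<in> sets lebesgue" by simp
    then obtain S N N' where S: "A = S \<union> N" "N \<subseteq> N'" "N' \<in> null_sets lborel" "S \<in> sets lborel"
      by (meson sets_completionE)
    have N': "N' \<in> null_sets lebesgue" using S by (meson null_sets_completionI)
    have "T -` N' \<in> null_sets lborel"
      using kT[of N'] measurable_sets_borel[OF Tm, of N'] S(3) by (auto simp: null_sets_def)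
    then have TN': "T -` N' \<in> null_sets lebesgue" by (rule null_sets_completionI)
    have TA: "T -` A \<in> sets lebesgue" "T -` S \<in> sets lebesgue" using measurable_sets[OF TL A] measurable_sets[OF TL, of S] S by auto
    have "emeasure lebesgue (T -` A) = emeasure lebesgue (T -` S)"
      by (rule emeasure_eq_AE) (use AE_not_in[OF TN'] S TA in auto)
    also have "\<dots> = emeasure lborel (T -` S)" using measurable_sets_borel[OF Tm, of S] S by simp
    also have "\<dots> = ennreal k * emeasure lborel S" using S by (intro kT) simp
    also have "emeasure lborel S = emeasure lebesgue S" using S by simp
    also have "emeasure lebesgue S = emeasure lebesgue A"
      by (rule emeasure_eq_AE) (use AE_not_in[OF N'] S A in auto)
    finally show "emeasure (distr lebesgue lebesgue T) A = emeasure (density lebesgue (\<lambda>_. ennreal k)) A"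
      using A TL by (simp add: emeasure_distr emeasure_density nn_integral_cmult)
  qed simp
  with k(1) TL show ?thesis unfolding T_def by (rule that)
qed

lemma affine_change_of_variables:
  fixes f :: "real^'d \<Rightarrow> 'b::euclidean_space"
  assumes T: "T \<in> lebesgue \<rightarrow>\<^sub>M lebesgue" and k: "0 < k" "distr lebesgue lebesgue T = density lebesgue (\<lambda>_. ennreal k)"
    and inj: "inj T" and S: "S \<in> sets lebesgue" "T ` S \<in> sets lebesgue" and f: "f \<in> borel_measurable (lebesgue_on (T ` S))"
  shows "(\<lambda>y. f (T y)) \<in> borel_measurable (lebesgue_on S)"
    "integrable (lebesgue_on S) (\<lambda>y. f (T y)) \<longleftrightarrow> integrable (lebesgue_on (T ` S)) f"
    "(LINT y|lebesgue_on S. f (T y)) = k *\<^sub>R (LINT x|lebesgue_on (T ` S). f x)"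
proof -
  define h where "h = (\<lambda>x. indicat_real (T ` S) x *\<^sub>R f x)"
  have h: "h \<in> borel_measurable lebesgue" using f S(2) unfolding h_def by (subst (asm) borel_measurable_restrict_space_iff) auto
  have hT: "h (T y) = indicat_real S y *\<^sub>R f (T y)" for y
    using inj by (auto simp: h_def indicator_def inj_def)
  show "(\<lambda>y. f (T y)) \<in> borel_measurable (lebesgue_on S)"
    using measurable_compose[OF T h] S by (subst borel_measurable_restrict_space_iff) (auto simp: hT)
  have "integrable lebesgue (\<lambda>y. h (T y)) \<longleftrightarrow> integrable (distr lebesgue lebesgue T) h"
    using T h by (subst integrable_distr_eq) auto
  also have "\<dots> \<longleftrightarrow> integrable lebesgue h"
    unfolding k(2) using h k(1) integrable_scaleR_right[of "1 / k" lebesgue "\<lambda>x. k *\<^sub>R h x"]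
    by (subst integrable_density) (auto simp: less_imp_le)
  finally show "integrable (lebesgue_on S) (\<lambda>y. f (T y)) \<longleftrightarrow> integrable (lebesgue_on (T ` S)) f"
    using S by (simp add: integrable_restrict_space hT) (simp add: h_def)
  have "(LINT y|lebesgue. h (T y)) = (LINT x|distr lebesgue lebesgue T. h x)"
    using T h by (subst integral_distr) auto
  also have "\<dots> = k *\<^sub>R (LINT x|lebesgue. h x)"
    unfolding k(2) using h k(1) by (subst integral_density) (auto simp: less_imp_le)
  finally show "(LINT y|lebesgue_on S. f (T y)) = k *\<^sub>R (LINT x|lebesgue_on (T ` S). f x)"
    using S by (simp add: integral_restrict_space hT) (simp add: h_def)
qed

text \<open>Cylinders over null sets are null in the product.\<close>

lemma measurable_lebesgue_fst: "fst \<in> (lebesgue :: ('a::euclidean_space \<times> 'b::euclidean_space) measure) \<rightarrow>\<^sub>M lebesgue"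
  and measurable_lebesgue_snd: "snd \<in> (lebesgue :: ('a::euclidean_space \<times> 'b::euclidean_space) measure) \<rightarrow>\<^sub>M lebesgue"
proof -
  show "fst \<in> (lebesgue :: ('a \<times> 'b) measure) \<rightarrow>\<^sub>M lebesgue"
  proof (rule measurable_lebesgueI)
    fix N :: "'a set" assume N: "N \<in> null_sets lborel"
    have "emeasure (lborel \<Otimes>\<^sub>M lborel) (N \<times> (UNIV :: 'b set)) = emeasure lborel N * emeasure lborel (UNIV :: 'b set)"
      using N by (intro lborel.emeasure_pair_measure_Times) auto
    moreover have "fst -` N = N \<times> (UNIV :: 'b set)" by auto
    moreover have "N \<times> (UNIV :: 'b set) \<in> sets (lborel \<Otimes>\<^sub>M lborel)" using N by (intro pair_measureI) auto
    ultimately show "fst -` N \<in> null_sets (lborel :: ('a \<times> 'b) measure)"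
      using N unfolding lborel_prod by (auto simp: null_sets_def)
  qed (intro borel_measurable_continuous_onI continuous_intros)
  show "snd \<in> (lebesgue :: ('a \<times> 'b) measure) \<rightarrow>\<^sub>M lebesgue"
  proof (rule measurable_lebesgueI)
    fix N :: "'b set" assume N: "N \<in> null_sets lborel"
    have "emeasure (lborel \<Otimes>\<^sub>M lborel) ((UNIV :: 'a set) \<times> N) = emeasure lborel (UNIV :: 'a set) * emeasure lborel N"
      using N by (intro lborel.emeasure_pair_measure_Times) auto
    moreover have "snd -` N = (UNIV :: 'a set) \<times> N" by auto
    moreover have "(UNIV :: 'a set) \<times> N \<in> sets (lborel \<Otimes>\<^sub>M lborel)" using N by (intro pair_measureI) auto
    ultimately show "snd -` N \<in> null_sets (lborel :: ('a \<times> 'b) measure)"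
      using N unfolding lborel_prod by (auto simp: null_sets_def)
  qed (intro borel_measurable_continuous_onI continuous_intros)
qed

lemma lebesgue_Times:
  fixes A :: "'a::euclidean_space set" and B :: "'b::euclidean_space set"
  assumes A: "A \<in> sets lebesgue" and B: "B \<in> sets lebesgue"
  shows "A \<times> B \<in> sets lebesgue" "emeasure lebesgue (A \<times> B) = emeasure lebesgue A * emeasure lebesgue B"
proof -
  have eqT: "A \<times> B = (fst -` A) \<inter> (snd -` B)" for A :: "'a set" and B :: "'b set" by auto
  have T: "A \<times> B \<in> sets lebesgue" if "A \<in> sets lebesgue" "B \<in> sets lebesgue" for A :: "'a set" and B :: "'b set"
    unfolding eqT using measurable_sets[OF measurable_lebesgue_fst that(1)] measurable_sets[OF measurable_lebesgue_snd that(2)] by auto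
  show AB: "A \<times> B \<in> sets lebesgue" by (rule T[OF A B])
  obtain S N N' where S: "A = S \<union> N" "N \<subseteq> N'" "N' \<in> null_sets lborel" "S \<in> sets lborel"
    using A by (meson sets_completionE)
  obtain R M M' where R: "B = R \<union> M" "M \<subseteq> M'" "M' \<in> null_sets lborel" "R \<in> sets lborel"
    using B by (meson sets_completionE)
  have N': "N' \<in> null_sets lebesgue" and M': "M' \<in> null_sets lebesgue" using S R by (auto intro: null_sets_completionI)
  have zA: "AE x in (lebesgue :: ('a \<times> 'b) measure). fst x \<notin> N'"
  proof -
    have "emeasure (lborel \<Otimes>\<^sub>M lborel) (N' \<times> (UNIV :: 'b set)) = 0"
      using S by (subst lborel.emeasure_pair_measure_Times) auto
    moreover have "N' \<times> (UNIV :: 'b set) \<in> sets (lborel \<Otimes>\<^sub>M lborel)" using S by (intro pair_measureI) auto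
    ultimately have "N' \<times> (UNIV :: 'b set) \<in> null_sets lborel" unfolding lborel_prod by auto
    then have "AE x in (lebesgue :: ('a \<times> 'b) measure). x \<notin> N' \<times> UNIV" by (intro AE_not_in null_sets_completionI)
    then show ?thesis by eventually_elim auto
  qed
  have zB: "AE x in (lebesgue :: ('a \<times> 'b) measure). snd x \<notin> M'"
  proof -
    have "emeasure (lborel \<Otimes>\<^sub>M lborel) ((UNIV :: 'a set) \<times> M') = 0"
      using R by (subst lborel.emeasure_pair_measure_Times) auto
    moreover have "(UNIV :: 'a set) \<times> M' \<in> sets (lborel \<Otimes>\<^sub>M lborel)" using R by (intro pair_measureI) auto
    ultimately have "(UNIV :: 'a set) \<times> M' \<in> null_sets lborel" unfolding lborel_prod by auto
    then have "AE x in (lebesgue :: ('a \<times> 'b) measure). x \<notin> UNIV \<times> M'" by (intro AE_not_in null_sets_completionI)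
    then show ?thesis by eventually_elim auto
  qed
  have SR: "S \<times> R \<in> sets (lborel \<Otimes>\<^sub>M lborel)" using S R by (intro pair_measureI) auto
  have "emeasure lebesgue (A \<times> B) = emeasure lebesgue (S \<times> R)"
  proof (rule emeasure_eq_AE)
    show "AE x in lebesgue. (x \<in> A \<times> B) = (x \<in> S \<times> R)"
      using zA zB by eventually_elim (use S R in auto)
    show "S \<times> R \<in> sets lebesgue" using SR unfolding lborel_prod by auto
  qed (rule AB)
  also have "\<dots> = emeasure (lborel \<Otimes>\<^sub>M lborel) (S \<times> R)" using SR unfolding lborel_prod by simp
  also have "\<dots> = emeasure lborel S * emeasure lborel R"
    using S R by (intro lborel.emeasure_pair_measure_Times) auto
  also have "emeasure lborel S = emeasure lebesgue A"
  proof -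
    have "emeasure lebesgue A = emeasure lebesgue S" by (rule emeasure_eq_AE) (use AE_not_in[OF N'] S A in auto)
    then show ?thesis using S by simp
  qed
  also have "emeasure lborel R = emeasure lebesgue B"
  proof -
    have "emeasure lebesgue B = emeasure lebesgue R" by (rule emeasure_eq_AE) (use AE_not_in[OF M'] R B in auto)
    then show ?thesis using R by simp
  qed
  finally show "emeasure lebesgue (A \<times> B) = emeasure lebesgue A * emeasure lebesgue B" .
qed

lemma measurable_id_lebesgue_on_Times:
  assumes "A \<in> sets lebesgue" "B \<in> sets lebesgue"
  shows "(\<lambda>z. z) \<in> lebesgue_on (A \<times> B) \<rightarrow>\<^sub>M lebesgue_on A \<Otimes>\<^sub>M lebesgue_on B"
proof -
  have "fst \<in> lebesgue_on (A \<times> B) \<rightarrow>\<^sub>M lebesgue_on A" "snd \<in> lebesgue_on (A \<times> B) \<rightarrow>\<^sub>M lebesgue_on B"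
    by (auto intro!: measurable_restrict_space3 measurable_lebesgue_fst measurable_lebesgue_snd)
  from measurable_Pair[OF this] show ?thesis by simp
qed

text \<open>The product of two completed measures need not be complete, so Lebesgue measure on the
  product set may have more measurable sets. The two are related through the identity map, which is
  measurable in this one direction.\<close>

lemma pair_lebesgue_on:
  fixes A :: "'a::euclidean_space set" and B :: "'b::euclidean_space set"
  assumes A: "A \<in> sets lebesgue" and B: "B \<in> sets lebesgue"
  shows "lebesgue_on A \<Otimes>\<^sub>M lebesgue_on B = distr (lebesgue_on (A \<times> B)) (lebesgue_on A \<Otimes>\<^sub>M lebesgue_on B) (\<lambda>z. z)"
proof (rule pair_measure_eqI)
  fix X Y assume X: "X \<in> sets (lebesgue_on A)" and Y: "Y \<in> sets (lebesgue_on B)"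
  have XY: "X \<subseteq> A" "X \<in> sets lebesgue" "Y \<subseteq> B" "Y \<in> sets lebesgue"
    using X Y A B by (auto simp: sets_restrict_space_iff)
  have "emeasure (distr (lebesgue_on (A \<times> B)) (lebesgue_on A \<Otimes>\<^sub>M lebesgue_on B) (\<lambda>z. z)) (X \<times> Y) = emeasure (lebesgue_on (A \<times> B)) (X \<times> Y)"
    using XY by (subst emeasure_distr[OF measurable_id_lebesgue_on_Times[OF A B]])
      (auto intro!: pair_measureI X Y arg_cong[where f = "emeasure (lebesgue_on (A \<times> B))"])
  also have "\<dots> = emeasure lebesgue (X \<times> Y)"
    using XY lebesgue_Times(1)[OF A B] by (intro emeasure_restrict_space) auto
  also have "\<dots> = emeasure lebesgue X * emeasure lebesgue Y" using XY by (intro lebesgue_Times)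
  also have "\<dots> = emeasure (lebesgue_on A) X * emeasure (lebesgue_on B) Y"
    using XY A B by (simp add: emeasure_restrict_space)
  finally show "emeasure (lebesgue_on A) X * emeasure (lebesgue_on B) Y =
    emeasure (distr (lebesgue_on (A \<times> B)) (lebesgue_on A \<Otimes>\<^sub>M lebesgue_on B) (\<lambda>z. z)) (X \<times> Y)" by simp
qed (use A B in \<open>auto intro: sigma_finite_lebesgue_on\<close>)

lemma pair_lebesgue_on_integral:
  fixes f :: "'a::euclidean_space \<times> 'b::euclidean_space \<Rightarrow> 'c::euclidean_space"
  assumes A: "A \<in> sets lebesgue" and B: "B \<in> sets lebesgue" and f: "f \<in> borel_measurable (lebesgue_on A \<Otimes>\<^sub>M lebesgue_on B)"
  shows "f \<in> borel_measurable (lebesgue_on (A \<times> B))"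
    "integrable (lebesgue_on (A \<times> B)) f \<longleftrightarrow> integrable (lebesgue_on A \<Otimes>\<^sub>M lebesgue_on B) f"
    "(LINT z|lebesgue_on (A \<times> B). f z) = (LINT z|(lebesgue_on A \<Otimes>\<^sub>M lebesgue_on B). f z)"
proof -
  note m = measurable_id_lebesgue_on_Times[OF A B]
  show "f \<in> borel_measurable (lebesgue_on (A \<times> B))" using measurable_compose[OF m f] .
  show "integrable (lebesgue_on (A \<times> B)) f \<longleftrightarrow> integrable (lebesgue_on A \<Otimes>\<^sub>M lebesgue_on B) f"
    by (subst pair_lebesgue_on[OF A B]) (simp add: integrable_distr_eq[OF m f])
  show "(LINT z|lebesgue_on (A \<times> B). f z) = (LINT z|(lebesgue_on A \<Otimes>\<^sub>M lebesgue_on B). f z)"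
    by (subst pair_lebesgue_on[OF A B]) (simp add: integral_distr[OF m f])
qed

lemma AE_pair_lebesgue_on:
  assumes A: "A \<in> sets lebesgue" and B: "B \<in> sets lebesgue"
    and P: "{z \<in> space (lebesgue_on A \<Otimes>\<^sub>M lebesgue_on B). P z} \<in> sets (lebesgue_on A \<Otimes>\<^sub>M lebesgue_on B)"
  shows "(AE z in lebesgue_on A \<Otimes>\<^sub>M lebesgue_on B. P z) \<longleftrightarrow> (AE z in lebesgue_on (A \<times> B). P z)"
  by (subst pair_lebesgue_on[OF A B]) (rule AE_distr_iff[OF measurable_id_lebesgue_on_Times[OF A B] P])

section \<open>Bochner spaces\<close>

text \<open>Completeness of Lebesgue measure makes measurability insensitive to null sets. It serves
  for functions controlled only almost everywhere, such as the fibrewise Sobolev norm.\<close>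

lemma borel_measurable_lebesgue_on_AE_cong:
  fixes f g :: "'a::euclidean_space \<Rightarrow> 'b::topological_space"
  assumes f: "f \<in> borel_measurable (lebesgue_on S)" and S: "S \<in> sets lebesgue" and eq: "AE x in lebesgue_on S. f x = g x"
  shows "g \<in> borel_measurable (lebesgue_on S)"
proof (rule measurableI)
  have "AE x in lebesgue. x \<in> S \<longrightarrow> f x = g x" using eq S by (simp add: AE_restrict_space_iff)
  then obtain N where N: "N \<in> null_sets lebesgue" "{x. \<not> (x \<in> S \<longrightarrow> f x = g x)} \<subseteq> N"
    by (auto simp: eventually_ae_filter)
  fix A :: "'b set" assume A: "A \<in> sets borel"
  have fA: "f -` A \<inter> S \<in> sets lebesgue" using measurable_sets[OF f A] S by (auto simp: sets_restrict_space_iff)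
  have "g -` A \<inter> S \<inter> N \<in> sets lebesgue"
    by (rule null_setsD2[OF null_sets_completion_subset[OF _ N(1)]]) auto
  moreover have "f -` A \<inter> S - N \<in> sets lebesgue" using fA N(1) by auto
  moreover have "g -` A \<inter> S = (f -` A \<inter> S - N) \<union> (g -` A \<inter> S \<inter> N)" using N(2) by auto
  ultimately have "g -` A \<inter> S \<in> sets lebesgue" by (metis sets.Un)
  then show "g -` A \<inter> space (lebesgue_on S) \<in> sets (lebesgue_on S)" using S by (auto simp: sets_restrict_space_iff)
qed simp

lemma tendsto_0_powr_iff:
  fixes f :: "'x \<Rightarrow> real"
  assumes p: "0 < p" and f: "\<And>x. 0 \<le> f x"
  shows "((\<lambda>x. f x powr p) \<longlongrightarrow> 0) F \<longleftrightarrow> (f \<longlongrightarrow> 0) F"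
proof
  assume "((\<lambda>x. f x powr p) \<longlongrightarrow> 0) F"
  then have "((\<lambda>x. (f x powr p) powr (1 / p)) \<longlongrightarrow> 0 powr (1 / p)) F"
    using p by (intro tendsto_powr' tendsto_const) auto
  then show "(f \<longlongrightarrow> 0) F" using p f by (simp add: powr_powr)
next
  assume "(f \<longlongrightarrow> 0) F"
  then have "((\<lambda>x. f x powr p) \<longlongrightarrow> 0 powr p) F" using p f by (intro tendsto_powr' tendsto_const) auto
  then show "((\<lambda>x. f x powr p) \<longlongrightarrow> 0) F" by simp
qed

text \<open>By linearity and boundedness, a functional takes convergent values on norm-convergent
  combinations, and this for every subsequence. The subspace \<open>X0\<close> is where sums and
  multiples are formed, so that no closure properties of the full space \<open>X\<close> have to be
  established.\<close>

lemma weakly_convergent_toI: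
  assumes X0: "X0 \<subseteq> X" "\<And>u v. u \<in> X0 \<Longrightarrow> v \<in> X0 \<Longrightarrow> (\<lambda>z. u z + v z) \<in> X0"
      "\<And>c u. u \<in> X0 \<Longrightarrow> (\<lambda>z. c *\<^sub>R u z) \<in> X0"
    and f: "\<And>k. f k \<in> X0" and u: "u \<in> X0"
    and conv: "\<And>t :: nat \<Rightarrow> nat. strict_mono t \<Longrightarrow> \<exists>c m. (\<forall>n. conv_weights n (m n) (c n)) \<and>
      (\<lambda>n. N (\<lambda>z. (\<Sum>k<m n. c n k *\<^sub>R f (t k) z) - u z)) \<longlonglongrightarrow> 0"
  shows "weakly_convergent_to X N f u"
  unfolding weakly_convergent_to_def
proof (intro conjI allI impI)
  fix l assume l: "bounded_functional X N l"
  have add: "l (\<lambda>z. a z + b z) = l a + l b" if "a \<in> X0" "b \<in> X0" for a b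
    using l that X0(1) unfolding bounded_functional_def by blast
  have scale: "l (\<lambda>z. c *\<^sub>R a z) = c * l a" if "a \<in> X0" for a c
    using l that X0(1) unfolding bounded_functional_def by blast
  obtain K where K: "\<And>a. a \<in> X0 \<Longrightarrow> \<bar>l a\<bar> \<le> K * N a"
    using l X0(1) unfolding bounded_functional_def by blast
  show "(\<lambda>k. l (f k)) \<longlonglongrightarrow> l u"
  proof (rule tendsto_of_convex_combinations)
    fix t :: "nat \<Rightarrow> nat" assume "strict_mono t"
    from conv[OF this] obtain c m where c: "\<forall>n. conv_weights n (m n) (c n)"
      and lim: "(\<lambda>n. N (\<lambda>z. (\<Sum>k<m n. c n k *\<^sub>R f (t k) z) - u z)) \<longlonglongrightarrow> 0" by blast
    have sum: "(\<lambda>z. \<Sum>k<j. b k *\<^sub>R f (t k) z) \<in> X0 \<and> l (\<lambda>z. \<Sum>k<j. b k *\<^sub>R f (t k) z) = (\<Sum>k<j. b k * l (f (t k)))" for j and b :: "nat \<Rightarrow> real"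
    proof (induction j)
      case 0
      have "(\<lambda>z. 0) = (\<lambda>z. 0 *\<^sub>R u z)" by simp
      then show ?case using X0(3)[OF u, of 0] scale[OF u, of 0] by simp
    next
      case (Suc j)
      then show ?case using X0(2)[of "\<lambda>z. \<Sum>k<j. b k *\<^sub>R f (t k) z" "\<lambda>z. b j *\<^sub>R f (t j) z"]
          add[of "\<lambda>z. \<Sum>k<j. b k *\<^sub>R f (t k) z" "\<lambda>z. b j *\<^sub>R f (t j) z"] X0(3)[OF f] scale[OF f] by simp
    qed
    have "(\<lambda>n. l (\<lambda>z. \<Sum>k<m n. c n k *\<^sub>R f (t k) z) - l u) \<longlonglongrightarrow> 0"
    proof (rule Lim_null_comparison)
      show "(\<lambda>n. K * N (\<lambda>z. (\<Sum>k<m n. c n k *\<^sub>R f (t k) z) - u z)) \<longlonglongrightarrow> 0"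
        using tendsto_mult_left[OF lim, of K] by simp
      show "eventually (\<lambda>n. norm (l (\<lambda>z. \<Sum>k<m n. c n k *\<^sub>R f (t k) z) - l u)
          \<le> K * N (\<lambda>z. (\<Sum>k<m n. c n k *\<^sub>R f (t k) z) - u z)) sequentially"
      proof (rule always_eventually, rule allI)
        fix n
        let ?h = "\<lambda>z. \<Sum>k<m n. c n k *\<^sub>R f (t k) z"
        have h: "?h \<in> X0" using sum by blast
        have d: "(\<lambda>z. ?h z + (-1) *\<^sub>R u z) \<in> X0" by (intro X0(2,3) h u)
        have "l (\<lambda>z. ?h z + (-1) *\<^sub>R u z) = l ?h - l u" using add[OF h X0(3)[OF u, of "-1"]] scale[OF u, of "-1"] by simp
        then show "norm (l ?h - l u) \<le> K * N (\<lambda>z. ?h z - u z)" using K[OF d] by simp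
      qed
    qed
    then have "(\<lambda>n. \<Sum>k<m n. c n k * l (f (t k))) \<longlonglongrightarrow> l u" using sum by (simp add: LIM_zero_iff)
    with c show "\<exists>c m. (\<forall>n. conv_weights n (m n) (c n)) \<and> (\<lambda>n. \<Sum>k<m n. c n k * l (f (t k))) \<longlonglongrightarrow> l u" by blast
  qed
qed (use X0(1) f u in auto)

lemma weakly_in_LpI:
  assumes p: "1 < p" and f: "\<And>k. f k \<in> Lp p S" and u: "u \<in> Lp p S"
    and conv: "\<And>t :: nat \<Rightarrow> nat. strict_mono t \<Longrightarrow> \<exists>c m. (\<forall>n. conv_weights n (m n) (c n)) \<and>
      (\<lambda>n. LINT z|lebesgue_on S. norm ((\<Sum>k<m n. c n k *\<^sub>R f (t k) z) - u z) powr p) \<longlonglongrightarrow> 0"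
  shows "weakly_in_Lp p S f u"
  unfolding weakly_in_Lp_def
proof (rule weakly_convergent_toI[of "Lp p S"])
  fix t :: "nat \<Rightarrow> nat" assume "strict_mono t"
  from conv[OF this] obtain c m where c: "\<forall>n. conv_weights n (m n) (c n)"
    and lim: "(\<lambda>n. LINT z|lebesgue_on S. norm ((\<Sum>k<m n. c n k *\<^sub>R f (t k) z) - u z) powr p) \<longlonglongrightarrow> 0" by blast
  have "(\<lambda>n. Lp_norm p S (\<lambda>z. (\<Sum>k<m n. c n k *\<^sub>R f (t k) z) - u z)) \<longlonglongrightarrow> 0"
    unfolding Lp_norm_def using p lim by (subst tendsto_0_powr_iff) auto
  with c show "\<exists>c m. (\<forall>n. conv_weights n (m n) (c n)) \<and>
      (\<lambda>n. Lp_norm p S (\<lambda>z. (\<Sum>k<m n. c n k *\<^sub>R f (t k) z) - u z)) \<longlonglongrightarrow> 0" by blast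
qed (use f u in \<open>auto simp: Lp_eq intro: Lp_fun_add[OF p] Lp_fun_scaleR\<close>)

text \<open>
  Elements of the Bochner space that come with a jointly measurable weak gradient; working with these
  makes all measurability questions instances of Fubini's theorem.
\<close>

definition bochner_pair ::
    "real \<Rightarrow> 'a::euclidean_space set \<Rightarrow> (real^'d) set \<Rightarrow> ('a \<times> (real^'d) \<Rightarrow> real) \<Rightarrow> ('a \<times> (real^'d) \<Rightarrow> real^'d) \<Rightarrow> bool" where
  "bochner_pair p U Y u g \<longleftrightarrow>
     u \<in> Lp_fun p (lebesgue_on U \<Otimes>\<^sub>M lebesgue_on Y) \<and> g \<in> Lp_fun p (lebesgue_on U \<Otimes>\<^sub>M lebesgue_on Y) \<and>
     (AE x in lebesgue_on U. has_weak_gradient Y (\<lambda>y. u (x, y)) (\<lambda>y. g (x, y))) \<and>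
     strongly_measurable_on U (W1p p Y) (W1p_norm p Y) u"

lemma AE_Lp_section:
  assumes U: "U \<in> sets lebesgue" and Y: "Y \<in> sets lebesgue"
    and f: "f \<in> Lp_fun p (lebesgue_on U \<Otimes>\<^sub>M lebesgue_on Y)"
  shows "AE x in lebesgue_on U. (\<lambda>y. f (x, y)) \<in> Lp p Y"
proof -
  interpret pair_sigma_finite "lebesgue_on U" "lebesgue_on Y"
    by (intro pair_sigma_finite.intro sigma_finite_lebesgue_on U Y)
  have "AE x in lebesgue_on U. integrable (lebesgue_on Y) (\<lambda>y. norm (f (x, y)) powr p)"
    by (rule AE_integrable_fst'[OF Lp_funD(2)[OF f]])
  then show ?thesis
  proof (rule AE_mp, intro AE_I2 impI)
    fix x assume "x \<in> space (lebesgue_on U)" and i: "integrable (lebesgue_on Y) (\<lambda>y. norm (f (x, y)) powr p)"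
    then have "(\<lambda>y. f (x, y)) \<in> borel_measurable (lebesgue_on Y)"
      using measurable_compose[OF measurable_Pair1' Lp_funD(1)[OF f]] by blast
    with i show "(\<lambda>y. f (x, y)) \<in> Lp p Y" by (simp add: Lp_def)
  qed
qed

lemma bochner_pair_norm:
  assumes p: "1 < p" and U: "U \<in> sets lebesgue" and Y: "open Y" and bp: "bochner_pair p U Y u g"
  shows "u \<in> bochner_Lp p U (W1p p Y) (W1p_norm p Y)"
    "bochner_Lp_norm p U (W1p_norm p Y) u = (integral\<^sup>L (lebesgue_on U \<Otimes>\<^sub>M lebesgue_on Y) (\<lambda>z. norm (u z) powr p)
       + integral\<^sup>L (lebesgue_on U \<Otimes>\<^sub>M lebesgue_on Y) (\<lambda>z. norm (g z) powr p)) powr (1 / p)"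
proof -
  have Ys: "Y \<in> sets lebesgue" using Y by simp
  interpret pair_sigma_finite "lebesgue_on U" "lebesgue_on Y"
    by (intro pair_sigma_finite.intro sigma_finite_lebesgue_on U Ys)
  have u: "u \<in> Lp_fun p (lebesgue_on U \<Otimes>\<^sub>M lebesgue_on Y)" and g: "g \<in> Lp_fun p (lebesgue_on U \<Otimes>\<^sub>M lebesgue_on Y)"
    and w: "AE x in lebesgue_on U. has_weak_gradient Y (\<lambda>y. u (x, y)) (\<lambda>y. g (x, y))"
    and sm: "strongly_measurable_on U (W1p p Y) (W1p_norm p Y) u" using bp by (auto simp: bochner_pair_def)
  have W: "AE x in lebesgue_on U. (\<lambda>y. u (x, y)) \<in> W1p p Y"
    using w AE_Lp_section[OF U Ys u] AE_Lp_section[OF U Ys g] by eventually_elim (rule W1p_I)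
  define J where "J = (\<lambda>x. (LINT y|lebesgue_on Y. norm (u (x, y)) powr p) + (LINT y|lebesgue_on Y. norm (g (x, y)) powr p))"
  have J: "integrable (lebesgue_on U) J" unfolding J_def
    by (intro Bochner_Integration.integrable_add integrable_fst' Lp_funD(2)[OF u] Lp_funD(2)[OF g])
  have eq: "AE x in lebesgue_on U. J x = W1p_norm p Y (\<lambda>y. u (x, y)) powr p"
    using w by eventually_elim (simp add: W1p_norm_powr[OF p Y] J_def)
  \<comment> \<open>Measurability of the fibrewise norm is inherited from the inner integrals in
    \<open>J\<close>, with which it agrees almost everywhere.\<close>
  have m: "(\<lambda>x. W1p_norm p Y (\<lambda>y. u (x, y)) powr p) \<in> borel_measurable (lebesgue_on U)"
    by (rule borel_measurable_lebesgue_on_AE_cong[OF borel_measurable_integrable[OF J] U eq])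
  have "integrable (lebesgue_on U) (\<lambda>x. W1p_norm p Y (\<lambda>y. u (x, y)) powr p)"
    using integrable_cong_AE[OF borel_measurable_integrable[OF J] m eq] J by simp
  with W sm show "u \<in> bochner_Lp p U (W1p p Y) (W1p_norm p Y)" by (simp add: bochner_Lp_def)
  have "(LINT x|lebesgue_on U. W1p_norm p Y (\<lambda>y. u (x, y)) powr p) = (LINT x|lebesgue_on U. J x)"
    by (rule integral_cong_AE[symmetric, OF borel_measurable_integrable[OF J] m eq])
  also have "\<dots> = integral\<^sup>L (lebesgue_on U \<Otimes>\<^sub>M lebesgue_on Y) (\<lambda>z. norm (u z) powr p)
       + integral\<^sup>L (lebesgue_on U \<Otimes>\<^sub>M lebesgue_on Y) (\<lambda>z. norm (g z) powr p)"
    unfolding J_def using integral_fst'[OF Lp_funD(2)[OF u]] integral_fst'[OF Lp_funD(2)[OF g]]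
      integrable_fst'[OF Lp_funD(2)[OF u]] integrable_fst'[OF Lp_funD(2)[OF g]] by simp
  finally show "bochner_Lp_norm p U (W1p_norm p Y) u = (integral\<^sup>L (lebesgue_on U \<Otimes>\<^sub>M lebesgue_on Y) (\<lambda>z. norm (u z) powr p)
       + integral\<^sup>L (lebesgue_on U \<Otimes>\<^sub>M lebesgue_on Y) (\<lambda>z. norm (g z) powr p)) powr (1 / p)"
    by (simp add: bochner_Lp_norm_def)
qed

lemma W1p_norm_tendsto_0_add:
  assumes p: "1 < p" and Y: "open Y" and a: "\<And>k. a k \<in> W1p p Y" and b: "\<And>k. b k \<in> W1p p Y"
    and lim: "(\<lambda>k. W1p_norm p Y (a k)) \<longlonglongrightarrow> 0" "(\<lambda>k. W1p_norm p Y (b k)) \<longlonglongrightarrow> 0"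
  shows "(\<lambda>k. W1p_norm p Y (\<lambda>y. a k y + b k y)) \<longlonglongrightarrow> 0"
proof -
  have p0: "0 < p" using p by simp
  note iff = tendsto_0_powr_iff[OF p0 W1p_norm_nonneg]
  have "(\<lambda>k. 2 powr p * (W1p_norm p Y (a k) powr p + W1p_norm p Y (b k) powr p)) \<longlonglongrightarrow> 2 powr p * (0 + 0)"
    using lim by (intro tendsto_mult_left tendsto_add) (simp_all add: iff)
  then have "(\<lambda>k. 2 powr p * (W1p_norm p Y (a k) powr p + W1p_norm p Y (b k) powr p)) \<longlonglongrightarrow> 0" by simp
  then have "(\<lambda>k. W1p_norm p Y (\<lambda>y. a k y + b k y) powr p) \<longlonglongrightarrow> 0"
    by (rule Lim_null_comparison[rotated]) (use W1p_norm_add_le[OF p Y a b] in simp)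
  then show ?thesis by (simp only: iff)
qed

lemma strongly_measurable_on_add:
  assumes p: "1 < p" and Y: "open Y" and u: "strongly_measurable_on U (W1p p Y) (W1p_norm p Y) u"
    and v: "strongly_measurable_on U (W1p p Y) (W1p_norm p Y) v"
    and uW: "AE x in lebesgue_on U. (\<lambda>y. u (x, y)) \<in> W1p p Y" and vW: "AE x in lebesgue_on U. (\<lambda>y. v (x, y)) \<in> W1p p Y"
  shows "strongly_measurable_on U (W1p p Y) (W1p_norm p Y) (\<lambda>z. u z + v z)"
proof -
  obtain s where s: "\<And>k. simple_function (lebesgue_on U) (s k)" "\<And>k. s k ` U \<subseteq> W1p p Y"
    "AE x in lebesgue_on U. (\<lambda>k. W1p_norm p Y (\<lambda>y. s k x y - u (x, y))) \<longlonglongrightarrow> 0"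
    using u unfolding strongly_measurable_on_def by blast
  obtain t where t: "\<And>k. simple_function (lebesgue_on U) (t k)" "\<And>k. t k ` U \<subseteq> W1p p Y"
    "AE x in lebesgue_on U. (\<lambda>k. W1p_norm p Y (\<lambda>y. t k x y - v (x, y))) \<longlonglongrightarrow> 0"
    using v unfolding strongly_measurable_on_def by blast
  have sub: "(\<lambda>y. a y - b y) \<in> W1p p Y" if "a \<in> W1p p Y" "b \<in> W1p p Y" for a b
    using W1p_add[OF p Y that(1) W1p_scaleR[OF that(2), of "-1"]] by simp
  show ?thesis unfolding strongly_measurable_on_def
  proof (intro exI[of _ "\<lambda>k x y. s k x y + t k x y"] conjI allI)
    show "simple_function (lebesgue_on U) (\<lambda>x y. s k x y + t k x y)" for k
      using simple_function_compose2[OF s(1)[of k] t(1)[of k], of "\<lambda>a b y. a y + b y"] by simp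
    show "(\<lambda>x y. s k x y + t k x y) ` U \<subseteq> W1p p Y" for k
      using s(2)[of k] t(2)[of k] by (auto intro!: W1p_add[OF p Y])
    have "AE x in lebesgue_on U. x \<in> U" by (rule AE_I2) simp
    with s(3) t(3) uW vW show "AE x in lebesgue_on U. (\<lambda>k. W1p_norm p Y (\<lambda>y. s k x y + t k x y - (u (x, y) + v (x, y)))) \<longlonglongrightarrow> 0"
    proof eventually_elim
      case (elim x)
      have "(\<lambda>k. W1p_norm p Y (\<lambda>y. (s k x y - u (x, y)) + (t k x y - v (x, y)))) \<longlonglongrightarrow> 0"
        using elim s(2) t(2) by (intro W1p_norm_tendsto_0_add[OF p Y] sub) (blast+)
      then show ?case by (simp add: algebra_simps)
    qed
  qed
qed

lemma strongly_measurable_on_scale: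
  assumes p: "1 < p" and Y: "open Y" and u: "strongly_measurable_on U (W1p p Y) (W1p_norm p Y) u"
    and uW: "AE x in lebesgue_on U. (\<lambda>y. u (x, y)) \<in> W1p p Y"
  shows "strongly_measurable_on U (W1p p Y) (W1p_norm p Y) (\<lambda>z. c * u z)"
proof -
  obtain s where s: "\<And>k. simple_function (lebesgue_on U) (s k)" "\<And>k. s k ` U \<subseteq> W1p p Y"
    "AE x in lebesgue_on U. (\<lambda>k. W1p_norm p Y (\<lambda>y. s k x y - u (x, y))) \<longlonglongrightarrow> 0"
    using u unfolding strongly_measurable_on_def by blast
  have p0: "0 < p" using p by simp
  note iff = tendsto_0_powr_iff[OF p0 W1p_norm_nonneg]
  have sub: "(\<lambda>y. a y - b y) \<in> W1p p Y" if "a \<in> W1p p Y" "b \<in> W1p p Y" for a b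
    using W1p_add[OF p Y that(1) W1p_scaleR[OF that(2), of "-1"]] by simp
  show ?thesis unfolding strongly_measurable_on_def
  proof (intro exI[of _ "\<lambda>k x y. c * s k x y"] conjI allI)
    show "simple_function (lebesgue_on U) (\<lambda>x y. c * s k x y)" for k
      using simple_function_compose1[OF s(1)[of k], of "\<lambda>a y. c * a y"] by simp
    show "(\<lambda>x y. c * s k x y) ` U \<subseteq> W1p p Y" for k using s(2)[of k] by (auto intro!: W1p_scaleR)
    have "AE x in lebesgue_on U. x \<in> U" by (rule AE_I2) simp
    with s(3) uW show "AE x in lebesgue_on U. (\<lambda>k. W1p_norm p Y (\<lambda>y. c * s k x y - c * u (x, y))) \<longlonglongrightarrow> 0"
    proof eventually_elim
      case (elim x)
      have "(\<lambda>k. W1p_norm p Y (\<lambda>y. c * (s k x y - u (x, y))) powr p) = (\<lambda>k. \<bar>c\<bar> powr p * W1p_norm p Y (\<lambda>y. s k x y - u (x, y)) powr p)"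
        using elim s(2) by (intro ext W1p_norm_scaleR_powr[OF p Y] sub) auto
      moreover have "(\<lambda>k. \<bar>c\<bar> powr p * W1p_norm p Y (\<lambda>y. s k x y - u (x, y)) powr p) \<longlonglongrightarrow> \<bar>c\<bar> powr p * 0"
        using elim(1) by (intro tendsto_mult_left) (simp only: iff)
      ultimately have "(\<lambda>k. W1p_norm p Y (\<lambda>y. c * (s k x y - u (x, y))) powr p) \<longlonglongrightarrow> 0" by simp
      then show ?case by (simp only: iff right_diff_distrib)
    qed
  qed
qed

lemma bochner_pair_add:
  assumes p: "1 < p" and U: "U \<in> sets lebesgue" and Y: "open Y" and u: "bochner_pair p U Y u g" and v: "bochner_pair p U Y v h"
  shows "bochner_pair p U Y (\<lambda>z. u z + v z) (\<lambda>z. g z + h z)"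
proof -
  have "AE x in lebesgue_on U. (\<lambda>y. u (x, y)) \<in> W1p p Y" "AE x in lebesgue_on U. (\<lambda>y. v (x, y)) \<in> W1p p Y"
    using bochner_pair_norm(1)[OF p U Y u] bochner_pair_norm(1)[OF p U Y v] by (auto simp: bochner_Lp_def)
  moreover have "AE x in lebesgue_on U. has_weak_gradient Y (\<lambda>y. u (x, y) + v (x, y)) (\<lambda>y. g (x, y) + h (x, y))"
  proof -
    have "AE x in lebesgue_on U. has_weak_gradient Y (\<lambda>y. u (x, y)) (\<lambda>y. g (x, y))"
      "AE x in lebesgue_on U. has_weak_gradient Y (\<lambda>y. v (x, y)) (\<lambda>y. h (x, y))"
      using u v by (auto simp: bochner_pair_def)
    then show ?thesis by eventually_elim (rule has_weak_gradient_add[OF Y])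
  qed
  ultimately show ?thesis
    using u v unfolding bochner_pair_def by (auto intro: Lp_fun_add[OF p] strongly_measurable_on_add[OF p Y])
qed

lemma bochner_pair_scaleR:
  assumes p: "1 < p" and U: "U \<in> sets lebesgue" and Y: "open Y" and u: "bochner_pair p U Y u g"
  shows "bochner_pair p U Y (\<lambda>z. c * u z) (\<lambda>z. c *\<^sub>R g z)"
proof -
  have "AE x in lebesgue_on U. (\<lambda>y. u (x, y)) \<in> W1p p Y"
    using bochner_pair_norm(1)[OF p U Y u] by (auto simp: bochner_Lp_def)
  moreover have "AE x in lebesgue_on U. has_weak_gradient Y (\<lambda>y. c * u (x, y)) (\<lambda>y. c *\<^sub>R g (x, y))"
  proof -
    have "AE x in lebesgue_on U. has_weak_gradient Y (\<lambda>y. u (x, y)) (\<lambda>y. g (x, y))"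
      using u by (auto simp: bochner_pair_def)
    then show ?thesis by eventually_elim (rule has_weak_gradient_scaleR)
  qed
  ultimately show ?thesis
    using u Lp_fun_scaleR[of u p "lebesgue_on U \<Otimes>\<^sub>M lebesgue_on Y" c] Lp_fun_scaleR[of g p "lebesgue_on U \<Otimes>\<^sub>M lebesgue_on Y" c]
    unfolding bochner_pair_def by (auto intro: strongly_measurable_on_scale[OF p Y])
qed

text \<open>The Bochner norm of a difference is a double integral of the function and its gradient,
  so both must converge with identical weights. The subspace consists of the functions that admit
  some jointly measurable gradient.\<close>

lemma weakly_in_Lp_W1pI:
  fixes g :: "nat \<Rightarrow> 'a::euclidean_space \<times> (real^'d) \<Rightarrow> real^'d"
  assumes p: "1 < p" and U: "U \<in> sets lebesgue" and Y: "open Y"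
    and u: "\<And>k. bochner_pair p U Y (u k) (g k)" and v: "bochner_pair p U Y v h"
    and conv: "\<And>t :: nat \<Rightarrow> nat. strict_mono t \<Longrightarrow> \<exists>c m. (\<forall>n. conv_weights n (m n) (c n)) \<and>
      (\<lambda>n. integral\<^sup>L (lebesgue_on U \<Otimes>\<^sub>M lebesgue_on Y) (\<lambda>z. norm ((\<Sum>k<m n. c n k *\<^sub>R u (t k) z) - v z) powr p)) \<longlonglongrightarrow> 0 \<and>
      (\<lambda>n. integral\<^sup>L (lebesgue_on U \<Otimes>\<^sub>M lebesgue_on Y) (\<lambda>z. norm ((\<Sum>k<m n. c n k *\<^sub>R g (t k) z) - h z) powr p)) \<longlonglongrightarrow> 0"
  shows "weakly_in_Lp_W1p p U Y u v"
  unfolding weakly_in_Lp_W1p_def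
proof (rule weakly_convergent_toI[of "{u. \<exists>g. bochner_pair p U Y u g}"])
  fix t :: "nat \<Rightarrow> nat" assume "strict_mono t"
  from conv[OF this] obtain c m where c: "\<forall>n. conv_weights n (m n) (c n)"
    and lim: "(\<lambda>n. integral\<^sup>L (lebesgue_on U \<Otimes>\<^sub>M lebesgue_on Y) (\<lambda>z. norm ((\<Sum>k<m n. c n k *\<^sub>R u (t k) z) - v z) powr p)) \<longlonglongrightarrow> 0"
      "(\<lambda>n. integral\<^sup>L (lebesgue_on U \<Otimes>\<^sub>M lebesgue_on Y) (\<lambda>z. norm ((\<Sum>k<m n. c n k *\<^sub>R g (t k) z) - h z) powr p)) \<longlonglongrightarrow> 0"
    by blast
  have zero: "bochner_pair p U Y (\<lambda>z. 0) (\<lambda>z. 0)" using bochner_pair_scaleR[OF p U Y v, of 0] by simp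
  have sum: "bochner_pair p U Y (\<lambda>z. \<Sum>k<j. b k *\<^sub>R u (t k) z) (\<lambda>z. \<Sum>k<j. b k *\<^sub>R g (t k) z)" for j b
    by (induction j) (auto intro!: bochner_pair_add[OF p U Y] bochner_pair_scaleR[OF p U Y] u zero)
  have d: "bochner_pair p U Y (\<lambda>z. (\<Sum>k<m n. c n k *\<^sub>R u (t k) z) - v z) (\<lambda>z. (\<Sum>k<m n. c n k *\<^sub>R g (t k) z) - h z)" for n
    using bochner_pair_add[OF p U Y sum bochner_pair_scaleR[OF p U Y v, of "-1"]] by simp
  have "(\<lambda>n. bochner_Lp_norm p U (W1p_norm p Y) (\<lambda>z. (\<Sum>k<m n. c n k *\<^sub>R u (t k) z) - v z)) \<longlonglongrightarrow> 0"
    unfolding bochner_pair_norm(2)[OF p U Y d] using tendsto_add[OF lim] p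
    by (subst tendsto_0_powr_iff) (auto intro!: add_nonneg_nonneg)
  with c show "\<exists>c m. (\<forall>n. conv_weights n (m n) (c n)) \<and>
      (\<lambda>n. bochner_Lp_norm p U (W1p_norm p Y) (\<lambda>z. (\<Sum>k<m n. c n k *\<^sub>R u (t k) z) - v z)) \<longlonglongrightarrow> 0" by blast
next
  show "{u. \<exists>g. bochner_pair p U Y u g} \<subseteq> bochner_Lp p U (W1p p Y) (W1p_norm p Y)"
    using bochner_pair_norm(1)[OF p U Y] by blast
next
  fix a b assume "a \<in> {u. \<exists>g. bochner_pair p U Y u g}" "b \<in> {u. \<exists>g. bochner_pair p U Y u g}"
  then show "(\<lambda>z. a z + b z) \<in> {u. \<exists>g. bochner_pair p U Y u g}"
    using bochner_pair_add[OF p U Y] by blast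
next
  fix a c assume "a \<in> {u. \<exists>g. bochner_pair p U Y u g}"
  then show "(\<lambda>z. c *\<^sub>R a z) \<in> {u. \<exists>g. bochner_pair p U Y u g}"
    using bochner_pair_scaleR[OF p U Y] unfolding real_scaleR_def by blast
qed (use u v in blast)+

text \<open>Here the fibre conditions hold at every x of \<open>U\<close>, and u takes finitely many
  values as a function of x, as unfolded functions do. Finite combinations keep this form, so they
  can serve as simple approximants.\<close>

definition simple_pair ::
    "real \<Rightarrow> 'a::euclidean_space set \<Rightarrow> (real^'d) set \<Rightarrow> ('a \<times> (real^'d) \<Rightarrow> real) \<Rightarrow> ('a \<times> (real^'d) \<Rightarrow> real^'d) \<Rightarrow> bool" where
  "simple_pair p U Y u g \<longleftrightarrow>
     u \<in> Lp_fun p (lebesgue_on U \<Otimes>\<^sub>M lebesgue_on Y) \<and> g \<in> Lp_fun p (lebesgue_on U \<Otimes>\<^sub>M lebesgue_on Y) \<and>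
     simple_function (lebesgue_on U) (\<lambda>x y. u (x, y)) \<and>
     (\<forall>x\<in>U. (\<lambda>y. u (x, y)) \<in> Lp p Y \<and> (\<lambda>y. g (x, y)) \<in> Lp p Y \<and> has_weak_gradient Y (\<lambda>y. u (x, y)) (\<lambda>y. g (x, y)))"

lemma simple_pair_add:
  assumes p: "1 < p" and Y: "open Y" and u: "simple_pair p U Y u g" and v: "simple_pair p U Y v h"
  shows "simple_pair p U Y (\<lambda>z. u z + v z) (\<lambda>z. g z + h z)"
  using u v simple_function_compose2[of "lebesgue_on U" "\<lambda>x y. u (x, y)" "\<lambda>x y. v (x, y)" "\<lambda>a b y. a y + b y"]
  unfolding simple_pair_def Lp_eq by (auto intro: Lp_fun_add[OF p] has_weak_gradient_add[OF Y])

lemma simple_pair_scaleR: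
  assumes u: "simple_pair p U Y u g"
  shows "simple_pair p U Y (\<lambda>z. c * u z) (\<lambda>z. c *\<^sub>R g z)"
  using u simple_function_compose1[of "lebesgue_on U" "\<lambda>x y. u (x, y)" "\<lambda>a y. c * a y"]
    Lp_fun_scaleR[of u p "lebesgue_on U \<Otimes>\<^sub>M lebesgue_on Y" c]
  unfolding simple_pair_def Lp_eq
  by (auto intro: Lp_fun_scaleR Lp_fun_scaleR[where 'b = real, simplified] has_weak_gradient_scaleR)

lemma simple_pair_sum:
  assumes p: "1 < p" and Y: "open Y" and u: "\<And>k. simple_pair p U Y (u k) (g k)"
  shows "simple_pair p U Y (\<lambda>z. \<Sum>k<j. b k *\<^sub>R u k z) (\<lambda>z. \<Sum>k<(j::nat). b k *\<^sub>R g k z)"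
proof (induction j)
  case 0
  show ?case using simple_pair_scaleR[OF u[of 0], of 0] by simp
next
  case (Suc j)
  then show ?case using simple_pair_add[OF p Y Suc simple_pair_scaleR[OF u[of j], of "b j"]] by simp
qed

text \<open>A function that is simple in x is its own approximating sequence.\<close>

lemma simple_pair_imp_bochner_pair:
  assumes p: "1 < p" and Y: "open Y" and u: "simple_pair p U Y u g"
  shows "bochner_pair p U Y u g"
proof -
  have [simp]: "W1p_norm p Y (\<lambda>y. 0) = 0"
    using W1p_norm_eq[OF p Y has_weak_gradient_zero] p by simp
  show ?thesis
    using u unfolding bochner_pair_def simple_pair_def strongly_measurable_on_def
    by (auto intro!: AE_I2 W1p_I exI[of _ "\<lambda>k x y. u (x, y)"])
qed


text \<open>The approximating functions are themselves simple in x, so strong measurability of the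
  limit needs only a subsequence along which their fibrewise distance tends to 0 for almost every x.
  Closedness of the weak gradient is applied in each such fibre.\<close>

lemma bochner_pair_limit:
  fixes g :: "nat \<Rightarrow> 'a::euclidean_space \<times> (real^'d) \<Rightarrow> real^'d"
  assumes p: "1 < p" and U: "U \<in> sets lebesgue" and Y: "open Y" "bounded Y"
    and u: "\<And>n. simple_pair p U Y (u n) (g n)"
    and v: "v \<in> Lp_fun p (lebesgue_on U \<Otimes>\<^sub>M lebesgue_on Y)" and h: "h \<in> Lp_fun p (lebesgue_on U \<Otimes>\<^sub>M lebesgue_on Y)"
    and lim_u: "(\<lambda>n. integral\<^sup>L (lebesgue_on U \<Otimes>\<^sub>M lebesgue_on Y) (\<lambda>z. norm (u n z - v z) powr p)) \<longlonglongrightarrow> 0"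
    and lim_g: "(\<lambda>n. integral\<^sup>L (lebesgue_on U \<Otimes>\<^sub>M lebesgue_on Y) (\<lambda>z. norm (g n z - h z) powr p)) \<longlonglongrightarrow> 0"
  shows "bochner_pair p U Y v h"
proof -
  have Ys: "Y \<in> sets lebesgue" using Y by simp
  have finY: "finite_measure (lebesgue_on Y)"
    using Y by (intro finite_measure_lebesgue_on) (simp add: bounded_set_imp_lmeasurable)
  interpret pair_sigma_finite "lebesgue_on U" "lebesgue_on Y"
    by (intro pair_sigma_finite.intro sigma_finite_lebesgue_on U Ys)
  have un: "u n \<in> Lp_fun p (lebesgue_on U \<Otimes>\<^sub>M lebesgue_on Y)" and gn: "g n \<in> Lp_fun p (lebesgue_on U \<Otimes>\<^sub>M lebesgue_on Y)" for n
    using u[of n] by (auto simp: simple_pair_def)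
  define J where "J = (\<lambda>n x. (LINT y|lebesgue_on Y. norm (u n (x, y) - v (x, y)) powr p) + (LINT y|lebesgue_on Y. norm (g n (x, y) - h (x, y)) powr p))"
  have I: "integrable (lebesgue_on U) (\<lambda>x. LINT y|lebesgue_on Y. norm (u n (x, y) - v (x, y)) powr p)"
    "integrable (lebesgue_on U) (\<lambda>x. LINT y|lebesgue_on Y. norm (g n (x, y) - h (x, y)) powr p)" for n
    using integrable_fst'[OF Lp_funD(2)[OF Lp_fun_diff[OF p un v]]] integrable_fst'[OF Lp_funD(2)[OF Lp_fun_diff[OF p gn h]]] by auto
  have J: "integrable (lebesgue_on U) (J n)" for n unfolding J_def by (intro Bochner_Integration.integrable_add I)
  have J0: "0 \<le> J n x" for n x by (simp add: J_def)
  have "(LINT x|lebesgue_on U. J n x) = integral\<^sup>L (lebesgue_on U \<Otimes>\<^sub>M lebesgue_on Y) (\<lambda>z. norm (u n z - v z) powr p)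
      + integral\<^sup>L (lebesgue_on U \<Otimes>\<^sub>M lebesgue_on Y) (\<lambda>z. norm (g n z - h z) powr p)" for n
    unfolding J_def using I[of n] integral_fst'[OF Lp_funD(2)[OF Lp_fun_diff[OF p un v]]]
      integral_fst'[OF Lp_funD(2)[OF Lp_fun_diff[OF p gn h]]] by simp
  with tendsto_add[OF lim_u lim_g] have "(\<lambda>n. LINT x|lebesgue_on U. norm (J n x)) \<longlonglongrightarrow> 0" using J0 by simp
  from tendsto_L1_AE_subseq[OF J this] obtain r where r: "strict_mono (r :: nat \<Rightarrow> nat)"
    and lim: "AE x in lebesgue_on U. (\<lambda>n. J (r n) x) \<longlonglongrightarrow> 0" by blast
  have AEU: "AE x in lebesgue_on U. x \<in> U" by (rule AE_I2) simp
  have main: "AE x in lebesgue_on U. has_weak_gradient Y (\<lambda>y. v (x, y)) (\<lambda>y. h (x, y)) \<and>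
      (\<lambda>n. W1p_norm p Y (\<lambda>y. u (r n) (x, y) - v (x, y))) \<longlonglongrightarrow> 0"
    using lim AE_Lp_section[OF U Ys v] AE_Lp_section[OF U Ys h] AEU
  proof eventually_elim
    case (elim x)
    have ux: "(\<lambda>y. u n (x, y)) \<in> Lp p Y" "(\<lambda>y. g n (x, y)) \<in> Lp p Y" "has_weak_gradient Y (\<lambda>y. u n (x, y)) (\<lambda>y. g n (x, y))" for n
      using u[of n] elim(4) by (auto simp: simple_pair_def)
    have l1: "(\<lambda>n. LINT y|lebesgue_on Y. norm (u (r n) (x, y) - v (x, y)) powr p) \<longlonglongrightarrow> 0"
      by (rule Lim_null_comparison[OF _ elim(1)]) (auto simp: J_def)
    have l2: "(\<lambda>n. LINT y|lebesgue_on Y. norm (g (r n) (x, y) - h (x, y)) powr p) \<longlonglongrightarrow> 0"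
      by (rule Lim_null_comparison[OF _ elim(1)]) (auto simp: J_def)
    note Lps = ux(1)[unfolded Lp_eq] ux(2)[unfolded Lp_eq] elim(2,3)[unfolded Lp_eq]
    have w: "has_weak_gradient Y (\<lambda>y. v (x, y)) (\<lambda>y. h (x, y))"
    proof (rule has_weak_gradient_closed[OF Y(1) ux(3)[of "r n" for n]])
      show "(\<lambda>n. LINT y|lebesgue_on Y. norm (u (r n) (x, y) - v (x, y))) \<longlonglongrightarrow> 0"
        by (rule Lp_tendsto_L1[OF p finY _ l1]) (intro Lp_fun_diff p Lps)
      show "(\<lambda>n. LINT y|lebesgue_on Y. norm (g (r n) (x, y) - h (x, y))) \<longlonglongrightarrow> 0"
        by (rule Lp_tendsto_L1[OF p finY _ l2]) (intro Lp_fun_diff p Lps)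
    qed (intro Lp_fun_integrable[OF p finY] Lps)+
    have "(\<lambda>n. W1p_norm p Y (\<lambda>y. u (r n) (x, y) - v (x, y)) powr p) = (\<lambda>n. J (r n) x)"
      unfolding W1p_norm_powr[OF p Y(1) has_weak_gradient_diff[OF Y(1) ux(3) w]] J_def ..
    with elim(1) have "(\<lambda>n. W1p_norm p Y (\<lambda>y. u (r n) (x, y) - v (x, y)) powr p) \<longlonglongrightarrow> 0" by simp
    then have "(\<lambda>n. W1p_norm p Y (\<lambda>y. u (r n) (x, y) - v (x, y))) \<longlonglongrightarrow> 0"
      using p by (subst (asm) tendsto_0_powr_iff) (auto simp: W1p_norm_nonneg)
    with w show ?case by blast
  qed
  have "strongly_measurable_on U (W1p p Y) (W1p_norm p Y) v"
    unfolding strongly_measurable_on_def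
  proof (intro exI[of _ "\<lambda>n x y. u (r n) (x, y)"] conjI allI)
    show "simple_function (lebesgue_on U) (\<lambda>x y. u (r n) (x, y))" for n using u[of "r n"] by (simp add: simple_pair_def)
    show "(\<lambda>x y. u (r n) (x, y)) ` U \<subseteq> W1p p Y" for n
      using u[of "r n"] by (auto simp: simple_pair_def intro: W1p_I)
  qed (use main in auto)
  with v h main show ?thesis unfolding bochner_pair_def by auto
qed

text \<open>
  Composing the simple approximants with an almost best approximation in the subset makes them take
  values in the subset without losing convergence.
\<close>

lemma strongly_measurable_on_subset:
  assumes p: "1 < p" and Y: "open Y" and u: "strongly_measurable_on U (W1p p Y) (W1p_norm p Y) u"
    and V: "V \<subseteq> W1p p Y" "v0 \<in> V" and uV: "AE x in lebesgue_on U. (\<lambda>y. u (x, y)) \<in> V"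
  shows "strongly_measurable_on U V (W1p_norm p Y) u"
proof -
  obtain s where s: "\<And>k. simple_function (lebesgue_on U) (s k)" "\<And>k. s k ` U \<subseteq> W1p p Y"
    "AE x in lebesgue_on U. (\<lambda>k. W1p_norm p Y (\<lambda>y. s k x y - u (x, y))) \<longlonglongrightarrow> 0"
    using u unfolding strongly_measurable_on_def by blast
  define d where "d = (\<lambda>a. INF b\<in>V. W1p_norm p Y (\<lambda>y. b y - a y))"
  have bdd: "bdd_below ((\<lambda>b. W1p_norm p Y (\<lambda>y. b y - a y)) ` V)" for a
    by (rule bdd_belowI2[of _ 0]) (rule W1p_norm_nonneg)
  have ex: "\<exists>b\<in>V. W1p_norm p Y (\<lambda>y. b y - a y) < d a + 1 / real (Suc k)" for a k
  proof -
    have "d a < d a + 1 / real (Suc k)" by simp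
    then show ?thesis unfolding d_def using V(2) bdd[of a] by (subst (asm) cINF_less_iff) auto
  qed
  define \<beta> where "\<beta> = (\<lambda>k a. SOME b. b \<in> V \<and> W1p_norm p Y (\<lambda>y. b y - a y) < d a + 1 / real (Suc k))"
  have "\<beta> k a \<in> V \<and> W1p_norm p Y (\<lambda>y. \<beta> k a y - a y) < d a + 1 / real (Suc k)" for k a
    using someI_ex[OF ex[of a k, unfolded Bex_def]] unfolding \<beta>_def .
  then have \<beta>: "\<And>k a. \<beta> k a \<in> V" "\<And>k a. W1p_norm p Y (\<lambda>y. \<beta> k a y - a y) < d a + 1 / real (Suc k)"
    by blast+
  have sub: "(\<lambda>y. a y - b y) \<in> W1p p Y" if "a \<in> W1p p Y" "b \<in> W1p p Y" for a b
    using W1p_add[OF p Y that(1) W1p_scaleR[OF that(2), of "-1"]] by simp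
  show ?thesis unfolding strongly_measurable_on_def
  proof (intro exI[of _ "\<lambda>k x. \<beta> k (s k x)"] conjI allI)
    show "simple_function (lebesgue_on U) (\<lambda>x. \<beta> k (s k x))" for k
      by (rule simple_function_compose1[OF s(1)])
    show "(\<lambda>x. \<beta> k (s k x)) ` U \<subseteq> V" for k using \<beta>(1) by auto
    have "AE x in lebesgue_on U. x \<in> U" by (rule AE_I2) simp
    with s(3) uV show "AE x in lebesgue_on U. (\<lambda>k. W1p_norm p Y (\<lambda>y. \<beta> k (s k x) y - u (x, y))) \<longlonglongrightarrow> 0"
    proof eventually_elim
      case (elim x)
      have uW: "(\<lambda>y. u (x, y)) \<in> W1p p Y" using elim(2) V(1) by auto
      have sW: "s k x \<in> W1p p Y" for k using s(2) elim(3) by blast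
      have \<beta>W: "\<beta> k a \<in> W1p p Y" for k a using \<beta>(1) V(1) by blast
      have sym: "W1p_norm p Y (\<lambda>y. a y - b y) = W1p_norm p Y (\<lambda>y. b y - a y)" if "a \<in> W1p p Y" "b \<in> W1p p Y" for a b
      proof -
        have "W1p_norm p Y (\<lambda>y. a y - b y) powr p = W1p_norm p Y (\<lambda>y. b y - a y) powr p"
          using W1p_norm_scaleR_powr[OF p Y sub[OF that(2,1)], of "-1"] by simp
        then have "(W1p_norm p Y (\<lambda>y. a y - b y) powr p) powr (1 / p) = (W1p_norm p Y (\<lambda>y. b y - a y) powr p) powr (1 / p)" by simp
        then show ?thesis using p by (simp add: powr_powr W1p_norm_nonneg)
      qed
      \<comment> \<open>The fibre of \<open>u\<close> at x lies in \<open>V\<close> and competes in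
        the infimum, so the distance of the approximant to \<open>V\<close> is at most its distance
        to the fibre.\<close>
      have dle: "d (s k x) \<le> W1p_norm p Y (\<lambda>y. s k x y - u (x, y))" for k
        unfolding d_def using cINF_lower[OF bdd elim(2), of "s k x"] sym[OF uW sW] by simp
      have le: "W1p_norm p Y (\<lambda>y. \<beta> k (s k x) y - s k x y) \<le> W1p_norm p Y (\<lambda>y. s k x y - u (x, y)) + 1 / real (Suc k)" for k
        by (rule order_trans[OF less_imp_le[OF \<beta>(2)] add_right_mono[OF dle]])
      have "(\<lambda>k. W1p_norm p Y (\<lambda>y. \<beta> k (s k x) y - s k x y)) \<longlonglongrightarrow> 0"
      proof (rule Lim_null_comparison)
        show "(\<lambda>k. W1p_norm p Y (\<lambda>y. s k x y - u (x, y)) + 1 / real (Suc k)) \<longlonglongrightarrow> 0"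
          using tendsto_add[OF elim(1) LIMSEQ_inverse_real_of_nat] by (simp add: inverse_eq_divide)
      qed (use le in \<open>simp add: W1p_norm_nonneg del: of_nat_Suc\<close>)
      from W1p_norm_tendsto_0_add[OF p Y _ _ this elim(1)]
      have "(\<lambda>k. W1p_norm p Y (\<lambda>y. (\<beta> k (s k x) y - s k x y) + (s k x y - u (x, y)))) \<longlonglongrightarrow> 0"
        using sub[OF \<beta>W sW] sub[OF sW uW] by blast
      then show ?case by simp
    qed
  qed
qed

section \<open>Lattice cells\<close>

text \<open>An affine substitution turns coordinate directions into columns of the matrix, so the
  pairing is needed for arbitrary directions; it follows by expanding v in the standard
  basis.\<close>

lemma has_weak_gradient_directional:
  assumes U: "open U" and u: "has_weak_gradient U u g" and phi: "test_function U \<phi>"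
  shows "(LINT x|lebesgue_on U. u x * frechet_derivative \<phi> (at x) v) = - (LINT x|lebesgue_on U. (g x \<bullet> v) * \<phi> x)"
proof -
  have lu: "locally_integrable_on u U" "locally_integrable_on g U" using u by (auto simp: has_weak_gradient_def)
  have "C_k (Suc 0) \<phi>" using phi unfolding test_function_def by blast
  then have lin: "linear (frechet_derivative \<phi> (at x))" for x by (intro linear_frechet_derivative) simp
  have dv: "frechet_derivative \<phi> (at x) v = (\<Sum>i\<in>UNIV. v $ i * frechet_derivative \<phi> (at x) (axis i 1))" for x
  proof -
    have "v = (\<Sum>i\<in>UNIV. v $ i *\<^sub>R axis i 1)"
      using basis_expansion[of v] by (simp only: scalar_mult_eq_scaleR)
    then have "frechet_derivative \<phi> (at x) v = frechet_derivative \<phi> (at x) (\<Sum>i\<in>UNIV. v $ i *\<^sub>R axis i 1)"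
      by (rule arg_cong)
    then show ?thesis by (simp only: linear_sum[OF lin] linear_cmul[OF lin] real_scaleR_def)
  qed
  have "(LINT x|lebesgue_on U. u x * frechet_derivative \<phi> (at x) v)
      = (LINT x|lebesgue_on U. (\<Sum>i\<in>UNIV. v $ i * (u x * frechet_derivative \<phi> (at x) (axis i 1))))"
    by (simp add: dv sum_distrib_left mult.left_commute)
  also have "\<dots> = (\<Sum>i\<in>UNIV. v $ i * (LINT x|lebesgue_on U. u x * frechet_derivative \<phi> (at x) (axis i 1)))"
    using integrable_test_function(2)[OF lu(1) U phi] by simp
  also have "\<dots> = (\<Sum>i\<in>UNIV. v $ i * - (LINT x|lebesgue_on U. g x $ i * \<phi> x))"
  proof -
    have "(LINT x|lebesgue_on U. u x * frechet_derivative \<phi> (at x) (axis i 1)) = - (LINT x|lebesgue_on U. g x $ i * \<phi> x)" for i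
      using u phi unfolding has_weak_gradient_def by blast
    then show ?thesis by (simp only:)
  qed
  also have "\<dots> = - (LINT x|lebesgue_on U. (\<Sum>i\<in>UNIV. v $ i * (g x $ i * \<phi> x)))"
    using integrable_test_function(1)[OF locally_integrable_on_component[OF lu(2)] U phi] by (simp add: sum_negf)
  also have "(\<lambda>x. \<Sum>i\<in>UNIV. v $ i * (g x $ i * \<phi> x)) = (\<lambda>x. (g x \<bullet> v) * \<phi> x)"
    by (simp add: inner_vec_def sum_distrib_left sum_distrib_right mult_ac)
  finally show ?thesis .
qed

lemma matrix_affine:
  fixes M :: "real^'d^'d"
  assumes M: "invertible M"
  shows "linear ((*v) M)" "bij ((*v) M)" "matrix_inv M *v (M *v y) = y" "M *v (matrix_inv M *v y) = y"
proof -
  have inv: "M ** matrix_inv M = mat 1 \<and> matrix_inv M ** M = mat 1"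
    unfolding matrix_inv_def by (rule someI_ex) (use M in \<open>simp add: invertible_def\<close>)
  show l: "matrix_inv M *v (M *v y) = y" for y
    using inv by (simp add: matrix_vector_mul_assoc)
  show r: "M *v (matrix_inv M *v y) = y" for y
    using inv by (simp add: matrix_vector_mul_assoc)
  show "bij ((*v) M)" by (rule o_bij[of "(*v) (matrix_inv M)"]) (auto simp: l r fun_eq_iff)
qed simp

lemma test_function_affine:
  fixes M :: "real^'d^'d"
  assumes M: "invertible M" and phi: "test_function S \<phi>"
  shows "test_function ((\<lambda>y. M *v y + c) ` S) (\<lambda>x. \<phi> (matrix_inv M *v (x - c)))"
    "frechet_derivative (\<lambda>x. \<phi> (matrix_inv M *v (x - c))) (at (M *v y + c)) (M *v v) = frechet_derivative \<phi> (at y) v"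
proof -
  note m = matrix_affine[OF M]
  define T where "T = (\<lambda>y. M *v y + c)"
  define T' where "T' = (\<lambda>x. matrix_inv M *v x + (- (matrix_inv M *v c)))"
  have T': "matrix_inv M *v (x - c) = T' x" for x by (simp add: T'_def matrix_vector_mult_diff_distrib)
  have T'T: "T' (T y) = y" for y by (simp add: T_def m flip: T')
  have TT': "T (T' x) = x" for x by (simp add: T_def m flip: T')
  have contT: "continuous_on UNIV T"
    unfolding T_def by (intro continuous_intros linear_continuous_on) simp
  obtain K where K: "compact K" "K \<subseteq> S" "\<And>x. x \<notin> K \<Longrightarrow> \<phi> x = 0" using test_functionD[OF phi] by metis
  have cTK: "compact (T ` K)" by (rule compact_continuous_image[OF continuous_on_subset[OF contT] K(1)]) simp
  have "{x. \<phi> (T' x) \<noteq> 0} \<subseteq> T ` K" using K(3) TT' by (metis (mono_tags, lifting) imageI mem_Collect_eq subsetI)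
  then have sub: "closure {x. \<phi> (T' x) \<noteq> 0} \<subseteq> T ` K" by (rule closure_minimal[OF _ compact_imp_closed[OF cTK]])
  then have "compact (closure {x. \<phi> (T' x) \<noteq> 0})"
    using bounded_subset[OF compact_imp_bounded[OF cTK] sub] by (simp add: compact_eq_bounded_closed)
  moreover have "C_k k (\<lambda>x. \<phi> (T' x))" for k
    unfolding T'_def using phi by (intro C_k_compose_affine) (auto simp: test_function_def)
  ultimately show "test_function ((\<lambda>y. M *v y + c) ` S) (\<lambda>x. \<phi> (matrix_inv M *v (x - c)))"
    using subset_trans[OF sub image_mono[OF K(2)]] unfolding T' test_function_def T_def[symmetric] by blast
  have "C_k (Suc 0) \<phi>" using phi unfolding test_function_def by blast
  then have d: "(\<phi> has_derivative frechet_derivative \<phi> (at y)) (at y)" for y by (simp add: frechet_derivative_works[symmetric])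
  have "((\<lambda>x. \<phi> (T' x)) has_derivative (\<lambda>v. frechet_derivative \<phi> (at (T' (T y))) (matrix_inv M *v v))) (at (T y))"
  proof (rule has_derivative_compose[of T' _ _ UNIV \<phi>])
    show "(T' has_derivative (*v) (matrix_inv M)) (at (T y))"
      unfolding T'_def
      using has_derivative_add[OF bounded_linear_imp_has_derivative[OF matrix_vector_mul_bounded_linear] has_derivative_const]
      by (simp only: add_0_right)
    show "(\<phi> has_derivative frechet_derivative \<phi> (at (T' (T y)))) (at (T' (T y)))" by (rule d)
  qed
  from frechet_derivative_at[OF this]
  have "frechet_derivative (\<lambda>x. \<phi> (T' x)) (at (T y)) (M *v v) = frechet_derivative \<phi> (at y) (matrix_inv M *v (M *v v))"
    by (metis T'T)
  then show "frechet_derivative (\<lambda>x. \<phi> (matrix_inv M *v (x - c))) (at (M *v y + c)) (M *v v) = frechet_derivative \<phi> (at y) v"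
    by (simp add: T' T_def m)
qed

lemma open_affine_image:
  fixes M :: "real^'d^'d"
  assumes M: "invertible M" and S: "open S"
  shows "open ((\<lambda>y. M *v y + c) ` S)"
proof -
  note m = matrix_affine[OF M]
  have "(\<lambda>y. M *v y + c) ` S = (\<lambda>x. matrix_inv M *v (x - c)) -` S"
  proof (intro equalityI subsetI)
    fix x assume "x \<in> (\<lambda>x. matrix_inv M *v (x - c)) -` S"
    then show "x \<in> (\<lambda>y. M *v y + c) ` S"
      by (intro image_eqI[of _ _ "matrix_inv M *v (x - c)"]) (auto simp: m)
  qed (auto simp: m)
  moreover have "continuous_on UNIV (\<lambda>x. matrix_inv M *v (x - c))"
    by (intro bounded_linear.continuous_on[OF matrix_vector_mul_bounded_linear] continuous_intros)
  ultimately show ?thesis using open_vimage[OF S] by simp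
qed

text \<open>Chain rule. A test function on \<open>S\<close> is transported by the inverse map, its
  i-th derivative becomes the derivative along \<open>M *v axis i 1\<close>, and the Jacobian factor
  cancels since it occurs on both sides.\<close>

lemma has_weak_gradient_affine:
  fixes M :: "real^'d^'d"
  assumes M: "invertible M" and S: "open S" and U: "open U" and SU: "(\<lambda>y. M *v y + c) ` S \<subseteq> U"
    and u: "has_weak_gradient U u g"
  shows "has_weak_gradient S (\<lambda>y. u (M *v y + c)) (\<lambda>y. transpose M *v g (M *v y + c))"
proof -
  note m = matrix_affine[OF M]
  define T where "T = (\<lambda>y. M *v y + c)"
  define V where "V = T ` S"
  have V: "open V" unfolding V_def T_def by (rule open_affine_image[OF M S])
  have uV: "has_weak_gradient V u g" using SU by (intro has_weak_gradient_subset[OF u U V]) (simp add: V_def T_def)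
  then have lV: "locally_integrable_on u V" "locally_integrable_on g V" by (auto simp: has_weak_gradient_def)
  obtain k where k: "0 < k" "T \<in> lebesgue \<rightarrow>\<^sub>M lebesgue" "distr lebesgue lebesgue T = density lebesgue (\<lambda>_. ennreal k)"
    unfolding T_def by (rule affine_lebesgue[OF m(1,2)])
  have inj: "inj T" using m(2) by (auto simp: T_def inj_def dest: bij_is_inj)
  have T': "matrix_inv M *v (T y - c) = y" for y by (simp add: T_def m)
  note ch = affine_change_of_variables[OF k(2,1,3) inj]
  have contT: "continuous_on UNIV T"
    unfolding T_def by (intro continuous_intros linear_continuous_on) simp
  have loc: "locally_integrable_on (\<lambda>y. f (T y)) S" if f: "locally_integrable_on f V" for f :: "real^'d \<Rightarrow> 'c::euclidean_space"
    unfolding locally_integrable_on_def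
  proof (intro allI impI)
    fix K assume K: "compact K \<and> K \<subseteq> S"
    then have TK: "compact (T ` K)" "T ` K \<subseteq> V"
      using compact_continuous_image[OF continuous_on_subset[OF contT], of K] by (auto simp: V_def)
    then have "integrable (lebesgue_on (T ` K)) f" using f by (auto simp: locally_integrable_on_def)
    then show "integrable (lebesgue_on K) (\<lambda>y. f (T y))"
      using K TK ch(2)[of K f] by (auto simp: lmeasurable_compact fmeasurableD)
  qed
  have lS: "locally_integrable_on (\<lambda>y. transpose M *v g (T y)) S"
    using loc[OF lV(2)] integrable_bounded_linear[OF matrix_vector_mul_bounded_linear]
    unfolding locally_integrable_on_def by blast
  have "has_weak_gradient S (\<lambda>y. u (T y)) (\<lambda>y. transpose M *v g (T y))"
    unfolding has_weak_gradient_def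
  proof (intro conjI allI impI lS loc[OF lV(1)])
    fix \<phi> i assume phi: "test_function S \<phi>"
    define \<theta> where "\<theta> = (\<lambda>x. \<phi> (matrix_inv M *v (x - c)))"
    define v where "v = M *v axis i 1"
    have th: "test_function V \<theta>" unfolding \<theta>_def V_def T_def by (rule test_function_affine(1)[OF M phi])
    have Dth: "frechet_derivative \<theta> (at (T y)) v = frechet_derivative \<phi> (at y) (axis i 1)" for y
      unfolding \<theta>_def T_def v_def by (rule test_function_affine(2)[OF M phi])
    have thT: "\<theta> (T y) = \<phi> y" for y by (simp add: \<theta>_def T')
    have gv: "(transpose M *v h) $ i = h \<bullet> v" for h
      unfolding v_def matrix_vector_mult_basis
      by (simp add: column_def matrix_vector_mult_def transpose_def inner_vec_def mult.commute)
    have meas: "(\<lambda>x. u x * frechet_derivative \<theta> (at x) v) \<in> borel_measurable (lebesgue_on V)"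
      "(\<lambda>x. (g x \<bullet> v) * \<theta> x) \<in> borel_measurable (lebesgue_on V)"
      using locally_integrable_on_measurable[OF lV(1) V] locally_integrable_on_measurable[OF lV(2) V]
        continuous_measurable_lebesgue_on[OF test_function_continuous(1)[OF th], where S = V]
        continuous_measurable_lebesgue_on[OF test_function_continuous(2)[OF th], where S = V] by measurable
    have "(LINT y|lebesgue_on S. u (T y) * frechet_derivative \<phi> (at y) (axis i 1))
        = (LINT y|lebesgue_on S. u (T y) * frechet_derivative \<theta> (at (T y)) v)" by (simp add: Dth)
    also have "\<dots> = k *\<^sub>R (LINT x|lebesgue_on V. u x * frechet_derivative \<theta> (at x) v)"
      using ch(3)[of S "\<lambda>x. u x * frechet_derivative \<theta> (at x) v"] meas(1) S V by (simp add: V_def)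
    also have "(LINT x|lebesgue_on V. u x * frechet_derivative \<theta> (at x) v) = - (LINT x|lebesgue_on V. (g x \<bullet> v) * \<theta> x)"
      by (rule has_weak_gradient_directional[OF V uV th])
    also have "k *\<^sub>R (- (LINT x|lebesgue_on V. (g x \<bullet> v) * \<theta> x)) = - (LINT y|lebesgue_on S. (g (T y) \<bullet> v) * \<theta> (T y))"
      using ch(3)[of S "\<lambda>x. (g x \<bullet> v) * \<theta> x"] meas(2) S V by (simp add: V_def)
    also have "\<dots> = - (LINT y|lebesgue_on S. (transpose M *v g (T y)) $ i * \<phi> y)" by (simp only: thT gv)
    finally show "(LINT y|lebesgue_on S. u (T y) * frechet_derivative \<phi> (at y) (axis i 1)) = - (LINT y|lebesgue_on S. (transpose M *v g (T y)) $ i * \<phi> y)" .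
  qed
  then show ?thesis by (simp only: T_def)
qed

lemma unit_cell_eq_box: "unit_cell = box 0 (1 :: real^'d)"
  by (auto simp: unit_cell_def mem_box_cart)

lemma open_unit_cell: "open unit_cell" and bounded_unit_cell: "bounded unit_cell"
  unfolding unit_cell_eq_box by auto

lemma unit_cell_lmeasurable: "unit_cell \<in> lmeasurable"
  unfolding unit_cell_eq_box by simp

lemma unit_cell_sets: "unit_cell \<in> sets (lebesgue :: (real^'d) measure)"
  using unit_cell_lmeasurable by (rule fmeasurableD)

lemma measure_unit_cell: "emeasure lebesgue (unit_cell :: (real^'d) set) = 1"
  and measure_unit_cell_shift: "emeasure lebesgue ((\<lambda>y. y + \<xi>) ` (unit_cell :: (real^'d) set)) = 1"
proof -
  have b: "emeasure lebesgue (box a (a + 1 :: real^'d)) = 1" for a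
  proof -
    have *: "(1 :: real^'d) \<bullet> i = 1" if "i \<in> Basis" for i
      using that by (auto simp: Basis_vec_def inner_axis)
    have "emeasure lborel (box a (a + 1)) = ennreal (\<Prod>i\<in>Basis. (a + 1 - a) \<bullet> i)"
      by (rule emeasure_lborel_box) (simp add: inner_add_left *)
    also have "(\<Prod>i\<in>Basis. (a + 1 - a) \<bullet> i) = 1" by (rule prod.neutral) (simp add: *)
    finally show ?thesis by simp
  qed
  show "emeasure lebesgue (unit_cell :: (real^'d) set) = 1" using b[of 0] by (simp add: unit_cell_eq_box)
  have "(\<lambda>y. y + \<xi>) ` (unit_cell :: (real^'d) set) = box \<xi> (\<xi> + 1)"
  proof (intro equalityI subsetI)
    fix x assume "x \<in> box \<xi> (\<xi> + 1)"
    then show "x \<in> (\<lambda>y. y + \<xi>) ` unit_cell"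
      by (intro image_eqI[of _ _ "x - \<xi>"]) (auto simp: unit_cell_def mem_box_cart algebra_simps)
  qed (auto simp: unit_cell_def mem_box_cart)
  then show "emeasure lebesgue ((\<lambda>y. y + \<xi>) ` (unit_cell :: (real^'d) set)) = 1" using b by simp
qed

lemma integral_shift_unit_cell:
  fixes f :: "real^'d \<Rightarrow> 'b::euclidean_space"
  assumes f: "f \<in> borel_measurable (lebesgue_on ((\<lambda>y. y + \<xi>) ` unit_cell))"
  shows "(LINT y|lebesgue_on unit_cell. f (y + \<xi>)) = (LINT x|lebesgue_on ((\<lambda>y. y + \<xi>) ` unit_cell). f x)"
    "integrable (lebesgue_on unit_cell) (\<lambda>y. f (y + \<xi>)) \<longleftrightarrow> integrable (lebesgue_on ((\<lambda>y. y + \<xi>) ` unit_cell)) f"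
    "(\<lambda>y. f (y + \<xi>)) \<in> borel_measurable (lebesgue_on unit_cell)"
proof -
  have l: "linear (\<lambda>y::real^'d. y)" "bij (\<lambda>y::real^'d. y)" by (auto simp: linear_id[unfolded id_def] bij_def)
  obtain k where k: "0 < k" "(\<lambda>y. y + \<xi>) \<in> lebesgue \<rightarrow>\<^sub>M lebesgue" "distr lebesgue lebesgue (\<lambda>y. y + \<xi>) = density lebesgue (\<lambda>_. ennreal k)"
    by (rule affine_lebesgue[OF l])
  have inj: "inj (\<lambda>y. y + \<xi>)" by (auto simp: inj_def)
  have o: "open ((\<lambda>y. y + \<xi>) ` unit_cell)"
    using open_translation[OF open_unit_cell, of \<xi>] by (simp add: add.commute)
  have "emeasure (distr lebesgue lebesgue (\<lambda>y. y + \<xi>)) ((\<lambda>y. y + \<xi>) ` unit_cell) = emeasure lebesgue (unit_cell :: (real^'d) set)"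
    using k(2) o by (subst emeasure_distr) (auto simp: inj_vimage_image_eq[OF inj])
  moreover have "emeasure (density lebesgue (\<lambda>_. ennreal k)) ((\<lambda>y. y + \<xi>) ` unit_cell) = ennreal k"
    using o measure_unit_cell_shift[of \<xi>] by (subst emeasure_density, simp_all del: emeasure_completion add: nn_integral_cmult_indicator)
  \<comment> \<open>The abstract volume factor of a translation is found by comparing the cell with
    its shifted copy, both of measure 1.\<close>
  ultimately have "k = 1" using k(1,3) measure_unit_cell by (metis ennreal_eq_1)
  note ch = affine_change_of_variables[OF k(2,1,3) inj, of unit_cell f]
  show "(LINT y|lebesgue_on unit_cell. f (y + \<xi>)) = (LINT x|lebesgue_on ((\<lambda>y. y + \<xi>) ` unit_cell). f x)"
    "integrable (lebesgue_on unit_cell) (\<lambda>y. f (y + \<xi>)) \<longleftrightarrow> integrable (lebesgue_on ((\<lambda>y. y + \<xi>) ` unit_cell)) f"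
    "(\<lambda>y. f (y + \<xi>)) \<in> borel_measurable (lebesgue_on unit_cell)"
    using ch[OF _ _ f] o unit_cell_lmeasurable by (auto simp: \<open>k = 1\<close> fmeasurableD)
qed

lemma int_part_lattice: "int_part y \<in> int_lattice"
  by (simp add: int_part_def int_lattice_def)

lemma int_part_unique:
  assumes "\<xi> \<in> int_lattice" "\<And>i. 0 \<le> (y - \<xi>) $ i" "\<And>i. (y - \<xi>) $ i < 1"
  shows "int_part y = \<xi>"
proof -
  have "of_int \<lfloor>y $ i\<rfloor> = \<xi> $ i" for i
  proof -
    obtain k :: int where k: "\<xi> $ i = of_int k" using assms(1) by (auto simp: int_lattice_def Ints_def)
    have "\<lfloor>y $ i\<rfloor> = k" using assms(2)[of i] assms(3)[of i] k by (intro floor_unique) auto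
    then show ?thesis using k by simp
  qed
  then show ?thesis by (simp add: int_part_def vec_eq_iff)
qed

lemma int_part_bounds: "0 \<le> (y - int_part y) $ i" "(y - int_part y) $ i < 1"
  by (simp_all add: int_part_def) linarith

text \<open>For points with all coordinates smaller than m in absolute value, the integer parts
  range from -m to m - 1. The symmetric box contains one further layer, on whose cells the functions
  decomposed with it vanish.\<close>

definition lattice_box :: "nat \<Rightarrow> (real^'d) set" where
  "lattice_box m = {\<xi> \<in> int_lattice. \<forall>i. \<bar>\<xi> $ i\<bar> \<le> real m}"

lemma finite_bounded_lattice:
  assumes "bounded S" "S \<subseteq> int_lattice"
  shows "finite (S :: (real^'d) set)"
proof -
  obtain B where B: "\<And>x. x \<in> S \<Longrightarrow> norm x \<le> B" using assms(1) by (auto simp: bounded_iff)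
  define F where "F = (\<lambda>f :: 'd \<Rightarrow> int. (\<chi> i. of_int (f i)) :: real^'d) ` (Pi\<^sub>E UNIV (\<lambda>_. {-\<lceil>B\<rceil>..\<lceil>B\<rceil>}))"
  have "finite F" unfolding F_def by (intro finite_imageI finite_PiE) auto
  moreover have "S \<subseteq> F"
  proof
    fix x assume x: "x \<in> S"
    have xi: "of_int \<lfloor>x $ i\<rfloor> = x $ i" for i using x assms(2) by (auto simp: int_lattice_def Ints_def)
    have "\<bar>x $ i\<bar> \<le> B" for i using component_le_norm_cart[of x i] B[OF x] by simp
    then have "\<lfloor>x $ i\<rfloor> \<in> {-\<lceil>B\<rceil>..\<lceil>B\<rceil>}" for i 
    proof -
      have "of_int (- \<lceil>B\<rceil>) \<le> (of_int \<lfloor>x $ i\<rfloor> :: real)" "(of_int \<lfloor>x $ i\<rfloor> :: real) \<le> of_int \<lceil>B\<rceil>" for i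
        using \<open>\<bar>x $ i\<bar> \<le> B\<close> xi[of i] le_of_int_ceiling[of B] by (simp_all only: of_int_minus abs_le_iff) linarith+
      then show ?thesis by (simp only: atLeastAtMost_iff of_int_le_iff)
    qed
    then show "x \<in> F" unfolding F_def
      by (intro image_eqI[of _ _ "\<lambda>i. \<lfloor>x $ i\<rfloor>"]) (simp_all add: vec_eq_iff xi PiE_iff)
  qed
  ultimately show ?thesis by (rule finite_subset[rotated])
qed

lemma finite_lattice_box: "finite (lattice_box m)"
proof (rule finite_bounded_lattice)
  have "lattice_box m \<subseteq> cbox (\<chi> i. - real m) (\<chi> i. real m)" 
  proof
    fix x :: "real^'d" assume "x \<in> lattice_box m"
    then have "\<bar>x $ i\<bar> \<le> real m" for i by (auto simp: lattice_box_def)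
    then have "- real m \<le> x $ i \<and> x $ i \<le> real m" for i by (metis abs_le_iff minus_le_iff)
    then show "x \<in> cbox (\<chi> i. - real m) (\<chi> i. real m)" by (simp add: mem_box_cart)
  qed
  then show "bounded (lattice_box m)" by (rule bounded_subset[OF bounded_cbox])
qed (auto simp: lattice_box_def)

lemma AE_no_integer_coordinate: "AE y in lebesgue. \<forall>i. (y :: real^'d) $ i \<notin> \<int>"
proof -
  have "AE y in lebesgue. (y :: real^'d) $ i \<noteq> of_int k" for i and k :: int
  proof -
    have "negligible {y :: real^'d. y \<bullet> axis i 1 = of_int k}"
      by (rule negligible_standard_hyperplane) (auto simp: Basis_vec_def)
    then have "negligible {y :: real^'d. y $ i = of_int k}" by (simp add: inner_axis)
    then have "AE y in lebesgue. y \<notin> {y :: real^'d. y $ i = of_int k}" by (intro AE_not_in) (simp add: negligible_iff_null_sets)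
    then show ?thesis by simp
  qed
  then have "AE y in lebesgue. \<forall>i\<in>UNIV. \<forall>k\<in>(UNIV :: int set). (y :: real^'d) $ i \<noteq> of_int k"
    by (simp add: AE_ball_countable AE_all_countable)
  then show ?thesis by eventually_elim (auto simp: Ints_def)
qed

text \<open>Almost every point has no integer coordinate and lies in exactly one open translate of
  the cell, the one at its integer part. The support condition makes the sum finite.\<close>

lemma integral_lattice_decomposition:
  fixes f :: "real^'d \<Rightarrow> 'b::euclidean_space"
  assumes f: "integrable lebesgue f" and supp: "\<And>y. (\<exists>i. real m \<le> \<bar>y $ i\<bar>) \<Longrightarrow> f y = 0"
  shows "(LINT y|lebesgue. f y) = (\<Sum>\<xi>\<in>lattice_box m. LINT y|lebesgue_on unit_cell. f (y + \<xi>))"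
proof -
  let ?C = "\<lambda>\<xi>. (\<lambda>y. y + \<xi>) ` (unit_cell :: (real^'d) set)"
  have o: "open (?C \<xi>)" for \<xi>
    using open_translation[OF open_unit_cell, of \<xi>] by (simp add: add.commute)
  have fm: "f \<in> borel_measurable (lebesgue_on (?C \<xi>))" for \<xi> using f by (intro measurable_restrict_space1) auto
  have ic: "integrable lebesgue (\<lambda>y. indicat_real (?C \<xi>) y *\<^sub>R f y)" for \<xi>
    by (rule integrable_mult_indicator[OF _ f]) (use o in simp)
  have "AE y in lebesgue. f y = (\<Sum>\<xi>\<in>lattice_box m. indicat_real (?C \<xi>) y *\<^sub>R f y)"
    using AE_no_integer_coordinate
  proof eventually_elim
    case (elim y)
    show ?case
    proof (cases "f y = 0")
      case False
      then have y: "\<bar>y $ i\<bar> < real m" for i using supp[of y] by (meson not_less)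
      define \<xi> where "\<xi> = int_part y"
      have \<xi>: "\<xi> \<in> lattice_box m"
        unfolding lattice_box_def
      proof (intro CollectI conjI allI)
        show "\<xi> \<in> int_lattice" by (simp add: \<xi>_def int_part_lattice)
        show "\<bar>\<xi> $ i\<bar> \<le> real m" for i
        proof -
          have "- int m \<le> \<lfloor>y $ i\<rfloor>" "\<lfloor>y $ i\<rfloor> \<le> int m" using y[of i] by (auto simp: le_floor_iff floor_le_iff abs_less_iff)
          then have "\<bar>of_int \<lfloor>y $ i\<rfloor> :: real\<bar> \<le> real m" by linarith
          then show ?thesis by (simp add: \<xi>_def int_part_def)
        qed
      qed
      have "y - \<xi> \<in> unit_cell"
        unfolding unit_cell_def
      proof (intro CollectI allI conjI)
        fix i
        have "(y - \<xi>) $ i \<noteq> 0"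
        proof
          assume "(y - \<xi>) $ i = 0"
          then have "y $ i = of_int \<lfloor>y $ i\<rfloor>" by (simp add: \<xi>_def int_part_def)
          then show False using elim by (metis Ints_of_int)
        qed
        then show "0 < (y - \<xi>) $ i" using int_part_bounds(1)[of y i] by (simp add: \<xi>_def)
        show "(y - \<xi>) $ i < 1" using int_part_bounds(2)[of y i] by (simp add: \<xi>_def)
      qed
      then have in\<xi>: "y \<in> ?C \<xi>" by (intro image_eqI[of _ _ "y - \<xi>"]) auto
      have out: "y \<notin> ?C \<eta>" if "\<eta> \<in> lattice_box m" "\<eta> \<noteq> \<xi>" for \<eta>
      proof
        assume "y \<in> ?C \<eta>"
        then have "y - \<eta> \<in> unit_cell" by auto
        then have "int_part y = \<eta>" using that by (intro int_part_unique) (auto simp: unit_cell_def lattice_box_def less_imp_le)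
        then show False using that by (simp add: \<xi>_def)
      qed
      have "(\<Sum>\<eta>\<in>lattice_box m. indicat_real (?C \<eta>) y *\<^sub>R f y) = (\<Sum>\<eta>\<in>{\<xi>}. indicat_real (?C \<eta>) y *\<^sub>R f y)"
        by (rule sum.mono_neutral_right[OF finite_lattice_box]) (use \<xi> out in \<open>auto simp: indicator_def\<close>)
      then show ?thesis using in\<xi> by simp
    qed simp
  qed
  then have "(LINT y|lebesgue. f y) = (LINT y|lebesgue. (\<Sum>\<xi>\<in>lattice_box m. indicat_real (?C \<xi>) y *\<^sub>R f y))"
    using f ic by (intro integral_cong_AE) auto
  also have "\<dots> = (\<Sum>\<xi>\<in>lattice_box m. LINT y|lebesgue. indicat_real (?C \<xi>) y *\<^sub>R f y)"
    by (rule Bochner_Integration.integral_sum[OF ic])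
  also have "\<dots> = (\<Sum>\<xi>\<in>lattice_box m. LINT y|lebesgue_on unit_cell. f (y + \<xi>))"
    using o by (simp add: integral_shift_unit_cell(1)[OF fm] integral_restrict_space)
  finally show ?thesis .
qed

lemma uniformly_continuous_compact_support:
  fixes f :: "'a::euclidean_space \<Rightarrow> 'b::real_normed_vector"
  assumes f: "continuous_on UNIV f" and K: "compact K" "\<And>x. x \<notin> K \<Longrightarrow> f x = 0" and e: "0 < e"
  obtains d where "0 < d" "\<And>x y. dist x y \<le> d \<Longrightarrow> norm (f x - f y) \<le> e"
proof -
  obtain R where R: "\<And>x. x \<in> K \<Longrightarrow> norm x \<le> R" using compact_imp_bounded[OF K(1)] by (auto simp: bounded_iff)
  have "uniformly_continuous_on (cball 0 (R + 1)) f"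
    by (rule compact_uniformly_continuous[OF continuous_on_subset[OF f]]) auto
  then obtain d where d: "0 < d" "\<And>x y. x \<in> cball 0 (R + 1) \<Longrightarrow> y \<in> cball 0 (R + 1) \<Longrightarrow> dist y x < d \<Longrightarrow> dist (f y) (f x) < e"
    using e by (rule uniformly_continuous_onE) blast
  \<comment> \<open>The bound 1 keeps the partner of a point of \<open>K\<close> within radius R +
    1, and d/2 turns the weak inequality into the strict one required by uniform continuity.\<close>
  have "norm (f x - f y) \<le> e" if xy: "dist x y \<le> min (d / 2) 1" for x y
  proof (cases "x \<in> K \<or> y \<in> K")
    case True
    have "norm x \<le> norm y + dist x y" "norm y \<le> norm x + dist x y"
      using norm_triangle_sub[of x y] norm_triangle_sub[of y x] by (auto simp: dist_norm norm_minus_commute)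
    then have "norm x \<le> R + 1" "norm y \<le> R + 1" using True R[of x] R[of y] xy by auto
    then have "x \<in> cball 0 (R + 1)" "y \<in> cball 0 (R + 1)" by auto
    then show ?thesis using d(2)[of y x] xy d(1) by (auto simp: dist_norm)
  qed (use K(2) e in simp)
  then show ?thesis using that[of "min (d / 2) 1"] d(1) by auto
qed

text \<open>
  Functions with a common modulus of continuity on the finitely many points of a net are determined up
  to a small error by rounding their values on the net, which leaves countably many patterns.
\<close>

lemma countable_sup_dense_subset:
  fixes \<F> :: "('a::euclidean_space \<Rightarrow> 'b::euclidean_space) set"
  assumes cont: "\<And>f. f \<in> \<F> \<Longrightarrow> continuous_on UNIV f" and K: "compact K" "\<And>f x. f \<in> \<F> \<Longrightarrow> x \<notin> K \<Longrightarrow> f x = 0"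
  obtains \<C> where "countable \<C>" "\<C> \<subseteq> \<F>" "\<And>f e. f \<in> \<F> \<Longrightarrow> 0 < e \<Longrightarrow> \<exists>f'\<in>\<C>. \<forall>x. norm (f x - f' x) \<le> e"
proof -
  obtain D :: "'b set" where "countable D \<and> (\<forall>X. open X \<longrightarrow> X \<noteq> {} \<longrightarrow> (\<exists>d\<in>D. d \<in> X))"
    using countable_dense_exists by (rule exE)
  then have D: "countable D" "\<And>X. open X \<Longrightarrow> X \<noteq> {} \<Longrightarrow> \<exists>d\<in>D. d \<in> X" by simp_all
  have "\<exists>cs. K \<subseteq> (\<Union>c\<in>set cs. ball c (1 / real (Suc n)))" for n
  proof -
    obtain k where "k \<subseteq> K" "finite k" "K \<subseteq> (\<Union>x\<in>k. ball x (1 / real (Suc n)))"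
    proof (rule compactE_image[OF K(1), of K "\<lambda>x. ball x (1 / real (Suc n))"])
      show "K \<subseteq> (\<Union>x\<in>K. ball x (1 / real (Suc n)))" by (auto simp del: of_nat_Suc)
    qed auto
    then show ?thesis using finite_list by blast
  qed
  then obtain cs where cs: "\<And>n. K \<subseteq> (\<Union>c\<in>set (cs n). ball c (1 / real (Suc n)))" by metis
  \<comment> \<open>A pattern consists of an accuracy j, a net n and a list l of rounded values; the
    last conjunct bounds the oscillation of f at the scale of the net by that accuracy. One function
    is chosen per realised pattern.\<close>
  define R where "R = (\<lambda>(j, n, l) f. f \<in> \<F> \<and> length l = length (cs n) \<and>
      (\<forall>i<length l. norm (f (cs n ! i) - l ! i) \<le> 1 / real (Suc j)) \<and>
      (\<forall>x y. dist x y \<le> 1 / real (Suc n) \<longrightarrow> norm (f x - f y) \<le> 1 / real (Suc j)))"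
  define P where "P = (UNIV :: nat set) \<times> (UNIV :: nat set) \<times> lists D"
  define \<C> where "\<C> = (\<lambda>q. SOME f. R q f) ` {q \<in> P. \<exists>f. R q f}"
  have "countable P" unfolding P_def using D(1) by (intro countable_SIGMA countable_lists) auto
  then have c: "countable \<C>" unfolding \<C>_def by (intro countable_image countable_Collect)
  have R\<F>: "f \<in> \<F>" if "R q f" for q f using that by (auto simp: R_def split: prod.splits)
  have sub: "\<C> \<subseteq> \<F>" 
  proof
    fix g assume "g \<in> \<C>"
    then obtain q where q: "g = (SOME f. R q f)" "\<exists>f. R q f" unfolding \<C>_def by blast
    have "R q g" unfolding q(1) by (rule someI_ex[OF q(2)])
    then show "g \<in> \<F>" by (rule R\<F>)
  qed
  have dense: "\<exists>f'\<in>\<C>. \<forall>x. norm (f x - f' x) \<le> e" if f: "f \<in> \<F>" and e: "0 < e" for f e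
  proof -
    \<comment> \<open>Two functions with the same pattern differ by at most four such errors: two
      oscillations and two roundings.\<close>
    obtain j where j: "1 / real (Suc j) < e / 4" using nat_approx_posE[of "e / 4"] e by auto
    obtain d where d: "0 < d" "\<And>x y. dist x y \<le> d \<Longrightarrow> norm (f x - f y) \<le> 1 / real (Suc j)"
    proof (rule uniformly_continuous_compact_support[OF cont[OF f] K(1) K(2)[OF f]])
      show "0 < 1 / real (Suc j)" by simp
    qed (simp, rule that)
    obtain n where n: "1 / real (Suc n) < d" using nat_approx_posE[OF d(1)] by auto
    have exb: "\<exists>b. b \<in> D \<and> norm (f x - b) \<le> 1 / real (Suc j)" for x
    proof -
      have "f x \<in> ball (f x) (1 / real (Suc j))" by (simp del: of_nat_Suc)
      then obtain b where "b \<in> D" "b \<in> ball (f x) (1 / real (Suc j))" using D(2)[OF open_ball] by blast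
      then show ?thesis by (auto simp: dist_norm intro: less_imp_le)
    qed
    define b where "b = (\<lambda>x. SOME b. b \<in> D \<and> norm (f x - b) \<le> 1 / real (Suc j))"
    have b: "b x \<in> D" "norm (f x - b x) \<le> 1 / real (Suc j)" for x
      using someI_ex[OF exb[of x]] unfolding b_def by blast+
    define q where "q = (j, n, map b (cs n))"
    have Rq: "R q f" using f b d n by (auto simp: R_def q_def)
    have "q \<in> P" using b by (auto simp: P_def q_def)
    define f' where "f' = (SOME f. R q f)"
    have Rf': "R q f'" unfolding f'_def by (rule someI[of "R q", OF Rq])
    have "f' \<in> \<C>" unfolding \<C>_def
    proof (rule image_eqI)
      show "f' = (SOME f. R q f)" by (rule f'_def)
      show "q \<in> {q \<in> P. \<exists>f. R q f}" using \<open>q \<in> P\<close> Rq by blast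
    qed
    moreover have "norm (f x - f' x) \<le> e" for x
    proof (cases "x \<in> K")
      case True
      then obtain c where "c \<in> set (cs n)" "x \<in> ball c (1 / real (Suc n))" using cs[of n] by blast
      then obtain i where i: "i < length (cs n)" "dist (cs n ! i) x < 1 / real (Suc n)"
        unfolding in_set_conv_nth mem_ball by blast
      let ?c = "cs n ! i"
      have c: "dist x ?c \<le> 1 / real (Suc n)" using i(2) by (simp add: dist_commute)
      have g: "norm (h x - h ?c) \<le> 1 / real (Suc j) \<and> norm (h ?c - b ?c) \<le> 1 / real (Suc j)" if "R q h" for h
        using that i(1) c by (auto simp: R_def q_def)
      have "norm (f x - f' x) = norm ((f x - f ?c) + (f ?c - b ?c) - (f' ?c - b ?c) - (f' x - f' ?c))" by simp
      also have "\<dots> \<le> norm (f x - f ?c) + norm (f ?c - b ?c) + norm (f' ?c - b ?c) + norm (f' x - f' ?c)"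
        using norm_triangle_ineq4[of "(f x - f ?c) + (f ?c - b ?c) - (f' ?c - b ?c)" "f' x - f' ?c"]
          norm_triangle_ineq4[of "(f x - f ?c) + (f ?c - b ?c)" "f' ?c - b ?c"]
          norm_triangle_ineq[of "f x - f ?c" "f ?c - b ?c"] by linarith
      also have "\<dots> \<le> e" using g[OF Rq] g[OF Rf'] j by linarith
      finally show ?thesis .
    qed (use K(2)[OF f] K(2)[OF R\<F>[OF Rf']] e in simp)
    ultimately show ?thesis by blast
  qed
  show ?thesis by (rule that[OF c sub dense])
qed

section \<open>Unfolding over a finite family of cubes\<close>

lemma integrable_product_scaleR:
  fixes b :: "'b \<Rightarrow> 'c::euclidean_space" and a :: "'a \<Rightarrow> real"
  assumes M: "sigma_finite_measure M1" "sigma_finite_measure M2" and a: "integrable M1 a" and b: "integrable M2 b"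
  shows "integrable (M1 \<Otimes>\<^sub>M M2) (\<lambda>(x, y). a x *\<^sub>R b y)"
    "integral\<^sup>L (M1 \<Otimes>\<^sub>M M2) (\<lambda>(x, y). a x *\<^sub>R b y) = (LINT x|M1. a x) *\<^sub>R (LINT y|M2. b y)"
proof -
  interpret pair_sigma_finite M1 M2 by (intro pair_sigma_finite.intro M)
  have am: "a \<in> borel_measurable M1" and bm: "b \<in> borel_measurable M2" using a b by auto
  show i: "integrable (M1 \<Otimes>\<^sub>M M2) (\<lambda>(x, y). a x *\<^sub>R b y)"
  proof (rule Fubini_integrable)
    show "(\<lambda>(x, y). a x *\<^sub>R b y) \<in> borel_measurable (M1 \<Otimes>\<^sub>M M2)"
      unfolding split_beta'
      by (intro borel_measurable_scaleR measurable_compose[OF measurable_fst am] measurable_compose[OF measurable_snd bm])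
    show "integrable M1 (\<lambda>x. LINT y|M2. norm (case (x, y) of (x, y) \<Rightarrow> a x *\<^sub>R b y))" using a by simp
    show "AE x in M1. integrable M2 (\<lambda>y. case (x, y) of (x, y) \<Rightarrow> a x *\<^sub>R b y)" using b by simp
  qed
  show "integral\<^sup>L (M1 \<Otimes>\<^sub>M M2) (\<lambda>(x, y). a x *\<^sub>R b y) = (LINT x|M1. a x) *\<^sub>R (LINT y|M2. b y)"
    using integral_fst'[OF i] a by simp
qed

lemma invertible_scaleR:
  fixes A :: "real^'d^'d"
  assumes "invertible A" "c \<noteq> 0"
  shows "invertible (c *\<^sub>R A)"
proof -
  obtain B where B: "A ** B = mat 1" "B ** A = mat 1" using assms(1) by (auto simp: invertible_def)
  have "(c *\<^sub>R A) ** ((1 / c) *\<^sub>R B) = A ** B" "((1 / c) *\<^sub>R B) ** (c *\<^sub>R A) = B ** A"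
    using assms(2) by (simp_all add: matrix_matrix_mult_def)
  then have "(c *\<^sub>R A) ** ((1 / c) *\<^sub>R B) = mat 1" "((1 / c) *\<^sub>R B) ** (c *\<^sub>R A) = mat 1"
    by (simp_all only: B)
  then show ?thesis by (auto simp: invertible_def)
qed

text \<open>The Jacobian is expressed as the volume \<kappa> of the image of the unit cell, which is
  the reciprocal of the abstract density because the cell itself has measure 1.\<close>

lemma affine_cell_change_of_variables:
  fixes M :: "real^'d^'d" and c :: "real^'d"
  assumes M: "invertible M"
  defines "T \<equiv> \<lambda>y. M *v y + c"
  defines "\<kappa> \<equiv> measure lebesgue (T ` unit_cell)"
  shows "0 < \<kappa>"
    and "\<And>S f :: real^'d \<Rightarrow> 'b::euclidean_space. S \<in> sets lebesgue \<Longrightarrow> T ` S \<in> sets lebesgue \<Longrightarrow>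
      f \<in> borel_measurable (lebesgue_on (T ` S)) \<Longrightarrow> (\<lambda>y. f (T y)) \<in> borel_measurable (lebesgue_on S) \<and>
      (integrable (lebesgue_on S) (\<lambda>y. f (T y)) \<longleftrightarrow> integrable (lebesgue_on (T ` S)) f) \<and>
      \<kappa> *\<^sub>R (LINT y|lebesgue_on S. f (T y)) = (LINT x|lebesgue_on (T ` S). f x)"
    and "\<And>S. S \<in> lmeasurable \<Longrightarrow> T ` S \<in> sets lebesgue \<Longrightarrow> T ` S \<in> lmeasurable \<and> measure lebesgue (T ` S) = \<kappa> * measure lebesgue S"
proof -
  note m = matrix_affine[OF M]
  obtain k where k: "0 < k" "T \<in> lebesgue \<rightarrow>\<^sub>M lebesgue" "distr lebesgue lebesgue T = density lebesgue (\<lambda>_. ennreal k)"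
    unfolding T_def by (rule affine_lebesgue[OF m(1,2)])
  have inj: "inj T" using m(2) by (auto simp: T_def inj_def dest: bij_is_inj)
  have meas: "T ` S \<in> lmeasurable \<and> measure lebesgue S = k * measure lebesgue (T ` S)" if S: "S \<in> lmeasurable" "T ` S \<in> sets lebesgue" for S
  proof -
    have "emeasure lebesgue S = emeasure (distr lebesgue lebesgue T) (T ` S)"
      using k(2) S by (subst emeasure_distr) (auto simp: inj_vimage_image_eq[OF inj])
    also have "\<dots> = ennreal k * emeasure lebesgue (T ` S)"
      unfolding k(3) using S by (subst emeasure_density) (auto simp: nn_integral_cmult_indicator)
    finally have e: "emeasure lebesgue S = ennreal k * emeasure lebesgue (T ` S)" .
    have "emeasure lebesgue (T ` S) < \<infinity>"
    proof (rule ccontr)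
      assume "\<not> emeasure lebesgue (T ` S) < \<infinity>"
      then have "emeasure lebesgue (T ` S) = \<infinity>" by (simp add: not_less top_unique)
      then have "emeasure lebesgue S = \<infinity>" using e k(1) by (simp add: ennreal_mult_top)
      then show False using S(1) by (auto simp: fmeasurable_def)
    qed
    then have f: "T ` S \<in> lmeasurable" using S(2) by (auto simp: fmeasurable_def)
    with e S k(1) have "measure lebesgue S = k * measure lebesgue (T ` S)"
      by (simp add: measure_def enn2real_mult less_imp_le)
    with f show ?thesis by simp
  qed
  have cell: "T ` unit_cell \<in> sets lebesgue" unfolding T_def using open_affine_image[OF M open_unit_cell] by simp
  have "measure lebesgue (unit_cell :: (real^'d) set) = 1" using measure_unit_cell by (simp add: measure_def)
  with meas[OF unit_cell_lmeasurable cell] have kk: "k * \<kappa> = 1" by (simp add: \<kappa>_def)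
  then show "0 < \<kappa>" using k(1) by (metis zero_less_mult_pos zero_less_one)
  show "(\<lambda>y. f (T y)) \<in> borel_measurable (lebesgue_on S) \<and>
      (integrable (lebesgue_on S) (\<lambda>y. f (T y)) \<longleftrightarrow> integrable (lebesgue_on (T ` S)) f) \<and>
      \<kappa> *\<^sub>R (LINT y|lebesgue_on S. f (T y)) = (LINT x|lebesgue_on (T ` S). f x)"
    if "S \<in> sets lebesgue" "T ` S \<in> sets lebesgue" "f \<in> borel_measurable (lebesgue_on (T ` S))" for S and f :: "real^'d \<Rightarrow> 'b"
    using affine_change_of_variables[OF k(2,1,3) inj that] kk by (simp add: mult.commute)
  show "T ` S \<in> lmeasurable \<and> measure lebesgue (T ` S) = \<kappa> * measure lebesgue S" if "S \<in> lmeasurable" "T ` S \<in> sets lebesgue" for S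
    using meas[OF that] kk by (simp add: mult.assoc[symmetric] mult.commute[of \<kappa>])
qed

definition half_open_cell :: "(real^'d) set" where
  "half_open_cell = {y. \<forall>i. 0 \<le> y $ i \<and> y $ i < 1}"

lemma closure_unit_cell: "closure unit_cell = cbox 0 (1 :: real^'d)"
proof -
  have "(\<chi> i. 1 / 2) \<in> box 0 (1 :: real^'d)" by (simp add: mem_box_cart)
  then show ?thesis unfolding unit_cell_eq_box by (intro closure_box) auto
qed

text \<open>One fixed scale: \<open>A n\<close> stands for the matrix at the chosen point of the
  n-th cube. Cubes enter here only as disjoint sets that equal the interior of their
  closure.\<close>

locale unfolding_cells =
  fixes \<Omega> :: "(real^'d) set" and A :: "nat \<Rightarrow> real^'d^'d" and Q :: "nat \<Rightarrow> (real^'d) set" and N :: nat and \<epsilon> :: real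
  assumes Om: "open \<Omega>" "bounded \<Omega>" and eps: "0 < \<epsilon>"
    and A: "\<And>n. n \<in> {1..N} \<Longrightarrow> invertible (A n)"
    and Q: "\<And>n. n \<in> {1..N} \<Longrightarrow> interior (closure (Q n)) = Q n"
    and disj: "disjoint_family_on Q {1..N}"
begin

definition I :: "(nat \<times> (real^'d)) set" where
  "I = (SIGMA n:{1..N}. Xi_hat \<epsilon> (A n) (Q n) \<Omega>)"

definition T :: "nat \<times> (real^'d) \<Rightarrow> real^'d \<Rightarrow> real^'d" where
  "T j y = \<epsilon> *\<^sub>R (A (fst j) *v (y + snd j))"

text \<open>For \<open>j\<close> in \<open>I\<close>, the points x at which unfolding evaluates in
  cell \<open>j\<close>. The half-open cell matches the floor convention of \<open>int_part\<close>;
  inside \<Omega> the set differs from the open cell by a null set.\<close>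

definition X :: "nat \<times> (real^'d) \<Rightarrow> (real^'d) set" where
  "X j = Omega_hat \<epsilon> (A (fst j)) (Q (fst j)) \<Omega> \<inter> T j ` half_open_cell"

definition cell :: "nat \<times> (real^'d) \<Rightarrow> (real^'d) set" where
  "cell j = T j ` unit_cell"

definition \<kappa> :: "nat \<times> (real^'d) \<Rightarrow> real" where
  "\<kappa> j = measure lebesgue (cell j)"

definition M :: "nat \<times> (real^'d) \<Rightarrow> real^'d^'d" where
  "M j = \<epsilon> *\<^sub>R A (fst j)"

definition piecewise :: "(nat \<times> (real^'d) \<Rightarrow> real^'d \<Rightarrow> 'b::real_vector) \<Rightarrow> (real^'d) \<times> (real^'d) \<Rightarrow> 'b" where
  "piecewise v = (\<lambda>(x, y). \<Sum>j\<in>I. indicat_real (X j) x *\<^sub>R v j y)"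

lemma I_D: "j \<in> I \<Longrightarrow> fst j \<in> {1..N}" "j \<in> I \<Longrightarrow> snd j \<in> Xi_hat \<epsilon> (A (fst j)) (Q (fst j)) \<Omega>"
  by (auto simp: I_def)

lemma T_affine: "T j = (\<lambda>y. M j *v y + M j *v snd j)"
  by (auto simp: T_def M_def matrix_vector_right_distrib scaleR_matrix_vector_assoc[symmetric] scaleR_add_right)

lemma M_inv: "fst j \<in> {1..N} \<Longrightarrow> invertible (M j)"
  unfolding M_def using A eps by (intro invertible_scaleR) auto

lemma scaled_cell_T: "scaled_cell \<epsilon> (A n) S \<xi> = T (n, \<xi>) ` S"
  by (simp add: scaled_cell_def T_def)

lemma T_inverse:
  assumes "n \<in> {1..N}"
  shows "T (n, \<xi>) y = x \<longleftrightarrow> y + \<xi> = (1 / \<epsilon>) *\<^sub>R (matrix_inv (A n) *v x)"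
  using matrix_affine(3,4)[OF A[OF assms]] eps
  by (auto simp: T_def matrix_vector_mult_scaleR)

lemma T_mem:
  assumes "n \<in> {1..N}"
  shows "x \<in> T (n, \<xi>) ` S \<longleftrightarrow> (1 / \<epsilon>) *\<^sub>R (matrix_inv (A n) *v x) - \<xi> \<in> S"
  unfolding image_iff using T_inverse[OF assms] by (metis add_diff_cancel_right' diff_add_cancel)

lemma open_cell: "fst j \<in> {1..N} \<Longrightarrow> open (cell j)"
  unfolding cell_def T_affine by (rule open_affine_image[OF M_inv open_unit_cell])

lemma cell_subset: "j \<in> I \<Longrightarrow> cell j \<subseteq> Q (fst j) \<inter> \<Omega>"
  using I_D(2)[of j] by (simp add: Xi_hat_def cell_def scaled_cell_T)

lemma Xi_hat_lattice: "\<xi> \<in> Xi_hat \<epsilon> (A n) (Q n) \<Omega> \<Longrightarrow> \<xi> \<in> int_lattice"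
  by (simp add: Xi_hat_def Xi_def)

text \<open>An admissible index is recovered from the centre of its cell, which lies in the bounded
  set \<Omega>; the indices are thus bounded lattice points.\<close>

lemma finite_Xi_hat:
  assumes n: "n \<in> {1..N}"
  shows "finite (Xi_hat \<epsilon> (A n) (Q n) \<Omega>)"
proof (rule finite_bounded_lattice)
  let ?h = "(\<chi> i. 1 / 2) :: real^'d"
  have "bounded ((\<lambda>x. (1 / \<epsilon>) *\<^sub>R (matrix_inv (A n) *v x)) ` \<Omega>)"
    by (intro bounded_linear_image[OF Om(2)] bounded_linear_scaleR_const bounded_linear_const_scaleR matrix_vector_mul_bounded_linear)
  then have b: "bounded ((\<lambda>z. z - ?h) ` (\<lambda>x. (1 / \<epsilon>) *\<^sub>R (matrix_inv (A n) *v x)) ` \<Omega>)"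
    by (rule bounded_translation_minus)
  have "Xi_hat \<epsilon> (A n) (Q n) \<Omega> \<subseteq> (\<lambda>z. z - ?h) ` (\<lambda>x. (1 / \<epsilon>) *\<^sub>R (matrix_inv (A n) *v x)) ` \<Omega>"
  proof
    fix \<xi> assume xi: "\<xi> \<in> Xi_hat \<epsilon> (A n) (Q n) \<Omega>"
    have "?h \<in> unit_cell" by (simp add: unit_cell_def)
    then have "T (n, \<xi>) ?h \<in> \<Omega>" using xi by (auto simp: Xi_hat_def scaled_cell_T)
    moreover have "\<xi> = (1 / \<epsilon>) *\<^sub>R (matrix_inv (A n) *v T (n, \<xi>) ?h) - ?h"
      using T_inverse[OF n, of \<xi> ?h "T (n, \<xi>) ?h"] by (simp add: algebra_simps)
    ultimately show "\<xi> \<in> (\<lambda>z. z - ?h) ` (\<lambda>x. (1 / \<epsilon>) *\<^sub>R (matrix_inv (A n) *v x)) ` \<Omega>" by blast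
  qed
  then show "bounded (Xi_hat \<epsilon> (A n) (Q n) \<Omega>)" by (rule bounded_subset[OF b])
qed (auto intro: Xi_hat_lattice)

lemma finite_I: "finite I"
  unfolding I_def by (intro finite_SigmaI finite_Xi_hat) auto

text \<open>Integers at distance less than 1 coincide. One point is strictly inside its cell while
  the other may lie on a face, which is the situation of an open cell meeting a closed one.\<close>

lemma lattice_diff_zero:
  assumes "\<xi> \<in> int_lattice" "\<eta> \<in> int_lattice" "y + \<xi> = z + \<eta>"
    and "\<And>i. 0 < y $ i \<and> y $ i < 1" "\<And>i. 0 \<le> z $ i \<and> z $ i \<le> 1"
  shows "\<xi> = \<eta>"
proof -
  have "\<xi> $ i = \<eta> $ i" for i
  proof -
    obtain a :: int where a: "\<xi> $ i = of_int a" using assms(1) by (auto simp: int_lattice_def Ints_def)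
    obtain b :: int where b: "\<eta> $ i = of_int b" using assms(2) by (auto simp: int_lattice_def Ints_def)
    note ab = a b
    have "y $ i + \<xi> $ i = z $ i + \<eta> $ i" using assms(3) by (metis vector_add_component)
    then have "\<bar>of_int a - of_int b :: real\<bar> < 1" using assms(4)[of i] assms(5)[of i] ab by (auto simp: abs_less_iff)
    then have "a = b" by linarith
    then show ?thesis using ab by simp
  qed
  then show ?thesis by (simp add: vec_eq_iff)
qed

text \<open>The closed cells are known to lie only in the closure of the cube; taking interiors
  returns to the cube because it is regular open.\<close>

lemma Omega_hat_subset: "n \<in> {1..N} \<Longrightarrow> Omega_hat \<epsilon> (A n) (Q n) \<Omega> \<subseteq> Q n"
proof -
  assume n: "n \<in> {1..N}"
  have cont: "continuous_on (closure unit_cell) (T (n, \<xi>))" for \<xi>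
    unfolding T_affine by (intro continuous_intros bounded_linear.continuous_on[OF matrix_vector_mul_bounded_linear])
  have "T (n, \<xi>) ` closure unit_cell \<subseteq> closure (Q n)" if "\<xi> \<in> Xi_hat \<epsilon> (A n) (Q n) \<Omega>" for \<xi>
  proof -
    have "T (n, \<xi>) ` unit_cell \<subseteq> Q n" using that by (simp add: Xi_hat_def scaled_cell_T)
    then show ?thesis by (intro image_closure_subset[OF cont]) (auto intro: closure_subset[THEN subsetD])
  qed
  then have "(\<Union>\<xi>\<in>Xi_hat \<epsilon> (A n) (Q n) \<Omega>. scaled_cell \<epsilon> (A n) (closure unit_cell) \<xi>) \<subseteq> closure (Q n)"
    by (auto simp: scaled_cell_T)
  then show ?thesis unfolding Omega_hat_def using interior_mono Q[OF n] by metis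
qed

text \<open>A point of the open set \<open>Omega_hat\<close> may lie on a face, so the cell at its
  integer part is not obviously the one that put it there. Openness gives a nearby point inside that
  cell which belongs to some admissible closed cell, and the two cells must coincide.\<close>

lemma int_part_in_Xi_hat:
  assumes n: "n \<in> {1..N}" and x: "x \<in> Omega_hat \<epsilon> (A n) (Q n) \<Omega>"
  shows "int_part ((1 / \<epsilon>) *\<^sub>R (matrix_inv (A n) *v x)) \<in> Xi_hat \<epsilon> (A n) (Q n) \<Omega>"
proof -
  define z where "z = (1 / \<epsilon>) *\<^sub>R (matrix_inv (A n) *v x)"
  define \<xi> where "\<xi> = int_part z"
  have "z - \<xi> \<in> closure unit_cell"
    unfolding closure_unit_cell \<xi>_def using int_part_bounds[of z] by (simp add: mem_box_cart less_imp_le)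
  then have "x \<in> T (n, \<xi>) ` closure unit_cell" unfolding T_mem[OF n] z_def .
  moreover have "T (n, \<xi>) ` closure unit_cell \<subseteq> closure (cell (n, \<xi>))"
    unfolding cell_def by (rule image_closure_subset)
      (auto simp: T_affine intro!: continuous_intros bounded_linear.continuous_on[OF matrix_vector_mul_bounded_linear] intro: closure_subset[THEN subsetD])
  ultimately have "x \<in> closure (cell (n, \<xi>))" by blast
  moreover have "open (Omega_hat \<epsilon> (A n) (Q n) \<Omega>)" by (simp add: Omega_hat_def)
  ultimately have "Omega_hat \<epsilon> (A n) (Q n) \<Omega> \<inter> cell (n, \<xi>) \<noteq> {}"
    using x open_Int_closure_eq_empty by blast
  then obtain x' where x': "x' \<in> Omega_hat \<epsilon> (A n) (Q n) \<Omega>" "x' \<in> cell (n, \<xi>)" by blast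
  obtain \<eta> where eta: "\<eta> \<in> Xi_hat \<epsilon> (A n) (Q n) \<Omega>" "x' \<in> T (n, \<eta>) ` closure unit_cell"
    using x'(1) interior_subset unfolding Omega_hat_def scaled_cell_T by blast
  obtain y where y: "y \<in> unit_cell" "x' = T (n, \<xi>) y" using x'(2) by (auto simp: cell_def)
  obtain y' where y': "y' \<in> cbox 0 1" "x' = T (n, \<eta>) y'" using eta(2) unfolding closure_unit_cell by auto
  have "y + \<xi> = y' + \<eta>" using y(2) y'(2) T_inverse[OF n] by metis
  have "\<xi> = \<eta>"
  proof (rule lattice_diff_zero[OF _ _ \<open>y + \<xi> = y' + \<eta>\<close>])
    show "\<xi> \<in> int_lattice" by (simp add: \<xi>_def int_part_lattice)
    show "\<eta> \<in> int_lattice" by (rule Xi_hat_lattice[OF eta(1)])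
    show "0 < y $ i \<and> y $ i < 1" for i using y(1) by (simp add: unit_cell_def)
    show "0 \<le> y' $ i \<and> y' $ i \<le> 1" for i using y'(1) by (simp add: mem_box_cart)
  qed
  with eta show ?thesis by (simp add: \<xi>_def z_def)
qed

text \<open>For x in \<open>Omega_hat\<close> the integer part selects one admissible index, so the
  operator becomes a finite sum of products of an indicator in x with a function of y.\<close>

lemma unfolding_piecewise:
  "(\<Sum>n\<in>{1..N}. indicat_real (Omega_hat \<epsilon> (A n) (Q n) \<Omega>) x *\<^sub>R
      \<psi> (\<epsilon> *\<^sub>R (A n *v int_part ((1 / \<epsilon>) *\<^sub>R (matrix_inv (A n) *v x))) + \<epsilon> *\<^sub>R (A n *v y)))
   = piecewise (\<lambda>j y. \<psi> (T j y)) (x, y)"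
proof -
  have *: "indicat_real (Omega_hat \<epsilon> (A n) (Q n) \<Omega>) x *\<^sub>R
      \<psi> (\<epsilon> *\<^sub>R (A n *v int_part ((1 / \<epsilon>) *\<^sub>R (matrix_inv (A n) *v x))) + \<epsilon> *\<^sub>R (A n *v y))
      = (\<Sum>\<xi>\<in>Xi_hat \<epsilon> (A n) (Q n) \<Omega>. indicat_real (X (n, \<xi>)) x *\<^sub>R \<psi> (T (n, \<xi>) y))" if n: "n \<in> {1..N}" for n
  proof (cases "x \<in> Omega_hat \<epsilon> (A n) (Q n) \<Omega>")
    case True
    define z where "z = (1 / \<epsilon>) *\<^sub>R (matrix_inv (A n) *v x)"
    have z: "int_part z \<in> Xi_hat \<epsilon> (A n) (Q n) \<Omega>" unfolding z_def by (rule int_part_in_Xi_hat[OF n True])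
    have inX: "x \<in> X (n, \<xi>) \<longleftrightarrow> \<xi> = int_part z" if "\<xi> \<in> Xi_hat \<epsilon> (A n) (Q n) \<Omega>" for \<xi>
    proof -
      have "x \<in> X (n, \<xi>) \<longleftrightarrow> z - \<xi> \<in> half_open_cell" using True by (simp add: X_def T_mem[OF n] z_def)
      also have "\<dots> \<longleftrightarrow> \<xi> = int_part z"
        using int_part_unique[OF Xi_hat_lattice[OF that], of z] int_part_bounds[of z]
        by (auto simp: half_open_cell_def simp del: vector_minus_component)
      finally show ?thesis .
    qed
    have "(\<Sum>\<xi>\<in>Xi_hat \<epsilon> (A n) (Q n) \<Omega>. indicat_real (X (n, \<xi>)) x *\<^sub>R \<psi> (T (n, \<xi>) y))
        = (\<Sum>\<xi>\<in>{int_part z}. indicat_real (X (n, \<xi>)) x *\<^sub>R \<psi> (T (n, \<xi>) y))"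
      by (rule sum.mono_neutral_right[OF finite_Xi_hat[OF n]]) (use z inX in \<open>auto simp: indicator_def\<close>)
    also have "\<dots> = \<psi> (T (n, int_part z) y)" using inX[OF z] by simp
    finally show ?thesis using True
      by (simp add: z_def T_def matrix_vector_right_distrib scaleR_add_right add.commute)
  next
    case False
    then show ?thesis by (simp add: X_def)
  qed
  have "(\<Sum>n\<in>{1..N}. \<Sum>\<xi>\<in>Xi_hat \<epsilon> (A n) (Q n) \<Omega>. indicat_real (X (n, \<xi>)) x *\<^sub>R \<psi> (T (n, \<xi>) y))
      = (\<Sum>(n, \<xi>)\<in>I. indicat_real (X (n, \<xi>)) x *\<^sub>R \<psi> (T (n, \<xi>) y))"
    unfolding I_def by (rule sum.Sigma) (auto intro: finite_Xi_hat)
  also have "\<dots> = piecewise (\<lambda>j y. \<psi> (T j y)) (x, y)"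
    unfolding piecewise_def prod.case by (rule sum.cong) auto
  finally have eq: "(\<Sum>n\<in>{1..N}. \<Sum>\<xi>\<in>Xi_hat \<epsilon> (A n) (Q n) \<Omega>. indicat_real (X (n, \<xi>)) x *\<^sub>R \<psi> (T (n, \<xi>) y))
      = piecewise (\<lambda>j y. \<psi> (T j y)) (x, y)" .
  show ?thesis unfolding eq[symmetric] by (rule sum.cong[OF refl *])
qed

lemma X_unique:
  assumes "j \<in> I" "j' \<in> I" "x \<in> X j" "x \<in> X j'"
  shows "j = j'"
proof -
  obtain n \<xi> n' \<xi>' where j: "j = (n, \<xi>)" "j' = (n', \<xi>')" by (cases j, cases j')
  have n: "n \<in> {1..N}" "n' \<in> {1..N}" using assms j I_D(1) by force+
  have "x \<in> Q n" "x \<in> Q n'" using assms(3,4) j Omega_hat_subset[OF n(1)] Omega_hat_subset[OF n(2)] by (auto simp: X_def)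
  then have nn: "n = n'" using disj n unfolding disjoint_family_on_def by blast
  define z where "z = (1 / \<epsilon>) *\<^sub>R (matrix_inv (A n) *v x)"
  have "x \<in> T (n, \<xi>) ` half_open_cell" "x \<in> T (n, \<xi>') ` half_open_cell"
    using assms(3,4) nn by (auto simp only: X_def j fst_conv snd_conv)
  then have "z - \<xi> \<in> half_open_cell" "z - \<xi>' \<in> half_open_cell" unfolding T_mem[OF n(1)] z_def by blast+
  moreover have "\<xi> \<in> int_lattice" "\<xi>' \<in> int_lattice" using assms(1,2) I_D(2) Xi_hat_lattice unfolding j by force+
  ultimately have "int_part z = \<xi>" "int_part z = \<xi>'"
    by (auto intro!: int_part_unique simp: half_open_cell_def simp del: vector_minus_component)
  then show ?thesis using nn j by simp
qed

text \<open>At each x at most one summand is active, so every map sending 0 to 0 commutes with the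
  sum; this covers powers of norms, where linearity is absent.\<close>

lemma piecewise_apply:
  assumes h: "h 0 = 0"
  shows "h (piecewise v z) = piecewise (\<lambda>j y. h (v j y)) z"
proof -
  obtain x y where z: "z = (x, y)" by (cases z)
  show ?thesis
  proof (cases "\<exists>j\<in>I. x \<in> X j")
    case True
    then obtain j where j: "j \<in> I" "x \<in> X j" by blast
    have one: "(\<Sum>i\<in>I. indicat_real (X i) x *\<^sub>R f i) = f j" for f :: "_ \<Rightarrow> 'z::real_vector"
    proof -
      have "(\<Sum>i\<in>I. indicat_real (X i) x *\<^sub>R f i) = (\<Sum>i\<in>{j}. indicat_real (X i) x *\<^sub>R f i)"
      proof (rule sum.mono_neutral_right[OF finite_I])
        show "\<forall>i\<in>I - {j}. indicat_real (X i) x *\<^sub>R f i = 0"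
        proof
          fix i assume "i \<in> I - {j}"
          then have "x \<notin> X i" using X_unique[OF j(1) _ j(2), of i] by blast
          then show "indicat_real (X i) x *\<^sub>R f i = 0" by simp
        qed
      qed (use j in simp)
      then show ?thesis using j by simp
    qed
    show ?thesis by (simp only: z piecewise_def prod.case one)
  next
    case False
    then show ?thesis using h unfolding z piecewise_def by (simp add: sum.neutral)
  qed
qed

lemma cell_subset_X:
  assumes j: "j \<in> I"
  shows "cell j \<subseteq> X j"
proof -
  have n: "fst j \<in> {1..N}" by (rule I_D(1)[OF j])
  have "unit_cell \<subseteq> half_open_cell" "unit_cell \<subseteq> closure unit_cell"
    by (auto simp: unit_cell_def half_open_cell_def less_imp_le closure_subset[THEN subsetD])
  then have sub: "cell j \<subseteq> T j ` half_open_cell" "cell j \<subseteq> T j ` closure unit_cell" by (auto simp: cell_def)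
  have "cell j \<subseteq> (\<Union>\<xi>\<in>Xi_hat \<epsilon> (A (fst j)) (Q (fst j)) \<Omega>. scaled_cell \<epsilon> (A (fst j)) (closure unit_cell) \<xi>)"
    by (intro subsetI UN_I[OF I_D(2)[OF j]]) (use sub(2) in \<open>simp add: scaled_cell_T subset_eq\<close>)
  then have "cell j \<subseteq> Omega_hat \<epsilon> (A (fst j)) (Q (fst j)) \<Omega>"
    unfolding Omega_hat_def by (rule interior_maximal[OF _ open_cell[OF n]])
  with sub(1) show ?thesis by (auto simp: X_def)
qed

lemma change_of_variables_cell:
  assumes j: "j \<in> I" and f: "f \<in> borel_measurable (lebesgue_on \<Omega>)"
  shows "(\<lambda>y. f (T j y)) \<in> borel_measurable (lebesgue_on unit_cell)"
    "integrable (lebesgue_on unit_cell) (\<lambda>y. f (T j y)) \<longleftrightarrow> integrable (lebesgue_on (cell j)) (f :: _ \<Rightarrow> 'b::euclidean_space)"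
    "\<kappa> j *\<^sub>R (LINT y|lebesgue_on unit_cell. f (T j y)) = (LINT x|lebesgue_on (cell j). f x)"
proof -
  have n: "fst j \<in> {1..N}" by (rule I_D(1)[OF j])
  have c: "cell j \<in> sets lebesgue" "cell j \<subseteq> \<Omega>" using open_cell[OF n] cell_subset[OF j] by auto
  have "restrict_space (lebesgue_on \<Omega>) (cell j) = lebesgue_on (cell j)"
    using Om c by (subst restrict_restrict_space) (auto simp: Int_absorb1)
  then have fm: "f \<in> borel_measurable (lebesgue_on (cell j))" using measurable_restrict_space1[OF f, of "cell j"] by simp
  have u: "unit_cell \<in> sets lebesgue" using unit_cell_lmeasurable by (rule fmeasurableD)
  note ch = affine_cell_change_of_variables(2)[OF M_inv[OF n], of unit_cell "M j *v snd j" f, folded T_affine, folded cell_def, folded \<kappa>_def, OF u c(1) fm]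
  show "(\<lambda>y. f (T j y)) \<in> borel_measurable (lebesgue_on unit_cell)"
    "integrable (lebesgue_on unit_cell) (\<lambda>y. f (T j y)) \<longleftrightarrow> integrable (lebesgue_on (cell j)) f"
    "\<kappa> j *\<^sub>R (LINT y|lebesgue_on unit_cell. f (T j y)) = (LINT x|lebesgue_on (cell j). f x)"
    using ch by (auto simp: T_affine)
qed

lemma \<kappa>_pos: "j \<in> I \<Longrightarrow> 0 < \<kappa> j"
  using affine_cell_change_of_variables(1)[OF M_inv[OF I_D(1)], of j "M j *v snd j"]
  by (simp add: \<kappa>_def cell_def T_affine)

text \<open>Within \<Omega> the set is squeezed between the open and the closed cell, whose volumes
  agree.\<close>

lemma X_measurable:
  assumes j: "j \<in> I"
  shows "X j \<in> sets lebesgue" "X j \<inter> \<Omega> \<in> lmeasurable" "measure lebesgue (X j \<inter> \<Omega>) = \<kappa> j"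
proof -
  have n: "fst j \<in> {1..N}" by (rule I_D(1)[OF j])
  obtain k :: real and T' where T': "T' \<in> lebesgue \<rightarrow>\<^sub>M lebesgue" "\<And>x. T' x = (1 / \<epsilon>) *\<^sub>R (matrix_inv (A (fst j)) *v x) - snd j"
  proof -
    define B where "B = (1 / \<epsilon>) *\<^sub>R matrix_inv (A (fst j))"
    have "matrix_inv (A (fst j)) ** A (fst j) = mat 1" "A (fst j) ** matrix_inv (A (fst j)) = mat 1"
      using someI_ex[OF A[OF n, unfolded invertible_def]] unfolding matrix_inv_def by auto
    then have "invertible (matrix_inv (A (fst j)))" by (auto simp: invertible_def)
    then have B: "invertible B" unfolding B_def using eps by (intro invertible_scaleR) auto
    obtain k where "(\<lambda>x. B *v x + (- snd j)) \<in> lebesgue \<rightarrow>\<^sub>M lebesgue"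
      using affine_lebesgue[OF matrix_affine(1,2)[OF B], of "- snd j"] by metis
    then show ?thesis by (rule that) (simp add: B_def scaleR_matrix_vector_assoc)
  qed
  have H: "half_open_cell \<in> sets (lebesgue :: (real^'d) measure)"
  proof -
    have "half_open_cell = (\<Inter>i. {y :: real^'d. 0 \<le> y $ i} \<inter> {y. y $ i < 1})" by (auto simp: half_open_cell_def)
    moreover have "{y :: real^'d. 0 \<le> y $ i} \<inter> {y. y $ i < 1} \<in> sets borel" for i by measurable
    ultimately have "half_open_cell \<in> sets (borel :: (real^'d) measure)"
      using sets.finite_INT[of UNIV "\<lambda>i. {y :: real^'d. 0 \<le> y $ i} \<inter> {y. y $ i < 1}" borel] by simp
    then show ?thesis by simp
  qed
  have eq: "T j ` half_open_cell = T' -` half_open_cell" using T_mem[of "fst j" _ "snd j"] n T'(2) by auto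
  have "T j ` half_open_cell \<in> sets lebesgue" unfolding eq using measurable_sets[OF T'(1) H] by simp
  then show Xs: "X j \<in> sets lebesgue" by (auto simp: X_def Omega_hat_def)
  have cb: "T j ` cbox 0 1 = T' -` cbox 0 1" using T_mem[of "fst j" _ "snd j"] n T'(2) by auto
  have cbs: "T j ` cbox 0 1 \<in> sets lebesgue" unfolding cb using measurable_sets[OF T'(1), of "cbox 0 1"] by simp
  note ms = affine_cell_change_of_variables(3)[OF M_inv[OF n], where c = "M j *v snd j", folded T_affine, folded cell_def, folded \<kappa>_def]
  have cbm: "T j ` cbox 0 1 \<in> lmeasurable" "measure lebesgue (T j ` cbox 0 1) = \<kappa> j * measure lebesgue (cbox 0 (1 :: real^'d))"
    using ms[of "cbox 0 1"] cbs by auto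
  have one: "measure lebesgue (cbox 0 (1 :: real^'d)) = 1"
  proof -
    have "measure lebesgue (unit_cell :: (real^'d) set) = 1" using measure_unit_cell by (simp add: measure_def)
    then show ?thesis unfolding unit_cell_eq_box by (simp add: measure_lborel_box_eq measure_lborel_cbox_eq)
  qed
  have sub1: "X j \<inter> \<Omega> \<subseteq> T j ` cbox 0 1" by (auto simp: X_def half_open_cell_def mem_box_cart less_imp_le)
  have sub2: "cell j \<subseteq> X j \<inter> \<Omega>" using cell_subset_X[OF j] cell_subset[OF j] by auto
  show lm: "X j \<inter> \<Omega> \<in> lmeasurable" using Xs Om by (intro fmeasurableI2[OF cbm(1) sub1]) auto
  have "measure lebesgue (X j \<inter> \<Omega>) \<le> \<kappa> j"
    using measure_mono_fmeasurable[OF sub1 fmeasurableD[OF lm] cbm(1)] cbm(2) one by simp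
  moreover have "\<kappa> j \<le> measure lebesgue (X j \<inter> \<Omega>)"
    unfolding \<kappa>_def using open_cell[OF n] by (intro measure_mono_fmeasurable[OF sub2 _ lm]) auto
  ultimately show "measure lebesgue (X j \<inter> \<Omega>) = \<kappa> j" by simp
qed

end

lemma integrable_lebesgue_on_subset:
  fixes f :: "'a::euclidean_space \<Rightarrow> 'b::euclidean_space"
  assumes f: "integrable (lebesgue_on U) f" and U: "U \<in> sets lebesgue" and C: "C \<in> sets lebesgue" "C \<subseteq> U"
  shows "integrable (lebesgue_on C) f" "(LINT x|lebesgue_on C. f x) = (LINT x|lebesgue_on U. indicat_real C x *\<^sub>R f x)"
    "integrable (lebesgue_on U) (\<lambda>x. indicat_real C x *\<^sub>R f x)"
proof -
  have r: "restrict_space (lebesgue_on U) C = lebesgue_on C"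
    using U C by (subst restrict_restrict_space) (auto simp: Int_absorb1)
  have CU: "C \<inter> space (lebesgue_on U) \<in> sets (lebesgue_on U)" using U C by (auto simp: sets_restrict_space_iff Int_absorb2)
  show i: "integrable (lebesgue_on U) (\<lambda>x. indicat_real C x *\<^sub>R f x)"
    by (rule integrable_mult_indicator[OF _ f]) (use CU C in \<open>auto simp: Int_absorb2\<close>)
  show "integrable (lebesgue_on C) f" "(LINT x|lebesgue_on C. f x) = (LINT x|lebesgue_on U. indicat_real C x *\<^sub>R f x)"
    using i integrable_restrict_space[OF CU, of f] integral_restrict_space[OF CU, of f] by (simp_all add: r)
qed

section \<open>Integrals and Sobolev regularity of unfolded functions\<close>

context unfolding_cells
begin

abbreviation P :: "((real^'d) \<times> (real^'d)) measure" where
  "P \<equiv> lebesgue_on \<Omega> \<Otimes>\<^sub>M lebesgue_on unit_cell"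

lemma Om_sets: "\<Omega> \<in> sets lebesgue" and Om_lmeasurable: "\<Omega> \<in> lmeasurable"
  using Om by (auto simp: bounded_set_imp_lmeasurable)

lemma finite_measure_Om: "finite_measure (lebesgue_on \<Omega>)"
  by (rule finite_measure_lebesgue_on[OF Om_lmeasurable])

lemma finite_measure_unit_cell: "finite_measure (lebesgue_on (unit_cell :: (real^'d) set))"
  by (rule finite_measure_lebesgue_on[OF unit_cell_lmeasurable])

lemma X_sets_Om: "j \<in> I \<Longrightarrow> X j \<inter> \<Omega> \<in> sets (lebesgue_on \<Omega>)"
  using X_measurable(1) Om_sets by (auto simp: sets_restrict_space_iff)

lemma indicator_X_measurable: "j \<in> I \<Longrightarrow> indicat_real (X j) \<in> borel_measurable (lebesgue_on \<Omega>)"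
  using X_measurable(1)[of j] by (intro measurable_restrict_space1) simp

text \<open>A finite sum of tensor products, integrated termwise. The bounded weight \<psi> is
  carried along because it later becomes the test function that localises x.\<close>

lemma piecewise_integral:
  fixes v :: "nat \<times> (real^'d) \<Rightarrow> real^'d \<Rightarrow> 'b::euclidean_space"
  assumes v: "\<And>j. j \<in> I \<Longrightarrow> integrable (lebesgue_on unit_cell) (v j)"
    and psi: "\<psi> \<in> borel_measurable (lebesgue_on \<Omega>)" "\<And>x. \<bar>\<psi> x\<bar> \<le> B"
  shows "integrable P (\<lambda>z. \<psi> (fst z) *\<^sub>R piecewise v z)"
    "integral\<^sup>L P (\<lambda>z. \<psi> (fst z) *\<^sub>R piecewise v z)
      = (\<Sum>j\<in>I. (LINT x|lebesgue_on \<Omega>. \<psi> x * indicat_real (X j) x) *\<^sub>R (LINT y|lebesgue_on unit_cell. v j y))"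
proof -
  interpret finite_measure "lebesgue_on \<Omega>" by (rule finite_measure_Om)
  have B: "0 \<le> B" using order_trans[OF abs_ge_zero psi(2)] .
  have a: "integrable (lebesgue_on \<Omega>) (\<lambda>x. \<psi> x * indicat_real (X j) x)" if "j \<in> I" for j
  proof (rule integrable_const_bound)
    show "(\<lambda>x. \<psi> x * indicat_real (X j) x) \<in> borel_measurable (lebesgue_on \<Omega>)"
      by (intro borel_measurable_times psi(1) indicator_X_measurable that)
    show "AE x in lebesgue_on \<Omega>. norm (\<psi> x * indicat_real (X j) x) \<le> B"
      using psi(2) B by (auto simp: indicator_def)
  qed
  note pr = integrable_product_scaleR[OF sigma_finite_lebesgue_on[OF Om_sets] sigma_finite_lebesgue_on[OF unit_cell_sets] a v]
  have eq: "(\<lambda>z. \<psi> (fst z) *\<^sub>R piecewise v z) = (\<lambda>z. \<Sum>j\<in>I. (\<lambda>(x, y). (\<psi> x * indicat_real (X j) x) *\<^sub>R v j y) z)"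
    by (auto simp: piecewise_def fun_eq_iff scaleR_sum_right)
  show "integrable P (\<lambda>z. \<psi> (fst z) *\<^sub>R piecewise v z)"
    unfolding eq by (intro Bochner_Integration.integrable_sum pr(1))
  have "integral\<^sup>L P (\<lambda>z. \<psi> (fst z) *\<^sub>R piecewise v z) = (\<Sum>j\<in>I. integral\<^sup>L P (\<lambda>(x, y). (\<psi> x * indicat_real (X j) x) *\<^sub>R v j y))"
    unfolding eq by (intro Bochner_Integration.integral_sum pr(1))
  then show "integral\<^sup>L P (\<lambda>z. \<psi> (fst z) *\<^sub>R piecewise v z)
      = (\<Sum>j\<in>I. (LINT x|lebesgue_on \<Omega>. \<psi> x * indicat_real (X j) x) *\<^sub>R (LINT y|lebesgue_on unit_cell. v j y))"
    using pr(2) by simp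
qed

lemma integral_indicator_X:
  assumes j: "j \<in> I"
  shows "integrable (lebesgue_on \<Omega>) (indicat_real (X j))" "(LINT x|lebesgue_on \<Omega>. indicat_real (X j) x) = \<kappa> j"
proof -
  interpret finite_measure "lebesgue_on \<Omega>" by (rule finite_measure_Om)
  show "integrable (lebesgue_on \<Omega>) (indicat_real (X j))"
    by (rule integrable_const_bound[of _ 1]) (use indicator_X_measurable[OF j] in \<open>auto simp: indicator_def\<close>)
  have "(LINT x|lebesgue_on \<Omega>. indicat_real (X j) x) = (LINT x|lebesgue_on \<Omega>. indicat_real (X j \<inter> \<Omega>) x)"
    by (intro Bochner_Integration.integral_cong) (auto simp: indicator_def)
  also have "\<dots> = measure (lebesgue_on \<Omega>) (X j \<inter> \<Omega>)" using X_sets_Om[OF j] by (simp add: Int_absorb2)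
  also have "\<dots> = measure lebesgue (X j \<inter> \<Omega>)" using Om_sets by (intro measure_restrict_space) auto
  finally show "(LINT x|lebesgue_on \<Omega>. indicat_real (X j) x) = \<kappa> j" using X_measurable(3)[OF j] by simp
qed

lemma piecewise_integral_1:
  fixes v :: "nat \<times> (real^'d) \<Rightarrow> real^'d \<Rightarrow> 'b::euclidean_space"
  assumes v: "\<And>j. j \<in> I \<Longrightarrow> integrable (lebesgue_on unit_cell) (v j)"
  shows "integrable P (piecewise v)" "integral\<^sup>L P (piecewise v) = (\<Sum>j\<in>I. \<kappa> j *\<^sub>R (LINT y|lebesgue_on unit_cell. v j y))"
  using piecewise_integral[where v = v and \<psi> = "\<lambda>x. 1" and B = 1, OF v] integral_indicator_X(2) by simp_all

lemma piecewise_measurable: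
  fixes v :: "nat \<times> (real^'d) \<Rightarrow> real^'d \<Rightarrow> 'b::euclidean_space"
  assumes v: "\<And>j. j \<in> I \<Longrightarrow> v j \<in> borel_measurable (lebesgue_on unit_cell)"
  shows "piecewise v \<in> borel_measurable P"
proof -
  have eq: "piecewise v = (\<lambda>z. \<Sum>j\<in>I. indicat_real (X j) (fst z) *\<^sub>R v j (snd z))"
    by (auto simp: piecewise_def)
  show ?thesis unfolding eq
    by (intro borel_measurable_sum borel_measurable_scaleR measurable_compose[OF measurable_fst indicator_X_measurable]
        measurable_compose[OF measurable_snd v])
qed

lemma piecewise_Lp:
  fixes v :: "nat \<times> (real^'d) \<Rightarrow> real^'d \<Rightarrow> 'b::euclidean_space"
  assumes v: "\<And>j. j \<in> I \<Longrightarrow> v j \<in> Lp p unit_cell"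
  shows "piecewise v \<in> Lp_fun p P"
    "integral\<^sup>L P (\<lambda>z. norm (piecewise v z) powr p) = (\<Sum>j\<in>I. \<kappa> j * (LINT y|lebesgue_on unit_cell. norm (v j y) powr p))"
proof -
  have eq: "(\<lambda>z. norm (piecewise v z) powr p) = piecewise (\<lambda>j y. norm (v j y) powr p)"
    by (rule ext) (rule piecewise_apply, simp)
  have i: "integrable (lebesgue_on unit_cell) (\<lambda>y. norm (v j y) powr p)" if "j \<in> I" for j
    using v[OF that] by (simp add: Lp_def)
  have "integrable P (piecewise (\<lambda>j y. norm (v j y) powr p))" by (rule piecewise_integral_1(1)[OF i])
  moreover have "piecewise v \<in> borel_measurable P" by (rule piecewise_measurable) (use v in \<open>simp add: Lp_def\<close>)
  ultimately show "piecewise v \<in> Lp_fun p P" by (simp only: Lp_fun_def mem_Collect_eq eq)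
  show "integral\<^sup>L P (\<lambda>z. norm (piecewise v z) powr p) = (\<Sum>j\<in>I. \<kappa> j * (LINT y|lebesgue_on unit_cell. norm (v j y) powr p))"
    unfolding eq using piecewise_integral_1(2)[OF i] by simp
qed

lemma cell_sets: "j \<in> I \<Longrightarrow> cell j \<in> sets lebesgue"
  using open_cell[OF I_D(1)] by simp

lemma integrable_cell:
  fixes f :: "real^'d \<Rightarrow> 'b::euclidean_space"
  assumes j: "j \<in> I" and f: "integrable (lebesgue_on \<Omega>) f"
  shows "integrable (lebesgue_on (cell j)) f" "integrable (lebesgue_on unit_cell) (\<lambda>y. f (T j y))"
proof -
  show "integrable (lebesgue_on (cell j)) f"
    using integrable_lebesgue_on_subset(1)[OF f Om_sets cell_sets[OF j]] cell_subset[OF j] by blast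
  then show "integrable (lebesgue_on unit_cell) (\<lambda>y. f (T j y))"
    using change_of_variables_cell(2)[OF j borel_measurable_integrable[OF f]] by simp
qed

text \<open>The cells are disjoint. Subfamilies and a target set \<open>S\<close> are allowed
  because the estimate is used for all of \<Omega> and also for the cells contained in the boundary
  layer.\<close>

lemma sum_cells_le:
  fixes f :: "real^'d \<Rightarrow> real"
  assumes f: "integrable (lebesgue_on \<Omega>) f" "\<And>x. 0 \<le> f x" and I': "I' \<subseteq> I"
    and S: "S \<in> sets lebesgue" "S \<subseteq> \<Omega>" "\<And>j. j \<in> I' \<Longrightarrow> cell j \<subseteq> S"
  shows "(\<Sum>j\<in>I'. LINT x|lebesgue_on (cell j). f x) \<le> (LINT x|lebesgue_on S. f x)"
proof -
  have fin: "finite I'" by (rule finite_subset[OF I' finite_I])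
  have c: "cell j \<in> sets lebesgue" "cell j \<subseteq> \<Omega>" if "j \<in> I'" for j
    using that I' cell_sets cell_subset by blast+
  note sub = integrable_lebesgue_on_subset[OF f(1) Om_sets]
  have "(\<Sum>j\<in>I'. LINT x|lebesgue_on (cell j). f x) = (\<Sum>j\<in>I'. LINT x|lebesgue_on \<Omega>. indicat_real (cell j) x *\<^sub>R f x)"
    using c by (intro sum.cong refl sub(2))
  also have "\<dots> = (LINT x|lebesgue_on \<Omega>. (\<Sum>j\<in>I'. indicat_real (cell j) x *\<^sub>R f x))"
    using c by (intro Bochner_Integration.integral_sum[symmetric] sub(3))
  also have "\<dots> \<le> (LINT x|lebesgue_on \<Omega>. indicat_real S x *\<^sub>R f x)"
  proof (rule integral_mono)
    show "integrable (lebesgue_on \<Omega>) (\<lambda>x. \<Sum>j\<in>I'. indicat_real (cell j) x *\<^sub>R f x)"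
      using c by (intro Bochner_Integration.integrable_sum sub(3))
    show "integrable (lebesgue_on \<Omega>) (\<lambda>x. indicat_real S x *\<^sub>R f x)" by (rule sub(3)[OF S(1,2)])
    fix x
    show "(\<Sum>j\<in>I'. indicat_real (cell j) x *\<^sub>R f x) \<le> indicat_real S x *\<^sub>R f x"
    proof (cases "\<exists>j\<in>I'. x \<in> cell j")
      case True
      then obtain j where j: "j \<in> I'" "x \<in> cell j" by blast
      have "(\<Sum>i\<in>I'. indicat_real (cell i) x *\<^sub>R f x) = (\<Sum>i\<in>{j}. indicat_real (cell i) x *\<^sub>R f x)"
      proof (rule sum.mono_neutral_right[OF fin])
        show "\<forall>i\<in>I' - {j}. indicat_real (cell i) x *\<^sub>R f x = 0"
        proof
          fix i assume i: "i \<in> I' - {j}"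
          have "x \<notin> cell i"
          proof
            assume "x \<in> cell i"
            then have "x \<in> X i" "x \<in> X j" using i j I' cell_subset_X by blast+
            then show False using X_unique[of i j x] i j I' by blast
          qed
          then show "indicat_real (cell i) x *\<^sub>R f x = 0" by simp
        qed
      qed (use j in simp)
      moreover have "x \<in> S" using j S(3) by blast
      ultimately show ?thesis using j by simp
    next
      case False
      then show ?thesis using f(2)[of x] by (simp add: sum.neutral)
    qed
  qed
  also have "\<dots> = (LINT x|lebesgue_on S. f x)" by (rule sub(2)[OF S(1,2), symmetric])
  finally show ?thesis .
qed

lemma Lp_compose_T:
  fixes f :: "real^'d \<Rightarrow> 'b::euclidean_space"
  assumes j: "j \<in> I" and f: "f \<in> Lp p \<Omega>"
  shows "(\<lambda>y. f (T j y)) \<in> Lp p unit_cell"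
  using change_of_variables_cell(1)[OF j, of f] integrable_cell(2)[OF j, of "\<lambda>x. norm (f x) powr p"] f
  by (simp add: Lp_def)

text \<open>Each index contributes the volume of its cell times an average, which is the integral
  over that cell; unfolding therefore does not increase the L^p norm. What is lost is the part of
  \<Omega> outside the admissible cells.\<close>

lemma piecewise_Lp_le:
  fixes f :: "real^'d \<Rightarrow> 'b::euclidean_space"
  assumes f: "f \<in> Lp p \<Omega>"
  shows "piecewise (\<lambda>j y. f (T j y)) \<in> Lp_fun p P"
    "integral\<^sup>L P (\<lambda>z. norm (piecewise (\<lambda>j y. f (T j y)) z) powr p) \<le> (LINT x|lebesgue_on \<Omega>. norm (f x) powr p)"
proof -
  note v = Lp_compose_T[OF _ f]
  show "piecewise (\<lambda>j y. f (T j y)) \<in> Lp_fun p P" by (rule piecewise_Lp(1)[OF v])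
  have fi: "integrable (lebesgue_on \<Omega>) (\<lambda>x. norm (f x) powr p)" using f by (simp add: Lp_def)
  have "integral\<^sup>L P (\<lambda>z. norm (piecewise (\<lambda>j y. f (T j y)) z) powr p)
      = (\<Sum>j\<in>I. \<kappa> j *\<^sub>R (LINT y|lebesgue_on unit_cell. norm (f (T j y)) powr p))"
    by (simp add: piecewise_Lp(2)[OF v])
  also have "\<dots> = (\<Sum>j\<in>I. LINT x|lebesgue_on (cell j). norm (f x) powr p)"
    by (intro sum.cong refl change_of_variables_cell(3) borel_measurable_integrable[OF fi])
  also have "\<dots> \<le> (LINT x|lebesgue_on \<Omega>. norm (f x) powr p)"
    by (rule sum_cells_le[OF fi]) (use Om_sets cell_subset in auto)
  finally show "integral\<^sup>L P (\<lambda>z. norm (piecewise (\<lambda>j y. f (T j y)) z) powr p) \<le> (LINT x|lebesgue_on \<Omega>. norm (f x) powr p)" .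
qed

lemma has_weak_gradient_T:
  assumes n: "fst j \<in> {1..N}" and S: "open S" and sub: "T j ` S \<subseteq> \<Omega>" and w: "has_weak_gradient \<Omega> w gw"
  shows "has_weak_gradient S (\<lambda>y. w (T j y)) (\<lambda>y. transpose (M j) *v gw (T j y))"
  using has_weak_gradient_affine[OF M_inv[OF n] S Om(1) _ w, of "M j *v snd j"] sub by (simp add: T_affine)

text \<open>For fixed x the unfolded function is w composed with one affine map, or zero; so it
  takes finitely many values as a function of x, and its y-gradient follows from the chain
  rule.\<close>

lemma simple_pair_unfolding:
  assumes p: "1 < p" and w: "w \<in> Lp p \<Omega>" "gw \<in> Lp p \<Omega>" "has_weak_gradient \<Omega> w gw"
  shows "simple_pair p \<Omega> unit_cell (piecewise (\<lambda>j y. w (T j y))) (piecewise (\<lambda>j y. transpose (M j) *v gw (T j y)))"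
proof -
  have gL: "(\<lambda>y. transpose (M j) *v gw (T j y)) \<in> Lp p unit_cell" if j: "j \<in> I" for j
  proof -
    obtain K where K: "\<And>x. norm (transpose (M j) *v x) \<le> norm x * K"
      using bounded_linear.bounded[OF matrix_vector_mul_bounded_linear] by blast
    have K0: "0 \<le> K" using order_trans[OF norm_ge_zero K[of "axis undefined 1"]] by simp
    have gT: "(\<lambda>y. gw (T j y)) \<in> Lp_fun p (lebesgue_on unit_cell)" using Lp_compose_T[OF j w(2)] by (simp add: Lp_eq)
    show ?thesis unfolding Lp_eq
    proof (rule Lp_fun_bounded_by)
      show "integrable (lebesgue_on unit_cell) (\<lambda>y. K powr p * norm (gw (T j y)) powr p)" using Lp_funD(2)[OF gT] by simp
      show "(\<lambda>y. transpose (M j) *v gw (T j y)) \<in> borel_measurable (lebesgue_on unit_cell)"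
        by (rule measurable_compose[OF Lp_funD(1)[OF gT] borel_measurable_linear[OF matrix_vector_mul_linear]])
      fix y
      have "norm (transpose (M j) *v gw (T j y)) powr p \<le> (K * norm (gw (T j y))) powr p"
        using K[of "gw (T j y)"] p by (intro powr_mono2) (auto simp: mult.commute)
      then show "norm (transpose (M j) *v gw (T j y)) powr p \<le> K powr p * norm (gw (T j y)) powr p"
        using K0 by (simp add: powr_mult)
    qed
  qed
  have wg: "has_weak_gradient unit_cell (\<lambda>y. w (T j y)) (\<lambda>y. transpose (M j) *v gw (T j y))" if j: "j \<in> I" for j
    using cell_subset[OF j] by (intro has_weak_gradient_T[OF I_D(1)[OF j] open_unit_cell _ w(3)]) (auto simp: cell_def)
  have sf: "simple_function (lebesgue_on \<Omega>) (\<lambda>x y. \<Sum>j\<in>J. indicat_real (X j) x *\<^sub>R w (T j y))" if "J \<subseteq> I" "finite J" for J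
    using that(2,1)
  proof (induction J rule: finite_induct)
    case (insert j J)
    have "simple_function (lebesgue_on \<Omega>) (indicat_real (X j))"
    proof -
      have "simple_function (lebesgue_on \<Omega>) (indicat_real (X j \<inter> \<Omega>))"
        using X_sets_Om[of j] insert.prems by (intro simple_function_indicator) auto
      then show ?thesis by (subst simple_function_cong[of _ _ "indicat_real (X j \<inter> \<Omega>)"]) (auto simp: indicator_def)
    qed
    from simple_function_compose1[OF this, of "\<lambda>a y. a *\<^sub>R w (T j y)"]
    have 1: "simple_function (lebesgue_on \<Omega>) (\<lambda>x y. indicat_real (X j) x *\<^sub>R w (T j y))" .
    have "simple_function (lebesgue_on \<Omega>) (\<lambda>x y. \<Sum>j\<in>J. indicat_real (X j) x *\<^sub>R w (T j y))"
      using insert by blast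
    from simple_function_compose2[OF 1 this, of "\<lambda>a b y. a y + b y"] show ?case by (simp only: sum.insert[OF insert(1,2)])
  qed simp
  have Lps: "(\<lambda>y. \<Sum>j\<in>I. indicat_real (X j) x *\<^sub>R v j y) \<in> Lp p unit_cell" if "\<And>j. j \<in> I \<Longrightarrow> v j \<in> Lp p unit_cell"
    for x and v :: "_ \<Rightarrow> _ \<Rightarrow> 'z::euclidean_space"
    unfolding Lp_eq by (intro Lp_fun_sum[OF p] Lp_fun_scaleR) (use that in \<open>simp add: Lp_eq\<close>)
  show ?thesis unfolding simple_pair_def
  proof (intro conjI ballI)
    show "piecewise (\<lambda>j y. w (T j y)) \<in> Lp_fun p P" by (rule piecewise_Lp_le(1)[OF w(1)])
    show "piecewise (\<lambda>j y. transpose (M j) *v gw (T j y)) \<in> Lp_fun p P" by (rule piecewise_Lp(1)[OF gL])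
    show "simple_function (lebesgue_on \<Omega>) (\<lambda>x y. piecewise (\<lambda>j y. w (T j y)) (x, y))"
      unfolding piecewise_def prod.case by (rule sf[OF subset_refl finite_I])
    fix x
    show "(\<lambda>y. piecewise (\<lambda>j y. w (T j y)) (x, y)) \<in> Lp p unit_cell"
      unfolding piecewise_def prod.case by (intro Lps Lp_compose_T w)
    show "(\<lambda>y. piecewise (\<lambda>j y. transpose (M j) *v gw (T j y)) (x, y)) \<in> Lp p unit_cell"
      unfolding piecewise_def prod.case by (intro Lps gL)
    have "has_weak_gradient unit_cell (\<lambda>y. \<Sum>j\<in>I. indicat_real (X j) x * w (T j y))
        (\<lambda>y. \<Sum>j\<in>I. indicat_real (X j) x *\<^sub>R (transpose (M j) *v gw (T j y)))"
      by (intro has_weak_gradient_sum[OF open_unit_cell] has_weak_gradient_scaleR wg)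
    then show "has_weak_gradient unit_cell (\<lambda>y. piecewise (\<lambda>j y. w (T j y)) (x, y))
        (\<lambda>y. piecewise (\<lambda>j y. transpose (M j) *v gw (T j y)) (x, y))"
      unfolding piecewise_def prod.case by (simp only: real_scaleR_def)
  qed
qed

end

section \<open>The discrete summation by parts inside the cubes\<close>

context unfolding_cells
begin

text \<open>Within one cube all cells are translates of each other, so the volume factor can be
  taken out of a sum over shifts.\<close>

lemma \<kappa>_shift: "\<kappa> (n, \<eta> + \<xi>) = \<kappa> (n, \<eta>)"
proof -
  have "cell (n, \<eta> + \<xi>) = (+) (\<epsilon> *\<^sub>R (A n *v \<xi>)) ` cell (n, \<eta>)"
    unfolding cell_def image_image
    by (rule image_cong[OF refl]) (simp add: T_def matrix_vector_right_distrib scaleR_add_right ac_simps)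
  then show ?thesis by (simp add: \<kappa>_def measure_translation)
qed

text \<open>Source of the radius \<open>r0\<close> below: up to the factor \<epsilon> and the bound
  for the matrix, this is how far a point of a cell can be from the lattice point reached by a shift
  from the box.\<close>

lemma norm_lattice_cell_le:
  assumes "\<xi> \<in> lattice_box m" "\<And>i. 0 \<le> y $ i \<and> y $ i \<le> 1"
  shows "norm (y + \<xi> :: real^'d) \<le> real CARD('d) * (real m + 1)"
proof -
  have "norm (y + \<xi>) \<le> (\<Sum>i\<in>UNIV. \<bar>(y + \<xi>) $ i\<bar>)" by (rule norm_le_l1_cart)
  also have "\<dots> \<le> (\<Sum>i\<in>(UNIV :: 'd set). real m + 1)"
  proof (rule sum_mono)
    fix i
    have "\<bar>\<xi> $ i\<bar> \<le> real m" using assms(1) by (simp add: lattice_box_def)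
    then show "\<bar>(y + \<xi>) $ i\<bar> \<le> real m + 1" using assms(2)[of i] unfolding vector_add_component by linarith
  qed
  finally show ?thesis by simp
qed

text \<open>
  The sum over the cells is rearranged so that each lattice point collects the contributions of the cells
  in its neighbourhood; this costs only the modulus of continuity of the weight. If the whole neighbourhood
  lies in the cube, the collected terms cancel by the definition of the weak gradient. The remaining cells
  lie in a thin layer along the boundary of the cube.
\<close>

lemma periodic_estimate:
  fixes w :: "real^'d \<Rightarrow> real" and gw :: "real^'d \<Rightarrow> real^'d"
  assumes w: "integrable (lebesgue_on \<Omega>) w" "integrable (lebesgue_on \<Omega>) gw" "has_weak_gradient \<Omega> w gw"
    and a: "0 < a" "\<And>n v. n \<in> {1..N} \<Longrightarrow> norm (A n *v v) \<le> a * norm v"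
      "\<And>n v. n \<in> {1..N} \<Longrightarrow> norm (transpose (A n) *v v) \<le> a * norm v"
    and phi: "test_function {y. \<forall>i. \<bar>y $ i\<bar> < real m} \<phi>"
      "\<And>y. \<bar>\<phi> y\<bar> \<le> B" "\<And>y. \<bar>frechet_derivative \<phi> (at y) (axis i 1)\<bar> \<le> B"
    and r0: "r0 = \<epsilon> * a * (real CARD('d) * (real m + 1))"
    and psi: "continuous_on UNIV \<psi>" "\<And>x. \<bar>\<psi> x\<bar> \<le> B\<psi>" "\<And>x z. dist x z \<le> r0 \<Longrightarrow> \<bar>\<psi> x - \<psi> z\<bar> \<le> \<omega>"
      "\<And>z. \<psi> z \<noteq> 0 \<Longrightarrow> ball z (2 * r0) \<subseteq> \<Omega>"
    and K: "\<And>n. n \<in> {1..N} \<Longrightarrow> K n \<in> sets lebesgue" "\<And>n z. n \<in> {1..N} \<Longrightarrow> z \<in> K n \<Longrightarrow> ball z (4 * r0) \<subseteq> Q n"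
  defines "\<Phi>0 \<equiv> \<lambda>y. \<Sum>\<xi>\<in>lattice_box m. frechet_derivative \<phi> (at (y + \<xi>)) (axis i 1)"
    and "\<Phi>1 \<equiv> \<lambda>y. \<Sum>\<xi>\<in>lattice_box m. \<phi> (y + \<xi>)"
    and "Gf \<equiv> \<lambda>x. norm (w x) + \<epsilon> * a * norm (gw x)"
  shows "\<bar>integral\<^sup>L P (\<lambda>z. \<psi> (fst z) * (piecewise (\<lambda>j y. w (T j y)) z * \<Phi>0 (snd z)
      + piecewise (\<lambda>j y. (transpose (M j) *v gw (T j y))) z $ i * \<Phi>1 (snd z)))\<bar>
    \<le> real (card (lattice_box m :: (real^'d) set)) * B * (\<omega> * (LINT x|lebesgue_on \<Omega>. Gf x)
        + B\<psi> * (LINT x|lebesgue_on (\<Omega> \<inter> (\<Union>n\<in>{1..N}. Q n - K n)). Gf x))"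
proof -
  define J where "J = (lattice_box m :: (real^'d) set)"
  have finJ: "finite J" unfolding J_def by (rule finite_lattice_box)
  have B0: "0 \<le> B" using order_trans[OF abs_ge_zero phi(2)] .
  have B\<psi>0: "0 \<le> B\<psi>" using order_trans[OF abs_ge_zero psi(2)] .
  have r0p: "0 < r0" unfolding r0 using eps a(1) by simp
  have \<omega>0: "0 \<le> \<omega>" using psi(3)[of 0 0] r0p by simp
  have Gi: "integrable (lebesgue_on \<Omega>) Gf" unfolding Gf_def using w(1,2) by simp
  have G0: "0 \<le> Gf x" for x unfolding Gf_def using eps a(1) by simp
  define D where "D = (\<lambda>y. frechet_derivative \<phi> (at y) (axis i 1))"
  have contD: "continuous_on UNIV D" "continuous_on UNIV \<phi>"
    unfolding D_def using test_function_continuous[OF phi(1)] by auto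
  \<comment> \<open>The contribution of cell \<open>j\<close> paired with the translate of the test
    function by \<xi>; \<open>b\<close> is its integral over the unit cell and \<open>g\<close> the
    local mass that bounds it through \<open>\<kappa>b\<close>.\<close>
  define f where "f = (\<lambda>j \<xi> y. w (T j y) * D (y + \<xi>) + (transpose (M j) *v gw (T j y)) $ i * \<phi> (y + \<xi>))"
  define b where "b = (\<lambda>j \<xi>. LINT y|lebesgue_on unit_cell. f j \<xi> y)"
  define g where "g = (\<lambda>j. LINT x|lebesgue_on (cell j). Gf x)"
  have tM: "norm (transpose (M j) *v v) \<le> \<epsilon> * a * norm v" if "fst j \<in> {1..N}" for j v
  proof -
    have "transpose (M j) *v v = \<epsilon> *\<^sub>R (transpose (A (fst j)) *v v)"
      by (simp add: M_def transpose_def matrix_vector_mult_def vec_eq_iff sum_distrib_left mult_ac)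
    then show ?thesis using a(3)[OF that, of v] eps by (simp add: mult.assoc)
  qed
  have f_le: "\<bar>f j \<xi> y\<bar> \<le> B * Gf (T j y)" if j: "fst j \<in> {1..N}" for j \<xi> y
  proof -
    have "\<bar>f j \<xi> y\<bar> \<le> \<bar>w (T j y)\<bar> * \<bar>D (y + \<xi>)\<bar> + \<bar>(transpose (M j) *v gw (T j y)) $ i\<bar> * \<bar>\<phi> (y + \<xi>)\<bar>"
      unfolding f_def using abs_triangle_ineq by (metis abs_mult)
    also have "\<dots> \<le> \<bar>w (T j y)\<bar> * B + (\<epsilon> * a * norm (gw (T j y))) * B"
    proof (intro add_mono mult_mono)
      show "\<bar>(transpose (M j) *v gw (T j y)) $ i\<bar> \<le> \<epsilon> * a * norm (gw (T j y))"
        by (rule order_trans[OF component_le_norm_cart tM[OF j]])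
    qed (use phi B0 eps a in \<open>auto simp: D_def\<close>)
    finally show ?thesis by (simp add: Gf_def algebra_simps)
  qed
  have shift_meas: "(\<lambda>y. h (y + \<xi>)) \<in> borel_measurable (lebesgue_on unit_cell)" if "continuous_on UNIV h" for h :: "real^'d \<Rightarrow> real" and \<xi>
    by (rule continuous_measurable_lebesgue_on)
      (intro continuous_on_compose2[OF that] continuous_intros subset_UNIV)
  have fi: "integrable (lebesgue_on unit_cell) (f j \<xi>)" if j: "j \<in> I" for j \<xi>
  proof (rule Bochner_Integration.integrable_bound[where f = "\<lambda>y. B * Gf (T j y)"])
    show "integrable (lebesgue_on unit_cell) (\<lambda>y. B * Gf (T j y))" using integrable_cell(2)[OF j Gi] by simp
    have 1: "(\<lambda>y. w (T j y)) \<in> borel_measurable (lebesgue_on unit_cell)" using integrable_cell(2)[OF j w(1)] by simp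
    have 2: "(\<lambda>y. gw (T j y)) \<in> borel_measurable (lebesgue_on unit_cell)" using integrable_cell(2)[OF j w(2)] by simp
    have 3: "(\<lambda>y. (transpose (M j) *v gw (T j y)) $ i) \<in> borel_measurable (lebesgue_on unit_cell)"
      by (intro measurable_compose[OF 2 borel_measurable_linear] linear_compose[OF matrix_vector_mul_linear, unfolded o_def]
          bounded_linear.linear[OF bounded_linear_vec_nth])
    show "f j \<xi> \<in> borel_measurable (lebesgue_on unit_cell)"
      unfolding f_def by (intro borel_measurable_add borel_measurable_times 1 3 shift_meas contD)
    show "AE y in lebesgue_on unit_cell. norm (f j \<xi> y) \<le> norm (B * Gf (T j y))"
      using f_le[OF I_D(1)[OF j]] B0 G0 by (intro AE_I2) (simp add: abs_of_nonneg)
  qed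
  have \<kappa>b: "\<kappa> j * \<bar>b j \<xi>\<bar> \<le> B * g j" if j: "j \<in> I" for j \<xi>
  proof -
    have "\<bar>b j \<xi>\<bar> \<le> (LINT y|lebesgue_on unit_cell. norm (f j \<xi> y))"
      unfolding b_def using integral_norm_bound[of "lebesgue_on unit_cell" "f j \<xi>"] by simp
    also have "\<dots> \<le> (LINT y|lebesgue_on unit_cell. B * Gf (T j y))"
      using f_le[OF I_D(1)[OF j]] fi[OF j] integrable_cell(2)[OF j Gi] by (intro integral_mono) auto
    finally have "\<kappa> j * \<bar>b j \<xi>\<bar> \<le> \<kappa> j * (LINT y|lebesgue_on unit_cell. B * Gf (T j y))"
      using \<kappa>_pos[OF j] by (intro mult_left_mono) auto
    also have "\<dots> = B * g j"
      using change_of_variables_cell(3)[OF j borel_measurable_integrable[OF Gi]] by (simp add: g_def mult.left_commute)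
    finally show ?thesis .
  qed
  have g0: "0 \<le> g j" for j unfolding g_def by (intro integral_nonneg_AE) (simp add: G0)
  \<comment> \<open>The reference point depends only on the cube and on the difference of cell index
    and shift. All pairs whose contributions cancel together share it, which is why the weight is
    frozen there and not in the cell.\<close>
  define pt where "pt = (\<lambda>j \<xi>. \<epsilon> *\<^sub>R (A (fst j) *v (snd j - \<xi>)))"
  have dist_pt: "dist (T j y) (pt j \<xi>) \<le> r0" if j: "fst j \<in> {1..N}" and "\<xi> \<in> J" and y: "\<And>i. 0 \<le> y $ i \<and> y $ i \<le> 1" for j \<xi> y
  proof -
    have "T j y - pt j \<xi> = \<epsilon> *\<^sub>R (A (fst j) *v (y + \<xi>))"
      by (simp add: T_def pt_def matrix_vector_right_distrib matrix_vector_mult_diff_distrib algebra_simps)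
    then have "dist (T j y) (pt j \<xi>) = \<epsilon> * norm (A (fst j) *v (y + \<xi>))" using eps by (simp add: dist_norm)
    also have "\<dots> \<le> \<epsilon> * (a * norm (y + \<xi>))" using a(2)[OF j] eps by simp
    also have "\<dots> \<le> \<epsilon> * (a * (real CARD('d) * (real m + 1)))"
      using norm_lattice_cell_le[OF _ y] that(2) eps a(1) unfolding J_def by (intro mult_left_mono) auto
    finally show ?thesis by (simp add: r0 mult.assoc)
  qed
  have psim: "\<psi> \<in> borel_measurable (lebesgue_on \<Omega>)" by (rule continuous_measurable_lebesgue_on[OF psi(1)])
  have \<Psi>: "\<bar>(LINT x|lebesgue_on \<Omega>. \<psi> x * indicat_real (X j) x) - \<kappa> j * \<psi> (pt j \<xi>)\<bar> \<le> \<kappa> j * \<omega>"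
    if j: "j \<in> I" and \<xi>: "\<xi> \<in> J" for j \<xi>
  proof -
    note ix = integral_indicator_X[OF j]
    have i1: "integrable (lebesgue_on \<Omega>) (\<lambda>x. \<psi> x * indicat_real (X j) x)"
      using integrable_bounded_scaleR[OF ix(1) psim psi(2)] by simp
    have "(LINT x|lebesgue_on \<Omega>. \<psi> x * indicat_real (X j) x) - \<kappa> j * \<psi> (pt j \<xi>)
        = (LINT x|lebesgue_on \<Omega>. \<psi> x * indicat_real (X j) x - \<psi> (pt j \<xi>) * indicat_real (X j) x)"
      using i1 ix by simp
    also have "\<bar>\<dots>\<bar> \<le> (LINT x|lebesgue_on \<Omega>. norm (\<psi> x * indicat_real (X j) x - \<psi> (pt j \<xi>) * indicat_real (X j) x))"
      using integral_norm_bound[of "lebesgue_on \<Omega>" "\<lambda>x. \<psi> x * indicat_real (X j) x - \<psi> (pt j \<xi>) * indicat_real (X j) x"] by simp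
    also have "\<dots> \<le> (LINT x|lebesgue_on \<Omega>. \<omega> * indicat_real (X j) x)"
    proof (intro integral_mono integrable_norm Bochner_Integration.integrable_diff i1 integrable_mult_right ix(1))
      fix x
      show "norm (\<psi> x * indicat_real (X j) x - \<psi> (pt j \<xi>) * indicat_real (X j) x) \<le> \<omega> * indicat_real (X j) x"
      proof (cases "x \<in> X j")
        case True
        then obtain y where y: "x = T j y" "y \<in> half_open_cell" by (auto simp: X_def)
        then have "dist x (pt j \<xi>) \<le> r0"
          using dist_pt[OF I_D(1)[OF j] \<xi>, of y] by (auto simp: half_open_cell_def less_imp_le)
        then show ?thesis using psi(3) True by simp
      qed simp
    qed
    also have "\<dots> = \<kappa> j * \<omega>" using ix by simp
    finally show ?thesis .
  qed
  have E: "integral\<^sup>L P (\<lambda>z. \<psi> (fst z) * (piecewise (\<lambda>j y. w (T j y)) z * \<Phi>0 (snd z)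
      + piecewise (\<lambda>j y. (transpose (M j) *v gw (T j y))) z $ i * \<Phi>1 (snd z)))
      = (\<Sum>j\<in>I. \<Sum>\<xi>\<in>J. (LINT x|lebesgue_on \<Omega>. \<psi> x * indicat_real (X j) x) * b j \<xi>)"
  proof -
    have "piecewise (\<lambda>j y. w (T j y)) z * \<Phi>0 (snd z) + piecewise (\<lambda>j y. (transpose (M j) *v gw (T j y))) z $ i * \<Phi>1 (snd z)
        = piecewise (\<lambda>j y. \<Sum>\<xi>\<in>J. f j \<xi> y) z" for z
    proof -
      have "(\<Sum>\<xi>\<in>J. f j \<xi> y) = w (T j y) * \<Phi>0 y + (transpose (M j) *v gw (T j y)) $ i * \<Phi>1 y" for j y
        unfolding f_def \<Phi>0_def \<Phi>1_def J_def D_def by (simp only: sum.distrib sum_distrib_left)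
      moreover have "piecewise (\<lambda>j y. (transpose (M j) *v gw (T j y))) z $ i = piecewise (\<lambda>j y. (transpose (M j) *v gw (T j y)) $ i) z"
        by (rule piecewise_apply) simp
      ultimately show ?thesis
        by (simp add: piecewise_def split_beta' sum.distrib sum_distrib_right distrib_left mult.assoc)
    qed
    then have "integral\<^sup>L P (\<lambda>z. \<psi> (fst z) * (piecewise (\<lambda>j y. w (T j y)) z * \<Phi>0 (snd z)
      + piecewise (\<lambda>j y. (transpose (M j) *v gw (T j y))) z $ i * \<Phi>1 (snd z)))
      = integral\<^sup>L P (\<lambda>z. \<psi> (fst z) *\<^sub>R piecewise (\<lambda>j y. \<Sum>\<xi>\<in>J. f j \<xi> y) z)" by simp
    also have "\<dots> = (\<Sum>j\<in>I. (LINT x|lebesgue_on \<Omega>. \<psi> x * indicat_real (X j) x) *\<^sub>R (LINT y|lebesgue_on unit_cell. (\<Sum>\<xi>\<in>J. f j \<xi> y)))"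
      by (intro piecewise_integral(2)[OF _ psim psi(2)] Bochner_Integration.integrable_sum fi)
    also have "\<dots> = (\<Sum>j\<in>I. \<Sum>\<xi>\<in>J. (LINT x|lebesgue_on \<Omega>. \<psi> x * indicat_real (X j) x) * b j \<xi>)"
      by (intro sum.cong refl) (simp add: Bochner_Integration.integral_sum[OF fi] b_def sum_distrib_left)
    finally show ?thesis .
  qed
  \<comment> \<open>The pairing with every weighted average replaced by the cell volume times the
    value at the reference point; the error is governed by the modulus \<omega> times the total
    mass, once for each shift.\<close>
  define E' where "E' = (\<Sum>j\<in>I. \<Sum>\<xi>\<in>J. \<kappa> j * \<psi> (pt j \<xi>) * b j \<xi>)"
  have EE': "\<bar>(\<Sum>j\<in>I. \<Sum>\<xi>\<in>J. (LINT x|lebesgue_on \<Omega>. \<psi> x * indicat_real (X j) x) * b j \<xi>) - E'\<bar>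
      \<le> real (card J) * B * (\<omega> * (LINT x|lebesgue_on \<Omega>. Gf x))"
  proof -
    have "(\<Sum>j\<in>I. \<Sum>\<xi>\<in>J. (LINT x|lebesgue_on \<Omega>. \<psi> x * indicat_real (X j) x) * b j \<xi>) - E'
        = (\<Sum>j\<in>I. \<Sum>\<xi>\<in>J. ((LINT x|lebesgue_on \<Omega>. \<psi> x * indicat_real (X j) x) - \<kappa> j * \<psi> (pt j \<xi>)) * b j \<xi>)"
      unfolding E'_def by (simp only: sum_subtractf[symmetric] left_diff_distrib)
    also have "\<bar>\<dots>\<bar> \<le> (\<Sum>j\<in>I. \<Sum>\<xi>\<in>J. \<omega> * (B * g j))"
    proof (rule order_trans[OF sum_abs sum_mono], rule order_trans[OF sum_abs sum_mono])
      fix j \<xi> assume j: "j \<in> I" and \<xi>: "\<xi> \<in> J"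
      have "\<bar>((LINT x|lebesgue_on \<Omega>. \<psi> x * indicat_real (X j) x) - \<kappa> j * \<psi> (pt j \<xi>)) * b j \<xi>\<bar> \<le> (\<kappa> j * \<omega>) * \<bar>b j \<xi>\<bar>"
        unfolding abs_mult by (intro mult_right_mono \<Psi>[OF j \<xi>]) simp
      also have "\<dots> = \<omega> * (\<kappa> j * \<bar>b j \<xi>\<bar>)" by simp
      also have "\<dots> \<le> \<omega> * (B * g j)" by (intro mult_left_mono \<kappa>b[OF j] \<omega>0)
      finally show "\<bar>((LINT x|lebesgue_on \<Omega>. \<psi> x * indicat_real (X j) x) - \<kappa> j * \<psi> (pt j \<xi>)) * b j \<xi>\<bar> \<le> \<omega> * (B * g j)" .
    qed
    also have "\<dots> = real (card J) * B * (\<omega> * (\<Sum>j\<in>I. g j))" by (simp add: sum_distrib_left mult_ac)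
    also have "\<dots> \<le> real (card J) * B * (\<omega> * (LINT x|lebesgue_on \<Omega>. Gf x))"
      unfolding g_def using B0 \<omega>0
      by (intro mult_left_mono sum_cells_le[OF Gi G0]) (use Om_sets cell_subset in auto)
    finally show ?thesis .
  qed
  \<comment> \<open>Pairs with nonzero weight whose neighbourhood stays in the cube. Nonzero weight
    also places the neighbourhood inside \<Omega> by \<open>psi(4)\<close>, so the cells of all
    shifts about the same reference point are admissible.\<close>
  define good where "good = {(j, \<xi>). j \<in> I \<and> \<xi> \<in> J \<and> \<psi> (pt j \<xi>) \<noteq> 0 \<and> ball (pt j \<xi>) (2 * r0) \<subseteq> Q (fst j)}"
  have good_sub: "good \<subseteq> I \<times> J" by (auto simp: good_def)
  have fin: "finite (I \<times> J)" using finite_I finJ by simp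
  define F where "F = (\<lambda>(j, \<xi>). \<kappa> j * \<psi> (pt j \<xi>) * b j \<xi>)"
  have E'F: "E' = sum F good + sum F (I \<times> J - good)"
  proof -
    have "E' = sum F (I \<times> J)" unfolding E'_def F_def by (simp add: sum.cartesian_product)
    then show ?thesis using sum.subset_diff[OF good_sub fin, of F] by simp
  qed
  have bad: "\<bar>sum F (I \<times> J - good)\<bar> \<le> real (card J) * B * (B\<psi> * (LINT x|lebesgue_on (\<Omega> \<inter> (\<Union>n\<in>{1..N}. Q n - K n)). Gf x))"
  proof -
    define S where "S = \<Omega> \<inter> (\<Union>n\<in>{1..N}. Q n - K n)"
    define I' where "I' = {j \<in> I. cell j \<subseteq> S}"
    have Fle: "\<bar>F (j, \<xi>)\<bar> \<le> (if cell j \<subseteq> S then B\<psi> * (B * g j) else 0)" if "(j, \<xi>) \<in> I \<times> J - good" for j \<xi>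
    proof (cases "\<psi> (pt j \<xi>) = 0")
      case True
      then show ?thesis using B0 B\<psi>0 g0[of j] by (simp add: F_def)
    next
      case False
      have j: "j \<in> I" and \<xi>: "\<xi> \<in> J" and nb: "\<not> ball (pt j \<xi>) (2 * r0) \<subseteq> Q (fst j)"
        using that False by (auto simp: good_def)
      have "cell j \<subseteq> S"
      proof
        fix z assume z: "z \<in> cell j"
        then obtain y where y: "z = T j y" "y \<in> unit_cell" by (auto simp: cell_def)
        have d: "dist z (pt j \<xi>) \<le> r0" unfolding y(1)
          by (rule dist_pt[OF I_D(1)[OF j] \<xi>]) (use y(2) in \<open>auto simp: unit_cell_def less_imp_le\<close>)
        \<comment> \<open>A bad pair with nonzero weight pushes its whole cell into the layer: if z
          were in \<open>K\<close>, the ball of radius 4 \<open>r0\<close> about z would stay in the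
          cube and would cover the ball of radius 2 \<open>r0\<close> around the reference point,
          which is within \<open>r0\<close> of z.\<close>
        have "z \<notin> K (fst j)"
        proof
          assume "z \<in> K (fst j)"
          from K(2)[OF I_D(1)[OF j] this] have "ball z (4 * r0) \<subseteq> Q (fst j)" .
          moreover have "ball (pt j \<xi>) (2 * r0) \<subseteq> ball z (4 * r0)"
          proof
            fix x assume "x \<in> ball (pt j \<xi>) (2 * r0)"
            then have "dist (pt j \<xi>) x < 2 * r0" by simp
            then show "x \<in> ball z (4 * r0)" using d dist_triangle[of z x "pt j \<xi>"] r0p by simp
          qed
          ultimately show False using nb by blast
        qed
        then show "z \<in> S" using z cell_subset[OF j] I_D(1)[OF j] unfolding S_def by blast
      qed
      moreover have "\<bar>F (j, \<xi>)\<bar> \<le> B\<psi> * (B * g j)"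
      proof -
        have "\<bar>F (j, \<xi>)\<bar> = \<bar>\<psi> (pt j \<xi>)\<bar> * (\<kappa> j * \<bar>b j \<xi>\<bar>)" using \<kappa>_pos[OF j] by (simp add: F_def abs_mult)
        also have "\<dots> \<le> B\<psi> * (B * g j)" using \<kappa>_pos[OF j] by (intro mult_mono psi(2) \<kappa>b[OF j] B\<psi>0) auto
        finally show ?thesis .
      qed
      ultimately show ?thesis by simp
    qed
    have "\<bar>sum F (I \<times> J - good)\<bar> \<le> (\<Sum>(j, \<xi>)\<in>I \<times> J - good. if cell j \<subseteq> S then B\<psi> * (B * g j) else 0)"
    proof (rule order_trans[OF sum_abs sum_mono])
      fix q assume q: "q \<in> I \<times> J - good"
      obtain j \<xi> where jx: "q = (j, \<xi>)" by (cases q)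
      show "\<bar>F q\<bar> \<le> (case q of (j, \<xi>) \<Rightarrow> if cell j \<subseteq> S then B\<psi> * (B * g j) else 0)"
        unfolding jx prod.case by (rule Fle) (use q jx in simp)
    qed
    also have "\<dots> \<le> (\<Sum>(j, \<xi>)\<in>I \<times> J. if cell j \<subseteq> S then B\<psi> * (B * g j) else 0)"
      by (rule sum_mono2[OF fin]) (use B0 B\<psi>0 g0 in auto)
    also have "\<dots> = (\<Sum>j\<in>I. \<Sum>\<xi>\<in>J. if cell j \<subseteq> S then B\<psi> * (B * g j) else 0)" by (rule sum.cartesian_product[symmetric])
    also have "\<dots> = real (card J) * (\<Sum>j\<in>I. if cell j \<subseteq> S then B\<psi> * (B * g j) else 0)"
      by (simp add: sum_distrib_left)
    also have "(\<Sum>j\<in>I. if cell j \<subseteq> S then B\<psi> * (B * g j) else 0) = (\<Sum>j\<in>I'. B\<psi> * (B * g j))"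
      unfolding I'_def using finite_I by (simp add: sum.inter_filter)
    also have "\<dots> = B * (B\<psi> * (\<Sum>j\<in>I'. g j))" by (simp add: sum_distrib_left mult_ac)
    also have "real (card J) * (B * (B\<psi> * (\<Sum>j\<in>I'. g j))) \<le> real (card J) * (B * (B\<psi> * (LINT x|lebesgue_on S. Gf x)))"
    proof (intro mult_left_mono)
      have "S \<in> sets lebesgue"
      proof -
        have "open (Q n)" if "n \<in> {1..N}" for n by (metis Q[OF that] open_interior)
        then have "Q n \<in> sets lebesgue" if "n \<in> {1..N}" for n using that by simp
        then show ?thesis unfolding S_def using K(1) Om_sets by (intro sets.Int sets.finite_UN sets.Diff) auto
      qed
      then show "(\<Sum>j\<in>I'. g j) \<le> (LINT x|lebesgue_on S. Gf x)"
        unfolding g_def by (intro sum_cells_le[OF Gi G0]) (auto simp: I'_def S_def)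
    qed (use B0 B\<psi>0 in auto)
    finally show ?thesis by (simp add: S_def mult.assoc)
  qed
  have good0: "sum F good = 0"
  proof -
    \<comment> \<open>Good pairs are regrouped by reference point: \<open>H\<close> collects the
      pairs of cube and lattice point, and \<open>s\<close> restores the cell index \<eta> + \<xi>
      from the lattice point and the shift.\<close>
    define H where "H = (\<lambda>(j, \<xi>). (fst j, snd j - \<xi>)) ` good"
    define s where "s = (\<lambda>(q, \<xi>). ((fst q, snd q + \<xi>), \<xi>) :: (nat \<times> (real^'d)) \<times> (real^'d))"
    have H: "n \<in> {1..N} \<and> \<eta> \<in> int_lattice \<and> \<psi> (\<epsilon> *\<^sub>R (A n *v \<eta>)) \<noteq> 0 \<and> ball (\<epsilon> *\<^sub>R (A n *v \<eta>)) (2 * r0) \<subseteq> Q n"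
      if h: "(n, \<eta>) \<in> H" for n \<eta>
    proof -
      obtain j \<xi> where j: "(j, \<xi>) \<in> good" "n = fst j" "\<eta> = snd j - \<xi>" using h by (auto simp: H_def)
      then have "j \<in> I" "\<xi> \<in> J" "\<psi> (pt j \<xi>) \<noteq> 0" "ball (pt j \<xi>) (2 * r0) \<subseteq> Q (fst j)" by (auto simp: good_def)
      moreover have "snd j \<in> int_lattice" using \<open>j \<in> I\<close> I_D(2) Xi_hat_lattice by blast
      moreover have "\<xi> \<in> int_lattice" using \<open>\<xi> \<in> J\<close> by (simp add: J_def lattice_box_def)
      ultimately show ?thesis using I_D(1) j by (auto simp: pt_def int_lattice_def)
    qed
    \<comment> \<open>This makes every group complete: if one shift about \<eta> is good, the cells
      for all shifts in the box are admissible, so the sum over shifts is a full integral.\<close>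
    have inI: "(n, \<eta> + \<xi>) \<in> I" if h: "(n, \<eta>) \<in> H" and \<xi>: "\<xi> \<in> J" for n \<eta> \<xi>
    proof -
      have n: "n \<in> {1..N}" and \<eta>: "\<eta> \<in> int_lattice" "\<psi> (\<epsilon> *\<^sub>R (A n *v \<eta>)) \<noteq> 0" "ball (\<epsilon> *\<^sub>R (A n *v \<eta>)) (2 * r0) \<subseteq> Q n"
        using H[OF h] by auto
      have ptj: "pt (n, \<eta> + \<xi>) \<xi> = \<epsilon> *\<^sub>R (A n *v \<eta>)" by (simp add: pt_def)
      have "cell (n, \<eta> + \<xi>) \<subseteq> ball (\<epsilon> *\<^sub>R (A n *v \<eta>)) (2 * r0)"
      proof
        fix z assume "z \<in> cell (n, \<eta> + \<xi>)"
        then obtain y where y: "z = T (n, \<eta> + \<xi>) y" "y \<in> unit_cell" by (auto simp: cell_def)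
        have "dist z (pt (n, \<eta> + \<xi>) \<xi>) \<le> r0" unfolding y(1)
          by (rule dist_pt[OF _ \<xi>]) (use n y(2) in \<open>auto simp: unit_cell_def less_imp_le\<close>)
        then show "z \<in> ball (\<epsilon> *\<^sub>R (A n *v \<eta>)) (2 * r0)" unfolding ptj using r0p by (simp add: dist_commute)
      qed
      then have sub: "T (n, \<eta> + \<xi>) ` unit_cell \<subseteq> Q n \<inter> \<Omega>" using \<eta>(3) psi(4)[OF \<eta>(2)] unfolding cell_def by blast
      have "(\<chi> i. 1 / 2) \<in> (unit_cell :: (real^'d) set)" by (simp add: unit_cell_def)
      then have "T (n, \<eta> + \<xi>) ` unit_cell \<inter> Q n \<noteq> {}" using sub by blast
      moreover have "\<eta> + \<xi> \<in> int_lattice" using \<eta>(1) \<xi> by (auto simp: int_lattice_def J_def lattice_box_def)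
      ultimately show ?thesis using sub n by (simp add: I_def Xi_hat_def Xi_def scaled_cell_T)
    qed
    have im: "good = s ` (H \<times> J)"
    proof (intro equalityI subsetI)
      fix q assume q: "q \<in> good"
      obtain j \<xi> where j: "q = (j, \<xi>)" by (cases q)
      have "(fst j, snd j - \<xi>) \<in> H" unfolding H_def using q j by force
      moreover have "\<xi> \<in> J" using q j by (auto simp: good_def)
      ultimately show "q \<in> s ` (H \<times> J)"
        by (intro image_eqI[of _ _ "((fst j, snd j - \<xi>), \<xi>)"]) (auto simp: s_def j)
    next
      fix q assume "q \<in> s ` (H \<times> J)"
      then obtain n \<eta> \<xi> where h: "(n, \<eta>) \<in> H" "\<xi> \<in> J" "q = ((n, \<eta> + \<xi>), \<xi>)" by (auto simp: s_def)
      then show "q \<in> good" using inI[OF h(1,2)] H[OF h(1)] by (auto simp: good_def pt_def)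
    qed
    have inj: "inj_on s (H \<times> J)" by (auto simp: inj_on_def s_def)
    have finH: "finite H" unfolding H_def using finite_subset[OF good_sub fin] by simp
    \<comment> \<open>For a complete group the cell integrals add up to one integral over the box
      carrying the test function, where \<open>f0\<close> integrates to zero by the weak gradient of
      w pulled back by the affine map.\<close>
    have zero: "(\<Sum>\<xi>\<in>J. b (n, \<eta> + \<xi>) \<xi>) = 0" if h: "(n, \<eta>) \<in> H" for n \<eta>
    proof -
      have n: "n \<in> {1..N}" and \<eta>: "\<psi> (\<epsilon> *\<^sub>R (A n *v \<eta>)) \<noteq> 0" using H[OF h] by auto
      define U where "U = {y :: real^'d. \<forall>i. \<bar>y $ i\<bar> < real m}"
      have oU: "open U"
      proof -
        have "U = (\<Inter>i. {y. \<bar>y $ i\<bar> < real m})" by (auto simp: U_def)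
        then show ?thesis by (auto intro!: open_INT open_Collect_less continuous_intros)
      qed
      define j where "j = (n, \<eta>)"
      have fj: "fst j \<in> {1..N}" using n by (simp add: j_def)
      have "T j ` U \<subseteq> \<Omega>"
      proof
        fix z assume "z \<in> T j ` U"
        then obtain y where y: "z = T j y" "y \<in> U" by auto
        have "norm y \<le> (\<Sum>i\<in>UNIV. \<bar>y $ i\<bar>)" by (rule norm_le_l1_cart)
        also have "\<dots> \<le> (\<Sum>i\<in>(UNIV :: 'd set). real m + 1)"
          using y(2) by (intro sum_mono) (smt (verit, best) U_def mem_Collect_eq)
        finally have ny: "norm y \<le> real CARD('d) * (real m + 1)" by simp
        have "z - \<epsilon> *\<^sub>R (A n *v \<eta>) = \<epsilon> *\<^sub>R (A n *v y)"
          by (simp add: y(1) T_def j_def matrix_vector_right_distrib scaleR_add_right)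
        then have "dist (\<epsilon> *\<^sub>R (A n *v \<eta>)) z = \<epsilon> * norm (A n *v y)" using eps by (simp add: dist_norm norm_minus_commute)
        also have "\<dots> \<le> \<epsilon> * (a * norm y)" using a(2)[OF n] eps by simp
        also have "\<dots> \<le> r0" unfolding r0 mult.assoc using ny eps a(1) by (intro mult_left_mono) auto
        finally show "z \<in> \<Omega>" using psi(4)[OF \<eta>] r0p by auto
      qed
      then have wg: "has_weak_gradient U (\<lambda>y. w (T j y)) (\<lambda>y. transpose (M j) *v gw (T j y))"
        by (rule has_weak_gradient_T[OF fj oU _ w(3)])
      have phiU: "test_function U \<phi>" using phi(1) by (simp add: U_def)
      have li: "locally_integrable_on (\<lambda>y. w (T j y)) U" "locally_integrable_on (\<lambda>y. transpose (M j) *v gw (T j y)) U"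
        using wg by (auto simp: has_weak_gradient_def)
      define f0 where "f0 = (\<lambda>y. w (T j y) * D y + (transpose (M j) *v gw (T j y)) $ i * \<phi> y)"
      have i1: "integrable (lebesgue_on U) (\<lambda>y. w (T j y) * D y)"
        unfolding D_def by (rule integrable_test_function(2)[OF li(1) oU phiU])
      have i2: "integrable (lebesgue_on U) (\<lambda>y. (transpose (M j) *v gw (T j y)) $ i * \<phi> y)"
        by (rule integrable_test_function(1)[OF locally_integrable_on_component[OF li(2)] oU phiU])
      have "(LINT y|lebesgue_on U. w (T j y) * D y) = - (LINT y|lebesgue_on U. (transpose (M j) *v gw (T j y)) $ i * \<phi> y)"
        using wg phiU unfolding has_weak_gradient_def D_def by blast
      then have z: "(LINT y|lebesgue_on U. f0 y) = 0" unfolding f0_def using i1 i2 by simp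
      obtain K0 where K0: "K0 \<subseteq> U" "\<And>x. x \<notin> K0 \<Longrightarrow> \<phi> x = 0" "\<And>x v. x \<notin> K0 \<Longrightarrow> frechet_derivative \<phi> (at x) v = 0"
        using test_functionD[OF phiU] by metis
      have out: "f0 y = 0" if "y \<notin> U" for y
      proof -
        have "y \<notin> K0" using that K0(1) by blast
        then show ?thesis by (simp add: f0_def D_def K0(2,3))
      qed
      have "integrable (lebesgue_on U) f0" unfolding f0_def using i1 i2 by simp
      then have f0i: "integrable lebesgue f0"
        using integrable_lebesgue_on_cong_support(1)[of UNIV U f0] oU out by (simp add: lebesgue_on_UNIV_eq)
      have f0z: "(LINT y|lebesgue. f0 y) = 0"
        using integrable_lebesgue_on_cong_support(2)[of UNIV U f0] oU out z by (simp add: lebesgue_on_UNIV_eq)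
      have "(LINT y|lebesgue. f0 y) = (\<Sum>\<xi>\<in>J. LINT y|lebesgue_on unit_cell. f0 (y + \<xi>))"
        unfolding J_def by (rule integral_lattice_decomposition[OF f0i]) (rule out, auto simp: U_def not_less)
      moreover have "b (n, \<eta> + \<xi>) \<xi> = (LINT y|lebesgue_on unit_cell. f0 (y + \<xi>))" for \<xi>
      proof -
        have "T (n, \<eta> + \<xi>) y = T j (y + \<xi>)" "M (n, \<eta> + \<xi>) = M j" for y
          by (simp_all add: T_def M_def j_def ac_simps)
        then show ?thesis unfolding b_def f_def f0_def by simp
      qed
      ultimately show ?thesis using f0z by simp
    qed
    have "sum F good = (\<Sum>q\<in>H \<times> J. F (s q))" unfolding im using sum.reindex[OF inj, of F] by simp
    also have "\<dots> = (\<Sum>q\<in>H. \<Sum>\<xi>\<in>J. F (s (q, \<xi>)))" by (simp add: sum.cartesian_product)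
    also have "\<dots> = (\<Sum>q\<in>H. 0)"
    proof (rule sum.cong[OF refl])
      fix q assume "q \<in> H"
      obtain n \<eta> where q: "q = (n, \<eta>)" by (cases q)
      have "F (s (q, \<xi>)) = \<kappa> (n, \<eta>) * \<psi> (\<epsilon> *\<^sub>R (A n *v \<eta>)) * b (n, \<eta> + \<xi>) \<xi>" for \<xi>
        by (simp add: F_def s_def q pt_def \<kappa>_shift)
      then have "(\<Sum>\<xi>\<in>J. F (s (q, \<xi>))) = \<kappa> (n, \<eta>) * \<psi> (\<epsilon> *\<^sub>R (A n *v \<eta>)) * (\<Sum>\<xi>\<in>J. b (n, \<eta> + \<xi>) \<xi>)"
        by (simp add: sum_distrib_left)
      then show "(\<Sum>\<xi>\<in>J. F (s (q, \<xi>))) = 0" using zero \<open>q \<in> H\<close> q by simp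
    qed
    finally show ?thesis by simp
  qed
  show ?thesis
    unfolding E
    using EE' bad E'F good0 unfolding J_def distrib_left by linarith
qed

end

section \<open>Geometry of the cubes\<close>

lemma open_cube_affine:
  fixes Q :: "(real^'d) set"
  assumes Q: "open_cube a Q" and a: "0 < a"
  obtains M :: "real^'d^'d" and c where "invertible M" "Q = (\<lambda>y. M *v y + c) ` unit_cell"
    "\<And>y z. norm (M *v y - M *v z) = a * norm (y - z)"
proof -
  obtain c and R :: "real^'d \<Rightarrow> real^'d" where R: "orthogonal_transformation R"
    and QR: "Q = (\<lambda>z. c + R z) ` {z. \<forall>i. 0 < z $ i \<and> z $ i < a}"
    using Q by (auto simp: open_cube_def)
  have lin: "linear R" and om: "orthogonal_matrix (matrix R)" using R by (auto simp: orthogonal_transformation_matrix)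
  define M where "M = a *\<^sub>R matrix R"
  have Mv: "M *v y = a *\<^sub>R R y" for y
    unfolding M_def scaleR_matrix_vector_assoc[symmetric]
    by (rule arg_cong[where f = "\<lambda>v. a *\<^sub>R v"], rule fun_cong[OF matrix_vector_mul(2)[OF lin]])
  have "invertible (matrix R)" using om by (auto simp: orthogonal_matrix_def invertible_def)
  then have inv: "invertible M" unfolding M_def by (rule invertible_scaleR) (use a in simp)
  have "Q = (\<lambda>y. M *v y + c) ` unit_cell"
  proof (intro equalityI subsetI)
    fix x assume "x \<in> Q"
    then obtain z where z: "x = c + R z" "\<And>i. 0 < z $ i \<and> z $ i < a" unfolding QR by auto
    have "x = M *v ((1 / a) *\<^sub>R z) + c" using a by (simp add: Mv linear_scale[OF lin] z(1))
    moreover have "(1 / a) *\<^sub>R z \<in> unit_cell" using z(2) a by (simp add: unit_cell_def field_simps)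
    ultimately show "x \<in> (\<lambda>y. M *v y + c) ` unit_cell" by blast
  next
    fix x assume "x \<in> (\<lambda>y. M *v y + c) ` unit_cell"
    then obtain y where y: "x = M *v y + c" "y \<in> unit_cell" by auto
    have "x = c + R (a *\<^sub>R y)" by (simp add: y(1) Mv linear_scale[OF lin])
    moreover have "\<forall>i. 0 < (a *\<^sub>R y) $ i \<and> (a *\<^sub>R y) $ i < a" using y(2) a by (simp add: unit_cell_def)
    ultimately show "x \<in> Q" unfolding QR by blast
  qed
  moreover have "norm (M *v y - M *v z) = a * norm (y - z)" for y z
  proof -
    have "M *v y - M *v z = a *\<^sub>R R (y - z)" by (simp add: Mv linear_diff[OF lin] scaleR_diff_right)
    then show ?thesis using a by (simp add: orthogonal_transformation_norm[OF R])
  qed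
  ultimately show ?thesis using inv that by blast
qed

text \<open>An open convex set equals the interior of its closure. The diameter bound goes through
  the l^1 norm, hence the dimension as a factor rather than its root.\<close>

lemma open_cube_regular:
  fixes Q :: "(real^'d) set"
  assumes Q: "open_cube a Q" and a: "0 < a"
  shows "interior (closure Q) = Q" "open Q" "\<And>x y. x \<in> Q \<Longrightarrow> y \<in> Q \<Longrightarrow> dist x y \<le> a * real CARD('d)"
proof -
  obtain M :: "real^'d^'d" and c where M: "invertible M" "Q = (\<lambda>y. M *v y + c) ` unit_cell"
    "\<And>y z. norm (M *v y - M *v z) = a * norm (y - z)"
    by (rule open_cube_affine[OF Q a]) blast
  have "Q = (+) c ` ((*v) M ` unit_cell)" unfolding M(2) image_image by (simp add: add.commute)
  moreover have "convex (unit_cell :: (real^'d) set)" unfolding unit_cell_eq_box by simp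
  ultimately have "convex Q" by (simp add: convex_translation convex_linear_image matrix_affine(1)[OF M(1)])
  moreover show o: "open Q" unfolding M(2) by (rule open_affine_image[OF M(1) open_unit_cell])
  ultimately show "interior (closure Q) = Q" by (simp add: convex_interior_closure interior_open)
  show "dist x y \<le> a * real CARD('d)" if xy: "x \<in> Q" "y \<in> Q" for x y
  proof -
    obtain x' y' where x': "x = M *v x' + c" "x' \<in> unit_cell" and y': "y = M *v y' + c" "y' \<in> unit_cell"
      using xy unfolding M(2) by blast
    have "norm (x' - y') \<le> (\<Sum>i\<in>UNIV. \<bar>(x' - y') $ i\<bar>)" by (rule norm_le_l1_cart)
    also have "\<dots> \<le> (\<Sum>i\<in>(UNIV :: 'd set). 1)"
    proof (rule sum_mono)
      fix i
      have "0 < x' $ i" "x' $ i < 1" "0 < y' $ i" "y' $ i < 1" using x'(2) y'(2) by (auto simp: unit_cell_def)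
      then show "\<bar>(x' - y') $ i\<bar> \<le> 1" unfolding vector_minus_component by linarith
    qed
    finally have n: "norm (x' - y') \<le> real CARD('d)" by simp
    have "dist x y = a * norm (x' - y')" using M(3)[of x' y'] by (simp add: dist_norm x'(1) y'(1))
    then show ?thesis using n a by simp
  qed
qed

text \<open>\<open>K\<close> is the concentric closed cube with faces moved inwards by \<rho>;
  distances scale exactly because the linear map is a times an isometry. With t = \<rho>/a its
  volume fraction is (1 - 2t)^d, at least 1 - 2dt by Bernoulli's inequality.\<close>

lemma open_cube_inner:
  fixes Q :: "(real^'d) set"
  assumes Q: "open_cube a Q" and a: "0 < a" and \<rho>: "0 < \<rho>" "2 * \<rho> \<le> a"
  obtains K where "K \<in> lmeasurable" "\<And>z. z \<in> K \<Longrightarrow> ball z \<rho> \<subseteq> Q" "Q \<in> lmeasurable"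
    "measure lebesgue (Q - K) \<le> 2 * real CARD('d) * \<rho> / a * measure lebesgue Q"
proof -
  obtain M :: "real^'d^'d" and c where M: "invertible M" "Q = (\<lambda>y. M *v y + c) ` unit_cell"
    "\<And>y z. norm (M *v y - M *v z) = a * norm (y - z)"
    by (rule open_cube_affine[OF Q a]) blast
  define T where "T = (\<lambda>y. M *v y + c)"
  define t where "t = \<rho> / a"
  have t: "0 < t" "2 * t \<le> 1" using a \<rho> by (auto simp: t_def field_simps)
  define K0 where "K0 = cbox (\<chi> i. t) ((\<chi> i. 1 - t) :: real^'d)"
  define K where "K = T ` K0"
  have contT: "continuous_on UNIV T" unfolding T_def
    by (intro continuous_intros linear_continuous_on linear_conv_bounded_linear[THEN iffD1] matrix_affine(1)[OF M(1)])
  have "compact K" unfolding K_def K0_def by (intro compact_continuous_image continuous_on_subset[OF contT]) auto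
  then have Ks: "K \<in> sets lebesgue" by (simp add: borel_compact)
  have m: "T ` S \<in> lmeasurable \<and> measure lebesgue (T ` S) = measure lebesgue (T ` unit_cell) * measure lebesgue S"
    if "S \<in> lmeasurable" "T ` S \<in> sets lebesgue" for S
    using affine_cell_change_of_variables(3)[OF M(1) that(1), of c] that(2) unfolding T_def by blast
  have "K0 \<in> lmeasurable" by (simp add: K0_def)
  note mK = m[OF this Ks[unfolded K_def], folded K_def]
  have QT: "Q = T ` unit_cell" unfolding M(2) T_def ..
  have Qs: "Q \<in> sets lebesgue" using open_cube_regular(2)[OF Q a] by simp
  have mQ: "Q \<in> lmeasurable" using m[OF unit_cell_lmeasurable] Qs unfolding QT by blast
  have ball: "ball z \<rho> \<subseteq> Q" if z: "z \<in> K" for z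
  proof
    fix x assume x: "x \<in> ball z \<rho>"
    obtain z' where z': "z = T z'" "z' \<in> K0" using z by (auto simp: K_def)
    define y where "y = matrix_inv M *v (x - c)"
    have xy: "x = T y" by (simp add: T_def y_def matrix_affine(4)[OF M(1)])
    have "a * norm (y - z') < \<rho>" using x M(3)[of y z'] by (simp add: xy z'(1) T_def dist_norm norm_minus_commute)
    then have n: "norm (y - z') < t" using a by (simp add: t_def field_simps)
    have "0 < y $ i \<and> y $ i < 1" for i
    proof -
      have "\<bar>y $ i - z' $ i\<bar> < t" using n component_le_norm_cart[of "y - z'" i] by simp
      moreover have "t \<le> z' $ i" "z' $ i \<le> 1 - t" using z'(2) by (auto simp: K0_def mem_box_cart)
      ultimately show ?thesis by linarith
    qed
    then show "x \<in> Q" unfolding QT xy by (simp add: unit_cell_def)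
  qed
  have KQ: "K \<subseteq> Q"
  proof
    fix z assume "z \<in> K"
    from ball[OF this] show "z \<in> Q" using \<rho> centre_in_ball[of z \<rho>] by blast
  qed
  have "measure lebesgue K0 = (1 - 2 * t) ^ CARD('d)"
  proof -
    have ne: "cbox (\<chi> i. t) ((\<chi> i. 1 - t) :: real^'d) \<noteq> {}" using t by (auto simp: interval_eq_empty_cart not_less)
    show ?thesis unfolding K0_def using content_cbox_cart[OF ne] by simp
  qed
  moreover have "1 + real CARD('d) * (- 2 * t) \<le> (1 + - 2 * t) ^ CARD('d)"
    by (rule Bernoulli_inequality) (use t in simp)
  ultimately have lo: "1 - 2 * real CARD('d) * t \<le> measure lebesgue K0" by simp
  have "measure lebesgue (Q - K) = measure lebesgue Q - measure lebesgue K"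
    using mK mQ KQ by (intro measurable_measure_Diff) auto
  also have "measure lebesgue K = measure lebesgue Q * measure lebesgue K0" using mK QT by simp
  also have "measure lebesgue Q - measure lebesgue Q * measure lebesgue K0 = (1 - measure lebesgue K0) * measure lebesgue Q"
    by (simp add: algebra_simps)
  also have "\<dots> \<le> (2 * real CARD('d) * t) * measure lebesgue Q" using lo by (intro mult_right_mono) auto
  finally have "measure lebesgue (Q - K) \<le> 2 * real CARD('d) * \<rho> / a * measure lebesgue Q" by (simp add: t_def)
  with mK mQ ball that show ?thesis by blast
qed

text \<open>The relative bound for one cube sums up, by disjointness, to a bound by the volume of
  any set containing all cubes, independent of their number. With \<rho> of order \<epsilon> and a =
  \<epsilon>^r it is of order \<epsilon>^(1-r).\<close>

lemma cube_boundary_layer: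
  fixes Q :: "nat \<Rightarrow> (real^'d) set"
  assumes Q: "\<And>n. n \<in> {1..N} \<Longrightarrow> open_cube a (Q n)" and disj: "disjoint_family_on Q {1..N}"
    and a: "0 < a" and \<rho>: "0 < \<rho>" "2 * \<rho> \<le> a" and S: "S \<in> lmeasurable" "\<And>n. n \<in> {1..N} \<Longrightarrow> Q n \<subseteq> S"
  obtains K where "\<And>n. n \<in> {1..N} \<Longrightarrow> K n \<in> sets lebesgue" "\<And>n z. n \<in> {1..N} \<Longrightarrow> z \<in> K n \<Longrightarrow> ball z \<rho> \<subseteq> Q n"
    "measure lebesgue (\<Union>n\<in>{1..N}. Q n - K n) \<le> 2 * real CARD('d) * \<rho> / a * measure lebesgue S"
    "(\<Union>n\<in>{1..N}. Q n - K n) \<in> lmeasurable"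
proof -
  have "\<exists>K. K \<in> lmeasurable \<and> (\<forall>z\<in>K. ball z \<rho> \<subseteq> Q n) \<and> Q n \<in> lmeasurable \<and>
    measure lebesgue (Q n - K) \<le> 2 * real CARD('d) * \<rho> / a * measure lebesgue (Q n)" if "n \<in> {1..N}" for n
    by (rule open_cube_inner[OF Q[OF that] a \<rho>]) blast
  then obtain K where K: "\<And>n. n \<in> {1..N} \<Longrightarrow> K n \<in> lmeasurable \<and> (\<forall>z\<in>K n. ball z \<rho> \<subseteq> Q n) \<and> Q n \<in> lmeasurable \<and>
    measure lebesgue (Q n - K n) \<le> 2 * real CARD('d) * \<rho> / a * measure lebesgue (Q n)"
    by metis
  have d: "Q n - K n \<in> lmeasurable" if "n \<in> {1..N}" for n using K[OF that] by (intro fmeasurable.Diff) auto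
  have Qm: "Q n \<in> lmeasurable" if "n \<in> {1..N}" for n using K[OF that] by blast
  have UQ: "(\<Union>n\<in>{1..N}. Q n) \<in> lmeasurable" using K by (intro fmeasurable.finite_UN) auto
  have "measure lebesgue (\<Union>n\<in>{1..N}. Q n - K n) \<le> (\<Sum>n\<in>{1..N}. measure lebesgue (Q n - K n))"
    using d by (intro measure_UNION_le) auto
  also have "\<dots> \<le> (\<Sum>n\<in>{1..N}. 2 * real CARD('d) * \<rho> / a * measure lebesgue (Q n))"
    using K by (intro sum_mono) blast
  also have "\<dots> = 2 * real CARD('d) * \<rho> / a * (\<Sum>n\<in>{1..N}. measure lebesgue (Q n))" by (rule sum_distrib_left[symmetric])
  also have "(\<Sum>n\<in>{1..N}. measure lebesgue (Q n)) = measure lebesgue (\<Union>n\<in>{1..N}. Q n)"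
    using fmeasurableD[OF Qm] fmeasurableD2[OF Qm] disj by (intro measure_finite_Union[symmetric]) auto
  also have "2 * real CARD('d) * \<rho> / a * \<dots> \<le> 2 * real CARD('d) * \<rho> / a * measure lebesgue S"
  proof (intro mult_left_mono measure_mono_fmeasurable)
    show "(\<Union>n\<in>{1..N}. Q n) \<subseteq> S" using S(2) by blast
  qed (use UQ S a \<rho> in auto)
  finally have "measure lebesgue (\<Union>n\<in>{1..N}. Q n - K n) \<le> 2 * real CARD('d) * \<rho> / a * measure lebesgue S" .
  moreover have "(\<Union>n\<in>{1..N}. Q n - K n) \<in> lmeasurable" using d by (intro fmeasurable.finite_UN) auto
  ultimately show ?thesis using K that[of K] by blast
qed

section \<open>Periodic limits\<close>

text \<open>A compact set meets finitely many translates of the cell, and on each of them the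
  extension is a translate of \<open>v\<close>.\<close>

lemma integrable_periodic_extension:
  fixes v :: "real^'d \<Rightarrow> 'b::euclidean_space"
  assumes v: "integrable (lebesgue_on unit_cell) v"
  shows "locally_integrable_on (\<lambda>y. v (y - int_part y)) UNIV"
  unfolding locally_integrable_on_def
proof (intro allI impI)
  fix K :: "(real^'d) set" assume "compact K \<and> K \<subseteq> UNIV"
  then have K: "compact K" by simp
  then obtain r where r: "\<And>y. y \<in> K \<Longrightarrow> norm y \<le> r" using compact_imp_bounded bounded_iff by metis
  \<comment> \<open>The additional 1 accounts for the integer part lying up to 1 below the
    coordinate.\<close>
  obtain m :: nat where m: "r + 1 \<le> real m" using real_arch_simple by blast
  let ?v = "\<lambda>y. v (y - int_part y)"
  let ?C = "\<lambda>\<xi>. (\<lambda>y. y + \<xi>) ` (unit_cell :: (real^'d) set)"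
  have C: "?C \<xi> \<in> sets lebesgue" for \<xi> :: "real^'d"
    using open_translation[OF open_unit_cell, of \<xi>] by (simp add: add.commute)
  have ip: "int_part (y + \<xi>) = \<xi>" if "y \<in> unit_cell" "\<xi> \<in> int_lattice" for y \<xi> :: "real^'d"
    by (rule int_part_unique[OF that(2)]) (use that(1) in \<open>auto simp: unit_cell_def less_imp_le\<close>)
  have cell: "integrable lebesgue (\<lambda>y. indicat_real (?C \<xi>) y *\<^sub>R ?v y)" if \<xi>: "\<xi> \<in> int_lattice" for \<xi> :: "real^'d"
  proof -
    have eq: "v (y + - \<xi>) = ?v y" if "y \<in> ?C \<xi>" for y
      using that ip \<xi> by auto
    have im: "(\<lambda>y. y + - \<xi>) ` (?C \<xi>) = unit_cell" by (simp add: image_image)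
    have "integrable (lebesgue_on (?C \<xi>)) (\<lambda>y. v (y + - \<xi>)) \<longleftrightarrow> integrable (lebesgue_on ((\<lambda>y. y + - \<xi>) ` (?C \<xi>))) v"
    proof -
      obtain k where k: "0 < k" "(\<lambda>y. y + - \<xi>) \<in> lebesgue \<rightarrow>\<^sub>M (lebesgue :: (real^'d) measure)"
          "distr lebesgue lebesgue (\<lambda>y. y + - \<xi>) = density lebesgue (\<lambda>_. ennreal k)"
        by (rule affine_lebesgue[of "\<lambda>y. y" "- \<xi>"]) (auto simp: linear_iff bij_def)
      show ?thesis
      proof (rule affine_change_of_variables(2)[OF k(2,1,3) _ C], unfold im)
        show "inj (\<lambda>y. y + - \<xi>)" by (simp add: inj_def)
        show "unit_cell \<in> sets (lebesgue :: (real^'d) measure)" using unit_cell_lmeasurable by (rule fmeasurableD)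
        show "v \<in> borel_measurable (lebesgue_on unit_cell)" by (rule borel_measurable_integrable[OF v])
      qed
    qed
    then have "integrable (lebesgue_on (?C \<xi>)) (\<lambda>y. v (y + - \<xi>))" unfolding im using v by blast
    then have "integrable (lebesgue_on (?C \<xi>)) ?v"
      by (subst Bochner_Integration.integrable_cong[OF refl, of _ _ "\<lambda>y. v (y + - \<xi>)"]) (use eq in auto)
    then show ?thesis using C by (simp add: integrable_restrict_space)
  qed
  define h where "h = (\<lambda>y. \<Sum>\<xi>\<in>lattice_box m. indicat_real (?C \<xi>) y *\<^sub>R ?v y)"
  have "integrable lebesgue h" unfolding h_def
    by (rule Bochner_Integration.integrable_sum) (rule cell, simp add: lattice_box_def)
  then have hi: "integrable lebesgue (\<lambda>y. indicat_real K y *\<^sub>R h y)"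
  proof (rule integrable_bounded_scaleR[where B = 1])
    have "K \<in> sets lebesgue" using K by (simp add: borel_compact)
    then show "indicat_real K \<in> borel_measurable lebesgue" by (rule borel_measurable_indicator)
  qed (auto split: split_indicator)
  have ae: "AE y in lebesgue. indicat_real K y *\<^sub>R h y = indicat_real K y *\<^sub>R ?v y"
    using AE_no_integer_coordinate
  proof eventually_elim
    case (elim y)
    show ?case
    proof (cases "y \<in> K")
      case True
      define \<xi> where "\<xi> = int_part y"
      have "y - \<xi> \<in> unit_cell"
      proof -
        have "0 < (y - \<xi>) $ i \<and> (y - \<xi>) $ i < 1" for i
        proof -
          have "(y - \<xi>) $ i \<noteq> 0" using elim by (auto simp: \<xi>_def int_part_def) (metis Ints_of_int)
          then show ?thesis using int_part_bounds[of y i] by (simp add: \<xi>_def less_le)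
        qed
        then show ?thesis by (simp add: unit_cell_def)
      qed
      then have y\<xi>: "y \<in> ?C \<xi>" by (intro image_eqI[of _ _ "y - \<xi>"]) auto
      have lat: "\<xi> \<in> lattice_box m"
      proof -
        have "\<bar>\<xi> $ i\<bar> \<le> real m" for i
          using int_part_bounds[of y i] component_le_norm_cart[of y i] r[OF True] m by (simp add: \<xi>_def)
        then show ?thesis using int_part_lattice[of y] by (simp add: lattice_box_def \<xi>_def)
      qed
      have "indicat_real (?C \<eta>) y = (if \<eta> = \<xi> then 1 else 0)" if "\<eta> \<in> lattice_box m" for \<eta>
        using y\<xi> ip[of _ \<eta>] that by (auto simp: \<xi>_def indicator_def lattice_box_def)
      then have "h y = (\<Sum>\<eta>\<in>lattice_box m. (if \<eta> = \<xi> then ?v y else 0))"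
        unfolding h_def by (intro sum.cong) auto
      then show ?thesis using lat by (simp add: finite_lattice_box)
    qed simp
  qed
  have "integrable lebesgue (\<lambda>y. indicat_real K y *\<^sub>R ?v y)"
  proof (rule integrable_cong_AE_imp[OF hi])
    have U: "UNIV \<in> sets (lebesgue :: (real^'d) measure)" by simp
    have "(\<lambda>y. indicat_real K y *\<^sub>R h y) \<in> borel_measurable (lebesgue_on UNIV)"
      using hi by (simp add: lebesgue_on_UNIV_eq)
    then show "(\<lambda>y. indicat_real K y *\<^sub>R ?v y) \<in> borel_measurable lebesgue"
      using borel_measurable_lebesgue_on_AE_cong[of "\<lambda>y. indicat_real K y *\<^sub>R h y" UNIV "\<lambda>y. indicat_real K y *\<^sub>R ?v y"] ae U
      unfolding lebesgue_on_UNIV_eq by blast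
  qed (use ae in auto)
  then show "integrable (lebesgue_on K) ?v" using K by (simp add: integrable_restrict_space borel_compact)
qed

lemma integrable_weak_pairing:
  fixes u :: "'x \<Rightarrow> real" and g :: "'x \<Rightarrow> real^'d"
  assumes "integrable M u" "integrable M g" "\<alpha> \<in> borel_measurable M" "\<beta> \<in> borel_measurable M"
    and "\<And>x. \<bar>\<alpha> x\<bar> \<le> B" "\<And>x. \<bar>\<beta> x\<bar> \<le> B"
  shows "integrable M (\<lambda>x. u x * \<alpha> x + g x $ i * \<beta> x)"
    "\<bar>LINT x|M. u x * \<alpha> x + g x $ i * \<beta> x\<bar> \<le> B * (LINT x|M. norm (u x) + norm (g x))"
proof -
  have "integrable M (\<lambda>x. \<alpha> x *\<^sub>R u x)" "integrable M (\<lambda>x. \<beta> x *\<^sub>R g x)"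
    using integrable_bounded_scaleR assms by blast+
  moreover from this(2) have "integrable M (\<lambda>x. (\<beta> x *\<^sub>R g x) $ i)"
    by (rule integrable_bounded_linear[OF bounded_linear_vec_nth])
  ultimately have "integrable M (\<lambda>x. \<alpha> x *\<^sub>R u x + (\<beta> x *\<^sub>R g x) $ i)" by (intro Bochner_Integration.integrable_add)
  then show i: "integrable M (\<lambda>x. u x * \<alpha> x + g x $ i * \<beta> x)" by (simp add: mult.commute)
  have "\<bar>LINT x|M. u x * \<alpha> x + g x $ i * \<beta> x\<bar> \<le> (LINT x|M. \<bar>u x * \<alpha> x + g x $ i * \<beta> x\<bar>)"
    by (rule integral_abs_bound)
  also have "\<dots> \<le> (LINT x|M. B * (norm (u x) + norm (g x)))"
  proof (rule integral_mono)
    fix x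
    have "\<bar>u x * \<alpha> x + g x $ i * \<beta> x\<bar> \<le> \<bar>u x\<bar> * \<bar>\<alpha> x\<bar> + \<bar>g x $ i\<bar> * \<bar>\<beta> x\<bar>"
      by (rule order_trans[OF abs_triangle_ineq]) (simp add: abs_mult)
    also have "\<dots> \<le> \<bar>u x\<bar> * B + norm (g x) * B"
      using assms(5,6)[of x] component_le_norm_cart[of "g x" i] by (intro add_mono mult_mono) auto
    finally show "\<bar>u x * \<alpha> x + g x $ i * \<beta> x\<bar> \<le> B * (norm (u x) + norm (g x))" by (simp add: algebra_simps)
  qed (use i assms(1,2) in auto)
  finally show "\<bar>LINT x|M. u x * \<alpha> x + g x $ i * \<beta> x\<bar> \<le> B * (LINT x|M. norm (u x) + norm (g x))" by simp
qed

text \<open>Exchanges quantifiers: the exceptional null set, which depends on the test function, is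
  made common to all of them. A countable sup-dense subfamily is enough, because for almost every x
  the functional is Lipschitz in the sup norm with a constant depending on x.\<close>

lemma sup_dense_AE:
  fixes \<F> :: "('c::euclidean_space \<Rightarrow> 'b::euclidean_space) set" and L :: "'x \<Rightarrow> ('c \<Rightarrow> 'b) \<Rightarrow> real"
  assumes cont: "\<And>f. f \<in> \<F> \<Longrightarrow> continuous_on UNIV f" and K: "compact K" "\<And>f x. f \<in> \<F> \<Longrightarrow> x \<notin> K \<Longrightarrow> f x = 0"
    and zero: "\<And>f. f \<in> \<F> \<Longrightarrow> AE x in M. L x f = 0"
    and bound: "AE x in M. \<exists>B. \<forall>f\<in>\<F>. \<forall>f'\<in>\<F>. \<forall>e>0. (\<forall>y. norm (f y - f' y) \<le> e) \<longrightarrow> \<bar>L x f - L x f'\<bar> \<le> B * e"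
  shows "AE x in M. \<forall>f\<in>\<F>. L x f = 0"
proof -
  obtain \<C> where C: "countable \<C>" "\<C> \<subseteq> \<F>" "\<And>f e. f \<in> \<F> \<Longrightarrow> 0 < e \<Longrightarrow> \<exists>f'\<in>\<C>. \<forall>x. norm (f x - f' x) \<le> e"
  proof (rule countable_sup_dense_subset[of \<F> K])
    show "continuous_on UNIV f" if "f \<in> \<F>" for f using that by (rule cont)
    show "f x = 0" if "f \<in> \<F>" "x \<notin> K" for f x using that by (rule K(2))
  qed (simp add: K(1), blast)
  have "AE x in M. \<forall>f\<in>\<C>. L x f = 0" using C(1,2) zero by (intro AE_ball_countable[THEN iffD2]) blast+
  then show ?thesis using bound
  proof eventually_elim
    case (elim x)
    then obtain B where B: "\<And>f f' e. f \<in> \<F> \<Longrightarrow> f' \<in> \<F> \<Longrightarrow> 0 < e \<Longrightarrow> (\<forall>y. norm (f y - f' y) \<le> e) \<Longrightarrow> \<bar>L x f - L x f'\<bar> \<le> B * e"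
      by meson
    show ?case
    proof
      fix f assume f: "f \<in> \<F>"
      have "\<bar>L x f\<bar> \<le> e" if e: "0 < e" for e
      proof -
        define d where "d = e / (\<bar>B\<bar> + 1)"
        have d: "0 < d" using e by (simp add: d_def)
        obtain f' where f': "f' \<in> \<C>" "\<forall>x. norm (f x - f' x) \<le> d" using C(3)[OF f d] by blast
        then have "\<bar>L x f\<bar> \<le> B * d" using B[OF f _ d] elim(1) C(2) by fastforce
        also have "\<dots> \<le> (\<bar>B\<bar> + 1) * d" using d by (intro mult_right_mono) auto
        also have "\<dots> = e" by (simp add: d_def)
        finally show ?thesis .
      qed
      then have "\<bar>L x f\<bar> \<le> 0" by (rule field_le_epsilon[where y = 0, simplified]) 
      then show "L x f = 0" by simp
    qed
  qed
qed

text \<open>Assumption \<open>zero\<close> is the weak gradient identity of the periodic extension,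
  integrated in x with weight \<psi> and written over one cell. Localising in x and making the null
  set independent of \<phi> turns it into a statement about almost every fibre.\<close>

lemma periodic_limit:
  fixes u :: "(real^'d) \<times> (real^'d) \<Rightarrow> real" and g :: "(real^'d) \<times> (real^'d) \<Rightarrow> real^'d"
  assumes Om: "open \<Omega>" "bounded \<Omega>"
    and u: "integrable (lebesgue_on \<Omega> \<Otimes>\<^sub>M lebesgue_on unit_cell) u" and g: "integrable (lebesgue_on \<Omega> \<Otimes>\<^sub>M lebesgue_on unit_cell) g"
    and zero: "\<And>m \<phi> i \<psi>. test_function {y. \<forall>i. \<bar>y $ i\<bar> < real m} \<phi> \<Longrightarrow> test_function \<Omega> \<psi> \<Longrightarrow>
      integral\<^sup>L (lebesgue_on \<Omega> \<Otimes>\<^sub>M lebesgue_on unit_cell) (\<lambda>z. \<psi> (fst z) *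
        (u z * (\<Sum>\<xi>\<in>lattice_box m. frechet_derivative \<phi> (at (snd z + \<xi>)) (axis i 1))
         + g z $ i * (\<Sum>\<xi>\<in>lattice_box m. \<phi> (snd z + \<xi>)))) = 0"
  shows "AE x in lebesgue_on \<Omega>. has_weak_gradient UNIV (\<lambda>y. u (x, y - int_part y)) (\<lambda>y. g (x, y - int_part y))"
proof -
  let ?Y = "lebesgue_on (unit_cell :: (real^'d) set)"
  have Oms: "\<Omega> \<in> sets lebesgue" using Om by simp
  have Ys: "unit_cell \<in> sets (lebesgue :: (real^'d) measure)" using unit_cell_lmeasurable by (rule fmeasurableD)
  interpret pair_sigma_finite "lebesgue_on \<Omega>" ?Y
    by (intro pair_sigma_finite.intro sigma_finite_lebesgue_on Oms Ys)
  define Bx where "Bx = (\<lambda>m::nat. {y :: real^'d. \<forall>i. \<bar>y $ i\<bar> < real m})"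
  \<comment> \<open>A test function is paired with one of its partial derivatives, so that closeness
    in the sup norm of the pair controls both terms of the identity.\<close>
  define \<F> where "\<F> = (\<lambda>m i. {f. \<exists>\<phi>. test_function (Bx m) \<phi> \<and> f = (\<lambda>y. (\<phi> y, frechet_derivative \<phi> (at y) (axis i 1)))})"
  define s where "s = (\<lambda>m (f :: real^'d \<Rightarrow> real \<times> real) y. \<Sum>\<xi>\<in>lattice_box m. f (y + \<xi>))"
  define L where "L = (\<lambda>m i x f. LINT y|?Y. u (x, y) * snd (s m f y) + g (x, y) $ i * fst (s m f y))"
  define K where "K = (\<lambda>m::nat. cbox (\<chi> i. - real m) ((\<chi> i. real m) :: real^'d))"
  have BK: "Bx m \<subseteq> K m" for m by (auto simp: Bx_def K_def mem_box_cart abs_less_iff less_imp_le minus_less_iff)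
  have cont: "continuous_on UNIV f" if "f \<in> \<F> m i" for f m i
    using that by (auto simp: \<F>_def intro!: continuous_on_Pair test_function_continuous)
  have out: "f y = 0" if "f \<in> \<F> m i" "y \<notin> Bx m" for f m i y
  proof -
    obtain \<phi> where phi: "test_function (Bx m) \<phi>" "f = (\<lambda>y. (\<phi> y, frechet_derivative \<phi> (at y) (axis i 1)))"
      using \<open>f \<in> \<F> m i\<close> by (auto simp: \<F>_def)
    obtain C where "C \<subseteq> Bx m" "\<And>x. x \<notin> C \<Longrightarrow> \<phi> x = 0" "\<And>x v. x \<notin> C \<Longrightarrow> frechet_derivative \<phi> (at x) v = 0"
      using test_functionD[OF phi(1)] by metis
    then show ?thesis using that(2) unfolding phi(2) by (metis subsetD zero_prod_def)
  qed
  have bdd: "\<exists>B. \<forall>y. norm (f y) \<le> B" if f: "f \<in> \<F> m i" for f m i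
  proof -
    have "compact (f ` K m)" by (rule compact_continuous_image[OF continuous_on_subset[OF cont[OF f]]]) (auto simp: K_def)
    then obtain B where B: "\<And>y. y \<in> K m \<Longrightarrow> norm (f y) \<le> B" by (metis bounded_iff compact_imp_bounded imageI)
    have "norm (f y) \<le> max B 0" for y
      using B[of y] out[OF f, of y] BK[of m] by (cases "y \<in> Bx m") auto
    then show ?thesis by blast
  qed
  have s_cont: "continuous_on UNIV (s m f)" if "f \<in> \<F> m i" for f m i
  proof -
    have "continuous_on UNIV (\<lambda>y. f (y + \<xi>))" for \<xi>
      by (rule continuous_on_compose2[OF cont[OF that]]) (auto intro: continuous_intros)
    then show ?thesis unfolding s_def by (intro continuous_on_sum)
  qed
  have s_le: "norm (s m f y) \<le> real (card (lattice_box m :: (real^'d) set)) * B" if "\<And>y. norm (f y) \<le> B" for m f y B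
    unfolding s_def by (rule order_trans[OF norm_sum]) (rule sum_bounded_above, rule that)
  have sY: "(\<lambda>y. fst (s m f y)) \<in> borel_measurable (lebesgue_on S)" "(\<lambda>y. snd (s m f y)) \<in> borel_measurable (lebesgue_on S)"
    if "f \<in> \<F> m i" for f m i S
    by (intro continuous_measurable_lebesgue_on continuous_intros s_cont[OF that])+
  have Hint: "integrable (lebesgue_on \<Omega> \<Otimes>\<^sub>M ?Y) (\<lambda>z. u z * snd (s m f (snd z)) + g z $ i * fst (s m f (snd z)))"
    if f: "f \<in> \<F> m i" for f m i
  proof -
    obtain B where B: "\<And>y. norm (f y) \<le> B" using bdd[OF f] by blast
    note b = s_le[where f = f and m = m and B = B, OF B]
    show ?thesis
    proof (rule integrable_weak_pairing[OF u g])
      show "(\<lambda>z. snd (s m f (snd z))) \<in> borel_measurable (lebesgue_on \<Omega> \<Otimes>\<^sub>M ?Y)" "(\<lambda>z. fst (s m f (snd z))) \<in> borel_measurable (lebesgue_on \<Omega> \<Otimes>\<^sub>M ?Y)"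
        by (rule measurable_compose[OF measurable_snd sY(2)[OF f]], rule measurable_compose[OF measurable_snd sY(1)[OF f]])
      show "\<bar>snd (s m f (snd z))\<bar> \<le> real (card (lattice_box m :: (real^'d) set)) * B" "\<bar>fst (s m f (snd z))\<bar> \<le> real (card (lattice_box m :: (real^'d) set)) * B" for z :: "(real^'d) \<times> (real^'d)"
        using b[of "snd z"] norm_fst_le[of "fst (s m f (snd z))" "snd (s m f (snd z))"] norm_snd_le[of "snd (s m f (snd z))" "fst (s m f (snd z))"] by auto
    qed
  qed
  \<comment> \<open>The fundamental lemma in the variable x, with \<psi> as test function, makes the
    fibrewise functional vanish for almost every x while \<phi> is fixed.\<close>
  have L0: "AE x in lebesgue_on \<Omega>. L m i x f = 0" if f: "f \<in> \<F> m i" for f m i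
  proof (rule fundamental_lemma[OF _ Om(1)])
    let ?H = "\<lambda>z. u z * snd (s m f (snd z)) + g z $ i * fst (s m f (snd z))"
    obtain \<phi> where phi: "test_function (Bx m) \<phi>" "f = (\<lambda>y. (\<phi> y, frechet_derivative \<phi> (at y) (axis i 1)))"
      using f by (auto simp: \<F>_def)
    have "integrable (lebesgue_on \<Omega>) (\<lambda>x. LINT y|?Y. ?H (x, y))" by (rule integrable_fst'[OF Hint[OF f]])
    then have Li: "integrable (lebesgue_on \<Omega>) (\<lambda>x. L m i x f)" by (simp add: L_def)
    then show "locally_integrable_on (\<lambda>x. L m i x f) \<Omega>"
      unfolding locally_integrable_on_def using integrable_lebesgue_on_subset(1)[OF Li Oms] by (simp add: borel_compact)
    fix \<psi> assume psi: "test_function \<Omega> \<psi>"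
    obtain B where B: "\<And>x. \<bar>\<psi> x\<bar> \<le> B" using test_function_bounded[OF psi] by metis
    have pm: "\<psi> \<in> borel_measurable (lebesgue_on \<Omega>)"
      by (rule continuous_measurable_lebesgue_on[OF test_function_continuous(1)[OF psi]])
    have "integrable (lebesgue_on \<Omega> \<Otimes>\<^sub>M ?Y) (\<lambda>z. \<psi> (fst z) *\<^sub>R ?H z)"
      by (rule integrable_bounded_scaleR[OF Hint[OF f] measurable_compose[OF measurable_fst pm] B])
    from integral_fst'[OF this]
    have "(LINT x|lebesgue_on \<Omega>. LINT y|?Y. \<psi> x * ?H (x, y)) = integral\<^sup>L (lebesgue_on \<Omega> \<Otimes>\<^sub>M ?Y) (\<lambda>z. \<psi> (fst z) * ?H z)" by simp
    also have "\<dots> = 0"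
      using zero[OF phi(1)[unfolded Bx_def] psi, of i] by (simp add: s_def phi(2) fst_sum snd_sum)
    finally show "(LINT x|lebesgue_on \<Omega>. L m i x f * \<psi> x) = 0" by (simp add: L_def mult.commute)
  qed
  have ui: "AE x in lebesgue_on \<Omega>. integrable ?Y (\<lambda>y. u (x, y))" and gi: "AE x in lebesgue_on \<Omega>. integrable ?Y (\<lambda>y. g (x, y))"
    using AE_integrable_fst' u g by auto
  have bound: "\<exists>B. \<forall>f\<in>\<F> m i. \<forall>f'\<in>\<F> m i. \<forall>e>0. (\<forall>y. norm (f y - f' y) \<le> e) \<longrightarrow> \<bar>L m i x f - L m i x f'\<bar> \<le> B * e"
    if x: "integrable ?Y (\<lambda>y. u (x, y))" "integrable ?Y (\<lambda>y. g (x, y))" for x m i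
  proof (intro exI ballI allI impI)
    fix f f' and e :: real assume f: "f \<in> \<F> m i" "f' \<in> \<F> m i" and e: "0 < e" "\<forall>y. norm (f y - f' y) \<le> e"
    let ?c = "real (card (lattice_box m :: (real^'d) set))"
    have Li: "integrable ?Y (\<lambda>y. u (x, y) * snd (s m f y) + g (x, y) $ i * fst (s m f y))" if f: "f \<in> \<F> m i" for f
    proof -
      obtain B where B: "\<And>y. norm (f y) \<le> B" using bdd[OF f] by blast
      note b = s_le[where f = f and m = m and B = B, OF B]
      show ?thesis
      proof (rule integrable_weak_pairing[OF x sY(2,1)[OF f]])
        show "\<bar>snd (s m f y)\<bar> \<le> ?c * B" "\<bar>fst (s m f y)\<bar> \<le> ?c * B" for y
          using b[of y] norm_fst_le[of "fst (s m f y)" "snd (s m f y)"] norm_snd_le[of "snd (s m f y)" "fst (s m f y)"] by auto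
      qed
    qed
    have sd: "s m f y - s m f' y = s m (\<lambda>y. f y - f' y) y" for y by (simp add: s_def sum_subtractf)
    have "L m i x f - L m i x f' = (LINT y|?Y. u (x, y) * snd (s m f y - s m f' y) + g (x, y) $ i * fst (s m f y - s m f' y))"
      unfolding L_def using Li[OF f(1)] Li[OF f(2)]
      by (subst Bochner_Integration.integral_diff[symmetric]) (auto intro!: Bochner_Integration.integral_cong simp: algebra_simps)
    also have "\<bar>\<dots>\<bar> \<le> (?c * e) * (LINT y|?Y. norm (u (x, y)) + norm (g (x, y)))"
    proof (rule integrable_weak_pairing(2)[OF x])
      show "(\<lambda>y. snd (s m f y - s m f' y)) \<in> borel_measurable ?Y" "(\<lambda>y. fst (s m f y - s m f' y)) \<in> borel_measurable ?Y"
        using sY[OF f(1)] sY[OF f(2)] by auto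
      have fs: "\<bar>fst q\<bar> \<le> norm q" "\<bar>snd q\<bar> \<le> norm q" for q :: "real \<times> real"
        by (metis norm_fst_le prod.collapse real_norm_def, metis norm_snd_le prod.collapse real_norm_def)
      have n: "norm (s m f y - s m f' y) \<le> ?c * e" for y unfolding sd by (rule s_le) (use e in blast)
      show "\<bar>snd (s m f y - s m f' y)\<bar> \<le> ?c * e" "\<bar>fst (s m f y - s m f' y)\<bar> \<le> ?c * e" for y
        by (rule order_trans[OF fs(2) n], rule order_trans[OF fs(1) n])
    qed
    finally show "\<bar>L m i x f - L m i x f'\<bar> \<le> (?c * (LINT y|?Y. norm (u (x, y)) + norm (g (x, y)))) * e"
      by (simp add: mult_ac)
  qed
  have "AE x in lebesgue_on \<Omega>. \<forall>f\<in>\<F> m i. L m i x f = 0" for m i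
  proof (rule sup_dense_AE[of "\<F> m i" "K m"])
    show "AE x in lebesgue_on \<Omega>. \<exists>B. \<forall>f\<in>\<F> m i. \<forall>f'\<in>\<F> m i. \<forall>e>0. (\<forall>y. norm (f y - f' y) \<le> e) \<longrightarrow> \<bar>L m i x f - L m i x f'\<bar> \<le> B * e"
      using ui gi by eventually_elim (rule bound)
    show "compact (K m)" by (simp add: K_def)
    show "f y = 0" if "f \<in> \<F> m i" "y \<notin> K m" for f y using out[OF that(1)] BK[of m] that(2) by blast
  qed (use cont L0 in auto)
  then have "AE x in lebesgue_on \<Omega>. \<forall>m i. \<forall>f\<in>\<F> m i. L m i x f = 0"
    by (simp add: AE_all_countable)
  then show ?thesis using ui gi
  proof eventually_elim
    case (elim x)
    let ?u = "\<lambda>y. u (x, y - int_part y)" and ?g = "\<lambda>y. g (x, y - int_part y)"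
    have lu: "locally_integrable_on ?u UNIV" and lg: "locally_integrable_on ?g UNIV"
      using integrable_periodic_extension[OF elim(2)] integrable_periodic_extension[OF elim(3)] by auto
    show ?case unfolding has_weak_gradient_def
    proof (intro conjI lu lg allI impI)
      fix \<phi> :: "real^'d \<Rightarrow> real" and i :: 'd assume phi: "test_function UNIV \<phi>"
      define D where "D = (\<lambda>y. frechet_derivative \<phi> (at y) (axis i 1))"
      have "bounded (closure {x. \<phi> x \<noteq> 0})" using phi by (auto simp: test_function_def compact_imp_bounded)
      then obtain r where r: "\<And>y. y \<in> closure {x. \<phi> x \<noteq> 0} \<Longrightarrow> norm y \<le> r" by (metis bounded_iff)
      \<comment> \<open>A test function on the whole space has compact support and therefore belongs
        to one of the countably many classes indexed by boxes.\<close>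
      obtain m :: nat where m: "r < real m" using reals_Archimedean2 by blast
      have "closure {x. \<phi> x \<noteq> 0} \<subseteq> Bx m"
      proof
        fix y assume "y \<in> closure {x. \<phi> x \<noteq> 0}"
        then have "\<bar>y $ i\<bar> < real m" for i using r[of y] m component_le_norm_cart[of y i] by linarith
        then show "y \<in> Bx m" by (simp add: Bx_def)
      qed
      then have phim: "test_function (Bx m) \<phi>" using phi by (simp add: test_function_def)
      define f where "f = (\<lambda>y. (\<phi> y, D y))"
      have f: "f \<in> \<F> m i" using phim by (auto simp: \<F>_def f_def D_def)
      define f0 where "f0 = (\<lambda>y. ?u y * D y + ?g y $ i * \<phi> y)"
      have i1: "integrable lebesgue (\<lambda>y. ?u y * D y)" unfolding D_def
        using integrable_test_function(2)[OF lu open_UNIV phi] by (simp add: lebesgue_on_UNIV_eq)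
      have i2: "integrable lebesgue (\<lambda>y. ?g y $ i * \<phi> y)"
        using integrable_test_function(1)[OF locally_integrable_on_component[OF lg] open_UNIV phi] by (simp add: lebesgue_on_UNIV_eq)
      have f0: "integrable lebesgue f0" unfolding f0_def using i1 i2 by simp
      have ip: "int_part (y + \<xi>) = \<xi>" if "y \<in> unit_cell" "\<xi> \<in> int_lattice" for y \<xi> :: "real^'d"
        by (rule int_part_unique[OF that(2)]) (use that(1) in \<open>auto simp: unit_cell_def less_imp_le\<close>)
      have sh: "f0 (y + \<xi>) = u (x, y) * D (y + \<xi>) + g (x, y) $ i * \<phi> (y + \<xi>)" if "y \<in> unit_cell" "\<xi> \<in> lattice_box m" for y \<xi>
        unfolding f0_def using ip[OF that(1), of \<xi>] that(2) by (simp add: lattice_box_def)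
      have shi: "integrable ?Y (\<lambda>y. u (x, y) * D (y + \<xi>) + g (x, y) $ i * \<phi> (y + \<xi>))" for \<xi>
      proof -
        obtain B where B: "\<And>y. norm (f y) \<le> B" using bdd[OF f] by blast
        have c: "continuous_on UNIV (\<lambda>y. f (y + \<xi>))"
          by (rule continuous_on_compose2[OF cont[OF f]]) (auto intro: continuous_intros)
        show ?thesis
        proof (rule integrable_weak_pairing[OF elim(2,3)])
          show "(\<lambda>y. D (y + \<xi>)) \<in> borel_measurable ?Y" "(\<lambda>y. \<phi> (y + \<xi>)) \<in> borel_measurable ?Y"
            using continuous_on_snd[OF c] continuous_on_fst[OF c]
            by (auto intro!: continuous_measurable_lebesgue_on simp: f_def)
          show "\<bar>D (y + \<xi>)\<bar> \<le> B" "\<bar>\<phi> (y + \<xi>)\<bar> \<le> B" for y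
            using B[of "y + \<xi>"] norm_fst_le[of "\<phi> (y + \<xi>)" "D (y + \<xi>)"] norm_snd_le[of "D (y + \<xi>)" "\<phi> (y + \<xi>)"] by (auto simp: f_def)
        qed
      qed
      have "(LINT y|lebesgue. f0 y) = (\<Sum>\<xi>\<in>lattice_box m. LINT y|?Y. f0 (y + \<xi>))"
      proof (rule integral_lattice_decomposition[OF f0])
        fix y :: "real^'d" assume "\<exists>i. real m \<le> \<bar>y $ i\<bar>"
        then have "y \<notin> Bx m" by (auto simp: Bx_def not_less)
        from out[OF f this] show "f0 y = 0" by (simp add: f_def f0_def zero_prod_def)
      qed
      also have "\<dots> = (\<Sum>\<xi>\<in>lattice_box m. LINT y|?Y. u (x, y) * D (y + \<xi>) + g (x, y) $ i * \<phi> (y + \<xi>))"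
        by (intro sum.cong refl Bochner_Integration.integral_cong) (use sh in auto)
      also have "\<dots> = (LINT y|?Y. (\<Sum>\<xi>\<in>lattice_box m. u (x, y) * D (y + \<xi>) + g (x, y) $ i * \<phi> (y + \<xi>)))"
        by (rule Bochner_Integration.integral_sum[symmetric]) (rule shi)
      also have "\<dots> = L m i x f"
        unfolding L_def s_def f_def by (simp add: fst_sum snd_sum sum.distrib sum_distrib_left)
      also have "\<dots> = 0" using elim(1) f by blast
      finally have "(LINT y|lebesgue. ?u y * D y) + (LINT y|lebesgue. ?g y $ i * \<phi> y) = 0"
        unfolding f0_def using i1 i2 by simp
      then show "(LINT y|lebesgue_on UNIV. ?u y * frechet_derivative \<phi> (at y) (axis i 1)) = - (LINT y|lebesgue_on UNIV. ?g y $ i * \<phi> y)"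
        by (simp add: lebesgue_on_UNIV_eq D_def)
    qed
  qed
qed

section \<open>Sequences of unfolded functions\<close>

lemma matrix_vector_norm_le:
  fixes A :: "real^'d^'d"
  shows "norm (A *v v) \<le> real CARD('d) * real CARD('d) * norm A * norm v"
    "norm (transpose A *v v) \<le> real CARD('d) * real CARD('d) * norm A * norm v"
proof -
  have e: "\<bar>A $ i $ j\<bar> \<le> norm A" for i j
    using component_le_norm_cart[of "A $ i" j] Finite_Cartesian_Product.norm_nth_le[of A i] by linarith
  have gen: "norm (B *v v) \<le> real CARD('d) * real CARD('d) * norm A * norm v" if B: "\<And>i j. \<bar>B $ i $ j\<bar> \<le> norm A" for B :: "real^'d^'d"
  proof -
    have "norm (B *v v) \<le> (\<Sum>i\<in>UNIV. \<bar>(B *v v) $ i\<bar>)" by (rule norm_le_l1_cart)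
    also have "\<dots> \<le> (\<Sum>i\<in>(UNIV :: 'd set). real CARD('d) * (norm A * norm v))"
    proof (rule sum_mono)
      fix i
      have "\<bar>(B *v v) $ i\<bar> \<le> (\<Sum>j\<in>UNIV. \<bar>B $ i $ j * v $ j\<bar>)" unfolding matrix_vector_mult_def by simp
      also have "\<dots> \<le> (\<Sum>j\<in>(UNIV :: 'd set). norm A * norm v)"
        unfolding abs_mult by (intro sum_mono mult_mono B component_le_norm_cart) auto
      finally show "\<bar>(B *v v) $ i\<bar> \<le> real CARD('d) * (norm A * norm v)" by simp
    qed
    finally show ?thesis by (simp add: mult.assoc)
  qed
  show "norm (A *v v) \<le> real CARD('d) * real CARD('d) * norm A * norm v" by (rule gen[OF e])
  show "norm (transpose A *v v) \<le> real CARD('d) * real CARD('d) * norm A * norm v"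
    by (rule gen) (simp add: transpose_def e)
qed

context unfolding_cells
begin

lemma piecewise_X:
  assumes "j \<in> I" "x \<in> X j"
  shows "piecewise v (x, y) = v j y"
proof -
  have "piecewise v (x, y) = (\<Sum>i\<in>I. if i = j then v j y else 0)"
    unfolding piecewise_def prod.case
  proof (rule sum.cong[OF refl])
    fix i assume "i \<in> I"
    then have "x \<in> X i \<longleftrightarrow> i = j" using X_unique[OF _ assms(1) _ assms(2)] assms(2) by blast
    then show "indicat_real (X i) x *\<^sub>R v i y = (if i = j then v j y else 0)" by (simp add: indicator_def)
  qed
  then show ?thesis using finite_I assms(1) by simp
qed

text \<open>The second case is stated for two value types so that two piecewise functions with
  different codomains can be compared at the same x.\<close>

lemma piecewise_cases:
  obtains (cell) j where "j \<in> I" "x \<in> X j"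
    | (zero) "\<And>v :: nat \<times> (real^'d) \<Rightarrow> real^'d \<Rightarrow> 'b::real_vector. \<And>y. piecewise v (x, y) = 0"
      "\<And>v :: nat \<times> (real^'d) \<Rightarrow> real^'d \<Rightarrow> 'c::real_vector. \<And>y. piecewise v (x, y) = 0"
proof (cases "\<exists>j\<in>I. x \<in> X j")
  case True then show ?thesis using that(1) by blast
next
  case False
  then have z: "\<And>j. j \<in> I \<Longrightarrow> indicat_real (X j) x = 0" by (auto simp: indicator_def)
  show ?thesis by (rule that(2)) (simp_all add: piecewise_def z)
qed

lemma norm_piecewise_le:
  fixes v :: "nat \<times> (real^'d) \<Rightarrow> real^'d \<Rightarrow> 'b::real_normed_vector" and w :: "nat \<times> (real^'d) \<Rightarrow> real^'d \<Rightarrow> 'c::real_normed_vector"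
  assumes "\<And>j. j \<in> I \<Longrightarrow> norm (v j y) \<le> b * norm (w j y)"
  shows "norm (piecewise v (x, y)) \<le> b * norm (piecewise w (x, y))"
proof (cases x rule: piecewise_cases[where ?'b = 'b and ?'c = 'c])
  case (cell j)
  then show ?thesis using assms by (simp add: piecewise_X)
next
  case zero
  show ?thesis unfolding zero by simp
qed

lemma X_subset_Q: "j \<in> I \<Longrightarrow> X j \<subseteq> Q (fst j)"
  unfolding X_def using Omega_hat_subset I_D(1) by blast

lemma transpose_M: "transpose (M j) *v v = \<epsilon> *\<^sub>R (transpose (A (fst j)) *v v)"
  by (simp add: M_def transpose_def matrix_vector_mult_def vec_eq_iff sum_distrib_left mult_ac)

end

locale lp_unfolding =
  fixes \<Omega> :: "(real^'d) set"
    and D :: "real^'d \<Rightarrow> real^'d^'d"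
    and r p C :: real
    and N :: "real \<Rightarrow> nat"
    and Q :: "real \<Rightarrow> nat \<Rightarrow> (real^'d) set"
    and pt :: "real \<Rightarrow> nat \<Rightarrow> real^'d"
    and eps :: "nat \<Rightarrow> real"
    and w :: "nat \<Rightarrow> real^'d \<Rightarrow> real"
    and grad_w :: "nat \<Rightarrow> real^'d \<Rightarrow> real^'d"
  assumes Om: "open \<Omega>" "bounded \<Omega>"
    and D_inv: "\<And>x. invertible (D x)"
    and D_lip: "\<exists>L. L-lipschitz_on UNIV D"
    and r: "0 < r" "r < 1"
    and cubes: "\<And>\<epsilon> n. 0 < \<epsilon> \<Longrightarrow> n \<in> {1..N \<epsilon>} \<Longrightarrow> open_cube (\<epsilon> powr r) (Q \<epsilon> n)"
    and cubes_disjoint: "\<And>\<epsilon>. 0 < \<epsilon> \<Longrightarrow> disjoint_family_on (Q \<epsilon>) {1..N \<epsilon>}"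
    and points: "\<And>\<epsilon> n. 0 < \<epsilon> \<Longrightarrow> n \<in> {1..N \<epsilon>} \<Longrightarrow> pt \<epsilon> n \<in> Q \<epsilon> n \<inter> \<Omega>"
    and p: "1 < p"
    and eps: "\<And>k. 0 < eps k" "eps \<longlonglongrightarrow> 0"
    and w: "\<And>k. w k \<in> Lp p \<Omega>" "\<And>k. grad_w k \<in> Lp p \<Omega>"
      "\<And>k. has_weak_gradient \<Omega> (w k) (grad_w k)"
    and bound: "\<And>k. Lp_norm p \<Omega> (w k) + eps k * Lp_norm p \<Omega> (grad_w k) \<le> C"
begin

abbreviation P :: "((real^'d) \<times> (real^'d)) measure" where
  "P \<equiv> lebesgue_on \<Omega> \<Otimes>\<^sub>M lebesgue_on unit_cell"

abbreviation A :: "nat \<Rightarrow> nat \<Rightarrow> real^'d^'d" where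
  "A k \<equiv> \<lambda>n. D (pt (eps k) n)"

lemma cells: "unfolding_cells \<Omega> (A k) (Q (eps k)) (N (eps k)) (eps k)"
proof
  show "disjoint_family_on (Q (eps k)) {1..N (eps k)}" by (rule cubes_disjoint[OF eps(1)])
  have "0 < eps k powr r" using eps(1)[of k] by simp
  then show "interior (closure (Q (eps k) n)) = Q (eps k) n" if "n \<in> {1..N (eps k)}" for n
    by (rule open_cube_regular(1)[OF cubes[OF eps(1) that]])
qed (use Om eps D_inv in auto)

definition u :: "nat \<Rightarrow> (real^'d) \<times> (real^'d) \<Rightarrow> real" where
  "u k = unfolding_op \<Omega> D N Q pt (eps k) (w k)"

definition q :: "nat \<Rightarrow> (real^'d) \<times> (real^'d) \<Rightarrow> real^'d" where
  "q k z = eps k *\<^sub>R unfolding_op \<Omega> D N Q pt (eps k) (grad_w k) z"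

text \<open>The gradient of \<open>u k\<close> in the cell variable: on a cell the chain rule gives
  \<epsilon> times the transposed matrix at the chosen point, applied to the gradient. It differs
  from D(x)^T applied to \<open>q k\<close> only in the point where D is evaluated.\<close>

definition g :: "nat \<Rightarrow> (real^'d) \<times> (real^'d) \<Rightarrow> real^'d" where
  "g k = unfolding_cells.piecewise \<Omega> (A k) (Q (eps k)) (N (eps k)) (eps k) (\<lambda>j y.
     transpose (unfolding_cells.M (A k) (eps k) j) *v grad_w k (unfolding_cells.T (A k) (eps k) j y))"

lemma unfolding_op_piecewise:
  "unfolding_op \<Omega> D N Q pt (eps k) \<psi> = unfolding_cells.piecewise \<Omega> (A k) (Q (eps k)) (N (eps k)) (eps k)
     (\<lambda>j y. \<psi> (unfolding_cells.T (A k) (eps k) j y))"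
proof -
  interpret U: unfolding_cells \<Omega> "A k" "Q (eps k)" "N (eps k)" "eps k" by (rule cells)
  show ?thesis
  proof
    fix z :: "(real^'d) \<times> (real^'d)"
    obtain x y where z: "z = (x, y)" by (cases z)
    show "unfolding_op \<Omega> D N Q pt (eps k) \<psi> z = U.piecewise (\<lambda>j y. \<psi> (U.T j y)) z"
      unfolding z U.unfolding_piecewise[symmetric] by (simp only: unfolding_op_def prod.case Let_def)
  qed
qed

lemma Om_sets: "\<Omega> \<in> sets lebesgue" and finite_P: "finite_measure P"
proof -
  interpret U: unfolding_cells \<Omega> "A 0" "Q (eps 0)" "N (eps 0)" "eps 0" by (rule cells)
  show "\<Omega> \<in> sets lebesgue" by (rule U.Om_sets)
  interpret f1: finite_measure "lebesgue_on \<Omega>" by (rule U.finite_measure_Om)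
  interpret f2: finite_measure "lebesgue_on (unit_cell :: (real^'d) set)" by (rule U.finite_measure_unit_cell)
  show "finite_measure P"
  proof
    have "emeasure P (space P) = emeasure (lebesgue_on \<Omega>) (space (lebesgue_on \<Omega>)) * emeasure (lebesgue_on unit_cell) (space (lebesgue_on (unit_cell :: (real^'d) set)))"
      unfolding space_pair_measure by (rule f2.emeasure_pair_measure_Times) auto
    then show "emeasure P (space P) \<noteq> \<infinity>" using f1.emeasure_finite f2.emeasure_finite by (simp add: ennreal_mult_eq_top_iff)
  qed
qed

lemma D_bounded:
  obtains a where "0 < a" "\<And>x v. x \<in> \<Omega> \<Longrightarrow> norm (D x *v v) \<le> a * norm v" "\<And>x v. x \<in> \<Omega> \<Longrightarrow> norm (transpose (D x) *v v) \<le> a * norm v"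
proof -
  obtain L where L: "L-lipschitz_on UNIV D" using D_lip by blast
  then have "bounded (D ` \<Omega>)"
    using Om(2) by (meson bounded_uniformly_continuous_image lipschitz_on_uniformly_continuous lipschitz_on_subset subset_UNIV)
  then obtain B where B: "\<And>x. x \<in> \<Omega> \<Longrightarrow> norm (D x) \<le> B" by (auto simp: bounded_iff)
  define a where "a = real CARD('d) * real CARD('d) * \<bar>B\<bar> + 1"
  have le: "real CARD('d) * real CARD('d) * norm (D x) * norm v \<le> a * norm v" if "x \<in> \<Omega>" for x and v :: "real^'d"
  proof -
    have "real CARD('d) * real CARD('d) * norm (D x) \<le> real CARD('d) * real CARD('d) * \<bar>B\<bar>"
      using B[OF that] by (intro mult_left_mono) auto
    then show ?thesis unfolding a_def by (intro mult_right_mono) (linarith, simp)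
  qed
  show ?thesis
  proof (rule that)
    show "0 < a" by (simp add: a_def add_nonneg_pos)
  qed (use order_trans[OF matrix_vector_norm_le(1) le] order_trans[OF matrix_vector_norm_le(2) le] in auto)
qed

text \<open>The chosen point and x lie in one cube of diameter at most d \<epsilon>^r, so the
  Lipschitz constant of D bounds the change of the matrix; the other factors come from bounding a
  matrix-vector product by entries.\<close>

lemma D_cube:
  obtains L where "0 \<le> L" "\<And>k n x v. n \<in> {1..N (eps k)} \<Longrightarrow> x \<in> Q (eps k) n \<Longrightarrow>
    norm (transpose (A k n) *v v - transpose (D x) *v v) \<le> L * eps k powr r * norm v"
proof -
  obtain L where L: "L-lipschitz_on UNIV D" using D_lip by blast
  define c where "c = real CARD('d)"
  have c: "0 \<le> c" by (simp add: c_def)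
  have L0: "0 \<le> L" using L by (rule lipschitz_on_nonneg)
  show ?thesis
  proof (rule that[of "c * c * L * c"])
    show "0 \<le> c * c * L * c" using c L0 by simp
    fix k n x and v :: "real^'d" assume n: "n \<in> {1..N (eps k)}" and x: "x \<in> Q (eps k) n"
    have "dist (pt (eps k) n) x \<le> eps k powr r * c"
      unfolding c_def using open_cube_regular(3)[OF cubes[OF eps(1) n]] eps(1)[of k] x points[OF eps(1) n] by auto
    then have "norm (A k n - D x) \<le> L * (eps k powr r * c)"
      using lipschitz_onD[OF L, of "pt (eps k) n" x] L0 by (auto simp: dist_norm intro: order_trans mult_left_mono)
    then have le: "c * c * norm (A k n - D x) * norm v \<le> c * c * (L * (eps k powr r * c)) * norm v"
      using c by (intro mult_right_mono mult_left_mono) auto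
    have "transpose (A k n) *v v - transpose (D x) *v v = transpose (A k n - D x) *v v"
      by (simp add: transpose_def matrix_vector_mult_def vec_eq_iff sum_subtractf left_diff_distrib)
    then have "norm (transpose (A k n) *v v - transpose (D x) *v v) \<le> c * c * norm (A k n - D x) * norm v"
      using matrix_vector_norm_le(2)[of "A k n - D x" v] by (simp add: c_def)
    with le show "norm (transpose (A k n) *v v - transpose (D x) *v v) \<le> c * c * L * c * eps k powr r * norm v"
      by (simp add: mult_ac)
  qed
qed

lemma Lp_bounds:
  "(LINT x|lebesgue_on \<Omega>. norm (w k x) powr p) \<le> \<bar>C\<bar> powr p"
  "(LINT x|lebesgue_on \<Omega>. norm (eps k *\<^sub>R grad_w k x) powr p) \<le> \<bar>C\<bar> powr p"
proof -
  have n: "0 \<le> Lp_norm p \<Omega> (w k)" "0 \<le> eps k * Lp_norm p \<Omega> (grad_w k)" using eps(1)[of k] by (auto simp: Lp_norm_def)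
  then have "Lp_norm p \<Omega> (w k) \<le> \<bar>C\<bar>" and le: "eps k * Lp_norm p \<Omega> (grad_w k) \<le> \<bar>C\<bar>" using bound[of k] by linarith+
  then show "(LINT x|lebesgue_on \<Omega>. norm (w k x) powr p) \<le> \<bar>C\<bar> powr p"
    unfolding Lp_norm_powr[OF p, symmetric] using n p by (intro powr_mono2) auto
  have "(LINT x|lebesgue_on \<Omega>. norm (eps k *\<^sub>R grad_w k x) powr p) = eps k powr p * (LINT x|lebesgue_on \<Omega>. norm (grad_w k x) powr p)"
    using eps(1)[of k] by (simp add: powr_mult)
  also have "\<dots> = (eps k * Lp_norm p \<Omega> (grad_w k)) powr p"
    unfolding Lp_norm_powr[OF p, symmetric] using eps(1)[of k] by (simp add: powr_mult Lp_norm_def)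
  also have "\<dots> \<le> \<bar>C\<bar> powr p" using n le p by (intro powr_mono2) auto
  finally show "(LINT x|lebesgue_on \<Omega>. norm (eps k *\<^sub>R grad_w k x) powr p) \<le> \<bar>C\<bar> powr p" .
qed

lemma q_piecewise: "q k = unfolding_cells.piecewise \<Omega> (A k) (Q (eps k)) (N (eps k)) (eps k)
     (\<lambda>j y. eps k *\<^sub>R grad_w k (unfolding_cells.T (A k) (eps k) j y))"
proof -
  interpret U: unfolding_cells \<Omega> "A k" "Q (eps k)" "N (eps k)" "eps k" by (rule cells)
  show ?thesis unfolding q_def unfolding_op_piecewise
    by (rule ext) (rule U.piecewise_apply[of "\<lambda>v. eps k *\<^sub>R v"], simp)
qed

lemma simple_pair_u: "simple_pair p \<Omega> unit_cell (u k) (g k)"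
proof -
  interpret U: unfolding_cells \<Omega> "A k" "Q (eps k)" "N (eps k)" "eps k" by (rule cells)
  show ?thesis unfolding u_def g_def unfolding_op_piecewise by (rule U.simple_pair_unfolding[OF p w])
qed

lemma u_Lp: "u k \<in> Lp_fun p P" "integral\<^sup>L P (\<lambda>z. norm (u k z) powr p) \<le> \<bar>C\<bar> powr p"
  and q_Lp: "q k \<in> Lp_fun p P" "integral\<^sup>L P (\<lambda>z. norm (q k z) powr p) \<le> \<bar>C\<bar> powr p"
  and g_Lp: "g k \<in> Lp_fun p P"
proof -
  interpret U: unfolding_cells \<Omega> "A k" "Q (eps k)" "N (eps k)" "eps k" by (rule cells)
  show "u k \<in> Lp_fun p P" "g k \<in> Lp_fun p P" using simple_pair_u by (auto simp: simple_pair_def)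
  show "integral\<^sup>L P (\<lambda>z. norm (u k z) powr p) \<le> \<bar>C\<bar> powr p"
    unfolding u_def unfolding_op_piecewise by (rule order_trans[OF U.piecewise_Lp_le(2)[OF w(1)] Lp_bounds(1)])
  have s: "(\<lambda>x. eps k *\<^sub>R grad_w k x) \<in> Lp p \<Omega>" by (simp add: Lp_eq Lp_fun_scaleR w(2)[unfolded Lp_eq])
  show "q k \<in> Lp_fun p P" unfolding q_piecewise by (rule U.piecewise_Lp_le(1)[OF s])
  show "integral\<^sup>L P (\<lambda>z. norm (q k z) powr p) \<le> \<bar>C\<bar> powr p"
    unfolding q_piecewise by (rule order_trans[OF U.piecewise_Lp_le(2)[OF s] Lp_bounds(2)])
qed

lemma g_le:
  assumes a: "\<And>x v. x \<in> \<Omega> \<Longrightarrow> norm (transpose (D x) *v v) \<le> a * norm v"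
  shows "norm (g k z) \<le> a * norm (q k z)"
proof -
  interpret U: unfolding_cells \<Omega> "A k" "Q (eps k)" "N (eps k)" "eps k" by (rule cells)
  obtain x y where z: "z = (x, y)" by (cases z)
  show ?thesis unfolding z g_def q_piecewise
  proof (rule U.norm_piecewise_le)
    fix j assume "j \<in> U.I"
    then have "pt (eps k) (fst j) \<in> \<Omega>" using points[OF eps(1)] U.I_D(1) by blast
    from a[OF this] show "norm (transpose (U.M j) *v grad_w k (U.T j y)) \<le> a * norm (eps k *\<^sub>R grad_w k (U.T j y))"
      unfolding U.transpose_M using eps(1)[of k] by (simp add: mult.left_commute)
  qed
qed

lemma g_approx:
  obtains L where "0 \<le> L"
    "\<And>k x y. norm (g k (x, y) - transpose (D x) *v q k (x, y)) \<le> L * eps k powr r * norm (q k (x, y))"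
proof -
  obtain L where L: "0 \<le> L" "\<And>k n x v. n \<in> {1..N (eps k)} \<Longrightarrow> x \<in> Q (eps k) n \<Longrightarrow>
    norm (transpose (A k n) *v v - transpose (D x) *v v) \<le> L * eps k powr r * norm v"
    using D_cube by blast
  have "norm (g k (x, y) - transpose (D x) *v q k (x, y)) \<le> L * eps k powr r * norm (q k (x, y))" for k x y
  proof -
    interpret U: unfolding_cells \<Omega> "A k" "Q (eps k)" "N (eps k)" "eps k" by (rule cells)
    show ?thesis
    proof (cases x rule: U.piecewise_cases[where ?'b = "real^'d" and ?'c = "real^'d"])
      case (cell j)
      define v where "v = eps k *\<^sub>R grad_w k (U.T j y)"
      have "g k (x, y) = transpose (A k (fst j)) *v v" "q k (x, y) = v"
        unfolding g_def q_piecewise v_def using U.piecewise_X[OF cell] U.transpose_M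
        by (simp_all add: matrix_vector_mult_scaleR)
      then show ?thesis using L(2)[OF U.I_D(1)[OF cell(1)], of x v] U.X_subset_Q[OF cell(1)] cell(2) by auto
    next
      case zero
      then have "g k (x, y) = 0" "q k (x, y) = 0" unfolding g_def q_piecewise by blast+
      then show ?thesis by simp
    qed
  qed
  with L(1) that show ?thesis by blast
qed

end

lemma Lp_limit_linear:
  fixes h :: "'b::euclidean_space \<Rightarrow> 'c::euclidean_space" and S :: "nat \<Rightarrow> 'x \<Rightarrow> 'b"
  assumes p: "1 < p" and h: "linear h" "\<And>v. norm (h v) \<le> norm v" and S: "\<And>n. S n \<in> Lp_fun p M" and L: "L \<in> Lp_fun p M"
    and lim: "(\<lambda>n. LINT x|M. norm (S n x - L x) powr p) \<longlonglongrightarrow> 0"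
  shows "(\<lambda>n. LINT x|M. norm (h (S n x) - h (L x)) powr p) \<longlonglongrightarrow> 0"
proof (rule tendsto_sandwich[OF _ _ tendsto_const lim])
  have hm: "h \<in> borel_measurable borel" using h(1) by (rule borel_measurable_linear)
  have le: "norm (h (S n x) - h (L x)) powr p \<le> norm (S n x - L x) powr p" for n x
    using h p by (intro powr_mono2) (auto simp: linear_diff[symmetric])
  have "(LINT x|M. norm (h (S n x) - h (L x)) powr p) \<le> (LINT x|M. norm (S n x - L x) powr p)" for n
  proof (rule integral_mono)
    note d = Lp_funD[OF Lp_fun_diff[OF p S L]]
    show "integrable M (\<lambda>x. norm (S n x - L x) powr p)" by (rule d(2))
    have "(\<lambda>x. h (S n x - L x)) \<in> Lp_fun p M"
    proof (rule Lp_fun_bounded_by[OF measurable_compose[OF d(1) hm] d(2)])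
      show "norm (h (S n x - L x)) powr p \<le> norm (S n x - L x) powr p" for x using le[of n x] h(1) by (simp add: linear_diff)
    qed
    then show "integrable M (\<lambda>x. norm (h (S n x) - h (L x)) powr p)" using Lp_funD(2) h(1) by (simp add: linear_diff)
  qed (rule le)
  then show "\<forall>\<^sub>F n in sequentially. (LINT x|M. norm (h (S n x) - h (L x)) powr p) \<le> (LINT x|M. norm (S n x - L x) powr p)"
    by simp
qed (simp add: integral_nonneg_AE)

text \<open>Applied to the projections of the triple: since these are linear and do not increase the
  norm, the weights found for the triple also work for each component.\<close>

lemma mazur_limit_linear:
  fixes F :: "nat \<Rightarrow> 'x \<Rightarrow> 'b::euclidean_space" and h :: "'b \<Rightarrow> 'c::euclidean_space"
  assumes p: "1 < p" and maz: "\<And>k. F k \<in> Lp_fun p M" "L \<in> Lp_fun p M"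
    and h: "linear h" "\<And>v. norm (h v) \<le> norm v"
    and lim: "(\<lambda>n. LINT x|M. norm ((\<Sum>k<m n. c n k *\<^sub>R F (t k) x) - L x) powr p) \<longlonglongrightarrow> 0"
  shows "(\<lambda>n. LINT x|M. norm ((\<Sum>k<m n. c n k *\<^sub>R h (F (t k) x)) - h (L x)) powr p) \<longlonglongrightarrow> 0"
proof -
  have "(\<lambda>n. LINT x|M. norm (h (\<Sum>k<m n. c n k *\<^sub>R F (t k) x) - h (L x)) powr p) \<longlonglongrightarrow> 0"
    by (rule Lp_limit_linear[OF p h _ maz(2) lim]) (intro Lp_fun_sum[OF p] Lp_fun_scaleR maz(1))
  then show ?thesis by (simp add: linear_sum[OF h(1)] linear_scale[OF h(1)])
qed

text \<open>Uniform integrability of L^p bounded functions: for large l the second term is small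
  because p > 1, and for that l a small measure of \<open>S\<close> makes the first one
  small.\<close>

lemma LINT_subset_le_powr:
  fixes f :: "'a::euclidean_space \<Rightarrow> real"
  assumes p: "1 < p" and U: "U \<in> lmeasurable" and S: "S \<in> sets lebesgue" "S \<subseteq> U" and f: "f \<in> Lp_fun p (lebesgue_on U)" "\<And>x. 0 \<le> f x"
    and l: "0 < l"
  shows "(LINT x|lebesgue_on S. f x) \<le> l * measure lebesgue S + l powr (1 - p) * (LINT x|lebesgue_on U. norm (f x) powr p)"
proof -
  have Us: "U \<in> sets lebesgue" using U by (rule fmeasurableD)
  interpret finite_measure "lebesgue_on U"
    using fmeasurableD2[OF U] by (intro finite_measureI) (simp add: emeasure_restrict_space Us)
  have fi: "integrable (lebesgue_on U) f" by (rule Lp_fun_integrable[OF p _ f(1)]) unfold_locales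
  note s1 = integrable_lebesgue_on_subset[OF fi Us S]
  have i1: "integrable (lebesgue_on U) (\<lambda>x. 1 :: real)" by simp
  note s2 = integrable_lebesgue_on_subset[OF i1 Us S]
  have "(LINT x|lebesgue_on S. f x) = (LINT x|lebesgue_on U. indicat_real S x *\<^sub>R f x)" by (rule s1(2))
  also have "\<dots> \<le> (LINT x|lebesgue_on U. l * (indicat_real S x *\<^sub>R 1) + l powr (1 - p) * norm (f x) powr p)"
  proof (rule integral_mono)
    fix x
    show "indicat_real S x *\<^sub>R f x \<le> l * (indicat_real S x *\<^sub>R 1) + l powr (1 - p) * norm (f x) powr p"
      using le_add_powr[of p l "f x"] p l f(2)[of x] by (auto simp: indicator_def)
  qed (use s1(3) s2(3) Lp_funD(2)[OF f(1)] in auto)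
  also have "\<dots> = l * (LINT x|lebesgue_on U. indicat_real S x *\<^sub>R 1) + l powr (1 - p) * (LINT x|lebesgue_on U. norm (f x) powr p)"
    using s2(3) Lp_funD(2)[OF f(1)] by simp
  also have "(LINT x|lebesgue_on U. indicat_real S x *\<^sub>R 1) = measure lebesgue S"
    using s2(2) S(1) by (simp add: measure_restrict_space)
  finally show ?thesis .
qed

section \<open>Compactness of the triple and vanishing of the periodicity defect\<close>

context lp_unfolding
begin

text \<open>The triple is bounded in L^p because unfolding does not increase norms and
  \<open>g\<close> is dominated by a fixed multiple of \<open>q\<close>.\<close>

lemma compactness:
  obtains s U0 G0 Q0 where "strict_mono (s :: nat \<Rightarrow> nat)"
    "mazur_limit p P (\<lambda>k z. (u (s k) z, g (s k) z, q (s k) z)) (\<lambda>z. (U0 z, G0 z, Q0 z))"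
proof -
  obtain a where a: "0 < a" "\<And>x v. x \<in> \<Omega> \<Longrightarrow> norm (transpose (D x) *v v) \<le> a * norm v" by (rule D_bounded) blast
  define F where "F = (\<lambda>k z. (u k z, g k z, q k z))"
  define H where "H = (\<lambda>k z. 2 powr p * (norm (u k z) powr p + (1 + a) powr p * norm (q k z) powr p))"
  have Hi: "integrable P (H k)" for k unfolding H_def using Lp_funD(2)[OF u_Lp(1)] Lp_funD(2)[OF q_Lp(1)] by simp
  have FH: "norm (F k z) powr p \<le> H k z" for k z
  proof -
    have "norm (F k z) \<le> norm (u k z) + (norm (g k z) + norm (q k z))"
      unfolding F_def by (rule order_trans[OF norm_Pair_le add_left_mono[OF norm_Pair_le]])
    also have "\<dots> \<le> norm (u k z) + (1 + a) * norm (q k z)" using g_le[OF a(2), of k z] by (simp add: algebra_simps)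
    finally have "norm (F k z) powr p \<le> norm (norm (u k z) + (1 + a) * norm (q k z)) powr p"
      using p a(1) by (intro powr_mono2) auto
    also have "\<dots> \<le> H k z" unfolding H_def
      using norm_add_powr_le[OF p, of "norm (u k z)" "(1 + a) * norm (q k z)"] a(1) by (simp add: powr_mult)
    finally show ?thesis .
  qed
  have Fm: "F k \<in> borel_measurable P" for k
    unfolding F_def by (intro borel_measurable_Pair Lp_funD(1)[OF u_Lp(1)] Lp_funD(1)[OF g_Lp] Lp_funD(1)[OF q_Lp(1)])
  have FLp: "F k \<in> Lp_fun p P" for k by (rule Lp_fun_bounded_by[OF Fm Hi FH])
  have Fb: "(LINT z|P. norm (F k z) powr p) \<le> 2 powr p * (\<bar>C\<bar> powr p + (1 + a) powr p * \<bar>C\<bar> powr p)" for k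
  proof -
    have "(LINT z|P. norm (F k z) powr p) \<le> (LINT z|P. H k z)"
      by (rule integral_mono[OF Lp_funD(2)[OF FLp] Hi FH])
    also have "\<dots> = 2 powr p * ((LINT z|P. norm (u k z) powr p) + (1 + a) powr p * (LINT z|P. norm (q k z) powr p))"
      unfolding H_def using Lp_funD(2)[OF u_Lp(1)] Lp_funD(2)[OF q_Lp(1)] by simp
    also have "\<dots> \<le> 2 powr p * (\<bar>C\<bar> powr p + (1 + a) powr p * \<bar>C\<bar> powr p)"
      by (intro mult_left_mono add_mono u_Lp(2) q_Lp(2)) auto
    finally show ?thesis .
  qed
  obtain G :: "nat \<Rightarrow> ((real^'d) \<times> (real^'d)) set" where G: "Int_stable (range G)" "sigma_sets UNIV (range G) = sets borel" "UNIV \<in> range G"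
    by (rule countable_Int_stable_generator)
  have idm: "(\<lambda>z. z) \<in> P \<rightarrow>\<^sub>M borel"
  proof -
    have i: "(\<lambda>x :: real^'d. x) \<in> borel_measurable (lebesgue_on S)" for S by (rule continuous_measurable_lebesgue_on) simp
    have "(\<lambda>z. (fst z, snd z)) \<in> P \<rightarrow>\<^sub>M borel"
      by (intro borel_measurable_Pair measurable_compose[OF measurable_fst i] measurable_compose[OF measurable_snd i])
    then show ?thesis by simp
  qed
  have Gb: "G n \<in> sets borel" for n unfolding G(2)[symmetric] by (rule sigma_sets.Basic) simp
  have GP: "G n \<inter> space P \<in> sets P" for n using measurable_sets[OF idm Gb] by simp
  \<comment> \<open>The test sets generate the Borel sets of the product space, whereas
    \<open>P\<close> is a product of completed measures. The determination property is therefore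
    proved for Lebesgue measure on the product set and brought back to \<open>P\<close>.\<close>
  have determ: "AE z in P. f z = 0" if f: "integrable P f" and zero: "\<And>n. (LINT z|P. indicat_real (G n \<inter> space P) z *\<^sub>R f z) = 0"
    for f :: "(real^'d) \<times> (real^'d) \<Rightarrow> real \<times> (real^'d) \<times> (real^'d)"
  proof -
    have fm: "f \<in> borel_measurable P" using f by simp
    have S: "\<Omega> \<times> (unit_cell :: (real^'d) set) \<in> sets lebesgue" by (rule lebesgue_Times(1)[OF Om_sets unit_cell_sets])
    have z: "(LINT z|lebesgue_on (\<Omega> \<times> unit_cell). indicat_real (G n) z *\<^sub>R f z) = 0" for n
    proof -
      have im: "indicat_real (G n) \<in> borel_measurable P"
        using measurable_compose[OF idm borel_measurable_indicator[OF Gb]] .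
      have "(LINT z|lebesgue_on (\<Omega> \<times> unit_cell). indicat_real (G n) z *\<^sub>R f z) = (LINT z|P. indicat_real (G n) z *\<^sub>R f z)"
        by (rule pair_lebesgue_on_integral(3)[OF Om_sets unit_cell_sets borel_measurable_scaleR[OF im fm]])
      also have "\<dots> = (LINT z|P. indicat_real (G n \<inter> space P) z *\<^sub>R f z)"
        by (rule Bochner_Integration.integral_cong) (auto simp: indicator_def)
      finally show ?thesis using zero by simp
    qed
    have "AE z in lebesgue_on (\<Omega> \<times> unit_cell). f z = 0"
    proof (rule AE_zero_from_generator[OF _ S G(1,2)])
      show "integrable (lebesgue_on (\<Omega> \<times> unit_cell)) f"
        using pair_lebesgue_on_integral(2)[OF Om_sets unit_cell_sets fm] f by blast
      show "(LINT x|lebesgue_on (\<Omega> \<times> unit_cell). indicat_real G' x *\<^sub>R f x) = 0" if "G' \<in> range G" for G' using z that by auto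
      obtain n where "G n = UNIV" using G(3) by auto
      then show "(LINT x|lebesgue_on (\<Omega> \<times> unit_cell). f x) = 0" using z[of n] by simp
    qed
    moreover have "{z \<in> space P. f z = 0} \<in> sets P" using fm by measurable
    ultimately show ?thesis using AE_pair_lebesgue_on[OF Om_sets unit_cell_sets, of "\<lambda>z. f z = 0"] by blast
  qed
  obtain s L where s: "strict_mono (s :: nat \<Rightarrow> nat)" "mazur_limit p P (F \<circ> s) L"
    by (rule Lp_bounded_mazur_subsequence[OF p finite_P FLp Fb GP determ])
  show ?thesis
  proof (rule that[OF s(1)])
    show "mazur_limit p P (\<lambda>k z. (u (s k) z, g (s k) z, q (s k) z)) (\<lambda>z. (fst (L z), fst (snd (L z)), snd (snd (L z))))"
      using s(2) by (simp add: F_def comp_def)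
  qed
qed

text \<open>The constants in \<open>periodic_estimate\<close> are fixed in the order \<omega>, l, k:
  the modulus for the weight, the truncation level for the boundary layer, and a scale small enough
  for both.\<close>

lemma pairing_tendsto:
  assumes phi: "test_function {y. \<forall>i. \<bar>y $ i\<bar> < real m} \<phi>" and psi: "test_function \<Omega> \<psi>"
  shows "(\<lambda>k. integral\<^sup>L P (\<lambda>z. \<psi> (fst z) * (u k z * (\<Sum>\<xi>\<in>lattice_box m. frechet_derivative \<phi> (at (snd z + \<xi>)) (axis i 1))
      + g k z $ i * (\<Sum>\<xi>\<in>lattice_box m. \<phi> (snd z + \<xi>))))) \<longlonglongrightarrow> 0"
    (is "?L \<longlonglongrightarrow> 0")
proof -
  obtain a where a: "0 < a" "\<And>x v. x \<in> \<Omega> \<Longrightarrow> norm (D x *v v) \<le> a * norm v" "\<And>x v. x \<in> \<Omega> \<Longrightarrow> norm (transpose (D x) *v v) \<le> a * norm v"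
    by (rule D_bounded) blast
  obtain B where B: "0 \<le> B" "\<And>x. \<bar>\<phi> x\<bar> \<le> B" "\<And>x. \<bar>frechet_derivative \<phi> (at x) (axis i 1)\<bar> \<le> B"
    by (rule test_function_bounded[OF phi]) blast
  obtain B\<psi> where B\<psi>: "0 \<le> B\<psi>" "\<And>x. \<bar>\<psi> x\<bar> \<le> B\<psi>" using test_function_bounded[OF psi] by metis
  obtain K\<psi> where K\<psi>: "compact K\<psi>" "K\<psi> \<subseteq> \<Omega>" "\<And>x. x \<notin> K\<psi> \<Longrightarrow> \<psi> x = 0" using test_functionD[OF psi] by metis
  obtain \<rho>0 where \<rho>0: "0 < \<rho>0" "\<And>z. z \<in> K\<psi> \<Longrightarrow> ball z \<rho>0 \<subseteq> \<Omega>"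
    using compact_subset_open_imp_ball_epsilon_subset[OF K\<psi>(1) Om(1) K\<psi>(2)] by (metis UN_subset_iff)
  define d where "d = real CARD('d)"
  have d0: "0 \<le> d" by (simp add: d_def)
  \<comment> \<open>The radius \<open>r0\<close> at index k is \<open>eps k * R\<close>, that is R
    times \<theta> times the side of the cubes, so its ratio to the side tends to 0.\<close>
  define R where "R = a * (d * (real m + 1))"
  have R0: "0 < R" using a(1) unfolding R_def d_def by simp
  define \<theta> where "\<theta> = (\<lambda>k. eps k powr (1 - r))"
  have \<theta>: "\<theta> \<longlonglongrightarrow> 0" unfolding \<theta>_def
    using tendsto_0_powr_iff[of "1 - r" eps] r eps less_imp_le by (metis diff_gt_0_iff_gt)
  have eps\<theta>: "eps k = \<theta> k * eps k powr r" for k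
    unfolding \<theta>_def using eps(1)[of k] by (simp add: powr_add[symmetric])
  obtain R\<Omega> where R\<Omega>: "\<And>x. x \<in> \<Omega> \<Longrightarrow> norm x \<le> R\<Omega>" using Om(2) by (auto simp: bounded_iff)
  define S where "S = cball (0 :: real^'d) (R\<Omega> + d)"
  have S: "S \<in> lmeasurable" by (simp add: S_def)
  \<comment> \<open>Bound for the measure of the layer: the factor 2 d \<rho> / a with \<rho> = 4
    \<open>r0\<close> and a the side gives 8 d R \<theta>, times the volume of a ball
    \<open>S\<close> that contains all cubes once the side is at most 1.\<close>
  define \<tau> where "\<tau> = (\<lambda>k. 8 * d * R * measure lebesgue S * \<theta> k)"
  have \<tau>: "\<tau> \<longlonglongrightarrow> 0" unfolding \<tau>_def using tendsto_mult_right_zero[OF \<theta>] by blast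
  define Gf where "Gf = (\<lambda>k x. norm (w k x) + eps k * a * norm (grad_w k x))"
  define C2 where "C2 = 2 powr p * (\<bar>C\<bar> powr p + a powr p * \<bar>C\<bar> powr p)"
  have C20: "0 \<le> C2" by (simp add: C2_def)
  have Gf0: "0 \<le> Gf k x" for k x unfolding Gf_def using eps(1)[of k] a(1) by simp
  define Hf where "Hf = (\<lambda>k x. 2 powr p * (norm (w k x) powr p + a powr p * norm (eps k *\<^sub>R grad_w k x) powr p))"
  have wi: "integrable (lebesgue_on \<Omega>) (\<lambda>x. norm (w k x) powr p)" "integrable (lebesgue_on \<Omega>) (\<lambda>x. norm (eps k *\<^sub>R grad_w k x) powr p)" for k
    using Lp_funD(2)[OF w(1)[unfolded Lp_eq], of k] Lp_funD(2)[OF Lp_fun_scaleR[OF w(2)[unfolded Lp_eq], of "eps k" k]] by auto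
  have Hfi: "integrable (lebesgue_on \<Omega>) (Hf k)" for k unfolding Hf_def using wi by simp
  have GfH: "norm (Gf k x) powr p \<le> Hf k x" for k x
    using norm_add_powr_le[OF p, of "norm (w k x)" "a * norm (eps k *\<^sub>R grad_w k x)"] a(1) eps(1)[of k]
    unfolding Gf_def Hf_def by (simp add: powr_mult mult_ac)
  have wm: "w k \<in> borel_measurable (lebesgue_on \<Omega>)" "grad_w k \<in> borel_measurable (lebesgue_on \<Omega>)" for k
    using Lp_funD(1)[OF w(1)[unfolded Lp_eq]] Lp_funD(1)[OF w(2)[unfolded Lp_eq]] by auto
  have GfLp: "Gf k \<in> Lp_fun p (lebesgue_on \<Omega>)" for k
  proof (rule Lp_fun_bounded_by[OF _ Hfi GfH])
    show "Gf k \<in> borel_measurable (lebesgue_on \<Omega>)" unfolding Gf_def using wm[of k] by measurable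
  qed
  have GfC: "(LINT x|lebesgue_on \<Omega>. norm (Gf k x) powr p) \<le> C2" for k
  proof -
    have "(LINT x|lebesgue_on \<Omega>. norm (Gf k x) powr p) \<le> (LINT x|lebesgue_on \<Omega>. Hf k x)"
      by (rule integral_mono[OF Lp_funD(2)[OF GfLp] Hfi GfH])
    also have "\<dots> = 2 powr p * ((LINT x|lebesgue_on \<Omega>. norm (w k x) powr p) + a powr p * (LINT x|lebesgue_on \<Omega>. norm (eps k *\<^sub>R grad_w k x) powr p))"
      unfolding Hf_def integral_mult_right_zero using wi[of k] by (subst Bochner_Integration.integral_add) auto
    also have "\<dots> \<le> C2" unfolding C2_def by (intro mult_left_mono add_mono Lp_bounds) auto
    finally show ?thesis .
  qed
  have Oml: "\<Omega> \<in> lmeasurable" using Om by (simp add: lmeasurable_open)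
  have GfS: "(LINT x|lebesgue_on S'. Gf k x) \<le> l * measure lebesgue S' + l powr (1 - p) * C2"
    if "S' \<in> sets lebesgue" "S' \<subseteq> \<Omega>" "0 < l" for S' l k
    by (rule order_trans[OF LINT_subset_le_powr[OF p Oml that(1,2) GfLp Gf0 that(3)]]) (intro add_left_mono mult_left_mono GfC, simp)
  define C1 where "C1 = measure lebesgue \<Omega> + C2"
  have C1: "(LINT x|lebesgue_on \<Omega>. Gf k x) \<le> C1" for k using GfS[OF Om_sets order_refl, of 1 k] by (simp add: C1_def)
  have C10: "0 \<le> C1" using C20 by (simp add: C1_def)
  define c where "c = real (card (lattice_box m :: (real^'d) set)) * B"
  have c0: "0 \<le> c" using B(1) by (simp add: c_def)
  show ?thesis
  proof (rule LIMSEQ_I)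
    fix e :: real assume e: "0 < e"
    define \<omega> where "\<omega> = e / (4 * (c + 1) * (C1 + 1))"
    have \<omega>: "0 < \<omega>" unfolding \<omega>_def using e c0 C10 by simp
    have "c * \<omega> * C1 \<le> (c + 1) * \<omega> * (C1 + 1)" using c0 C10 \<omega> by (intro mult_mono) auto
    also have "\<dots> = e / 4"
    proof -
      have "x * (e / (4 * x * y)) * y = e / 4" if "x \<noteq> 0" "y \<noteq> 0" for x y :: real using that by (simp add: field_simps)
      moreover have "c + 1 \<noteq> 0" "C1 + 1 \<noteq> 0" using c0 C10 by auto
      ultimately show ?thesis unfolding \<omega>_def by blast
    qed
    finally have e1: "c * \<omega> * C1 \<le> e / 4" .
    \<comment> \<open>\<open>x0\<close> is the value wanted for l^(1-p), and l is obtained by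
      inverting that power. Each of the three error terms is then at most e/4.\<close>
    define x0 where "x0 = e / (4 * (c * B\<psi> * C2 + 1))"
    have den: "0 < c * B\<psi> * C2 + 1" using c0 B\<psi>(1) C20 by (simp add: add_nonneg_pos)
    have x0: "0 < x0" unfolding x0_def using e den by simp
    define l where "l = x0 powr (1 / (1 - p))"
    have l: "0 < l" "l powr (1 - p) = x0" using x0 p by (auto simp: l_def powr_powr)
    have "c * B\<psi> * C2 * x0 \<le> (c * B\<psi> * C2 + 1) * x0" using x0 by simp
    also have "\<dots> = e / 4" unfolding x0_def using den by (simp add: field_simps)
    finally have e2: "c * B\<psi> * (l powr (1 - p) * C2) \<le> e / 4" by (simp add: l(2) mult_ac)
    obtain d1 where d1: "0 < d1" "\<And>x y. dist x y \<le> d1 \<Longrightarrow> norm (\<psi> x - \<psi> y) \<le> \<omega>"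
      using uniformly_continuous_compact_support[OF test_function_continuous(1)[OF psi] K\<psi>(1,3) \<omega>] by metis
    have lim1: "(\<lambda>k. eps k * R) \<longlonglongrightarrow> 0" using tendsto_mult_left_zero[OF eps(2)] by blast
    have lim2: "(\<lambda>k. 8 * R * \<theta> k) \<longlonglongrightarrow> 0" using tendsto_mult_right_zero[OF \<theta>] by blast
    have lim3: "(\<lambda>k. c * B\<psi> * l * \<tau> k) \<longlonglongrightarrow> 0" using tendsto_mult_right_zero[OF \<tau>] by blast
    have "\<forall>\<^sub>F k in sequentially. eps k < 1 \<and> eps k * R < d1 \<and> eps k * R < \<rho>0 / 2 \<and> 8 * R * \<theta> k < 1 \<and> c * B\<psi> * l * \<tau> k < e / 4"
      using order_tendstoD(2)[OF eps(2), of 1] order_tendstoD(2)[OF lim1, of d1] order_tendstoD(2)[OF lim1, of "\<rho>0 / 2"]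
        order_tendstoD(2)[OF lim2, of 1] order_tendstoD(2)[OF lim3, of "e / 4"] d1(1) \<rho>0(1) e
      by (intro eventually_conj) auto
    then obtain k0 where k0: "\<And>k. k \<ge> k0 \<Longrightarrow> eps k < 1 \<and> eps k * R < d1 \<and> eps k * R < \<rho>0 / 2 \<and> 8 * R * \<theta> k < 1 \<and> c * B\<psi> * l * \<tau> k < e / 4"
      by (auto simp: eventually_sequentially)
    have "norm (?L k - 0) < e" if k: "k \<ge> k0" for k
    proof -
      interpret U: unfolding_cells \<Omega> "A k" "Q (eps k)" "N (eps k)" "eps k" by (rule cells)
      note kk = k0[OF k]
      define r0 where "r0 = eps k * R"
      define b where "b = eps k powr r"
      have b: "0 < b" "b \<le> 1" using eps(1)[of k] kk r powr_mono2[of r "eps k" 1] by (auto simp: b_def)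
      have r0: "0 < r0" "r0 = R * \<theta> k * b" using eps(1)[of k] R0 eps\<theta>[of k] by (auto simp: r0_def b_def)
      \<comment> \<open>The margin 4 \<open>r0\<close> has to fit twice into the side of a cube;
        this is secured by 8 R \<theta> < 1.\<close>
      have r0b: "2 * (4 * r0) \<le> b" using mult_right_mono[of "8 * R * \<theta> k" 1 b] kk b(1) by (simp add: r0(2) mult_ac)
      have QS: "Q (eps k) n \<subseteq> S" if n: "n \<in> {1..N (eps k)}" for n
      proof
        fix x assume x: "x \<in> Q (eps k) n"
        have "dist (pt (eps k) n) x \<le> b * d"
          unfolding d_def b_def using open_cube_regular(3)[OF cubes[OF eps(1) n]] eps(1)[of k] x points[OF eps(1) n] by auto
        also have "\<dots> \<le> d" using b(2) d0 by (simp add: mult_left_le_one_le b(1) less_imp_le)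
        finally have "dist (pt (eps k) n) x \<le> d" .
        moreover have "norm (pt (eps k) n) \<le> R\<Omega>" using R\<Omega> points[OF eps(1) n] by blast
        ultimately have "norm x \<le> R\<Omega> + d" using norm_triangle_sub[of x "pt (eps k) n"] by (simp add: dist_norm norm_minus_commute)
        then show "x \<in> S" by (simp add: S_def)
      qed
      have dj: "disjoint_family_on (Q (eps k)) {1..N (eps k)}" by (rule cubes_disjoint[OF eps(1)])
      have oc: "open_cube b (Q (eps k) n)" if "n \<in> {1..N (eps k)}" for n unfolding b_def by (rule cubes[OF eps(1) that])
      have r4: "0 < 4 * r0" using r0 by simp
      obtain K where K: "\<And>n. n \<in> {1..N (eps k)} \<Longrightarrow> K n \<in> sets lebesgue" "\<And>n z. n \<in> {1..N (eps k)} \<Longrightarrow> z \<in> K n \<Longrightarrow> ball z (4 * r0) \<subseteq> Q (eps k) n"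
        and Km: "measure lebesgue (\<Union>n\<in>{1..N (eps k)}. Q (eps k) n - K n) \<le> 2 * real CARD('d) * (4 * r0) / b * measure lebesgue S"
        "(\<Union>n\<in>{1..N (eps k)}. Q (eps k) n - K n) \<in> lmeasurable"
        by (rule cube_boundary_layer[OF oc dj b(1) r4 r0b S QS]) blast+
      define Bad where "Bad = \<Omega> \<inter> (\<Union>n\<in>{1..N (eps k)}. Q (eps k) n - K n)"
      have Bads: "Bad \<in> sets lebesgue" unfolding Bad_def using Om_sets fmeasurableD[OF Km(2)] by (rule sets.Int)
      have "measure lebesgue Bad \<le> measure lebesgue (\<Union>n\<in>{1..N (eps k)}. Q (eps k) n - K n)"
        by (rule measure_mono_fmeasurable[OF _ Bads Km(2)]) (simp add: Bad_def)
      also have "\<dots> \<le> 2 * real CARD('d) * (4 * r0) / b * measure lebesgue S" by (rule Km(1))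
      also have "\<dots> = \<tau> k" unfolding \<tau>_def r0(2) d_def using b(1) by simp
      finally have Badm: "measure lebesgue Bad \<le> \<tau> k" .
      have an: "norm (A k n *v v) \<le> a * norm v" "norm (transpose (A k n) *v v) \<le> a * norm v" if "n \<in> {1..N (eps k)}" for n v
        using a(2,3) points[OF eps(1) that] by blast+
      have wint: "integrable (lebesgue_on \<Omega>) (w k)" "integrable (lebesgue_on \<Omega>) (grad_w k)"
        using Lp_fun_integrable[OF p U.finite_measure_Om] w(1,2)[of k] unfolding Lp_eq by blast+
      have r0': "r0 = eps k * a * (real CARD('d) * (real m + 1))" by (simp add: r0_def R_def d_def mult_ac)
      have psi3: "\<bar>\<psi> x - \<psi> z\<bar> \<le> \<omega>" if "dist x z \<le> r0" for x z
        using d1(2)[of x z] that kk by (simp add: r0_def)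
      have psi4: "ball z (2 * r0) \<subseteq> \<Omega>" if "\<psi> z \<noteq> 0" for z
      proof -
        have "z \<in> K\<psi>" using that K\<psi>(3) by blast
        moreover have "ball z (2 * r0) \<subseteq> ball z \<rho>0" using kk by (intro subset_ball) (simp add: r0_def)
        ultimately show ?thesis using \<rho>0(2) by blast
      qed
      have "\<bar>?L k\<bar> \<le> real (card (lattice_box m :: (real^'d) set)) * B * (\<omega> * (LINT x|lebesgue_on \<Omega>. norm (w k x) + eps k * a * norm (grad_w k x))
        + B\<psi> * (LINT x|lebesgue_on (\<Omega> \<inter> (\<Union>n\<in>{1..N (eps k)}. Q (eps k) n - K n)). norm (w k x) + eps k * a * norm (grad_w k x)))"
        unfolding u_def g_def unfolding_op_piecewise
        by (rule U.periodic_estimate[OF wint w(3) a(1) an phi B(2,3) r0' test_function_continuous(1)[OF psi] B\<psi>(2) psi3 psi4 K])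
      also have "\<dots> = c * (\<omega> * (LINT x|lebesgue_on \<Omega>. Gf k x) + B\<psi> * (LINT x|lebesgue_on Bad. Gf k x))"
        by (simp add: c_def Gf_def Bad_def)
      also have "\<dots> \<le> c * (\<omega> * C1 + B\<psi> * (l * \<tau> k + l powr (1 - p) * C2))"
      proof (intro mult_left_mono add_mono C1)
        have "l * measure lebesgue Bad \<le> l * \<tau> k" using l(1) Badm by simp
        then show "(LINT x|lebesgue_on Bad. Gf k x) \<le> l * \<tau> k + l powr (1 - p) * C2"
          using GfS[OF Bads _ l(1), of k] by (simp add: Bad_def)
      qed (use c0 \<omega> B\<psi>(1) in auto)
      also have "\<dots> = c * \<omega> * C1 + c * B\<psi> * l * \<tau> k + c * B\<psi> * (l powr (1 - p) * C2)" by (simp add: algebra_simps)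
      also have "\<dots> < e" using e1 e2 kk e by linarith
      finally show ?thesis by simp
    qed
    then show "\<exists>no. \<forall>k\<ge>no. norm (?L k - 0) < e" by blast
  qed
qed

end

lemma borel_measurable_matrix_vector:
  fixes A :: "'x \<Rightarrow> real^'d^'d" and v :: "'x \<Rightarrow> real^'d"
  assumes "A \<in> borel_measurable M" "v \<in> borel_measurable M"
  shows "(\<lambda>x. A x *v v x) \<in> borel_measurable M" "(\<lambda>x. transpose (A x) *v v x) \<in> borel_measurable M"
proof -
  have "continuous_on UNIV (\<lambda>z :: (real^'d^'d) \<times> (real^'d). fst z *v snd z)"
    "continuous_on UNIV (\<lambda>z :: (real^'d^'d) \<times> (real^'d). transpose (fst z) *v snd z)"
    unfolding matrix_vector_mult_def transpose_def by (auto intro!: continuous_intros)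
  note c = this[THEN borel_measurable_continuous_onI]
  show "(\<lambda>x. A x *v v x) \<in> borel_measurable M" "(\<lambda>x. transpose (A x) *v v x) \<in> borel_measurable M"
    using measurable_compose[OF borel_measurable_Pair[OF assms] c(1)] measurable_compose[OF borel_measurable_Pair[OF assms] c(2)] by simp_all
qed

lemma inner_transpose_vector:
  fixes A :: "real^'d^'d"
  shows "(transpose A *v v) \<bullet> w = v \<bullet> (A *v w)"
  by (simp add: transpose_matrix_vector dot_lmul_matrix)

lemma transpose_matrix_inv_vector:
  fixes A :: "real^'d^'d"
  assumes "invertible A"
  shows "transpose (matrix_inv A) *v (transpose A *v v) = v"
proof (rule vector_eq_ldot[THEN iffD1], rule allI)
  fix z
  show "z \<bullet> (transpose (matrix_inv A) *v (transpose A *v v)) = z \<bullet> v"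
    using matrix_affine(4)[OF assms, of z] inner_transpose_vector[of "matrix_inv A" "transpose A *v v" z]
      inner_transpose_vector[of A v "matrix_inv A *v z"]
    by (simp add: inner_commute)
qed

lemma Lp_fun_linear:
  fixes h :: "'b::euclidean_space \<Rightarrow> 'c::euclidean_space"
  assumes p: "1 < p" and h: "linear h" "\<And>v. norm (h v) \<le> norm v" and L: "L \<in> Lp_fun p M"
  shows "(\<lambda>x. h (L x)) \<in> Lp_fun p M"
proof (rule Lp_fun_bounded_by)
  show "(\<lambda>x. h (L x)) \<in> borel_measurable M" by (rule measurable_compose[OF Lp_funD(1)[OF L] borel_measurable_linear[OF h(1)]])
  show "norm (h (L x)) powr p \<le> norm (L x) powr p" for x using h(2) p by (intro powr_mono2) auto
qed (rule Lp_funD(2)[OF L])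

lemma Lp_fun_cong: "(\<And>x. x \<in> space M \<Longrightarrow> f x = g x) \<Longrightarrow> f \<in> Lp_fun p M \<longleftrightarrow> g \<in> Lp_fun p M"
  unfolding Lp_fun_def using measurable_cong[of M f g borel]
  by (auto cong: Bochner_Integration.integrable_cong)

lemma triple_projections:
  "linear (\<lambda>v :: 'a::euclidean_space \<times> 'b::euclidean_space \<times> 'c::euclidean_space. fst v)"
  "linear (\<lambda>v :: 'a \<times> 'b \<times> 'c. fst (snd v))"
  "linear (\<lambda>v :: 'a \<times> 'b \<times> 'c. snd (snd v))"
  "norm (fst v) \<le> norm v" "norm (fst (snd v)) \<le> norm v" "norm (snd (snd v)) \<le> norm (v :: 'a \<times> 'b \<times> 'c)"
proof -
  show "linear (\<lambda>v :: 'a \<times> 'b \<times> 'c. fst v)" "linear (\<lambda>v :: 'a \<times> 'b \<times> 'c. fst (snd v))"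
    "linear (\<lambda>v :: 'a \<times> 'b \<times> 'c. snd (snd v))" by (auto simp: linear_iff)
  have "norm (fst v) \<le> norm v" "norm (snd v) \<le> norm v" "norm (fst (snd v)) \<le> norm (snd v)" "norm (snd (snd v)) \<le> norm (snd v)"
    by (metis norm_fst_le prod.collapse, metis norm_snd_le prod.collapse, metis norm_fst_le prod.collapse, metis norm_snd_le prod.collapse)
  then show "norm (fst v) \<le> norm v" "norm (fst (snd v)) \<le> norm v" "norm (snd (snd v)) \<le> norm v" by linarith+
qed

section \<open>Relation between the two limit gradients\<close>

context lp_unfolding
begin

text \<open>The defect of \<open>g\<close> against D^T \<open>q\<close> tends to 0 in L^1 at rate
  \<epsilon>^r. Its limit H is tested against the bounded field H/(1 + |H|), which gives a vanishing
  integral of |H|^2/(1 + |H|) and hence H = 0 almost everywhere.\<close>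

lemma gradient_relation:
  assumes s: "strict_mono (s :: nat \<Rightarrow> nat)"
    and maz: "mazur_limit p P (\<lambda>k z. (u (s k) z, g (s k) z, q (s k) z)) (\<lambda>z. (U0 z, G0 z, Q0 z))"
    and G0: "G0 \<in> Lp_fun p P" and Q0: "Q0 \<in> Lp_fun p P"
  shows "AE z in P. G0 z = transpose (D (fst z)) *v Q0 z" "{z \<in> space P. G0 z = transpose (D (fst z)) *v Q0 z} \<in> sets P"
proof -
  interpret finite_measure P by (rule finite_P)
  obtain a where a: "0 < a" "\<And>x v. x \<in> \<Omega> \<Longrightarrow> norm (D x *v v) \<le> a * norm v" "\<And>x v. x \<in> \<Omega> \<Longrightarrow> norm (transpose (D x) *v v) \<le> a * norm v"
    by (rule D_bounded) blast
  obtain L where L: "0 \<le> L" "\<And>k x y. norm (g k (x, y) - transpose (D x) *v q k (x, y)) \<le> L * eps k powr r * norm (q k (x, y))"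
    by (rule g_approx) blast
  have "continuous_on UNIV D" using D_lip lipschitz_on_continuous_on by blast
  then have "D \<in> borel_measurable (lebesgue_on \<Omega>)" by (rule continuous_measurable_lebesgue_on)
  from measurable_compose[OF measurable_fst this] have Dm: "(\<lambda>z. D (fst z)) \<in> borel_measurable P" .
  define H where "H = (\<lambda>z. G0 z - transpose (D (fst z)) *v Q0 z)"
  have Hm: "H \<in> borel_measurable P" unfolding H_def
    by (intro borel_measurable_diff borel_measurable_matrix_vector Dm Lp_funD(1)[OF G0] Lp_funD(1)[OF Q0])
  have Hnm: "(\<lambda>z. norm (H z)) \<in> borel_measurable P" using Hm by measurable
  define \<psi> where "\<psi> = (\<lambda>z. (indicat_real \<Omega> (fst z) / (1 + norm (H z))) *\<^sub>R H z)"
  have n1: "0 < 1 + norm (H z)" for z by (simp add: add_pos_nonneg)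
  have \<psi>1: "norm (\<psi> z) \<le> 1" for z
  proof -
    have "norm (H z) / (1 + norm (H z)) \<le> 1" using n1[of z] by (simp add: divide_le_eq_1)
    then show ?thesis using n1[of z] by (auto simp: \<psi>_def indicator_def)
  qed
  have im: "indicat_real \<Omega> \<in> borel_measurable (lebesgue_on \<Omega>)"
    by (rule borel_measurable_indicator) (simp add: sets_restrict_space_iff Om_sets)
  have \<psi>m: "\<psi> \<in> borel_measurable P" unfolding \<psi>_def
    by (intro borel_measurable_scaleR borel_measurable_divide measurable_compose[OF measurable_fst im] borel_measurable_add Hnm borel_measurable_const Hm)
  \<comment> \<open>Moves the matrix to the test side: pairing this field with the triple equals
    pairing \<psi> with the defect. The indicator of \<Omega> in \<psi> restricts to points where D
    is bounded.\<close>
  define \<Psi> where "\<Psi> = (\<lambda>z. (0 :: real, \<psi> z, - (D (fst z) *v \<psi> z)))"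
  have \<Psi>m: "\<Psi> \<in> borel_measurable P" unfolding \<Psi>_def
    by (intro borel_measurable_Pair borel_measurable_uminus borel_measurable_matrix_vector(1) Dm \<psi>m borel_measurable_const)
  have \<Psi>b: "norm (\<Psi> z) \<le> 0 + (1 + a)" for z
  proof -
    have "norm (D (fst z) *v \<psi> z) \<le> a"
    proof (cases "fst z \<in> \<Omega>")
      case True
      have "a * norm (\<psi> z) \<le> a" using a(1) \<psi>1[of z] by simp
      then show ?thesis using a(2)[OF True, of "\<psi> z"] by linarith
    qed (use a(1) in \<open>simp add: \<psi>_def\<close>)
    then show ?thesis unfolding \<Psi>_def using \<psi>1[of z]
      by (intro order_trans[OF norm_Pair_le] add_mono) (auto intro!: order_trans[OF norm_Pair_le] add_mono)
  qed
  have inner: "\<Psi> z \<bullet> (x, y, t) = \<psi> z \<bullet> (y - transpose (D (fst z)) *v t)" for z x y t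
    using inner_transpose_vector[of "D (fst z)" t "\<psi> z"] by (simp add: \<Psi>_def inner_diff_right inner_commute)
  have lim1: "(\<lambda>k. LINT z|P. \<Psi> z \<bullet> (u (s k) z, g (s k) z, q (s k) z)) \<longlonglongrightarrow> (LINT z|P. \<Psi> z \<bullet> (U0 z, G0 z, Q0 z))"
    by (rule mazur_limit_inner[OF p finite_P maz \<Psi>m \<Psi>b])
  define c where "c = measure P (space P) + \<bar>C\<bar> powr p"
  have est: "norm (LINT z|P. \<Psi> z \<bullet> (u k z, g k z, q k z)) \<le> L * c * eps k powr r" for k
  proof -
    note qL = q_Lp(1)[of k]
    have qi: "integrable P (\<lambda>z. L * eps k powr r * norm (q k z))" using Lp_fun_integrable[OF p finite_P qL] by simp
    have le: "norm (\<Psi> z \<bullet> (u k z, g k z, q k z)) \<le> L * eps k powr r * norm (q k z)" for z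
    proof -
      have "norm (\<psi> z \<bullet> (g k z - transpose (D (fst z)) *v q k z)) \<le> norm (\<psi> z) * norm (g k z - transpose (D (fst z)) *v q k z)"
        by (simp add: Cauchy_Schwarz_ineq2)
      also have "\<dots> \<le> 1 * (L * eps k powr r * norm (q k z))"
        using L(2)[of k "fst z" "snd z"] \<psi>1[of z] by (intro mult_mono) auto
      finally show ?thesis unfolding inner by simp
    qed
    have m: "(\<lambda>z. \<Psi> z \<bullet> (u k z, g k z, q k z)) \<in> borel_measurable P"
      by (intro borel_measurable_inner \<Psi>m borel_measurable_Pair Lp_funD(1)[OF u_Lp(1)] Lp_funD(1)[OF g_Lp] Lp_funD(1)[OF qL])
    have i: "integrable P (\<lambda>z. \<Psi> z \<bullet> (u k z, g k z, q k z))"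
      by (rule Bochner_Integration.integrable_bound[OF qi m]) (intro AE_I2, use le order_trans[OF _ abs_ge_self] in fastforce)
    have "norm (LINT z|P. \<Psi> z \<bullet> (u k z, g k z, q k z)) \<le> (LINT z|P. L * eps k powr r * norm (q k z))"
      by (rule Bochner_Integration.integral_norm_bound_integral[OF i qi le])
    also have "\<dots> = L * eps k powr r * (LINT z|P. norm (q k z))" by simp
    also have "\<dots> \<le> L * eps k powr r * c"
      unfolding c_def using LINT_norm_le_powr[OF p finite_P qL, of 1] q_Lp(2)[of k] L(1) by (intro mult_left_mono) auto
    finally show ?thesis by (simp add: mult_ac)
  qed
  have "(\<lambda>k. L * c * eps k powr r) \<longlonglongrightarrow> 0"
    using tendsto_mult_right_zero[OF tendsto_0_powr_iff[of r eps, THEN iffD2]] r eps less_imp_le by metis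
  then have "(\<lambda>k. LINT z|P. \<Psi> z \<bullet> (u k z, g k z, q k z)) \<longlonglongrightarrow> 0"
    by (rule Lim_null_comparison[rotated]) (use est in simp)
  from LIMSEQ_subseq_LIMSEQ[OF this s] LIMSEQ_unique[OF lim1]
  have zero: "(LINT z|P. \<Psi> z \<bullet> (U0 z, G0 z, Q0 z)) = 0" by (auto simp: comp_def)
  have eqH: "\<Psi> z \<bullet> (U0 z, G0 z, Q0 z) = norm (H z) ^ 2 / (1 + norm (H z))" if "z \<in> space P" for z
  proof -
    have "\<Psi> z \<bullet> (U0 z, G0 z, Q0 z) = \<psi> z \<bullet> H z" by (simp only: inner H_def)
    then show ?thesis using that by (simp add: \<psi>_def space_pair_measure mem_Times_iff power2_norm_eq_inner)
  qed
  have Hi: "integrable P (\<lambda>z. norm (G0 z) + a * norm (Q0 z))"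
    using Lp_fun_integrable[OF p finite_P G0] Lp_fun_integrable[OF p finite_P Q0] by simp
  have Hle: "norm (H z) ^ 2 / (1 + norm (H z)) \<le> norm (G0 z) + a * norm (Q0 z)" if "z \<in> space P" for z
  proof -
    have "norm (H z) ^ 2 / (1 + norm (H z)) \<le> norm (H z)"
      using n1[of z] by (simp add: pos_divide_le_eq power2_eq_square algebra_simps)
    also have "\<dots> \<le> norm (G0 z) + norm (transpose (D (fst z)) *v Q0 z)" unfolding H_def by (rule norm_triangle_ineq4)
    also have "\<dots> \<le> norm (G0 z) + a * norm (Q0 z)" using a(3)[of "fst z"] that by (simp add: space_pair_measure mem_Times_iff)
    finally show ?thesis .
  qed
  have i: "integrable P (\<lambda>z. norm (H z) ^ 2 / (1 + norm (H z)))"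
  proof (rule Bochner_Integration.integrable_bound[OF Hi])
    show "(\<lambda>z. norm (H z) ^ 2 / (1 + norm (H z))) \<in> borel_measurable P" using Hm by measurable
    show "AE z in P. norm (norm (H z) ^ 2 / (1 + norm (H z))) \<le> norm (norm (G0 z) + a * norm (Q0 z))"
    proof (rule AE_I2)
      fix z assume "z \<in> space P"
      from Hle[OF this] show "norm (norm (H z) ^ 2 / (1 + norm (H z))) \<le> norm (norm (G0 z) + a * norm (Q0 z))"
        using n1[of z] a(1) by (simp add: abs_of_nonneg)
    qed
  qed
  have "(LINT z|P. norm (H z) ^ 2 / (1 + norm (H z))) = 0"
    unfolding zero[symmetric] by (rule Bochner_Integration.integral_cong) (use eqH in auto)
  then have "AE z in P. norm (H z) ^ 2 / (1 + norm (H z)) = 0"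
    using integral_nonneg_eq_0_iff_AE[OF i] n1 by (simp add: less_imp_le)
  then show "AE z in P. G0 z = transpose (D (fst z)) *v Q0 z"
  proof eventually_elim
    case (elim z)
    then have "H z = 0" using n1[of z] by (simp add: less_imp_neq[symmetric])
    then show ?case by (simp add: H_def)
  qed
  have "{z \<in> space P. H z = 0} \<in> sets P" using Hm by measurable
  then show "{z \<in> space P. G0 z = transpose (D (fst z)) *v Q0 z} \<in> sets P" by (simp add: H_def)
qed

end

lemma int_part_add_lattice:
  fixes y \<xi> :: "real^'d"
  assumes \<xi>: "\<xi> \<in> int_lattice"
  shows "int_part (y + \<xi>) = int_part y + \<xi>"
proof (rule int_part_unique)
  show "int_part y + \<xi> \<in> int_lattice" using int_part_lattice[of y] \<xi> by (auto simp: int_lattice_def)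
qed (use int_part_bounds[of y] in auto)

lemma int_part_unit_cell:
  fixes y :: "real^'d"
  assumes "y \<in> unit_cell"
  shows "int_part y = 0"
  by (rule int_part_unique) (use assms in \<open>auto simp: unit_cell_def int_lattice_def less_imp_le\<close>)

lemma W1p_per_subset: "W1p_per p \<subseteq> (W1p p unit_cell :: (real^'d \<Rightarrow> real) set)"
proof
  fix v :: "real^'d \<Rightarrow> real" assume "v \<in> W1p_per p"
  then obtain g where g: "v \<in> Lp p unit_cell" "g \<in> Lp p unit_cell" "has_weak_gradient UNIV v g"
    by (auto simp: W1p_per_def)
  show "v \<in> W1p p unit_cell"
    by (rule W1p_I[OF g(1,2) has_weak_gradient_subset[OF g(3) open_UNIV open_unit_cell subset_UNIV]])
qed

lemma W1p_per_zero: "(\<lambda>y. 0) \<in> W1p_per p"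
proof -
  have "(\<lambda>y :: real^'d. 0 :: real) \<in> Lp p unit_cell" "(\<lambda>y :: real^'d. 0 :: real^'d) \<in> Lp p unit_cell"
    by (auto simp: Lp_eq Lp_fun_zero)
  then show ?thesis unfolding W1p_per_def using has_weak_gradient_zero by blast
qed

section \<open>Identification of the limits\<close>

context lp_unfolding
begin

lemma limit_pairing:
  assumes s: "strict_mono (s :: nat \<Rightarrow> nat)"
    and maz: "mazur_limit p P (\<lambda>k z. (u (s k) z, g (s k) z, q (s k) z)) (\<lambda>z. (U0 z, G0 z, Q0 z))"
    and phi: "test_function {y. \<forall>i. \<bar>y $ i\<bar> < real m} \<phi>" and psi: "test_function \<Omega> \<psi>"
  shows "integral\<^sup>L P (\<lambda>z. \<psi> (fst z) * (U0 z * (\<Sum>\<xi>\<in>lattice_box m. frechet_derivative \<phi> (at (snd z + \<xi>)) (axis i 1))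
      + G0 z $ i * (\<Sum>\<xi>\<in>lattice_box m. \<phi> (snd z + \<xi>)))) = 0"
proof -
  obtain B where B: "0 \<le> B" "\<And>x. \<bar>\<phi> x\<bar> \<le> B" "\<And>x. \<bar>frechet_derivative \<phi> (at x) (axis i 1)\<bar> \<le> B"
    by (rule test_function_bounded[OF phi]) blast
  obtain B\<psi> where B\<psi>: "0 \<le> B\<psi>" "\<And>x. \<bar>\<psi> x\<bar> \<le> B\<psi>" using test_function_bounded[OF psi] by metis
  define \<Phi>0 where "\<Phi>0 = (\<lambda>y. \<Sum>\<xi>\<in>lattice_box m. frechet_derivative \<phi> (at (y + \<xi>)) (axis i 1))"
  define \<Phi>1 where "\<Phi>1 = (\<lambda>y. \<Sum>\<xi>\<in>lattice_box m. \<phi> (y + \<xi>))"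
  have shift: "continuous_on UNIV (\<lambda>y. f (y + \<xi>))" if "continuous_on UNIV f" for f :: "real^'d \<Rightarrow> real" and \<xi>
    by (rule continuous_on_compose2[OF that]) (auto intro: continuous_intros)
  have c: "continuous_on UNIV \<Phi>0" "continuous_on UNIV \<Phi>1" unfolding \<Phi>0_def \<Phi>1_def
    by (intro continuous_on_sum shift[OF test_function_continuous(2)[OF phi]], intro continuous_on_sum shift[OF test_function_continuous(1)[OF phi]])
  define b where "b = real (card (lattice_box m :: (real^'d) set)) * B"
  have b0: "0 \<le> b" using B(1) by (simp add: b_def)
  have \<Phi>b: "\<bar>\<Phi>0 y\<bar> \<le> b" "\<bar>\<Phi>1 y\<bar> \<le> b" for y
    unfolding \<Phi>0_def \<Phi>1_def b_def
    by (rule order_trans[OF sum_abs sum_bounded_above], rule B)+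
  note cm = continuous_measurable_lebesgue_on
  have pm: "(\<lambda>z. \<psi> (fst z)) \<in> borel_measurable P"
    by (rule measurable_compose[OF measurable_fst cm[OF test_function_continuous(1)[OF psi]]])
  have \<Phi>m: "(\<lambda>z. \<Phi>0 (snd z)) \<in> borel_measurable P" "(\<lambda>z. \<Phi>1 (snd z)) \<in> borel_measurable P"
    by (rule measurable_compose[OF measurable_snd cm[OF c(1)]], rule measurable_compose[OF measurable_snd cm[OF c(2)]])
  \<comment> \<open>The whole pairing written as an inner product of the triple with one bounded
    field, so that convergence of bounded pairings applies.\<close>
  define \<Psi> where "\<Psi> = (\<lambda>z. (\<psi> (fst z) * \<Phi>0 (snd z), (\<psi> (fst z) * \<Phi>1 (snd z)) *\<^sub>R (axis i 1 :: real^'d), 0 :: real^'d))"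
  have \<Psi>m: "\<Psi> \<in> borel_measurable P" unfolding \<Psi>_def
    by (intro borel_measurable_Pair borel_measurable_times borel_measurable_scaleR pm \<Phi>m borel_measurable_const)
  have \<Psi>b: "norm (\<Psi> z) \<le> B\<psi> * b + (B\<psi> * b + 0)" for z
    unfolding \<Psi>_def
    by (rule order_trans[OF norm_Pair_le add_mono[OF _ order_trans[OF norm_Pair_le add_mono]]])
      (use B\<psi> \<Phi>b b0 in \<open>auto simp: abs_mult norm_axis_1 intro!: mult_mono\<close>)
  have inner: "\<Psi> z \<bullet> (x, v, t) = \<psi> (fst z) * (x * \<Phi>0 (snd z) + v $ i * \<Phi>1 (snd z))" for z x v t
    by (simp add: \<Psi>_def inner_axis' algebra_simps)
  have "(\<lambda>k. LINT z|P. \<Psi> z \<bullet> (u (s k) z, g (s k) z, q (s k) z)) \<longlonglongrightarrow> (LINT z|P. \<Psi> z \<bullet> (U0 z, G0 z, Q0 z))"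
    by (rule mazur_limit_inner[OF p finite_P maz \<Psi>m \<Psi>b])
  moreover have "(\<lambda>k. LINT z|P. \<Psi> z \<bullet> (u (s k) z, g (s k) z, q (s k) z)) \<longlonglongrightarrow> 0"
    using LIMSEQ_subseq_LIMSEQ[OF pairing_tendsto[OF phi psi, of i] s] unfolding inner comp_def \<Phi>0_def \<Phi>1_def .
  ultimately have "(LINT z|P. \<Psi> z \<bullet> (U0 z, G0 z, Q0 z)) = 0" by (rule LIMSEQ_unique)
  then show ?thesis unfolding inner \<Phi>0_def \<Phi>1_def .
qed

lemma Lp_product:
  fixes f :: "(real^'d) \<times> (real^'d) \<Rightarrow> 'b::euclidean_space"
  assumes f: "f \<in> Lp_fun p P"
  shows "f \<in> Lp p (\<Omega> \<times> unit_cell)"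
    "(LINT z|lebesgue_on (\<Omega> \<times> unit_cell). norm (f z) powr p) = (LINT z|P. norm (f z) powr p)"
proof -
  note t = pair_lebesgue_on_integral[OF Om_sets unit_cell_sets]
  have n: "(\<lambda>z. norm (f z) powr p) \<in> borel_measurable P" using Lp_funD(2)[OF f] by simp
  show "f \<in> Lp p (\<Omega> \<times> unit_cell)" unfolding Lp_def using t(1)[OF Lp_funD(1)[OF f]] t(2)[OF n] Lp_funD(2)[OF f] by blast
  show "(LINT z|lebesgue_on (\<Omega> \<times> unit_cell). norm (f z) powr p) = (LINT z|P. norm (f z) powr p)" by (rule t(3)[OF n])
qed

theorem weak_limits:
  "\<exists>s w0 G. strict_mono (s :: nat \<Rightarrow> nat) \<and>
    w0 \<in> Lp_W1p_per_transformed p \<Omega> D \<and>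
    weakly_in_Lp_W1p p \<Omega> unit_cell (\<lambda>k. unfolding_op \<Omega> D N Q pt (eps (s k)) (w (s k))) (\<lambda>(x, y). w0 (x, D x *v y)) \<and>
    (AE x in lebesgue_on \<Omega>. has_weak_gradient unit_cell (\<lambda>y. w0 (x, D x *v y)) (\<lambda>y. G (x, y))) \<and>
    weakly_in_Lp p (\<Omega> \<times> unit_cell)
      (\<lambda>k z. eps (s k) *\<^sub>R unfolding_op \<Omega> D N Q pt (eps (s k)) (grad_w (s k)) z)
      (\<lambda>(x, y). transpose (matrix_inv (D x)) *v G (x, y))"
proof -
  obtain s U0 G0 Q0 where s: "strict_mono (s :: nat \<Rightarrow> nat)"
    and maz: "mazur_limit p P (\<lambda>k z. (u (s k) z, g (s k) z, q (s k) z)) (\<lambda>z. (U0 z, G0 z, Q0 z))"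
    by (rule compactness)
  define F where "F = (\<lambda>k z. (u (s k) z, g (s k) z, q (s k) z))"
  define L where "L = (\<lambda>z. (U0 z, G0 z, Q0 z))"
  have FLp: "F k \<in> Lp_fun p P" and LLp: "L \<in> Lp_fun p P" for k
    using maz unfolding mazur_limit_def F_def L_def by blast+
  have U0: "U0 \<in> Lp_fun p P" and G0: "G0 \<in> Lp_fun p P" and Q0: "Q0 \<in> Lp_fun p P"
    using Lp_fun_linear[OF p triple_projections(1,4) LLp] Lp_fun_linear[OF p triple_projections(2,5) LLp]
      Lp_fun_linear[OF p triple_projections(3,6) LLp] by (simp_all add: L_def)
  \<comment> \<open>The limit is determined only for y in the unit cell; elsewhere it is replaced by
    the periodic extension, which changes nothing in integrals over \<open>P\<close>.\<close>
  define U1 where "U1 = (\<lambda>z. U0 (fst z, snd z - int_part (snd z)))"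
  define G1 where "G1 = (\<lambda>z. G0 (fst z, snd z - int_part (snd z)))"
  have eq: "U1 z = U0 z" "G1 z = G0 z" if "snd z \<in> unit_cell" for z
    using int_part_unit_cell[OF that] by (simp_all add: U1_def G1_def)
  have spP: "snd z \<in> unit_cell" if "z \<in> space P" for z using that by (auto simp: space_pair_measure)
  have U1: "U1 \<in> Lp_fun p P" using U0 Lp_fun_cong[of P U1 U0 p] eq(1) spP by blast
  have G1: "G1 \<in> Lp_fun p P" using G0 Lp_fun_cong[of P G1 G0 p] eq(2) spP by blast
  \<comment> \<open>The Bochner measurability of the limit and both weak convergences draw on these
    common weights.\<close>
  have combos: "\<exists>c m. (\<forall>n. conv_weights n (m n) (c n)) \<and>
      (\<lambda>n. LINT z|P. norm ((\<Sum>k<m n. c n k *\<^sub>R u (s (t k)) z) - U1 z) powr p) \<longlonglongrightarrow> 0 \<and>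
      (\<lambda>n. LINT z|P. norm ((\<Sum>k<m n. c n k *\<^sub>R g (s (t k)) z) - G1 z) powr p) \<longlonglongrightarrow> 0 \<and>
      (\<lambda>n. LINT z|P. norm ((\<Sum>k<m n. c n k *\<^sub>R q (s (t k)) z) - Q0 z) powr p) \<longlonglongrightarrow> 0"
    if t: "strict_mono (t :: nat \<Rightarrow> nat)" for t
  proof -
    obtain c m where cm: "\<forall>n. conv_weights n (m n) (c n)"
      and lim: "(\<lambda>n. LINT z|P. norm ((\<Sum>k<m n. c n k *\<^sub>R F (t k) z) - L z) powr p) \<longlonglongrightarrow> 0"
      using maz t unfolding mazur_limit_def F_def L_def by blast
    note lin = mazur_limit_linear[where F = F and L = L and M = P and c = c and m = m and t = t, OF p FLp LLp _ _ lim]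
    have "(\<lambda>n. LINT z|P. norm ((\<Sum>k<m n. c n k *\<^sub>R u (s (t k)) z) - U0 z) powr p) \<longlonglongrightarrow> 0"
      using lin[OF triple_projections(1,4)] by (simp add: F_def L_def)
    moreover have "(LINT z|P. norm ((\<Sum>k<m n. c n k *\<^sub>R u (s (t k)) z) - U0 z) powr p)
        = (LINT z|P. norm ((\<Sum>k<m n. c n k *\<^sub>R u (s (t k)) z) - U1 z) powr p)" for n
      by (rule Bochner_Integration.integral_cong[OF refl]) (use eq(1) spP in simp)
    moreover have "(\<lambda>n. LINT z|P. norm ((\<Sum>k<m n. c n k *\<^sub>R g (s (t k)) z) - G0 z) powr p) \<longlonglongrightarrow> 0"
      using lin[OF triple_projections(2,5)] by (simp add: F_def L_def)
    moreover have "(LINT z|P. norm ((\<Sum>k<m n. c n k *\<^sub>R g (s (t k)) z) - G0 z) powr p)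
        = (LINT z|P. norm ((\<Sum>k<m n. c n k *\<^sub>R g (s (t k)) z) - G1 z) powr p)" for n
      by (rule Bochner_Integration.integral_cong[OF refl]) (use eq(2) spP in simp)
    moreover have "(\<lambda>n. LINT z|P. norm ((\<Sum>k<m n. c n k *\<^sub>R q (s (t k)) z) - Q0 z) powr p) \<longlonglongrightarrow> 0"
      using lin[OF triple_projections(3,6)] by (simp add: F_def L_def)
    ultimately show ?thesis using cm by (intro exI[of _ c] exI[of _ m]) simp
  qed
  have per: "AE x in lebesgue_on \<Omega>. has_weak_gradient UNIV (\<lambda>y. U1 (x, y)) (\<lambda>y. G1 (x, y))"
    unfolding U1_def G1_def fst_conv snd_conv
    by (rule periodic_limit[OF Om Lp_fun_integrable[OF p finite_P U0] Lp_fun_integrable[OF p finite_P G0]])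
      (rule limit_pairing[OF s maz])
  \<comment> \<open>The identity subsequence already provides simple approximants converging to the
    limit.\<close>
  have bp: "bochner_pair p \<Omega> unit_cell U1 G1"
  proof -
    have "strict_mono (\<lambda>k :: nat. k)" by (simp add: strict_mono_def)
    from combos[OF this] obtain c m where
      l1: "(\<lambda>n. LINT z|P. norm ((\<Sum>k<m n. c n k *\<^sub>R u (s k) z) - U1 z) powr p) \<longlonglongrightarrow> 0" and
      l2: "(\<lambda>n. LINT z|P. norm ((\<Sum>k<m n. c n k *\<^sub>R g (s k) z) - G1 z) powr p) \<longlonglongrightarrow> 0" by blast
    show ?thesis
      by (rule bochner_pair_limit[OF p Om_sets open_unit_cell bounded_unit_cell _ U1 G1 l1 l2])
        (rule simple_pair_sum[OF p open_unit_cell simple_pair_u])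
  qed
  have AEper: "AE x in lebesgue_on \<Omega>. (\<lambda>y. U1 (x, y)) \<in> W1p_per p"
    using per AE_Lp_section[OF Om_sets unit_cell_sets U1] AE_Lp_section[OF Om_sets unit_cell_sets G1]
  proof eventually_elim
    case (elim x)
    have "U1 (x, y + \<xi>) = U1 (x, y)" if "\<xi> \<in> int_lattice" for y \<xi>
      by (simp add: U1_def int_part_add_lattice[OF that])
    then show ?case unfolding W1p_per_def using elim by blast
  qed
  have W: "U1 \<in> bochner_Lp p \<Omega> (W1p_per p) (W1p_norm p unit_cell)"
  proof -
    have b: "U1 \<in> bochner_Lp p \<Omega> (W1p p unit_cell) (W1p_norm p unit_cell)"
      by (rule bochner_pair_norm(1)[OF p Om_sets open_unit_cell bp])
    \<comment> \<open>The approximants come from unfolded functions, which are not periodic in y, so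
      their values are moved into the periodic subspace.\<close>
    have "strongly_measurable_on \<Omega> (W1p_per p) (W1p_norm p unit_cell) U1"
      by (rule strongly_measurable_on_subset[OF p open_unit_cell _ W1p_per_subset W1p_per_zero AEper])
        (use bp in \<open>simp add: bochner_pair_def\<close>)
    then show ?thesis using b AEper by (simp add: bochner_Lp_def)
  qed
  \<comment> \<open>The inverse matrix undoes the substitution y -> D_x y of the statement, which
    brings back \<open>U1\<close>.\<close>
  define w0 where "w0 = (\<lambda>(x, y). U1 (x, matrix_inv (D x) *v y))"
  have w0D: "w0 (x, D x *v y) = U1 (x, y)" for x y by (simp add: w0_def matrix_affine(3)[OF D_inv])
  have w0: "w0 \<in> Lp_W1p_per_transformed p \<Omega> D"
    unfolding Lp_W1p_per_transformed_def using W by (auto simp: w0_def)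
  have weak1: "weakly_in_Lp_W1p p \<Omega> unit_cell (\<lambda>k. unfolding_op \<Omega> D N Q pt (eps (s k)) (w (s k))) (\<lambda>(x, y). w0 (x, D x *v y))"
  proof -
    have "weakly_in_Lp_W1p p \<Omega> unit_cell (\<lambda>k. u (s k)) U1"
    proof (rule weakly_in_Lp_W1pI[OF p Om_sets open_unit_cell _ bp])
      show "bochner_pair p \<Omega> unit_cell (u (s k)) (g (s k))" for k
        by (rule simple_pair_imp_bochner_pair[OF p open_unit_cell simple_pair_u])
    qed (use combos in blast)
    then show ?thesis unfolding u_def w0D by simp
  qed
  have grad: "AE x in lebesgue_on \<Omega>. has_weak_gradient unit_cell (\<lambda>y. w0 (x, D x *v y)) (\<lambda>y. G1 (x, y))"
    unfolding w0D using per by eventually_elim (rule has_weak_gradient_subset[OF _ open_UNIV open_unit_cell subset_UNIV])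
  \<comment> \<open>The target of the second convergence is expressed through \<open>G1\<close>,
    while the combinations converge to \<open>Q0\<close>. The two agree almost everywhere by
    inverting the transposed matrix, and this agreement also supplies the measurability of
    \<open>R\<close>.\<close>
  define R where "R = (\<lambda>(x, y). transpose (matrix_inv (D x)) *v G1 (x, y))"
  have sets: "\<Omega> \<times> (unit_cell :: (real^'d) set) \<in> sets lebesgue" by (rule lebesgue_Times(1)[OF Om_sets unit_cell_sets])
  have AER: "AE z in lebesgue_on (\<Omega> \<times> unit_cell). Q0 z = R z"
  proof -
    note gr = gradient_relation[OF s maz G0 Q0]
    have "AE z in lebesgue_on (\<Omega> \<times> unit_cell). G0 z = transpose (D (fst z)) *v Q0 z"
      using AE_pair_lebesgue_on[OF Om_sets unit_cell_sets gr(2)] gr(1) by blast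
    moreover have "AE z in lebesgue_on (\<Omega> \<times> (unit_cell :: (real^'d) set)). snd z \<in> unit_cell"
      by (rule AE_I2) (auto simp: space_restrict_space)
    ultimately show ?thesis
    proof eventually_elim
      case (elim z)
      then show ?case using eq(2)[OF elim(2)] transpose_matrix_inv_vector[OF D_inv, of "fst z" "Q0 z"]
        by (simp add: R_def split_beta)
    qed
  qed
  note Q0L = Lp_product(1)[OF Q0]
  have Rm: "R \<in> borel_measurable (lebesgue_on (\<Omega> \<times> unit_cell))"
    by (rule borel_measurable_lebesgue_on_AE_cong[OF _ sets AER]) (use Q0L in \<open>simp add: Lp_def\<close>)
  have RLp: "R \<in> Lp p (\<Omega> \<times> unit_cell)"
  proof -
    have "integrable (lebesgue_on (\<Omega> \<times> unit_cell)) (\<lambda>z. norm (R z) powr p)"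
    proof (rule integrable_cong_AE_imp)
      show "integrable (lebesgue_on (\<Omega> \<times> unit_cell)) (\<lambda>z. norm (Q0 z) powr p)" using Q0L by (simp add: Lp_def)
      show "(\<lambda>z. norm (R z) powr p) \<in> borel_measurable (lebesgue_on (\<Omega> \<times> unit_cell))" using Rm by measurable
      show "AE z in lebesgue_on (\<Omega> \<times> unit_cell). norm (Q0 z) powr p = norm (R z) powr p" using AER by eventually_elim simp
    qed
    with Rm show ?thesis by (simp add: Lp_def)
  qed
  have weak2: "weakly_in_Lp p (\<Omega> \<times> unit_cell) (\<lambda>k. q (s k)) R"
  proof (rule weakly_in_LpI[OF p Lp_product(1)[OF q_Lp(1)] RLp])
    fix t :: "nat \<Rightarrow> nat" assume "strict_mono t"
    from combos[OF this] obtain c m where cm: "\<forall>n. conv_weights n (m n) (c n)"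
      and lim: "(\<lambda>n. LINT z|P. norm ((\<Sum>k<m n. c n k *\<^sub>R q (s (t k)) z) - Q0 z) powr p) \<longlonglongrightarrow> 0" by blast
    have "(LINT z|lebesgue_on (\<Omega> \<times> unit_cell). norm ((\<Sum>k<m n. c n k *\<^sub>R q (s (t k)) z) - R z) powr p)
        = (LINT z|P. norm ((\<Sum>k<m n. c n k *\<^sub>R q (s (t k)) z) - Q0 z) powr p)" for n
    proof -
      define S where "S = (\<lambda>z. \<Sum>k<m n. c n k *\<^sub>R q (s (t k)) z)"
      have S: "S \<in> Lp_fun p P" unfolding S_def by (intro Lp_fun_sum[OF p] Lp_fun_scaleR q_Lp(1))
      have dm: "(\<lambda>z. S z - Q0 z) \<in> borel_measurable (lebesgue_on (\<Omega> \<times> unit_cell))" "(\<lambda>z. S z - R z) \<in> borel_measurable (lebesgue_on (\<Omega> \<times> unit_cell))"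
        using Lp_product(1)[OF S] Q0L Rm by (auto simp: Lp_def)
      have "(LINT z|lebesgue_on (\<Omega> \<times> unit_cell). norm (S z - R z) powr p) = (LINT z|lebesgue_on (\<Omega> \<times> unit_cell). norm (S z - Q0 z) powr p)"
      proof (rule integral_cong_AE)
        show "(\<lambda>z. norm (S z - R z) powr p) \<in> borel_measurable (lebesgue_on (\<Omega> \<times> unit_cell))" using dm(2) by measurable
        show "(\<lambda>z. norm (S z - Q0 z) powr p) \<in> borel_measurable (lebesgue_on (\<Omega> \<times> unit_cell))" using dm(1) by measurable
        show "AE z in lebesgue_on (\<Omega> \<times> unit_cell). norm (S z - R z) powr p = norm (S z - Q0 z) powr p" using AER by eventually_elim simp
      qed
      then show ?thesis using Lp_product(2)[OF Lp_fun_diff[OF p S Q0]] by (simp add: S_def)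
    qed
    then show "\<exists>c m. (\<forall>n. conv_weights n (m n) (c n)) \<and>
      (\<lambda>n. LINT z|lebesgue_on (\<Omega> \<times> unit_cell). norm ((\<Sum>k<m n. c n k *\<^sub>R q (s (t k)) z) - R z) powr p) \<longlonglongrightarrow> 0"
      using cm lim by (intro exI[of _ c] exI[of _ m]) simp
  qed
  show ?thesis
    using s w0 weak1 grad weak2 unfolding q_def R_def
    by (intro exI[of _ s] exI[of _ w0] exI[of _ G1]) simp
qed

end

text \<open>\<open>G\<close> is a witness for the gradient of w0(x, D_x y) in y, chosen jointly for
  all x, since choosing a gradient in each fibre separately would give no control of its dependence
  on x. It is determined almost everywhere in the fibres, so the second limit is D_x^(-T) applied to
  the gradient.\<close>

theorem theorem4p1:
  fixes \<Omega> :: "(real^'d) set"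
    and D :: "real^'d \<Rightarrow> real^'d^'d"
    and D1 D2 r p C :: real
    and N :: "real \<Rightarrow> nat"
    and Q :: "real \<Rightarrow> nat \<Rightarrow> (real^'d) set"
    and pt :: "real \<Rightarrow> nat \<Rightarrow> real^'d"
    and eps :: "nat \<Rightarrow> real"
    and w :: "nat \<Rightarrow> real^'d \<Rightarrow> real"
    and grad_w :: "nat \<Rightarrow> real^'d \<Rightarrow> real^'d"
  assumes domain: "lipschitz_domain \<Omega>" "bounded \<Omega>"
    and D_inv: "\<And>x. invertible (D x)"
    and D_lip: "\<exists>L. L-lipschitz_on UNIV D" "\<exists>L. L-lipschitz_on UNIV (\<lambda>x. matrix_inv (D x))"
    and D_det: "0 < D1" "\<And>x. x \<in> closure \<Omega> \<Longrightarrow> D1 \<le> \<bar>det (D x)\<bar> \<and> \<bar>det (D x)\<bar> \<le> D2"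
    and r: "0 < r" "r < 1"
    and cubes: "\<And>\<epsilon> n. 0 < \<epsilon> \<Longrightarrow> n \<in> {1..N \<epsilon>} \<Longrightarrow> open_cube (\<epsilon> powr r) (Q \<epsilon> n)"
    and cubes_disjoint: "\<And>\<epsilon>. 0 < \<epsilon> \<Longrightarrow> disjoint_family_on (Q \<epsilon>) {1..N \<epsilon>}"
    and cubes_cover: "\<And>\<epsilon>. 0 < \<epsilon> \<Longrightarrow> \<Omega> \<subseteq> (\<Union>n\<in>{1..N \<epsilon>}. closure (Q \<epsilon> n))"
    and cubes_meet: "\<And>\<epsilon> n. 0 < \<epsilon> \<Longrightarrow> n \<in> {1..N \<epsilon>} \<Longrightarrow> Q \<epsilon> n \<inter> \<Omega> \<noteq> {}"
    and points: "\<And>\<epsilon> n. 0 < \<epsilon> \<Longrightarrow> n \<in> {1..N \<epsilon>} \<Longrightarrow> pt \<epsilon> n \<in> Q \<epsilon> n \<inter> \<Omega>"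
    and p: "1 < p"
    and eps: "\<And>k. 0 < eps k" "eps \<longlonglongrightarrow> 0"
    and w: "\<And>k. w k \<in> Lp p \<Omega>" "\<And>k. grad_w k \<in> Lp p \<Omega>"
      "\<And>k. has_weak_gradient \<Omega> (w k) (grad_w k)"
    and bound: "\<And>k. Lp_norm p \<Omega> (w k) + eps k * Lp_norm p \<Omega> (grad_w k) \<le> C"
  shows "\<exists>(s :: nat \<Rightarrow> nat) (w0 :: (real^'d) \<times> (real^'d) \<Rightarrow> real) (G :: (real^'d) \<times> (real^'d) \<Rightarrow> real^'d).
    strict_mono s \<and>
    w0 \<in> Lp_W1p_per_transformed p \<Omega> D \<and>
    weakly_in_Lp_W1p p \<Omega> unit_cell
      (\<lambda>k. unfolding_op \<Omega> D N Q pt (eps (s k)) (w (s k)))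
      (\<lambda>(x, y). w0 (x, D x *v y)) \<and>
    (AE x in lebesgue_on \<Omega>.
       has_weak_gradient unit_cell (\<lambda>y. w0 (x, D x *v y)) (\<lambda>y. G (x, y))) \<and>
    weakly_in_Lp p (\<Omega> \<times> unit_cell)
      (\<lambda>k z. eps (s k) *\<^sub>R unfolding_op \<Omega> D N Q pt (eps (s k)) (grad_w (s k)) z)
      (\<lambda>(x, y). transpose (matrix_inv (D x)) *v G (x, y))"
proof -
  have "open \<Omega>" using domain(1) by (simp add: lipschitz_domain_def)
  interpret lp_unfolding \<Omega> D r p C N Q pt eps w grad_w
  proof unfold_locales
    show "open \<Omega>" by fact
    show "open_cube (\<epsilon> powr r) (Q \<epsilon> n)" if "0 < \<epsilon>" "n \<in> {1..N \<epsilon>}" for \<epsilon> n using that by (rule cubes)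
    show "disjoint_family_on (Q \<epsilon>) {1..N \<epsilon>}" if "0 < \<epsilon>" for \<epsilon> using that by (rule cubes_disjoint)
    show "pt \<epsilon> n \<in> Q \<epsilon> n \<inter> \<Omega>" if "0 < \<epsilon>" "n \<in> {1..N \<epsilon>}" for \<epsilon> n using that by (rule points)
    show "Lp_norm p \<Omega> (w k) + eps k * Lp_norm p \<Omega> (grad_w k) \<le> C" for k by (rule bound)
  qed (rule domain(2) D_inv D_lip(1) r p eps w)+
  show ?thesis by (rule weak_limits)
qed

end
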